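(* Let $F$ be a number field with ring of integers $\mathcal{O}_F$, let $p$ be a prime number, and let $f\in\mathcal{O}_F[T]$ be monic of degree $d\ge2$, where $d$ is a power of $p$. Suppose that $f$ is postcritically finite, that the barycenter of $f$ is an algebraic integer, and that $f$ is not $\overline F$-linearly conjugate to a Chebyshev polynomial or a negative Chebyshev polynomial. Set $$\mathfrak{e}=\max\{e_v: v\in M_F,\ v\mid p\}\quad\text{and}\quad\mathfrak{f}=\mathrm{lcm}\{f_v: v\in M_F,\ v\mid p\},$$ where $e_v$ denotes the ramification index and $f_v$ the residue degree of the place $v$. Let $\alpha\in\overline F$ be $f$-preperiodic. Then $$\mathrm{preper}(\alpha)\le\left(1+\left\lceil\frac{\log\mathfrak{e}}{\log d}\right\rceil\right)\left(1+\frac{\log[F(\alpha):F]}{\log d}\right)\quad\text{and}\quad\mathrm{per}(\alpha)\le p\,\mathfrak{f}\,[F(\alpha):F].$$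
   Context: $\overline F$ is an algebraic closure of $F$; $M_F$ is the set of places of $F$, and $v\mid p$ means $v$ is a finite place above $p$. $f^{(n)}$ is the $n$-th iterate of $f$, $f^{(0)}=T$. A point $\alpha\in\overline F$ is $f$-preperiodic if its forward orbit $\{f^{(n)}(\alpha):n\ge0\}$ is finite, and $f$-periodic if $f^{(n)}(\alpha)=\alpha$ for some $n\ge1$. For preperiodic $\alpha$, the preperiod length $\mathrm{preper}(\alpha)$ is the least $m\ge0$ such that $f^{(m)}(\alpha)$ is periodic, and $\mathrm{per}(\alpha)$ is the least $n\ge1$ with $f^{(n)}(f^{(m)}(\alpha))=f^{(m)}(\alpha)$ for that $m$ (the period length of the cycle eventually reached). $f$ is postcritically finite if all critical points of $f$ (roots of $f'$ in $\overline F$) are $f$-preperiodic. The barycenter of a monic polynomial $T^d+f_1T^{d-1}+\cdots$ is $-f_1/d$. Two polynomials $f,g$ are $\overline F$-linearly conjugate if $f=(g(aT+b)-b)/a$ for some $a\in\overline F^\times$, $b\in\overline F$. The degree $d$ Chebyshev polynomial $\Psi_d$ is the monic polynomial with $\Psi_d(2\cos\theta)=2\cos(d\theta)$ for all $\theta\in\mathbb{C}$ (e.g. $\Psi_2=T^2-2$); a negative Chebyshev polynomial is $-\Psi_d$. $\lceil x\rceil$ is the smallest integer $\ge x$. *)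

theory Defs
  imports Complex_Main "HOL-Algebra.Algebra" "HOL-Algebra.Algebraic_Closure_Type"
begin

text \<open>
  A number field is a subset \<open>F\<close> of an ambient algebraically closed field \<open>'k\<close> of characteristic
  zero; the algebraic closure of \<open>F\<close> is the set of elements of \<open>'k\<close> that are algebraic
  over \<open>F\<close>. Every number field has this shape, e.g. inside \<open>complex\<close> or inside the type of its own
  algebraic closure.
\<close>

abbreviation ambient :: "'k :: field ring"
  where "ambient \<equiv> ring_of_type_algebra"

definition number_field :: "'k :: field_char_0 set \<Rightarrow> bool"
  where "number_field F \<longleftrightarrow> subfield F ambient \<and> ring.finite_dimension ambient \<rat> F"

definition alg_closure_in :: "'k :: field set \<Rightarrow> 'k set"
  where "alg_closure_in F = {x. ring.algebraic ambient F x}"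

definition ring_of_integers :: "'k :: field set \<Rightarrow> 'k ring"
  where "ring_of_integers F = ambient\<lparr>carrier := {x \<in> F. algebraic_int x}\<rparr>"

definition adjoin_degree :: "'k :: field set \<Rightarrow> 'k \<Rightarrow> nat"
  where "adjoin_degree F \<alpha> = ring.dim ambient F (generate_field ambient (insert \<alpha> F))"


subsection \<open>Finite places\<close>

text \<open>
  The finite places above \<open>p\<close> are represented by the prime ideals of the ring of integers that
  contain \<open>p\<close>; such an ideal is automatically nonzero.
\<close>

definition places_above :: "'k :: field set \<Rightarrow> nat \<Rightarrow> 'k set set"
  where "places_above F p = {P. primeideal P (ring_of_integers F) \<and> of_nat p \<in> P}"

definition ramification_index :: "'k :: field set \<Rightarrow> nat \<Rightarrow> 'k set \<Rightarrow> nat"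
  where "ramification_index F p P =
    (GREATEST e. PIdl\<^bsub>ring_of_integers F\<^esub> (of_nat p) \<subseteq> P [^]\<^bsub>ideals_set (ring_of_integers F)\<^esub> (e :: nat))"

text \<open>
  \<open>generate_field k {}\<close> is the prime subfield of \<open>k\<close>, i.e. the field with \<open>p\<close> elements when
  \<open>k\<close> is the residue field of a place above \<open>p\<close>.
\<close>

definition residue_degree :: "'k :: field set \<Rightarrow> 'k set \<Rightarrow> nat"
  where "residue_degree F P =
    (let k = ring_of_integers F Quot P in ring.dim k (generate_field k {}) (carrier k))"


subsection \<open>Preperiodic points\<close>

definition preperiodic :: "'k :: comm_semiring_0 poly \<Rightarrow> 'k \<Rightarrow> bool"
  where "preperiodic f \<alpha> \<longleftrightarrow> finite {(poly f ^^ n) \<alpha> | n. n \<ge> 0}"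

definition periodic :: "'k :: comm_semiring_0 poly \<Rightarrow> 'k \<Rightarrow> bool"
  where "periodic f \<alpha> \<longleftrightarrow> (\<exists>n\<ge>1. (poly f ^^ n) \<alpha> = \<alpha>)"

definition preper :: "'k :: comm_semiring_0 poly \<Rightarrow> 'k \<Rightarrow> nat"
  where "preper f \<alpha> = (LEAST m. periodic f ((poly f ^^ m) \<alpha>))"

definition per :: "'k :: comm_semiring_0 poly \<Rightarrow> 'k \<Rightarrow> nat"
  where "per f \<alpha> = (LEAST n. n \<ge> 1 \<and>
    (poly f ^^ n) ((poly f ^^ preper f \<alpha>) \<alpha>) = (poly f ^^ preper f \<alpha>) \<alpha>)"

text \<open>The set \<open>K\<close> below is the algebraic closure in which critical points are taken.\<close>

definition postcritically_finite :: "'k :: field set \<Rightarrow> 'k poly \<Rightarrow> bool"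
  where "postcritically_finite K f \<longleftrightarrow> (\<forall>c\<in>K. poly (pderiv f) c = 0 \<longrightarrow> preperiodic f c)"

definition barycenter :: "'k :: field poly \<Rightarrow> 'k"
  where "barycenter f = - coeff f (degree f - 1) / of_nat (degree f)"

definition linearly_conjugate :: "'k :: field set \<Rightarrow> 'k poly \<Rightarrow> 'k poly \<Rightarrow> bool"
  where "linearly_conjugate K f g \<longleftrightarrow>
    (\<exists>a\<in>K. \<exists>b\<in>K. a \<noteq> 0 \<and> f = smult (inverse a) (pcompose g [:b, a:] - [:b:]))"


subsection \<open>Chebyshev polynomials\<close>

definition is_chebyshev :: "nat \<Rightarrow> int poly \<Rightarrow> bool"
  where "is_chebyshev n P \<longleftrightarrow> lead_coeff P = 1 \<and>
    (\<forall>\<theta> :: complex. poly (map_poly of_int P) (2 * cos \<theta>) = 2 * cos (of_nat n * \<theta>))"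

text \<open>Well defined for \<open>n \<ge> 1\<close>, see below; for \<open>n = 0\<close> there is no such monic polynomial.\<close>

definition chebyshev :: "nat \<Rightarrow> int poly"
  where "chebyshev n = (THE P. is_chebyshev n P)"

fun chebyshev_rec :: "nat \<Rightarrow> int poly" where
  "chebyshev_rec 0 = [:2:]"
| "chebyshev_rec (Suc 0) = [:0, 1:]"
| "chebyshev_rec (Suc (Suc n)) = pCons 0 (chebyshev_rec (Suc n)) - chebyshev_rec n"

lemma chebyshev_rec_degree:
  "degree (chebyshev_rec n) = n \<and> (n \<ge> 1 \<longrightarrow> lead_coeff (chebyshev_rec n) = 1)"
proof (induction n rule: chebyshev_rec.induct)
  case (3 n)
  have nz: "chebyshev_rec (Suc n) \<noteq> 0"
    using 3 by auto
  have deg: "degree (chebyshev_rec (Suc n)) = Suc n"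
    and lead: "coeff (chebyshev_rec (Suc n)) (Suc n) = 1"
    using 3(1) by (simp_all del: chebyshev_rec.simps) (metis le_add1 plus_1_eq_Suc)
  have lt: "degree (- chebyshev_rec n) < degree (pCons 0 (chebyshev_rec (Suc n)))"
    using 3 nz by simp
  have eq: "chebyshev_rec (Suc (Suc n)) = - chebyshev_rec n + pCons 0 (chebyshev_rec (Suc n))"
    by simp
  have "degree (chebyshev_rec (Suc (Suc n))) = Suc (Suc n)"
    unfolding eq degree_add_eq_right[OF lt] using 3 nz by simp
  moreover have "lead_coeff (chebyshev_rec (Suc (Suc n))) = 1"
    unfolding eq lead_coeff_add_le[OF lt] using deg lead nz by simp
  ultimately show ?case by blast
qed auto

lemma chebyshev_rec_cos:
  "poly (map_poly of_int (chebyshev_rec n)) (2 * cos \<theta>) = 2 * cos (of_nat n * \<theta> :: complex)"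
proof (induction n rule: chebyshev_rec.induct)
  case (3 n)
  have hom: "map_poly complex_of_int (p - q) = map_poly of_int p - map_poly of_int q" for p q
    by (intro poly_eqI) (simp add: coeff_map_poly)
  have "cos ((of_nat n + 1) * \<theta> + \<theta>) + cos ((of_nat n + 1) * \<theta> - \<theta>)
      = 2 * cos ((of_nat n + 1) * \<theta>) * cos \<theta>"
    by (simp add: cos_add cos_diff)
  then have "cos (of_nat (Suc (Suc n)) * \<theta>)
      = 2 * cos (of_nat (Suc n) * \<theta>) * cos \<theta> - cos (of_nat n * \<theta>)"
    by (simp add: algebra_simps)
  then show ?case
    using 3 by (simp only: chebyshev_rec.simps hom) (simp add: map_poly_pCons)
qed (simp_all add: map_poly_pCons)

lemma is_chebyshev_unique:
  assumes "is_chebyshev n P" "is_chebyshev n Q"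
  shows "P = Q"
proof -
  define R where "R = map_poly complex_of_int P - map_poly complex_of_int Q"
  let ?c = "\<lambda>t::real. complex_of_real (2 * cos t)"
  have "inj_on ?c {0..pi}"
    by (auto intro!: inj_onI dest: cos_inj_pi)
  then have "infinite (?c ` {0..pi})"
    by (subst finite_image_iff) (auto simp: infinite_Icc)
  moreover have "?c ` {0..pi} \<subseteq> {x. poly R x = 0}"
  proof safe
    fix t :: real
    have "?c t = 2 * cos (complex_of_real t)"
      by (simp add: cos_of_real)
    then show "poly R (?c t) = 0"
      using assms by (simp add: R_def is_chebyshev_def)
  qed
  ultimately have "R = 0"
    using poly_roots_finite[of R] finite_subset by blast
  then have "coeff (map_poly complex_of_int P) i = coeff (map_poly complex_of_int Q) i" for i
    by (simp add: R_def)
  then show ?thesis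
    by (intro poly_eqI) (simp add: coeff_map_poly)
qed

lemma is_chebyshev_chebyshev:
  assumes "n \<ge> 1"
  shows "is_chebyshev n (chebyshev n)" "chebyshev n = chebyshev_rec n"
proof -
  have *: "is_chebyshev n (chebyshev_rec n)"
    using assms chebyshev_rec_degree[of n] chebyshev_rec_cos unfolding is_chebyshev_def by blast
  then show "chebyshev n = chebyshev_rec n"
    unfolding chebyshev_def by (intro the_equality is_chebyshev_unique)
  with * show "is_chebyshev n (chebyshev n)" by simp
qed

end

theory Submission
  imports Defs "HOL-Complex_Analysis.Complex_Analysis" "Jordan_Normal_Form.Char_Poly"
    "Jordan_Normal_Form.Schur_Decomposition" "HOL-Real_Asymp.Real_Asymp"
begin

text \<open>
  Let \<open>v\<close> run over the valuations of the algebraic numbers above \<open>p\<close>, with \<open>v p = 1\<close>. Since \<open>f\<close> is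
  postcritically finite of degree \<open>p ^ r\<close>, its critical points are integral, so \<open>f(y + T) - f(y)\<close> is
  congruent to \<open>T ^ d\<close> modulo \<open>p\<close> with explicit control on the intermediate coefficients. Hence
  periodic points inject into the residue field, where \<open>f\<close> acts as a Frobenius power followed by a
  translation: this bounds the period.

  For the preperiod \<open>m\<close>, compare \<open>\<alpha>\<close> with the periodic point \<open>\<beta>\<close> of its orbit having the same \<open>m\<close>-th
  iterate. By Newton polygons, \<open>v\<close> of the difference of the iterates is multiplied by \<open>d\<close> at each step
  as long as it stays below \<open>p / (p - 1)\<close>, while \<open>v (\<alpha> - \<beta>) \<ge> 1 / (e n)\<close>; so it suffices to find one \<open>v\<close>
  at which the last nonzero difference is not too divisible. This is an archimedean statement: the
  filled Julia set of a monic postcritically finite polynomial is connected of capacity one, so two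
  preperiodic points have distance at most 4, with equality only for Chebyshev polynomials, and the
  area theorem for odd univalent functions gives a discriminant bound for several such points. The
  latter is needed when \<open>p\<close> is unramified, for the conjugates of an iterate of \<open>\<alpha>\<close> over the unramified
  extension generated by a periodic point.
\<close>

section \<open>Inverse branches of polynomials at infinity\<close>

text \<open>Let \<open>d\<close> be the degree, \<open>Suc k\<close> the preperiod, \<open>n\<close>
  the degree of the point. One good prime gives \<open>d^k < 2 e n\<close>. If
  \<open>e \<ge> 2\<close>, the ceiling in the claim absorbs the 2; if \<open>e = 1\<close> it does
  not, and \<open>d^k \<le> n\<close> must be proved. Otherwise the difference of the last distinct
  iterates has valuation above 1 at every prime above \<open>p\<close>. If \<open>m\<close> is its
  degree over an unramified extension, its valuations have denominators at most \<open>m\<close>, so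
  they are at least \<open>1 + 1/m\<close>. The \<open>m\<close> conjugates and the periodic point
  are then \<open>N = m + 1\<close> points whose differences have valuation at least
  \<open>N/(N-1)\<close>, and the \<open>N (N-1)\<close> factors of their discriminant give
  divisibility by \<open>p^(N^2)\<close>. The area theorem excludes this by the bound
  \<open>2^(N^2)\<close>, valid from \<open>N = 4\<close> on; \<open>N = 3\<close> occurs only for
  \<open>p = 2\<close> and is settled by a parity argument. For two points the threshold
  \<open>p/(p-1)\<close> means that \<open>z^(p-1) / p^p\<close> is integral, to be set against
  \<open>4^(p-1)\<close>, which reaches \<open>p^p\<close> only for \<open>p = 2\<close>. Boettcher
  coordinates are replaced by inverse branches of the iterates, on discs whose radii tend to
  1.\<close>

lemma poly_roots_card:
 fixes P :: "complex poly"
 assumes "P \<noteq> 0" "\<And>y. poly P y = 0 ==> poly (pderiv P) y \<noteq> 0"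
 shows "card {y. poly P y = 0} = degree P"
proof -
 show ?thesis using assms rsquarefree_card_degree[OF assms(1)] by (auto simp: rsquarefree_roots)
qed

text \<open>Over \<open>T\<close> every fibre has exactly \<open>degree P\<close> points. Discs
  around the points of one fibre, small enough to be disjoint and to map injectively, already supply
  that many preimages of each nearby value, so they contain the whole preimage and are the
  sheets.\<close>

lemma covering_space_poly:
 fixes P :: "complex poly"
 assumes T: "open T" and deg: "degree P > 0"
  and crit: "\<And>y. poly P y \<in> T ==> poly (pderiv P) y \<noteq> 0"
 shows "covering_space (poly P -` T) (poly P) T"
proof
 show "continuous_on (poly P -` T) (poly P)" by (intro continuous_intros)
 have ex: "\<exists>y. poly P y = w" for w
 proof -
  have d: "degree (P - [:w:]) > 0"
   using deg degree_add_eq_left[of "[:- w:]" P] by (simp add: diff_conv_add_uminus[of P] del: add_uminus_conv_diff)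
  thus ?thesis using alg_closed_imp_poly_has_root[of "P - [:w:]"] by auto
 qed
 show "poly P ` (poly P -` T) = T"
 proof safe
  fix w assume "w \<in> T"
  moreover obtain y where "poly P y = w" using ex by blast
  ultimately show "w \<in> poly P ` (poly P -` T)" by (intro image_eqI[of _ _ y]) auto
 qed
 fix w0 assume w0: "w0 \<in> T"
 define Y where "Y = {y. poly P y = w0}"
 have degw: "degree (P - [:w:]) = degree P" for w
  using deg degree_add_eq_left[of "[:- w:]" P] by (simp add: diff_conv_add_uminus[of P] del: add_uminus_conv_diff)
 have nz: "P - [:w:] \<noteq> 0" for w using degw[of w] deg by auto
 have rts: "{y. poly P y = w} = {y. poly (P - [:w:]) y = 0}" for w by auto
 have finr: "finite {y. poly P y = w}" for w unfolding rts by (rule poly_roots_finite[OF nz])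
 have cardr: "card {y. poly P y = w} = degree P" if "w \<in> T" for w
  unfolding rts using poly_roots_card[OF nz[of w]] crit that
  by (simp add: degw pderiv_diff)
 have finY: "finite Y" unfolding Y_def by (rule finr)
 have "\<exists>r>0. inj_on (poly P) (ball y r)" if "y \<in> Y" for y
 proof -
  have "(poly P) holomorphic_on UNIV" by (intro holomorphic_intros)
  moreover have "deriv (poly P) y \<noteq> 0"
   using crit[of y] that w0 DERIV_imp_deriv[OF poly_DERIV, of P y] by (simp add: Y_def)
  ultimately obtain r where "r > 0" "inj_on (poly P) (ball y r)"
   using has_complex_derivative_locally_injective[of "poly P" UNIV y] by auto
  thus ?thesis by blast
 qed
 then obtain r1 where r1: "\<And>y. y \<in> Y ==> r1 y > 0 \<and> inj_on (poly P) (ball y (r1 y))" by metis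
 have "\<exists>r>0. \<forall>y'\<in>Y. y' \<noteq> y --> r \<le> dist y y'" for y using finite_set_avoid[OF finY, of y] by auto
 then obtain r2 where r2: "\<And>y. r2 y > 0 \<and> (\<forall>y'\<in>Y. y' \<noteq> y --> r2 y \<le> dist y y')" by metis
 define rr where "rr y = min (r1 y) (r2 y / 2)" for y
 have rr0: "rr y > 0" if "y \<in> Y" for y using r1[OF that] r2[of y] by (auto simp: rr_def)
 have inj: "inj_on (poly P) (ball y (rr y))" if "y \<in> Y" for y
  by (rule inj_on_subset[of _ "ball y (r1 y)"]) (use r1[OF that] in \<open>auto simp: rr_def\<close>)
 have disj: "ball y (rr y) \<inter> ball y' (rr y') = {}" if "y \<in> Y" "y' \<in> Y" "y \<noteq> y'" for y y'
 proof -
  have "dist y y' \<ge> r2 y" "dist y y' \<ge> r2 y'"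
   using r2[of y] r2[of y'] that by (auto simp: dist_commute)
  hence "rr y + rr y' \<le> dist y y'" unfolding rr_def by linarith
  thus ?thesis by (rule disjoint_ballI)
 qed
 define V where "V = T \<inter> (\<Inter>y\<in>Y. poly P ` ball y (rr y))"
 have op: "open (poly P ` ball y (rr y))" if "y \<in> Y" for y
  by (rule open_mapping_thm3[OF _ _ inj[OF that]]) (auto intro!: holomorphic_intros)
 have oV: "open V" unfolding V_def using op finY T by (intro open_Int open_INT) auto
 have wV: "w0 \<in> V" unfolding V_def
 proof (intro IntI INT_I)
  fix y assume "y \<in> Y"
  thus "w0 \<in> poly P ` ball y (rr y)"
   using rr0[of y] by (intro image_eqI[of _ _ y]) (auto simp: Y_def)
 qed (rule w0)
 define U where "U y = ball y (rr y) \<inter> poly P -` V" for y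
 have oU: "open (U y)" for y
  unfolding U_def by (intro open_Int open_ball open_vimage oV continuous_intros)
 have imU: "poly P ` U y = V" if "y \<in> Y" for y
 proof -
  have "V \<subseteq> poly P ` ball y (rr y)" using that by (auto simp: V_def)
  thus ?thesis by (auto simp: U_def)
 qed
 have cov: "z \<in> (\<Union>y\<in>Y. U y)" if "poly P z \<in> V" for z
 proof -
  define w where "w = poly P z"
  have wVT: "w \<in> V" "w \<in> T" using that by (auto simp: w_def V_def)
  have "\<exists>u. u \<in> U y \<and> poly P u = w" if "y \<in> Y" for y using imU[OF that] wVT by auto
  then obtain u where u: "\<And>y. y \<in> Y ==> u y \<in> U y \<and> poly P (u y) = w" by metis
  have "inj_on u Y"
  proof (rule inj_onI, rule ccontr)
   fix y y' assume H: "y \<in> Y" "y' \<in> Y" "u y = u y'" "y \<noteq> y'"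
   have "u y \<in> ball y (rr y)" "u y' \<in> ball y' (rr y')"
    using u[OF H(1)] u[OF H(2)] by (auto simp: U_def)
   thus False using disj[OF H(1,2,4)] H(3) by auto
  qed
  hence "card (u ` Y) = degree P" using cardr[OF w0] by (simp add: card_image Y_def)
  moreover have "u ` Y \<subseteq> {y. poly P y = w}" using u by auto
  ultimately have "u ` Y = {y. poly P y = w}" using cardr[OF wVT(2)] finr by (metis card_subset_eq)
  hence "z \<in> u ` Y" by (auto simp: w_def)
  thus ?thesis using u by auto
 qed
 show "\<exists>S. w0 \<in> S \<and> openin (top_of_set T) S \<and>
   (\<exists>v. \<Union> v = poly P -` T \<inter> poly P -` S \<and> (\<forall>u\<in>v. openin (top_of_set (poly P -` T)) u) \<and>
    pairwise disjnt v \<and> (\<forall>u\<in>v. \<exists>q. homeomorphism u S (poly P) q))"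
 proof (intro exI[of _ V] conjI exI[of _ "U ` Y"] ballI)
  show "w0 \<in> V" by (rule wV)
  show "openin (top_of_set T) V" using oV by (auto simp: V_def openin_open)
  show "\<Union> (U ` Y) = poly P -` T \<inter> poly P -` V" using cov by (auto simp: U_def V_def)
  show "openin (top_of_set (poly P -` T)) u" if "u \<in> U ` Y" for u
   using oU that by (auto simp: openin_open U_def V_def)
  show "pairwise disjnt (U ` Y)"
  proof (clarsimp simp: pairwise_def)
   fix y y' assume H: "y \<in> Y" "y' \<in> Y" "U y \<noteq> U y'"
   hence "ball y (rr y) \<inter> ball y' (rr y') = {}" by (intro disj) auto
   thus "disjnt (U y) (U y')" by (auto simp: disjnt_def U_def)
  qed
  show "\<exists>q. homeomorphism u V (poly P) q" if "u \<in> U ` Y" for u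
  proof -
   from that obtain y where y: "y \<in> Y" "u = U y" by auto
   have "inj_on (poly P) (U y)" by (rule inj_on_subset[OF inj[OF y(1)]]) (auto simp: U_def)
   moreover have "continuous_on (U y) (poly P)" by (intro continuous_intros)
   ultimately obtain q where "homeomorphism (U y) (poly P ` U y) (poly P) q"
    using invariance_of_domain_homeomorphism[OF oU, of y "poly P"] by blast
   thus ?thesis using y imU by auto
  qed
 qed
qed

lemma holomorphic_on_locally:
 assumes "\<And>x. x \<in> S ==> \<exists>N g. open N \<and> x \<in> N \<and> g holomorphic_on N \<and> (\<forall>y\<in>N. f y = g y)"
 shows "f holomorphic_on S"
 unfolding holomorphic_on_def
proof
 fix x assume "x \<in> S"
 then obtain N g where "open N" "x \<in> N" "g holomorphic_on N" "\<forall>y\<in>N. f y = g y" using assms by blast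
 thus "f field_differentiable at x within S"
  using holomorphic_cong[of N N f g] \<open>open N\<close> \<open>x \<in> N\<close> holomorphic_on_imp_differentiable_at field_differentiable_at_within by blast
qed

text \<open>In the coordinate \<open>t = 1 / y\<close>, with \<open>R\<close> the reflected
  polynomial, \<open>1 / P y = t^D / R t\<close>. Hence \<open>g t = t * E t\<close>, with
  \<open>E\<close> a \<open>D\<close>-th root of \<open>1 / R\<close>, is a local coordinate whose
  \<open>D\<close>-th power is \<open>1 / P y\<close>. Its inverse \<open>k\<close> gives the
  branch, since \<open>1 / k u = E (k u) / u\<close>.\<close>

lemma poly_local_inverse_at_infinity:
 fixes P :: "complex poly"
 assumes deg: "degree P > 0" and lead: "lead_coeff P = 1"
 obtains e h where "e > 0" "h holomorphic_on ball 0 e" "h 0 = 1"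
  "\<And>u. u \<in> ball 0 e ==> u \<noteq> 0 ==> poly P (h u / u) = inverse (u ^ degree P)"
proof -
 define D where "D = degree P"
 define R where "R t = poly (reflect_poly P) t" for t
 have R0: "R 0 = 1" using lead by (simp add: R_def)
 have Rnz: "R t = t ^ D * poly P (inverse t)" if "t \<noteq> 0" for t
  using poly_reflect_poly_nz[OF that, of P] by (simp add: R_def D_def)
 have Rhol: "R holomorphic_on S" for S unfolding R_def by (intro holomorphic_intros)
 have "isCont R 0" unfolding R_def by (intro continuous_intros)
 hence "\<exists>e>0. \<forall>t. dist t 0 < e --> dist (R t) (R 0) < 1"
  unfolding continuous_at_eps_delta by (metis less_numeral_extra(1))
 then obtain e1 where e1: "e1 > 0" "\<And>t. norm t < e1 ==> norm (R t - 1) < 1"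
  by (auto simp: dist_norm R0)
 have Rre: "R t \<notin> \<real>\<^sub>\<le>\<^sub>0" if "norm t < e1" for t
 proof
  assume "R t \<in> \<real>\<^sub>\<le>\<^sub>0"
  hence "Re (R t) \<le> 0" by (auto simp: complex_nonpos_Reals_iff)
  moreover have "\<bar>Re (R t - 1)\<bar> < 1"
   using e1(2)[OF that] abs_Re_le_cmod order_le_less_trans by blast
  ultimately show False by simp
 qed
 define E where "E t = exp (- Ln (R t) / of_nat D)" for t
 have Ehol: "E holomorphic_on ball 0 e1"
  unfolding E_def using Rhol Rre by (auto intro!: holomorphic_intros)
 have ED: "E t ^ D = inverse (R t)" if "norm t < e1" for t
 proof -
  have "R t \<noteq> 0" using Rre[OF that] by auto
  moreover have "E t ^ D = exp (- Ln (R t))"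
   using deg unfolding E_def D_def by (subst exp_of_nat_mult [symmetric]) simp
  ultimately show ?thesis by (simp add: exp_minus)
 qed
 have E0: "E 0 = 1" by (simp add: E_def R0)
 define g where "g t = t * E t" for t
 have ghol: "g holomorphic_on ball 0 e1" unfolding g_def by (intro holomorphic_intros Ehol)
 have dg: "deriv g 0 = 1"
 proof -
  have "(E has_field_derivative deriv E 0) (at 0)"
   using Ehol e1(1) by (intro holomorphic_derivI[of _ "ball 0 e1"]) auto
  hence "(g has_field_derivative 1) (at 0)"
   unfolding g_def by (auto intro!: derivative_eq_intros simp: E0)
  thus ?thesis by (rule DERIV_imp_deriv)
 qed
  obtain r where r: "r > 0" "ball (0::complex) r \<subseteq> ball 0 e1" "inj_on g (ball 0 r)"
 proof (rule has_complex_derivative_locally_injective[OF ghol])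
  show "0 \<in> ball (0::complex) e1" using e1(1) by simp
  show "deriv g 0 \<noteq> 0" by (simp add: dg)
 qed simp_all
 have ghol': "g holomorphic_on ball 0 r" by (rule holomorphic_on_subset[OF ghol r(2)])
 obtain k where k: "k holomorphic_on (g ` ball 0 r)" "\<And>z. z \<in> ball 0 r ==> k (g z) = z"
  using holomorphic_has_inverse[OF ghol' open_ball r(3)] by metis
 have "open (g ` ball 0 r)" by (rule open_mapping_thm3[OF ghol' open_ball r(3)])
 moreover have "0 \<in> g ` ball 0 r" using r(1) by (intro image_eqI[of _ _ 0]) (auto simp: g_def)
 ultimately obtain e where e: "e > 0" "ball 0 e \<subseteq> g ` ball 0 r" by (meson open_contains_ball)
 have kb: "k u \<in> ball 0 r \<and> g (k u) = u" if u: "u \<in> ball 0 e" for u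
 proof -
  have "u \<in> g ` ball 0 r" using e(2) u by (rule subsetD)
  then obtain t where "t \<in> ball 0 r" "u = g t" by (elim imageE)
  thus ?thesis using k(2) by simp
 qed
 show ?thesis
 proof (rule that[OF e(1), of "\<lambda>u. E (k u)"])
  have "k holomorphic_on ball 0 e" by (rule holomorphic_on_subset[OF k(1) e(2)])
  moreover have "k ` ball 0 e \<subseteq> ball 0 e1"
  proof
   fix t assume "t \<in> k ` ball 0 e"
   then obtain u where "t = k u" "u \<in> ball 0 e" by blast
   thus "t \<in> ball 0 e1" using kb subsetD[OF r(2)] by blast
  qed
  ultimately show "(\<lambda>u. E (k u)) holomorphic_on ball 0 e"
   using holomorphic_on_compose_gen[OF _ Ehol] by (auto simp: o_def)
  have "k 0 = 0" using k(2)[of 0] r(1) by (simp add: g_def)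
  thus "E (k 0) = 1" by (simp add: E0)
  fix u :: complex assume u: "u \<in> ball 0 e" "u \<noteq> 0"
  define t where "t = k u"
  have t: "g t = u" "norm t < e1" using kb[OF u(1)] subsetD[OF r(2), of "k u"] by (simp_all add: t_def)
  have tnz: "t \<noteq> 0" using t(1) u(2) by (auto simp: g_def)
  have Enz: "E t \<noteq> 0" by (simp add: E_def)
  have "R t \<noteq> 0" using Rre[OF t(2)] by auto
  have "E t / u = inverse t" using t(1) tnz Enz by (auto simp: g_def field_simps)
  moreover have "poly P (inverse t) = R t / t ^ D" using Rnz[OF tnz] tnz by simp
  moreover have "u ^ D = t ^ D / R t"
   using t(1) ED[OF t(2)] by (auto simp: g_def power_mult_distrib field_simps)
  ultimately show "poly P (E (k u) / u) = inverse (u ^ degree P)"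
   by (simp add: t_def D_def[symmetric])
 qed
qed

text \<open>With \<open>u = exp (- s)\<close> the map \<open>u \<mapsto> u^(-D)\<close> becomes
  \<open>F\<close> on a half-plane, which is simply connected and is sent into \<open>T\<close>,
  where \<open>P\<close> has no critical values. So \<open>F\<close> lifts through the covering
  \<open>P\<close>, normalised by the local inverse near infinity. It remains to see that the lift
  \<open>Y\<close> depends on \<open>exp s\<close> only and is injective in it.\<close>

lemma poly_inverse_at_infinity:
 fixes P :: "complex poly" and \<rho> :: real
 assumes deg: "degree P > 0" and lead: "lead_coeff P = 1" and rho: "\<rho> > 0"
  and crit: "\<And>y. poly (pderiv P) y = 0 ==> norm (poly P y) \<le> \<rho> ^ degree P"
 obtains h where "h holomorphic_on ball 0 (1 / \<rho>)" "h 0 = 1"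
  "\<And>u. u \<in> ball 0 (1 / \<rho>) ==> u \<noteq> 0 ==> poly P (h u / u) = inverse (u ^ degree P)"
  "inj_on (\<lambda>u. h u / u) (ball 0 (1 / \<rho>) - {0})"
proof -
 define D where "D = degree P"
 have D0: "D > 0" using deg by (simp add: D_def)
 define T where "T = {w::complex. norm w > \<rho> ^ D}"
 have oT: "open T" unfolding T_def by (intro open_Collect_less continuous_intros)
 define C where "C = poly P -` T"
 have cov: "covering_space C (poly P) T"
  unfolding C_def using crit by (intro covering_space_poly oT deg) (force simp: T_def D_def)
 define H where "H = {s::complex. Re s > ln \<rho>}"
 have Hconv: "convex H" unfolding H_def by (rule convex_halfspace_Re_gt)
 have Hopen: "open H" unfolding H_def by (rule open_halfspace_Re_gt)
 define F where "F s = exp (of_nat D * s :: complex)" for s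
 have Fcont: "continuous_on S F" for S unfolding F_def by (intro continuous_intros)
 have FT: "F s \<in> T" if "s \<in> H" for s
 proof -
  have "\<rho> < exp (Re s)" using that rho by (metis H_def exp_less_cancel_iff exp_ln mem_Collect_eq)
  hence "\<rho> ^ D < exp (Re s) ^ D" using rho D0 by (intro power_strict_mono) auto
  thus ?thesis by (simp add: T_def F_def exp_of_nat_mult norm_power)
 qed
 obtain e h0 where h0: "e > 0" "h0 holomorphic_on ball 0 e" "h0 0 = 1"
  "\<And>u. u \<in> ball 0 e ==> u \<noteq> 0 ==> poly P (h0 u / u) = inverse (u ^ D)"
  using poly_local_inverse_at_infinity[OF deg lead] unfolding D_def by metis
 define \<sigma> where "\<sigma> = max (ln \<rho>) (- ln e)"
 define H1 where "H1 = {s::complex. Re s > \<sigma>}"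
 have H1conv: "convex H1" unfolding H1_def by (rule convex_halfspace_Re_gt)
 have H1H: "H1 \<subseteq> H" by (auto simp: H1_def H_def \<sigma>_def)
 have H1e: "exp (- s) \<in> ball 0 e" if "s \<in> H1" for s
 proof -
  have "- Re s < ln e" using that by (auto simp: H1_def \<sigma>_def)
  hence "exp (- Re s) < e" using h0(1) by (metis exp_less_cancel_iff exp_ln)
  thus ?thesis by simp
 qed
 define Y0 where "Y0 s = exp s * h0 (exp (- s))" for s
 have PY0: "poly P (Y0 s) = F s" if "s \<in> H1" for s using h0(4)[OF H1e[OF that]]
  by (simp add: Y0_def F_def exp_minus field_simps flip: exp_of_nat_mult)
 have Y0C: "Y0 s \<in> C" if "s \<in> H1" for s using PY0[OF that] FT H1H that by (auto simp: C_def)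
 have Y0cont: "continuous_on H1 Y0" unfolding Y0_def
  by (intro continuous_intros continuous_on_compose2[OF holomorphic_on_imp_continuous_on[OF h0(2)]])
   (use H1e in auto)
 define s0 where "s0 = complex_of_real (\<sigma> + 1)"
 have s0: "s0 \<in> H1" "s0 \<in> H" using H1H by (auto simp: s0_def H1_def)
 obtain Y where Y: "continuous_on H Y" "Y \<in> H \<rightarrow> C" "Y s0 = Y0 s0" "\<And>s. s \<in> H ==> poly P (Y s) = F s"
 proof (rule covering_space_lift_strong[OF cov Y0C[OF s0(1)] s0(2) _ _ Fcont])
  show "simply_connected H" by (rule convex_imp_simply_connected[OF Hconv])
  show "locally path_connected H" by (rule convex_imp_locally_path_connected[OF Hconv])
  show "F \<in> H \<rightarrow> T" using FT by blast
  show "F s0 = poly P (Y0 s0)" using PY0[OF s0(1)] by simp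
 qed blast
 have YY0: "Y s = Y0 s" if "s \<in> H1" for s
 proof (rule covering_space_lift_unique[where T = H1 and f = F and ?g1.0 = Y and ?g2.0 = Y0, OF cov Y(3) Fcont _ _ _ _ Y0cont _ _ _ s0(1) that])
  show "continuous_on H1 Y" by (rule continuous_on_subset[OF Y(1) H1H])
  show "connected H1" using H1conv by (rule convex_connected)
 qed (use FT Y H1H Y0C PY0 in \<open>auto dest: subsetD[OF H1H]\<close>)
 \<comment> \<open>Both sides are lifts of \<open>F\<close> when \<open>D * \<theta>\<close> is a
   period of \<open>exp\<close>, so agreement at a single point propagates to all of
   \<open>H\<close>.\<close>
 have shift: "Y (s + \<theta>) = Y s"
  if th: "exp (of_nat D * \<theta>) = 1" and s1: "s1 \<in> H" "Y (s1 + \<theta>) = Y s1" and s: "s \<in> H" for \<theta> s1 s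
 proof -
  have "norm (exp (of_nat D * \<theta>)) = 1" using th by simp
  hence Reth: "Re \<theta> = 0" using D0 by simp
  have inH: "t + \<theta> \<in> H" if "t \<in> H" for t using that Reth by (simp add: H_def)
  have FF: "F (t + \<theta>) = F t" for t using th by (simp add: F_def distrib_left exp_add)
  show ?thesis
  proof (rule covering_space_lift_unique[where T = H and f = F and ?g1.0 = "\<lambda>s. Y (s + \<theta>)" and ?g2.0 = Y, OF cov _ Fcont _ _ _ _ Y(1) _ _ _ s1(1) s])
   show "continuous_on H (\<lambda>s. Y (s + \<theta>))"
    by (intro continuous_on_compose2[OF Y(1)] continuous_intros) (use inH in auto)
   show "connected H" using Hconv by (rule convex_connected)
  qed (use FT Y inH FF s1 in auto)
 qed
 have per: "Y s = Y s'" if "s \<in> H" "s' \<in> H" "exp s = exp s'" for s s'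
 proof -
  define \<theta> where "\<theta> = s - s'"
  have th1: "exp \<theta> = 1" using that(3) by (simp add: \<theta>_def exp_diff)
  hence th: "exp (of_nat D * \<theta>) = 1" by (simp add: exp_of_nat_mult)
  have "norm (exp \<theta>) = 1" using th1 by simp
  hence "Re \<theta> = 0" by simp
  hence "s0 + \<theta> \<in> H1" using s0 by (simp add: H1_def)
  hence "Y (s0 + \<theta>) = Y s0" using YY0 s0 th1 by (simp add: Y0_def exp_add exp_minus)
  from shift[OF th s0(2) this that(2)] show ?thesis by (simp add: \<theta>_def)
 qed
 have injY: "exp s1 = exp s2" if ss: "s1 \<in> H" "s2 \<in> H" "Y s1 = Y s2" for s1 s2
 proof -
  define \<theta> where "\<theta> = s2 - s1"
  have "F s1 = F s2" using Y(4) that by metis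
  hence th: "exp (of_nat D * \<theta>) = 1" by (simp add: F_def \<theta>_def right_diff_distrib exp_diff)
  hence "norm (exp (of_nat D * \<theta>)) = 1" by simp
  hence Reth: "Re \<theta> = 0" using D0 by simp
  \<comment> \<open>The coincidence at \<open>s1\<close> propagates to a neighbourhood of infinity,
    where \<open>Y\<close> is \<open>Y0\<close>; letting \<open>u\<close> tend to 0 then gives
    \<open>exp \<theta> = 1\<close>.\<close>
  have eq: "exp \<theta> * h0 (exp (- \<theta>) * u) = h0 u" if u: "u \<in> ball 0 (exp (- \<sigma>))" "u \<noteq> 0" for u
  proof -
   define s where "s = - Ln u"
   have es: "exp (- s) = u" using u by (simp add: s_def)
   have "ln (norm u) < ln (exp (- \<sigma>))" using u by (subst ln_less_cancel_iff) auto
   hence sH: "s \<in> H1" "s + \<theta> \<in> H1" using u Reth by (auto simp: s_def H1_def)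
   have "Y (s + \<theta>) = Y s"
    using shift[OF th ss(1) _ subsetD[OF H1H sH(1)]] ss(3) by (simp add: \<theta>_def)
   hence "Y0 (s + \<theta>) = Y0 s" using YY0 sH by simp
   hence "exp s * (exp \<theta> * h0 (exp (- \<theta>) * exp (- s))) = exp s * h0 (exp (- s))"
    by (simp add: Y0_def exp_add exp_diff exp_minus field_simps)
   thus ?thesis unfolding es by simp
  qed
  have cont: "isCont h0 0" using holomorphic_on_imp_continuous_on[OF h0(2)] h0(1)
   by (simp add: continuous_on_eq_continuous_at)
  have lim1: "((\<lambda>u. exp \<theta> * h0 (exp (- \<theta>) * u)) \<longlongrightarrow> exp \<theta> * h0 0) (at 0)"
  proof -
   have "((\<lambda>u. exp (- \<theta>) * u) \<longlongrightarrow> 0) (at 0)" by (auto intro!: tendsto_eq_intros)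
   hence "((\<lambda>u. h0 (exp (- \<theta>) * u)) \<longlongrightarrow> h0 0) (at 0)" by (rule isCont_tendsto_compose[OF cont])
   thus ?thesis by (rule tendsto_mult_left)
  qed
  moreover have "eventually (\<lambda>u. exp \<theta> * h0 (exp (- \<theta>) * u) = h0 u) (at 0)"
   unfolding eventually_at using eq by (intro exI[of _ "exp (- \<sigma>)"]) auto
  ultimately have "(h0 \<longlongrightarrow> exp \<theta> * h0 0) (at 0)" by (rule Lim_transform_eventually)
  moreover have "(h0 \<longlongrightarrow> h0 0) (at 0)" using cont by (simp add: isCont_def)
  ultimately have "exp \<theta> * h0 0 = h0 0" using tendsto_unique by (metis at_neq_bot)
  hence "exp \<theta> = 1" using h0(3) by simp
  thus ?thesis by (simp add: \<theta>_def exp_diff)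
 qed
 have Yhol: "Y holomorphic_on H"
 proof (rule holomorphic_on_locally)
  fix s assume s: "s \<in> H"
  have "deriv (poly P) (Y s) \<noteq> 0"
   using crit[of "Y s"] Y(4)[OF s] FT[OF s] DERIV_imp_deriv[OF poly_DERIV, of P "Y s"]
   by (auto simp: T_def D_def)
  moreover have Phol: "poly P holomorphic_on A" for A by (intro holomorphic_intros)
  ultimately obtain r where r: "r > 0" "inj_on (poly P) (ball (Y s) r)"
   using has_complex_derivative_locally_injective[of "poly P" UNIV "Y s"] by auto
  obtain k where k: "k holomorphic_on (poly P ` ball (Y s) r)" "\<And>z. z \<in> ball (Y s) r ==> k (poly P z) = z"
   using holomorphic_has_inverse[OF Phol open_ball r(2)] by metis
  define N where "N = H \<inter> Y -` ball (Y s) r"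
  have "open N" unfolding N_def using continuous_open_preimage[OF Y(1) Hopen open_ball] by simp
  moreover have "s \<in> N" using s r(1) by (simp add: N_def)
  moreover have "(k \<circ> F) holomorphic_on N"
  proof (rule holomorphic_on_compose_gen[OF _ k(1)])
   show "F holomorphic_on N" unfolding F_def by (intro holomorphic_intros)
   show "F ` N \<subseteq> poly P ` ball (Y s) r" using Y(4) by (force simp: N_def)
  qed
  moreover have "\<forall>y\<in>N. Y y = (k \<circ> F) y" using Y(4) k(2) by (force simp: N_def)
  ultimately show "\<exists>N g. open N \<and> s \<in> N \<and> g holomorphic_on N \<and> (\<forall>y\<in>N. Y y = g y)" by blast
 qed
 have LnH: "- l \<in> H" if "exp l = u" "u \<in> ball 0 (1 / \<rho>)" for u l
 proof -
  have "exp (Re l) = norm u" using that(1) by (metis norm_exp_eq_Re)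
  hence "exp (Re l) < exp (- ln \<rho>)" using that(2) rho by (simp add: exp_minus inverse_eq_divide)
  thus ?thesis by (simp add: H_def)
 qed
 define h where "h u = (if u = 0 then 1 else u * Y (- Ln u))" for u
 have heq: "h u = u * Y (- l)" if "exp l = u" "u \<in> ball 0 (1 / \<rho>)" for u l
 proof -
  have nz: "u \<noteq> 0" using that(1) by auto
  hence "exp (- Ln u) = exp (- l)" using that(1) by (simp add: exp_minus)
  hence "Y (- Ln u) = Y (- l)" using per LnH that nz by (metis exp_Ln)
  thus ?thesis using nz by (simp add: h_def)
 qed
 have Ph: "poly P (h u / u) = inverse (u ^ degree P)" if "u \<in> ball 0 (1 / \<rho>)" "u \<noteq> 0" for u
 proof -
  show ?thesis using Y(4) LnH that that(2) by (simp add: h_def F_def exp_of_nat_mult exp_minus D_def power_inverse)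
 qed
 show ?thesis
 proof (rule that[of h])
  show "h 0 = 1" by (simp add: h_def)
  show "poly P (h u / u) = inverse (u ^ degree P)" if "u \<in> ball 0 (1 / \<rho>)" "u \<noteq> 0" for u
   by (rule Ph[OF that])
  show "inj_on (\<lambda>u. h u / u) (ball 0 (1 / \<rho>) - {0})"
  proof (rule inj_onI)
   fix u v assume uv: "u \<in> ball 0 (1 / \<rho>) - {0}" "v \<in> ball 0 (1 / \<rho>) - {0}" "h u / u = h v / v"
   hence "Y (- Ln u) = Y (- Ln v)" by (simp add: h_def)
   hence "exp (- Ln u) = exp (- Ln v)" using LnH uv by (intro injY) (auto simp del: mem_ball)
   thus "u = v" using uv by (simp add: exp_minus)
  qed
  show "h holomorphic_on ball 0 (1 / \<rho>)"
  proof (rule holomorphic_on_locally)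
   fix u1 :: complex assume u1: "u1 \<in> ball 0 (1 / \<rho>)"
   show "\<exists>N g. open N \<and> u1 \<in> N \<and> g holomorphic_on N \<and> (\<forall>y\<in>N. h y = g y)"
   proof (cases "u1 = 0")
    case True
    define N where "N = ball (0::complex) (exp (- \<sigma>))"
    have "exp (- \<sigma>) \<le> exp (ln e)" unfolding exp_le_cancel_iff by (simp add: \<sigma>_def)
    hence Ne: "N \<subseteq> ball 0 e" using h0(1) by (auto simp: N_def)
    have "h u = h0 u" if "u \<in> N" for u
    proof (cases "u = 0")
     case False
     have "ln (norm u) < ln (exp (- \<sigma>))"
      using that False by (subst ln_less_cancel_iff) (auto simp: N_def)
     hence "- Ln u \<in> H1" using False by (simp add: H1_def)
     from YY0[OF this] show ?thesis using False by (simp add: h_def Y0_def exp_minus)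
    qed (simp add: h_def h0)
    thus ?thesis
     using h0(2) Ne True by (intro exI[of _ N] exI[of _ h0]) (auto simp: N_def intro: holomorphic_on_subset)
   next
    case False
    define N where "N = ball 0 (1 / \<rho>) \<inter> ball u1 (norm u1)"
    \<comment> \<open>The principal logarithm may jump near \<open>u1\<close>. This branch is
      holomorphic on \<open>N\<close>, and by \<open>heq\<close> the choice of the logarithm does
      not affect \<open>h\<close>.\<close>
    define l where "l u = Ln (u / u1) + Ln u1" for u
    have l1: "u / u1 \<notin> \<real>\<^sub>\<le>\<^sub>0" "u \<noteq> 0" if "u \<in> N" for u
    proof -
     have "norm (u - u1) < norm u1" using that by (simp add: N_def dist_norm norm_minus_commute)
     hence "norm (u / u1 - 1) < 1" using False by (simp add: divide_simps flip: norm_divide)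
       (metis diff_divide_distrib divide_self norm_divide divide_less_eq_1_pos zero_less_norm_iff)
     hence "\<bar>Re (u / u1 - 1)\<bar> < 1" using abs_Re_le_cmod order_le_less_trans by blast
     hence "Re (u / u1) > 0" by simp
     thus "u / u1 \<notin> \<real>\<^sub>\<le>\<^sub>0" by (auto simp: complex_nonpos_Reals_iff)
     thus "u \<noteq> 0" by auto
    qed
    have el: "exp (l u) = u" if "u \<in> N" for u using l1[OF that] False by (simp add: l_def exp_add)
    have lhol: "l holomorphic_on N" unfolding l_def using l1 by (intro holomorphic_intros) auto
    have "(\<lambda>u. u * Y (- l u)) holomorphic_on N"
    proof (intro holomorphic_intros)
     have "(Y \<circ> (\<lambda>u. - l u)) holomorphic_on N" by (rule holomorphic_on_compose_gen[OF _ Yhol])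
       (use LnH[OF el] lhol in \<open>auto simp: N_def intro!: holomorphic_intros\<close>)
     thus "(\<lambda>u. Y (- l u)) holomorphic_on N" by (simp add: o_def)
    qed
    thus ?thesis
     using u1 False heq[OF el] by (intro exI[of _ N] exI[of _ "\<lambda>u. u * Y (- l u)"]) (auto simp: N_def)
   qed
  qed
 qed
qed

section \<open>The area theorem\<close>

lemma has_integral_exp_int:
 fixes m :: int
 shows "((\<lambda>x. exp (2 * \<i> * of_int m * of_real x)) has_integral (if m = 0 then 2 * of_real pi else 0)) {0..2 * pi}"
proof (cases "m = 0")
 case True
 show ?thesis using has_integral_const_real[of "1::complex" 0 "2 * pi"] True by (simp add: scaleR_conv_of_real)
next
 case False
 let ?c = "2 * \<i> * of_int m :: complex"
 have c: "?c \<noteq> 0" using False by simp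
 have "((\<lambda>x. exp (?c * of_real x)) has_integral
   (exp (?c * of_real (2 * pi)) / ?c - exp (?c * of_real 0) / ?c)) {0..2 * pi}"
 proof (rule fundamental_theorem_of_calculus)
  fix x :: real
  have "((\<lambda>z. exp (?c * z) / ?c) has_field_derivative exp (?c * of_real x)) (at (of_real x))"
   using c by (auto intro!: derivative_eq_intros)
  hence "((\<lambda>x. exp (?c * of_real x) / ?c) has_vector_derivative exp (?c * of_real x)) (at x)"
   by (rule has_vector_derivative_real_field)
  thus "((\<lambda>x. exp (?c * of_real x) / ?c) has_vector_derivative exp (?c * of_real x)) (at x within {0..2 * pi})"
   by (rule has_vector_derivative_at_within)
 qed simp
 moreover have "exp (?c * of_real (2 * pi)) = 1"
  by (subst exp_eq_1) (auto intro!: exI[of _ "2 * m"])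
 ultimately show ?thesis using False by simp
qed

text \<open>Parseval for finite sums. The frequencies are even because the odd functions considered
  below are \<open>z\<close> times a power series in \<open>z^(-2)\<close>.\<close>

lemma has_integral_trig_poly_norm2:
 fixes b :: "nat => complex"
 shows "((\<lambda>x. (norm (\<Sum>k<n. b k * exp (- 2 * \<i> * of_nat k * of_real x)))\<^sup>2)
  has_integral 2 * pi * (\<Sum>k<n. (norm (b k))\<^sup>2)) {0..2 * pi}"
proof -
 let ?e = "\<lambda>k x. exp (- 2 * \<i> * of_nat k * of_real x) :: complex"
 have eq: "b j * ?e j x * cnj (b k * ?e k x) = (b j * cnj (b k)) * exp (2 * \<i> * of_int (int k - int j) * of_real x)" for j k x
 proof -
  show ?thesis by (simp add: exp_cnj flip: exp_add) (simp add: algebra_simps)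
 qed
 have "((\<lambda>x. \<Sum>j<n. \<Sum>k<n. b j * ?e j x * cnj (b k * ?e k x)) has_integral
   (\<Sum>j<n. \<Sum>k<n. (b j * cnj (b k)) * (if int k - int j = 0 then 2 * of_real pi else 0))) {0..2 * pi}"
  unfolding eq by (intro has_integral_sum has_integral_mult_right has_integral_exp_int finite_lessThan)
 also have "(\<Sum>j<n. \<Sum>k<n. (b j * cnj (b k)) * (if int k - int j = 0 then 2 * of_real pi else 0))
   = (\<Sum>j<n. of_real (2 * pi * (norm (b j))\<^sup>2))"
 proof (rule sum.cong[OF refl])
  fix j assume "j \<in> {..<n}"
  have "(\<Sum>k<n. (b j * cnj (b k)) * (if int k - int j = 0 then 2 * of_real pi else 0))
    = (\<Sum>k<n. if k = j then of_real (2 * pi * (norm (b j))\<^sup>2) else 0)"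
   by (rule sum.cong) (auto simp: complex_norm_square simp del: of_real_power)
  thus "(\<Sum>k<n. (b j * cnj (b k)) * (if int k - int j = 0 then 2 * of_real pi else 0)) = of_real (2 * pi * (norm (b j))\<^sup>2)"
   using \<open>j \<in> {..<n}\<close> by simp
 qed
 finally have "((\<lambda>x. Re (\<Sum>j<n. \<Sum>k<n. b j * ?e j x * cnj (b k * ?e k x))) has_integral
   Re (\<Sum>j<n. of_real (2 * pi * (norm (b j))\<^sup>2))) {0..2 * pi}"
  using has_integral_linear[OF _ bounded_linear_Re] unfolding o_def by blast
 also have "Re (\<Sum>j<n. of_real (2 * pi * (norm (b j))\<^sup>2)) = 2 * pi * (\<Sum>k<n. (norm (b k))\<^sup>2)"
  by (simp add: sum_distrib_left flip: of_real_sum)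
 also have "(\<lambda>x. Re (\<Sum>j<n. \<Sum>k<n. b j * ?e j x * cnj (b k * ?e k x)))
   = (\<lambda>x. (norm (\<Sum>k<n. b k * ?e k x))\<^sup>2)"
 proof
  fix x
  have "(\<Sum>j<n. \<Sum>k<n. b j * ?e j x * cnj (b k * ?e k x)) = of_real ((norm (\<Sum>k<n. b k * ?e k x))\<^sup>2)"
   unfolding complex_norm_square cnj_sum sum_product ..
  thus "Re (\<Sum>j<n. \<Sum>k<n. b j * ?e j x * cnj (b k * ?e k x)) = (norm (\<Sum>k<n. b k * ?e k x))\<^sup>2" by simp
 qed
 finally show ?thesis .
qed

text \<open>The partial sums converge uniformly on the circle, so their Parseval identities pass to
  the limit; nonnegativity of the terms allows truncation at \<open>N\<close>.\<close>

lemma integral_powser_norm2_ge: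
 fixes a :: "nat => complex"
 assumes q: "0 < q" "q < \<tau>" and sums: "\<And>w. norm w < \<tau> ==> (\<lambda>k. a k * w ^ k) sums G w"
 shows "integral {0..2 * pi} (\<lambda>x. (norm (G (of_real q * exp (- 2 * \<i> * of_real x))))\<^sup>2)
  \<ge> 2 * pi * (\<Sum>k<N. (norm (a k) * q ^ k)\<^sup>2)"
proof -
 have rad: "ereal ((q + \<tau>) / 2) \<le> conv_radius a"
 proof (rule conv_radius_geI_ex)
  fix r assume r: "0 < r" "ereal r < ereal ((q + \<tau>) / 2)"
  thus "\<exists>z. norm z = r \<and> summable (\<lambda>n. a n * z ^ n)"
   using q sums_summable[OF sums] r by (intro exI[of _ "of_real r"]) auto
 qed
 have "ereal q < ereal ((q + \<tau>) / 2)" using q by simp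
 hence cr: "ereal q < conv_radius a" using rad by (rule less_le_trans)
 define w where "w x = of_real q * exp (- 2 * \<i> * of_real x)" for x
 have nw: "norm (w x) = q" for x using q by (simp add: w_def norm_mult)
 have "uniform_limit (cball 0 q) (\<lambda>n x. \<Sum>i<n. a i * x ^ i) (\<lambda>x. suminf (\<lambda>i. a i * x ^ i)) sequentially"
  using powser_uniform_limit[OF cr, of 0] by simp
 hence "uniform_limit {0..2 * pi} (\<lambda>n x. \<Sum>i<n. a i * w x ^ i) (\<lambda>x. suminf (\<lambda>i. a i * w x ^ i)) sequentially"
  by (rule uniform_limit_compose') (auto simp: nw)
 also have "(\<lambda>x. suminf (\<lambda>i. a i * w x ^ i)) = (\<lambda>x. G (w x))"
  using sums_unique[OF sums[of "w _"]] nw q by simp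
 finally have ul: "uniform_limit {0..2 * pi} (\<lambda>n x. \<Sum>i<n. a i * w x ^ i) (\<lambda>x. G (w x)) sequentially" .
 have wcont: "continuous_on A w" for A unfolding w_def by (intro continuous_intros)
 have Gcont: "continuous_on {0..2 * pi} (\<lambda>x. G (w x))"
  by (rule uniform_limit_theorem[OF _ ul]) (auto intro!: always_eventually continuous_intros wcont)
 have bdd: "bounded ((\<lambda>x. norm (G (w x))) ` {0..2 * pi})"
  by (intro compact_imp_bounded compact_continuous_image continuous_intros Gcont) auto
 have ul1: "uniform_limit {0..2 * pi} (\<lambda>n x. norm (\<Sum>i<n. a i * w x ^ i)) (\<lambda>x. norm (G (w x))) sequentially"
  by (rule uniform_limit_norm[OF ul])
 have ul2: "uniform_limit {0..2 * pi} (\<lambda>n x. (norm (\<Sum>i<n. a i * w x ^ i))\<^sup>2) (\<lambda>x. (norm (G (w x)))\<^sup>2) sequentially"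
  unfolding power2_eq_square by (rule uniform_lim_mult[OF ul1 ul1 bdd bdd])
 obtain I J where IJ: "\<And>n. ((\<lambda>x. (norm (\<Sum>i<n. a i * w x ^ i))\<^sup>2) has_integral I n) {0..2 * pi}"
  "((\<lambda>x. (norm (G (w x)))\<^sup>2) has_integral J) {0..2 * pi}" "I \<longlonglongrightarrow> J"
 proof (rule uniform_limit_integral[OF ul2])
  show "continuous_on {0..2 * pi} (\<lambda>x. (cmod (\<Sum>i<n. a i * w x ^ i))\<^sup>2)" for n
   by (intro continuous_intros wcont)
 qed auto
 have In: "I n = 2 * pi * (\<Sum>k<n. (norm (a k) * q ^ k)\<^sup>2)" for n
 proof (rule has_integral_unique[OF IJ(1)])
  have aw: "a i * w x ^ i = (a i * of_real q ^ i) * exp (- 2 * \<i> * of_nat i * of_real x)" for i x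
   by (simp add: w_def power_mult_distrib mult_ac flip: exp_of_nat_mult)
  show "((\<lambda>x. (norm (\<Sum>i<n. a i * w x ^ i))\<^sup>2) has_integral 2 * pi * (\<Sum>k<n. (norm (a k) * q ^ k)\<^sup>2)) {0..2 * pi}"
   unfolding aw using has_integral_trig_poly_norm2[of "\<lambda>i. a i * of_real q ^ i" n] q
   by (simp add: norm_mult norm_power)
 qed
 have "2 * pi * (\<Sum>k<N. (norm (a k) * q ^ k)\<^sup>2) \<le> J"
 proof (rule tendsto_lowerbound[OF IJ(3)])
  show "\<forall>\<^sub>F n in sequentially. 2 * pi * (\<Sum>k<N. (norm (a k) * q ^ k)\<^sup>2) \<le> I n"
   unfolding In using pi_ge_zero
   by (intro eventually_sequentiallyI[of N] mult_left_mono sum_mono2) auto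
 qed simp
 thus ?thesis using IJ(2) by (simp add: w_def integral_unique)
qed

text \<open>The domain is a rectangle in logarithmic coordinates. The real-linear map
  \<open>z \<mapsto> z - \<kappa> * cnj z\<close> has determinant \<open>1 - |\<kappa>|^2\<close>;
  it is there to round off the image of \<open>\<Phi>\<close>, nearly an ellipse in the application,
  so that a disc is a sharp enough container.\<close>

lemma area_image_le:
 fixes \<Phi> :: "complex => complex"
 assumes hol: "\<Phi> holomorphic_on U" and U: "open U" and ab: "a < b" "0 \<le> B"
  and sub: "\<And>t x. a \<le> t ==> t \<le> b ==> Complex t x \<in> U"
  and inj: "\<And>t x t' x'. a < t ==> t < b ==> 0 < x ==> x < 2 * pi ==> a < t' ==> t' < b ==> 0 < x' ==> x' < 2 * pi
    ==> \<Phi> (Complex t x) = \<Phi> (Complex t' x') ==> t = t' \<and> x = x'"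
  and kappa: "norm \<kappa> < 1"
  and bound: "\<And>t x. a \<le> t ==> t \<le> b ==> norm (\<Phi> (Complex t x) - \<kappa> * cnj (\<Phi> (Complex t x))) \<le> B"
 shows "(1 - (norm \<kappa>)\<^sup>2) * integral {a..b} (\<lambda>t. integral {0..2 * pi} (\<lambda>x. (norm (deriv \<Phi> (Complex t x)))\<^sup>2)) \<le> pi * B\<^sup>2"
proof -
 define S where "S = (box (vector [a, 0]) (vector [b, 2 * pi]) :: (real^2) set)"
 define CS where "CS = (cbox (vector [a, 0]) (vector [b, 2 * pi]) :: (real^2) set)"
 have S_iff: "v \<in> S \<longleftrightarrow> a < vec_nth v 1 \<and> vec_nth v 1 < b \<and> 0 < vec_nth v 2 \<and> vec_nth v 2 < 2 * pi" for v
  by (auto simp: S_def mem_box_cart forall_2)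
 have CS_iff: "v \<in> CS \<longleftrightarrow> a \<le> vec_nth v 1 \<and> vec_nth v 1 \<le> b \<and> 0 \<le> vec_nth v 2 \<and> vec_nth v 2 \<le> 2 * pi" for v
  by (auto simp: CS_def mem_box_cart forall_2)
 define c where "c v = Complex (vec_nth v 1) (vec_nth v 2)" for v :: "real^2"
 let ?k = "1 - (norm \<kappa>)\<^sup>2"
 let ?N = "\<lambda>v. (norm (deriv \<Phi> (c v)))\<^sup>2"
 define r where "r z = (vector [Re z, Im z] :: real^2)" for z
 define L where "L z = z - \<kappa> * cnj z" for z
 have r_bl: "bounded_linear r"
  unfolding r_def by (intro linear_conv_bounded_linear[THEN iffD1] linearI) (auto simp: Finite_Cartesian_Product.vec_eq_iff forall_2)
 have c_bl: "bounded_linear c"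
  unfolding c_def by (intro linear_conv_bounded_linear[THEN iffD1] linearI) (auto simp: complex_eq_iff)
 have L_bl: "bounded_linear L"
  unfolding L_def by (intro bounded_linear_sub bounded_linear_ident bounded_linear_const_mult bounded_linear_cnj)
 have r_norm: "norm (r z) = norm z" for z
  by (simp add: r_def norm_vec_def L2_set_def sum_2 cmod_def)
 have L_inj: "z = z'" if "L z = L z'" for z z'
 proof (rule ccontr)
  assume "z \<noteq> z'"
  have "z - z' = \<kappa> * cnj (z - z')" using that by (simp add: L_def algebra_simps)
  hence "norm (z - z') = norm \<kappa> * norm (z - z')" by (metis norm_mult complex_mod_cnj)
  thus False using \<open>z \<noteq> z'\<close> kappa by simp
 qed
 define f where "f v = r (L (\<Phi> (c v)))" for v
 define f' where "f' v h = r (L (deriv \<Phi> (c v) * c h))" for v h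
 have cU: "c v \<in> U" if "v \<in> CS" for v using that sub by (auto simp: c_def CS_iff)
 have SCS: "S \<subseteq> CS" unfolding S_def CS_def by (rule box_subset_cbox)
 have der: "(f has_derivative f' v) (at v within S)" if "v \<in> S" for v
 proof -
  have "(\<Phi> has_field_derivative deriv \<Phi> (c v)) (at (c v))"
   by (rule holomorphic_derivI[OF hol U cU]) (use that SCS in blast)
  hence "(\<Phi> has_derivative (*) (deriv \<Phi> (c v))) (at (c v))" by (simp add: has_field_derivative_def)
  from diff_chain_at[OF bounded_linear_imp_has_derivative[OF c_bl] this]
  have "((L \<circ> (\<Phi> \<circ> c)) has_derivative (L \<circ> ((*) (deriv \<Phi> (c v)) \<circ> c))) (at v)"
   by (rule diff_chain_at[OF _ bounded_linear_imp_has_derivative[OF L_bl]])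
  hence "((r \<circ> (L \<circ> (\<Phi> \<circ> c))) has_derivative (r \<circ> (L \<circ> ((*) (deriv \<Phi> (c v)) \<circ> c)))) (at v)"
   by (rule diff_chain_at[OF _ bounded_linear_imp_has_derivative[OF r_bl]])
  thus ?thesis unfolding f_def f'_def o_def by (rule has_derivative_at_withinI)
 qed
 have det: "Determinants.det (matrix (f' v)) = ?k * ?N v" for v
 proof -
  define w where "w = deriv \<Phi> (c v)"
  have c1: "c (axis 1 1) = 1" "c (axis 2 1) = \<i>" by (auto simp: c_def axis_def complex_eq_iff)
  have "Determinants.det (matrix (f' v)) = Re (L w) * Im (L (w * \<i>)) - Re (L (w * \<i>)) * Im (L w)"
   by (simp add: det_2 matrix_def f'_def w_def c1 r_def)
  also have "... = ?k * (norm w)\<^sup>2"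
   unfolding cmod_power2 L_def by (simp add: power2_eq_square algebra_simps)
  finally show ?thesis by (simp add: w_def)
 qed
 have injf: "inj_on f S"
 proof (rule inj_onI)
  fix v v' assume v: "v \<in> S" "v' \<in> S" "f v = f v'"
  have "r z = r z' ==> z = z'" for z z'
   by (simp add: r_def Finite_Cartesian_Product.vec_eq_iff forall_2 complex_eq_iff)
  hence "\<Phi> (c v) = \<Phi> (c v')" using v(3) L_inj by (auto simp: f_def)
  thus "v = v'" using inj[of "vec_nth v 1" "vec_nth v 2" "vec_nth v' 1" "vec_nth v' 2"] v
   by (auto simp: c_def S_iff Finite_Cartesian_Product.vec_eq_iff forall_2)
 qed
 have ccont: "continuous_on A c" for A using c_bl by (rule linear_continuous_on)
 have dcont: "continuous_on U (deriv \<Phi>)"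
  by (intro holomorphic_on_imp_continuous_on holomorphic_deriv hol U)
 have gcont: "continuous_on CS (\<lambda>v. ?k * ?N v)"
  by (intro continuous_intros continuous_on_compose2[OF dcont ccont]) (use cU in blast)
 define J where "J = integral CS (\<lambda>v. ?k * ?N v)"
 have "((\<lambda>v. ?k * ?N v) has_integral J) CS"
  unfolding J_def CS_def by (rule integrable_integral[OF integrable_continuous[OF gcont[unfolded CS_def]]])
 hence "((\<lambda>v. ?k * ?N v) has_integral J) S"
  unfolding S_def CS_def by (subst has_integral_open_interval)
 moreover have "\<bar>Determinants.det (matrix (f' v))\<bar> = ?k * ?N v" for v
  unfolding det using kappa by (simp add: abs_square_le_1 abs_mult)
 ultimately have m: "f ` S \<in> lmeasurable" "measure lebesgue (f ` S) = J"
  using has_measure_differentiable_image[OF _ der injf, of J] by (auto simp: S_def)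
 have "f ` S \<subseteq> cball 0 B" using bound SCS by (auto simp: f_def r_norm L_def c_def CS_iff)
 hence "J \<le> measure lebesgue (cball (0::real^2) B)"
  unfolding m(2)[symmetric] by (intro measure_mono_fmeasurable) (use m(1) in \<open>auto simp: fmeasurableD\<close>)
 also have "... = pi * B\<^sup>2" using ab content_cball[of B "0::real^2"] by (simp add: unit_ball_vol_2)
 finally have J_le: "J \<le> pi * B\<^sup>2" .
 have "J = ?k * integral CS ?N" by (simp add: J_def)
 also have "integral CS ?N
  = integral (cbox (a, 0) (b, 2 * pi)) (\<lambda>(t, x). (norm (deriv \<Phi> (Complex t x)))\<^sup>2)"
 proof -
  \<comment> \<open>The change of variables took place on \<open>real^2\<close>, while Fubini is
    applied on pairs; \<open>g\<close> and \<open>h\<close> identify the two spaces and preserve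
    volume.\<close>
  define g where "g p = (vector [fst p, snd p] :: real^2)" for p :: "real \<times> real"
  define h where "h v = (vec_nth v 1, vec_nth v 2)" for v :: "real^2"
  have gh: "g (h w) = w" for w by (simp add: g_def h_def Finite_Cartesian_Product.vec_eq_iff forall_2)
  have hg: "h (g p) = p" for p by (simp add: g_def h_def)
  have gim: "g ` cbox u v = cbox (g u) (g v)" for u v
  proof -
   have "w \<in> g ` cbox u v \<longleftrightarrow> h w \<in> cbox u v" for w using gh hg by (metis image_iff)
   thus ?thesis by (cases u; cases v) (auto simp: h_def g_def mem_box_cart forall_2)
  qed
  have him: "h ` cbox u v = cbox (h u) (h v)" for u v
  proof -
   have "w \<in> h ` cbox u v \<longleftrightarrow> g w \<in> cbox u v" for w using gh hg by (metis image_iff)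
   thus ?thesis by (auto simp: h_def g_def mem_box_cart forall_2)
  qed
  have cont: "content (g ` cbox u v) = 1 * content (cbox u v)" for u v
  proof -
   obtain u1 u2 v1 v2 where uv: "u = (u1, u2)" "v = (v1, v2)" by fastforce
   have "cbox (vector [u1, u2]) (vector [v1, v2]) = ({} :: (real^2) set) \<longleftrightarrow> \<not> (u1 \<le> v1 \<and> u2 \<le> v2)"

   proof
    assume e: "cbox (vector [u1, u2]) (vector [v1, v2]) = ({} :: (real^2) set)"
    have "(vector [u1, u2] :: real^2) \<notin> cbox (vector [u1, u2]) (vector [v1, v2])" unfolding e by simp
    thus "\<not> (u1 \<le> v1 \<and> u2 \<le> v2)" by (auto simp: mem_box_cart forall_2)
   next
    assume "\<not> (u1 \<le> v1 \<and> u2 \<le> v2)"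
    thus "cbox (vector [u1, u2]) (vector [v1, v2]) = ({} :: (real^2) set)"
     by (auto simp: mem_box_cart forall_2)
   qed
   thus ?thesis unfolding gim uv content_Pair by (auto simp: g_def content_cbox_if_cart UNIV_2)
  qed
  have gcont: "continuous (at x) g" for x
  proof -
   have "bounded_linear g"
    unfolding g_def by (intro linear_conv_bounded_linear[THEN iffD1] linearI) (auto simp: Finite_Cartesian_Product.vec_eq_iff forall_2)
   thus ?thesis by (rule linear_continuous_at)
  qed
  have "continuous_on CS ?N"
   by (intro continuous_intros continuous_on_compose2[OF dcont ccont]) (use cU in blast)
  hence X: "(?N has_integral integral CS ?N) CS"
   unfolding CS_def by (intro integrable_integral integrable_continuous)
  have "((\<lambda>p. (norm (deriv \<Phi> (c (g p))))\<^sup>2) has_integral (1 / 1) *\<^sub>R integral CS ?N) (h ` CS)"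
   unfolding CS_def
   by (rule has_integral_twiddle[of 1 h g, OF _ hg gh gcont _ _ cont X[unfolded CS_def]])
    (use gim him in \<open>simp, blast, blast\<close>)
  moreover have "h ` CS = cbox (a, 0) (b, 2 * pi)" unfolding CS_def him by (simp add: h_def)
  moreover have "(\<lambda>p. (norm (deriv \<Phi> (c (g p))))\<^sup>2) = (\<lambda>(t, x). (norm (deriv \<Phi> (Complex t x)))\<^sup>2)"
   by (auto simp: c_def g_def)
  ultimately show ?thesis by (simp add: integral_unique)
 qed
 also have "... = integral {a..b} (\<lambda>t. integral {0..2 * pi} (\<lambda>x. (norm (deriv \<Phi> (Complex t x)))\<^sup>2))"
 proof -
  have "continuous_on (cbox (a, 0) (b, 2 * pi)) (\<lambda>p. deriv \<Phi> (Complex (fst p) (snd p)))"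
  proof (rule continuous_on_compose2[OF dcont])
   show "continuous_on (cbox (a, 0) (b, 2 * pi)) (\<lambda>p. Complex (fst p) (snd p))"
    by (auto intro!: continuous_intros)
   show "(\<lambda>p. Complex (fst p) (snd p)) ` cbox (a, 0) (b, 2 * pi) \<subseteq> U"
    using sub by (auto simp: cbox_Pair_eq)
  qed
  hence "continuous_on (cbox (a, 0) (b, 2 * pi)) (\<lambda>p. (norm (deriv \<Phi> (Complex (fst p) (snd p))))\<^sup>2)"
   by (intro continuous_intros)
  thus ?thesis
   using integral_prod_continuous[of a 0 b "2 * pi" "\<lambda>p. (norm (deriv \<Phi> (Complex (fst p) (snd p))))\<^sup>2"]
   by (simp add: case_prod_unfold)
 qed
 finally show ?thesis using J_le by simp
qed

text \<open>Compare the area of the image of the annulus \<open>r \<le> |z| \<le> R\<close> with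
  that of a region containing it, and let \<open>R\<close> tend to infinity. The disc of radius
  \<open>R + A / R\<close> is too large by an area that does not vanish in the limit. But
  \<open>Y z = z + c 1 / z + ...\<close> sends \<open>|z| = R\<close> to nearly an ellipse, and
  straightening it with \<open>\<kappa> R\<close> reduces the error in the radius to
  \<open>K / R^2\<close>.\<close>

lemma area_theorem_odd:
 fixes c :: "nat => complex" and s :: "complex => complex"
 assumes r: "0 < r" "1 / r\<^sup>2 < \<tau>" and c0: "c 0 = 1"
  and sums: "\<And>w. norm w < \<tau> ==> (\<lambda>k. c k * w ^ k) sums s w"
  and inj: "inj_on (\<lambda>z. z * s (inverse (z\<^sup>2))) {z. norm z \<ge> r}"
 shows "(\<Sum>k=1..<N. (2 * real k - 1) * (norm (c k))\<^sup>2 / r ^ (4 * k)) \<le> 1"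
proof -
 define Y where "Y z = z * s (inverse (z\<^sup>2))" for z
 let ?E = "\<lambda>z. s (inverse (z\<^sup>2)) - 1 - c 1 * inverse (z\<^sup>2)"
 define s' where "s' w = suminf (\<lambda>n. diffs c n * w ^ n)" for w
 have wlt: "norm (inverse (z\<^sup>2)) < \<tau>" if "norm z \<ge> r" for z :: complex
 proof -
  have "1 / (norm z)\<^sup>2 \<le> 1 / r\<^sup>2" using that r(1) by (intro divide_left_mono) (auto intro!: mult_pos_pos zero_less_power)
  thus ?thesis using r(2) by (simp add: norm_power norm_divide inverse_eq_divide)
 qed
 have sder: "(s has_field_derivative s' w) (at w)" if "norm w < \<tau>" for w
 proof -
  have "((\<lambda>z. suminf (\<lambda>n. c n * z ^ n)) has_field_derivative s' w) (at w)"
   unfolding s'_def by (rule termdiffs_strong'[OF _ that]) (use sums in \<open>auto simp: sums_iff\<close>)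
  thus ?thesis by (rule has_field_derivative_transform_within_open[where S = "ball 0 \<tau>"])
    (use that sums in \<open>auto simp: sums_iff\<close>)
 qed
 \<comment> \<open>The derivative of \<open>Y\<close>, written as a function of
   \<open>w = z^(-2)\<close>.\<close>
 define G where "G w = s w - 2 * w * s' w" for w
 have Gsums: "(\<lambda>k. ((1 - 2 * of_nat k) * c k) * w ^ k) sums G w" if w: "norm w < \<tau>" for w
 proof -
  have "summable (\<lambda>n. diffs c n * w ^ n)"
   by (rule termdiff_converges[OF w]) (use sums in \<open>auto simp: sums_iff\<close>)
  hence "(\<lambda>n. of_nat n * c n * w ^ (n - Suc 0)) sums s' w" unfolding s'_def by (rule diffs_equiv)
  hence "(\<lambda>n. 2 * w * (of_nat n * c n * w ^ (n - Suc 0))) sums (2 * w * s' w)" by (rule sums_mult)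
  also have "(\<lambda>n. 2 * w * (of_nat n * c n * w ^ (n - Suc 0))) = (\<lambda>n. 2 * of_nat n * c n * w ^ n)"
  proof
   fix n show "2 * w * (of_nat n * c n * w ^ (n - Suc 0)) = 2 * of_nat n * c n * w ^ n"
    by (cases n) auto
  qed
  finally show ?thesis using sums_diff[OF sums[OF w]] unfolding G_def by (simp add: algebra_simps)
 qed
 define \<Phi> where "\<Phi> \<xi> = Y (exp \<xi>)" for \<xi> :: complex
 let ?I = "\<lambda>t. integral {0..2 * pi} (\<lambda>x. (norm (deriv \<Phi> (Complex t x)))\<^sup>2)"
 define U where "U = {\<xi>::complex. norm (exp (- 2 * \<xi>)) < \<tau>}"
 have U: "open U" unfolding U_def by (intro open_Collect_less continuous_intros)
 have exp2: "inverse ((exp \<xi>)\<^sup>2) = exp (- 2 * \<xi>)" for \<xi> :: complex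
  by (simp add: exp_minus flip: exp_of_nat_mult)
 have \<Phi>der: "(\<Phi> has_field_derivative exp \<xi> * G (exp (- 2 * \<xi>))) (at \<xi>)" if "\<xi> \<in> U" for \<xi>
 proof -
  have s2: "(s has_field_derivative s' (exp (- 2 * \<xi>))) (at (exp (- 2 * \<xi>)))"
   by (rule sder) (use that in \<open>simp add: U_def\<close>)
  have "((\<lambda>\<xi>. exp \<xi> * s (exp (- 2 * \<xi>))) has_field_derivative exp \<xi> * G (exp (- 2 * \<xi>))) (at \<xi>)"
  proof -
   have "((\<lambda>\<xi>. exp (- 2 * \<xi>)) has_field_derivative - 2 * exp (- 2 * \<xi>)) (at \<xi>)"
    by (auto intro!: derivative_eq_intros)
   from DERIV_chain2[where g = "\<lambda>\<xi>. exp (- 2 * \<xi>)", OF s2 this]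
   have "((\<lambda>\<xi>. s (exp (- 2 * \<xi>))) has_field_derivative s' (exp (- 2 * \<xi>)) * (- 2 * exp (- 2 * \<xi>))) (at \<xi>)" .
   from DERIV_mult[OF DERIV_exp this] show ?thesis by (simp add: G_def algebra_simps)
  qed
  thus ?thesis by (simp add: \<Phi>_def [abs_def] Y_def exp2)
 qed
 have \<Phi>hol: "\<Phi> holomorphic_on U" using \<Phi>der by (auto simp: holomorphic_on_open[OF U])
 have d\<Phi>: "deriv \<Phi> \<xi> = exp \<xi> * G (exp (- 2 * \<xi>))" if "\<xi> \<in> U" for \<xi>
  using \<Phi>der[OF that] by (rule DERIV_imp_deriv)
 have exp_ge: "r \<le> exp t" if "ln r \<le> t" for t
 proof -
  have "exp (ln r) \<le> exp t" using that by simp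
  thus ?thesis using r(1) by simp
 qed
 have subU: "Complex t x \<in> U" if "ln r \<le> t" for t x
 proof -
  have "r \<le> norm (exp (Complex t x))" using exp_ge[OF that] by simp
  from wlt[OF this] show ?thesis unfolding U_def exp2 by simp
 qed
 have \<Phi>inj: "t = t' \<and> x = x'" if "ln r < t" "ln r < t'" "0 < x" "x < 2 * pi" "0 < x'" "x' < 2 * pi"
  "\<Phi> (Complex t x) = \<Phi> (Complex t' x')" for t x t' x'
 proof -
  have "r \<le> exp t" "r \<le> exp t'" using that(1,2) by (auto intro: exp_ge)
  hence rr: "Complex t x \<in> exp -` {z. r \<le> norm z}" "Complex t' x' \<in> exp -` {z. r \<le> norm z}" by simp_all
  have "exp (Complex t x) = exp (Complex t' x')"
  proof (rule inj_onD[OF inj])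
   show "exp (Complex t x) * s (inverse ((exp (Complex t x))\<^sup>2)) = exp (Complex t' x') * s (inverse ((exp (Complex t' x'))\<^sup>2))"
    using that(7) unfolding \<Phi>_def Y_def .
  qed (use rr in simp_all)
  then obtain n :: int where n: "Complex t x = Complex t' x' + of_int (2 * n) * of_real pi * \<i>"
   by (auto simp: exp_eq)
  hence tt: "t = t'" "x = x' + 2 * of_int n * pi" by (auto simp: complex_eq_iff)
  hence "\<bar>of_int n * (2 * pi)\<bar> < 1 * (2 * pi)" using that by auto
  hence "\<bar>of_int n :: real\<bar> < 1" by (simp add: abs_mult)
  thus ?thesis using tt by simp
 qed
 obtain M where M: "M \<ge> 0" "\<And>z. norm z \<ge> r ==> norm (?E z) \<le> M / norm z ^ 4"
 proof -
  define q where "q w = suminf (\<lambda>k. c (k + 2) * w ^ k)" for w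
  have qsum: "summable (\<lambda>k. c (k + 2) * w ^ k)" if "norm w < \<tau>" for w
  proof -
   have "summable (\<lambda>k. c (k + 2) * w ^ (k + 2))"
    using sums_summable[OF sums[OF that]] by (subst summable_iff_shift)
   hence "summable (\<lambda>k. c (k + 2) * w ^ (k + 2) * inverse (w\<^sup>2))" by (rule summable_mult2)
   moreover have "c (k + 2) * w ^ (k + 2) * inverse (w\<^sup>2) = c (k + 2) * w ^ k" if "w \<noteq> 0" for k
    using that by (simp add: power_add power2_eq_square field_simps)
   ultimately show ?thesis by (cases "w = 0") (simp_all only: summable_0_powser refl if_True not_False_eq_True)
  qed
  have qs: "s w - 1 - c 1 * w = w\<^sup>2 * q w" if w: "norm w < \<tau>" for w
  proof -
   have "(\<lambda>k. c (k + 2) * w ^ (k + 2)) sums (s w - (\<Sum>k<2. c k * w ^ k))"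
    using sums_split_initial_segment[OF sums[OF w], of 2] .
   moreover have "(\<lambda>k. w\<^sup>2 * (c (k + 2) * w ^ k)) sums (w\<^sup>2 * q w)"
    unfolding q_def by (rule sums_mult[OF summable_sums[OF qsum[OF w]]])
   moreover have "(\<lambda>k. w\<^sup>2 * (c (k + 2) * w ^ k)) = (\<lambda>k. c (k + 2) * w ^ (k + 2))"
    by (simp add: power2_eq_square mult_ac)
   ultimately have "s w - (\<Sum>k<2. c k * w ^ k) = w\<^sup>2 * q w" by (simp add: sums_unique2)
   thus ?thesis by (simp add: c0 eval_nat_numeral diff_diff_eq)
  qed
  have "isCont q w" if "norm w < \<tau>" for w
   unfolding q_def using DERIV_isCont[OF termdiffs_strong'[OF qsum that]] by simp
  hence "continuous_on (cball 0 (1 / r\<^sup>2)) q"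
   using r(2) by (intro continuous_at_imp_continuous_on) auto
  hence "bounded (q ` cball 0 (1 / r\<^sup>2))"
   by (intro compact_imp_bounded compact_continuous_image compact_cball)
  then obtain M where M: "\<And>w. w \<in> cball 0 (1 / r\<^sup>2) ==> norm (q w) \<le> M"
   unfolding bounded_iff by blast
  show ?thesis
  proof (rule that[of M])
   show "M \<ge> 0" using M[of 0] r(1) by (simp add: order_trans[OF norm_ge_zero])
   fix z :: complex assume z: "norm z \<ge> r"
   have "1 / (norm z)\<^sup>2 \<le> 1 / r\<^sup>2" using z r(1) by (intro divide_left_mono) (auto intro!: mult_pos_pos zero_less_power)
   hence "norm (q (inverse (z\<^sup>2))) \<le> M"
    by (intro M) (simp add: norm_power norm_divide inverse_eq_divide)
   hence "norm ((inverse (z\<^sup>2))\<^sup>2) * norm (q (inverse (z\<^sup>2))) \<le> norm ((inverse (z\<^sup>2))\<^sup>2) * M"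
    by (rule mult_left_mono) simp
   also have "norm ((inverse (z\<^sup>2))\<^sup>2) * M = M / norm z ^ 4"
    by (simp add: norm_power norm_divide inverse_eq_divide power_divide flip: power_mult)
   finally show "norm (?E z) \<le> M / norm z ^ 4" unfolding qs[OF wlt[OF z]] by (simp add: norm_mult)
  qed
 qed
 define A where "A = norm (c 1)"
 have A: "A \<ge> 0" by (simp add: A_def)
 \<comment> \<open>The three terms come from the reflection of \<open>c 1 / z\<close>, the
   reflection of the remainder \<open>E\<close>, and \<open>E\<close> itself when
   \<open>|z| > R / 2\<close>.\<close>
 define K where "K = A\<^sup>2 / r + A * M / r ^ 3 + 8 * M / r"
 have K: "K \<ge> 0" using A M(1) r(1) by (simp add: K_def)
 define \<kappa> where "\<kappa> R = c 1 / of_real R ^ 2" for R :: real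
 have bound: "norm (Y z - \<kappa> R * cnj (Y z)) \<le> R + K / R\<^sup>2"
  if z: "r \<le> norm z" "norm z \<le> R" and R: "4 * A \<le> r * R" "4 * M \<le> r ^ 3 * R" for z R
 proof -
  define t where "t = norm z"
  have t: "r \<le> t" "t \<le> R" "0 < t" "0 < R" using z r(1) by (auto simp: t_def)
  have znz: "z \<noteq> 0" using t by (auto simp: t_def)
  define E where "E = Y z - z - c 1 / z"
  have E: "norm E \<le> M / t ^ 3"
  proof -
   have "E = z * (?E z)"
   proof -
    define v where "v = s (inverse (z\<^sup>2))"
    have "c 1 / z = z * (c 1 * inverse (z\<^sup>2))" using znz by (simp add: field_simps power2_eq_square)
    thus ?thesis unfolding E_def Y_def v_def[symmetric] by (simp add: algebra_simps)
   qed
   hence "norm E = t * norm (?E z)" by (simp add: norm_mult t_def)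
   also have "... \<le> t * (M / t ^ 4)" using M(2)[OF z(1)] t by (intro mult_left_mono) (auto simp: t_def)
   also have "t * (M / t ^ 4) = M / t ^ 3" by (simp add: eval_nat_numeral)
   finally show ?thesis .
  qed
  have zz: "z * cnj z = of_real (t\<^sup>2)" by (simp add: t_def complex_norm_square[symmetric])
  \<comment> \<open>This is the reason for the choice of \<open>\<kappa> R\<close>: the term
    \<open>c 1 / z\<close> cancels on \<open>|z| = R\<close>, and inside it is small enough to be
    absorbed by the slack \<open>R - |z|\<close>.\<close>
  have "c 1 / z - \<kappa> R * cnj z = c 1 / z * of_real (1 - t\<^sup>2 / R\<^sup>2)"
  proof -
   have "\<kappa> R * cnj z = c 1 / z * (z * cnj z) / of_real R ^ 2" by (simp add: \<kappa>_def)
   thus ?thesis unfolding zz by (simp add: algebra_simps)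
  qed
  moreover have "t\<^sup>2 / R\<^sup>2 \<le> 1" using t by (simp add: divide_le_eq)
  ultimately have n1: "norm (c 1 / z - \<kappa> R * cnj z) = A / t * (1 - t\<^sup>2 / R\<^sup>2)"
   by (simp add: norm_mult norm_divide A_def t_def del: of_real_diff of_real_divide)
  have eq: "Y z - \<kappa> R * cnj (Y z) = z + (c 1 / z - \<kappa> R * cnj z) + (E - \<kappa> R * cnj (c 1 / z) - \<kappa> R * cnj E)"
   by (simp add: E_def algebra_simps)
  have n\<kappa>: "norm (\<kappa> R) = A / R\<^sup>2" using t by (simp add: \<kappa>_def A_def norm_divide norm_power)
  have nn: "norm (\<kappa> R * cnj (c 1 / z)) = A / R\<^sup>2 * (A / t)" "norm (\<kappa> R * cnj E) = A / R\<^sup>2 * norm E" "norm z = t"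
   unfolding norm_mult n\<kappa> complex_mod_cnj norm_divide A_def[symmetric] t_def by simp_all
  have "norm (Y z - \<kappa> R * cnj (Y z)) \<le> t + A / t * (1 - t\<^sup>2 / R\<^sup>2) + (norm E + A / R\<^sup>2 * (A / t) + A / R\<^sup>2 * norm E)"
  proof -
   have tri: "norm (a1 + a2 + (a3 - a4 - a5)) \<le> norm a1 + norm a2 + (norm a3 + norm a4 + norm a5)"
    for a1 a2 a3 a4 a5 :: complex
    by (intro order_trans[OF norm_triangle_ineq] add_mono order_trans[OF norm_triangle_ineq4] order_refl)
   show ?thesis using tri[of z "c 1 / z - \<kappa> R * cnj z" E "\<kappa> R * cnj (c 1 / z)" "\<kappa> R * cnj E"]
    unfolding eq nn n1 .
  qed
  also have "... \<le> t + A / t * (1 - t\<^sup>2 / R\<^sup>2) + (M / t ^ 3 + A / R\<^sup>2 * (A / r) + A / R\<^sup>2 * (M / r ^ 3))"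
  proof -
   have le: "A / t \<le> A / r" "M / t ^ 3 \<le> M / r ^ 3"
    using t A M(1) r(1) by (auto intro!: divide_left_mono power_mono)
   show ?thesis
    using mult_left_mono[OF le(1), of "A / R\<^sup>2"] mult_left_mono[OF order_trans[OF E le(2)], of "A / R\<^sup>2"] E A t
    by simp
  qed
  also have "... \<le> R + K / R\<^sup>2"
  proof -
   have "A / t * (1 - t\<^sup>2 / R\<^sup>2) = A / t * ((R - t) * (R + t) / R\<^sup>2)"
    using t by (simp add: field_simps power2_eq_square)
   also have "... \<le> A / t * ((R - t) * (2 * R) / R\<^sup>2)"
    using t A by (intro mult_left_mono divide_right_mono) auto
   also have "... = (R - t) * (2 * A / (t * R))" using t by (simp add: power2_eq_square)
   also have "... \<le> (R - t) * (1 / 2)"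
   proof (intro mult_left_mono)
    have "4 * A \<le> t * R" using R(1) t by (meson mult_right_mono order_trans less_imp_le)
    thus "2 * A / (t * R) \<le> 1 / 2" using t by (simp add: divide_le_eq)
   qed (use t in auto)
   finally have 1: "A / t * (1 - t\<^sup>2 / R\<^sup>2) \<le> (R - t) / 2" by simp
   have 2: "M / t ^ 3 \<le> (R - t) / 2 + 8 * M / r / R\<^sup>2"
   proof (cases "t \<le> R / 2")
    case True
    have "M / t ^ 3 \<le> M / r ^ 3" using t r(1) M(1) by (auto intro!: divide_left_mono power_mono)
    also have "... \<le> R / 4" using R(2) r(1) by (simp add: divide_le_eq mult.commute)
    also have "... \<le> (R - t) / 2" using True by simp
    also have "... \<le> (R - t) / 2 + 8 * M / r / R\<^sup>2" using M(1) r(1) by simp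
    finally show ?thesis .
   next
    case False
    have "R\<^sup>2 * r \<le> (2 * t)\<^sup>2 * (2 * t)" using False t r(1) by (intro mult_mono power_mono) auto
    hence "R\<^sup>2 * r \<le> 8 * t ^ 3" by (simp add: power2_eq_square eval_nat_numeral)
    hence "M * (R\<^sup>2 * r) \<le> M * (8 * t ^ 3)" using M(1) by (rule mult_left_mono)
    hence "M / t ^ 3 \<le> 8 * M / r / R\<^sup>2" using t r(1) by (simp add: field_simps)
    moreover have "(R - t) / 2 \<ge> 0" using t by simp
    ultimately show ?thesis by linarith
   qed
   have "K / R\<^sup>2 = A / R\<^sup>2 * (A / r) + A / R\<^sup>2 * (M / r ^ 3) + 8 * M / r / R\<^sup>2"
    by (simp add: K_def add_divide_distrib power2_eq_square mult_ac)
   thus ?thesis using 1 2 by argo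
  qed
  finally show ?thesis .
 qed
 define S where "S R = (\<Sum>k=1..<N. (2 * real k - 1) * (norm (c k))\<^sup>2 * (r powr (2 - 4 * real k) - R powr (2 - 4 * real k)))" for R
 let ?d = "\<lambda>k. (1 - 2 * of_nat k) * c k"
 let ?e = "\<lambda>k. 2 - 4 * real k"
 have main: "(1 - A\<^sup>2 / R ^ 4) * (R\<^sup>2 - r\<^sup>2 + S R) \<le> (R + K / R\<^sup>2)\<^sup>2"
  if R: "r < R" "4 * A \<le> r * R" "4 * M \<le> r ^ 3 * R" "A < R\<^sup>2" for R
 proof -
  have Rpos: "R > 0" using R r by simp
  have n\<kappa>: "norm (\<kappa> R) = A / R\<^sup>2" using Rpos by (simp add: \<kappa>_def A_def norm_divide norm_power)
  have "(1 - (norm (\<kappa> R))\<^sup>2) * integral {ln r..ln R} ?I \<le> pi * (R + K / R\<^sup>2)\<^sup>2"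
  proof (rule area_image_le[OF \<Phi>hol U])
   show "ln r < ln R" using R(1) r(1) by simp
   show "norm (\<kappa> R) < 1" using R(4) Rpos by (simp add: n\<kappa>)
   fix t x assume t: "ln r \<le> t" "t \<le> ln R"
   have "exp t \<le> exp (ln R)" using t by simp
   hence "r \<le> exp t" "exp t \<le> R" using exp_ge t Rpos by auto
   thus "norm (\<Phi> (Complex t x) - \<kappa> R * cnj (\<Phi> (Complex t x))) \<le> R + K / R\<^sup>2"
    unfolding \<Phi>_def by (intro bound R) auto
  qed (use subU \<Phi>inj K Rpos in auto)
  moreover have "pi * (R\<^sup>2 - r\<^sup>2 + S R) \<le> integral {ln r..ln R} ?I"
  proof -
   \<comment> \<open>Lower bound for the inner integral, with antiderivative \<open>L'\<close>. The
     sum runs to \<open>max 1 N\<close> so that the main term \<open>k = 0\<close>, which produces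
     \<open>R\<^sup>2 - r\<^sup>2\<close>, is present for every \<open>N\<close>.\<close>
   define L where "L t = 2 * pi * (\<Sum>k<max 1 N. (norm (?d k))\<^sup>2 * exp ((?e k) * t))" for t
   define L' where "L' t = pi * (\<Sum>k<max 1 N. (1 - 2 * real k) * (norm (c k))\<^sup>2 * exp ((?e k) * t))" for t
   have "(L has_integral L' (ln R) - L' (ln r)) {ln r..ln R}"
   proof (rule fundamental_theorem_of_calculus)
    fix t assume "t \<in> {ln r..ln R}"
    have nn: "(norm (?d k))\<^sup>2 = (1 - 2 * real k)\<^sup>2 * (norm (c k))\<^sup>2" for k
    proof -
     have "(1 - 2 * of_nat k :: complex) = of_real (1 - 2 * real k)" by simp
     hence "norm (1 - 2 * of_nat k :: complex) = \<bar>1 - 2 * real k\<bar>" by (simp only: norm_of_real)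
     thus ?thesis by (simp add: norm_mult power_mult_distrib)
    qed
    have "(L' has_field_derivative L t) (at t)" unfolding L'_def L_def nn
     by (auto intro!: derivative_eq_intros sum.cong simp: sum_distrib_left power2_eq_square algebra_simps)
    thus "(L' has_vector_derivative L t) (at t within {ln r..ln R})"
     by (simp add: has_real_derivative_iff_has_vector_derivative[symmetric] has_field_derivative_at_within)
   qed (use R(1) r(1) in auto)
   hence Lint: "L integrable_on {ln r..ln R}" and "L' (ln R) - L' (ln r) = integral {ln r..ln R} L"
    by (auto simp: integral_unique)
   note this(2)
   also have "integral {ln r..ln R} L \<le> integral {ln r..ln R} ?I"
   proof (rule integral_le)
    show "L integrable_on {ln r..ln R}" by (rule Lint)
    have "continuous_on (cbox (ln r) (ln R)) (\<lambda>t. integral (cbox 0 (2 * pi)) (\<lambda>x. (norm (deriv \<Phi> (Complex t x)))\<^sup>2))"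
    proof (rule integral_continuous_on_param)
     have dcont: "continuous_on U (deriv \<Phi>)"
      by (intro holomorphic_on_imp_continuous_on holomorphic_deriv \<Phi>hol U)
     have "continuous_on (cbox (ln r) (ln R) \<times> cbox 0 (2 * pi)) (\<lambda>p. deriv \<Phi> (Complex (fst p) (snd p)))"
     proof (rule continuous_on_compose2[OF dcont])
      show "continuous_on (cbox (ln r) (ln R) \<times> cbox 0 (2 * pi)) (\<lambda>p. Complex (fst p) (snd p))"
       by (auto intro!: continuous_intros)
     qed (use subU in auto)
     hence "continuous_on (cbox (ln r) (ln R) \<times> cbox 0 (2 * pi)) (\<lambda>p. (norm (deriv \<Phi> (Complex (fst p) (snd p))))\<^sup>2)"
      by (intro continuous_intros)
     thus "continuous_on (cbox (ln r) (ln R) \<times> cbox 0 (2 * pi)) (\<lambda>(t, x). (norm (deriv \<Phi> (Complex t x)))\<^sup>2)"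
      by (simp add: case_prod_unfold)
    qed
    thus "?I integrable_on {ln r..ln R}" using integrable_continuous[of "ln r" "ln R"] by simp
    fix t assume t: "t \<in> {ln r..ln R}"
    define q where "q = exp (- 2 * t)"
    have q: "0 < q" "q < \<tau>" using t subU by (auto simp: U_def q_def)
    have "norm (deriv \<Phi> (Complex t x)) = exp t * norm (G (of_real q * exp (- 2 * \<i> * of_real x)))" for x
    proof -
     have "exp (- 2 * Complex t x) = of_real q * exp (- 2 * \<i> * of_real x)"
      unfolding q_def exp_of_real[symmetric] exp_add[symmetric] by (simp add: Complex_eq algebra_simps)
     thus ?thesis using d\<Phi>[OF subU] t by (simp add: norm_mult)
    qed
    hence "?I t =
      (exp t)\<^sup>2 * integral {0..2 * pi} (\<lambda>x. (norm (G (of_real q * exp (- 2 * \<i> * of_real x))))\<^sup>2)"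
     by (simp add: power_mult_distrib)
    also have "... \<ge> (exp t)\<^sup>2 * (2 * pi * (\<Sum>k<max 1 N. (norm (?d k) * q ^ k)\<^sup>2))"
     by (intro mult_left_mono integral_powser_norm2_ge[OF q Gsums]) auto
    also have "(exp t)\<^sup>2 * (2 * pi * (\<Sum>k<max 1 N. (norm (?d k) * q ^ k)\<^sup>2)) = L t"
    proof -
     have "(exp t)\<^sup>2 * (q ^ k)\<^sup>2 = exp ((?e k) * t)" for k
      unfolding q_def by (simp add: algebra_simps flip: exp_of_nat_mult exp_add)
     hence "(exp t)\<^sup>2 * (norm (?d k) * q ^ k)\<^sup>2
       = (norm (?d k))\<^sup>2 * exp ((?e k) * t)" for k
      by (metis (no_types, lifting) mult.left_commute power_mult_distrib)
     thus ?thesis unfolding L_def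
      by (subst mult.left_commute, subst sum_distrib_left) (simp add: mult.assoc)
    qed
    finally show "L t \<le> ?I t" .
   qed
   also have "L' (ln R) - L' (ln r) = pi * (R\<^sup>2 - r\<^sup>2 + S R)"
   proof -
    have el: "exp ((?e k) * ln x) = x powr (?e k)" if "x > 0" for x k
     using that by (simp add: powr_def)
    have sp: "(\<Sum>k<max 1 N. f k) = f 0 + (\<Sum>k=1..<N. f k)" for f :: "nat => real"
    proof -
     have "{..<max 1 N} = insert 0 {1..<N}" by auto
     thus ?thesis by simp
    qed
    have "L' (ln R) - L' (ln r) = pi * ((\<Sum>k<max 1 N. (1 - 2 * real k) * (norm (c k))\<^sup>2 * R powr (?e k))
      - (\<Sum>k<max 1 N. (1 - 2 * real k) * (norm (c k))\<^sup>2 * r powr (?e k)))"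
     unfolding L'_def using Rpos r(1) by (simp add: el right_diff_distrib)
    also have "... = pi * (\<Sum>k<max 1 N. (2 * real k - 1) * (norm (c k))\<^sup>2 * (r powr (?e k) - R powr (?e k)))"
     unfolding sum_subtractf[symmetric] by (intro arg_cong[of _ _ "(*) pi"] sum.cong) (auto simp: algebra_simps)
    also have "... = pi * (R\<^sup>2 - r\<^sup>2 + S R)" unfolding sp S_def using Rpos r(1) by (simp add: c0)
    finally show ?thesis .
   qed
   finally show ?thesis .
  qed
  moreover have "(1 - (norm (\<kappa> R))\<^sup>2) \<ge> 0" using R(4) A Rpos by (simp add: n\<kappa> power_le_one)
  ultimately have "(1 - (norm (\<kappa> R))\<^sup>2) * (pi * (R\<^sup>2 - r\<^sup>2 + S R)) \<le> pi * (R + K / R\<^sup>2)\<^sup>2"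
   by (meson mult_left_mono order_trans)
  hence "pi * ((1 - (norm (\<kappa> R))\<^sup>2) * (R\<^sup>2 - r\<^sup>2 + S R)) \<le> pi * (R + K / R\<^sup>2)\<^sup>2"
   by (simp add: mult_ac)
  thus ?thesis by (simp add: n\<kappa> power_divide flip: power_mult)
 qed
 define Sinf where "Sinf = (\<Sum>k=1..<N. (2 * real k - 1) * (norm (c k))\<^sup>2 * r powr (?e k))"
 have Slim: "(S \<longlongrightarrow> Sinf) at_top"
 proof -
  have "((\<lambda>R::real. R powr (?e k)) \<longlongrightarrow> 0) at_top" if "k \<ge> 1" for k
   by (rule tendsto_neg_powr[OF _ filterlim_ident]) (use that in simp)
  hence "(S \<longlongrightarrow> (\<Sum>k=1..<N. (2 * real k - 1) * (norm (c k))\<^sup>2 * (r powr (?e k) - 0))) at_top"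
   unfolding S_def by (intro tendsto_intros) auto
  thus ?thesis by (simp add: Sinf_def)
 qed
 \<comment> \<open>The inequality \<open>main\<close>, expanded and rearranged so that the divergent
   \<open>R\<^sup>2\<close> cancels.\<close>
 have "((\<lambda>R. S R - r\<^sup>2 - A\<^sup>2 / R\<^sup>2 + A\<^sup>2 / R ^ 4 * (r\<^sup>2 - S R) - 2 * K / R - K\<^sup>2 / R ^ 4) \<longlongrightarrow> Sinf - r\<^sup>2 - 0 + 0 * (r\<^sup>2 - Sinf) - 0 - 0) at_top"
 proof (intro tendsto_intros Slim)
  show "((\<lambda>R. A\<^sup>2 / R\<^sup>2) \<longlongrightarrow> 0) at_top" "((\<lambda>R. A\<^sup>2 / R ^ 4) \<longlongrightarrow> 0) at_top"
   "((\<lambda>R. 2 * K / R) \<longlongrightarrow> 0) at_top" "((\<lambda>R. K\<^sup>2 / R ^ 4) \<longlongrightarrow> 0) at_top"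
   by real_asymp+
 qed
 moreover have "\<forall>\<^sub>F R in at_top. S R - r\<^sup>2 - A\<^sup>2 / R\<^sup>2 + A\<^sup>2 / R ^ 4 * (r\<^sup>2 - S R) - 2 * K / R - K\<^sup>2 / R ^ 4 \<le> 0"
 proof -
  have "\<forall>\<^sub>F R in at_top. r < R \<and> 4 * A / r \<le> R \<and> 4 * M / r ^ 3 \<le> R \<and> A < R \<and> 1 < R"
   by (intro eventually_conj eventually_gt_at_top eventually_ge_at_top)
  thus ?thesis
  proof eventually_elim
   case (elim R)
   have Rp: "R > 0" using elim by simp
   have "A < R\<^sup>2" using elim by (smt (verit) power2_eq_square mult_le_cancel_right1)
   hence "(1 - A\<^sup>2 / R ^ 4) * (R\<^sup>2 - r\<^sup>2 + S R) \<le> (R + K / R\<^sup>2)\<^sup>2"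
    using elim r(1) by (intro main) (auto simp: divide_le_eq mult.commute)
   moreover have "(1 - A\<^sup>2 / R ^ 4) * (R\<^sup>2 - r\<^sup>2 + S R) = R\<^sup>2 - r\<^sup>2 + S R - A\<^sup>2 / R\<^sup>2 + A\<^sup>2 / R ^ 4 * (r\<^sup>2 - S R)"
   proof -
    have "A\<^sup>2 / R ^ 4 * R\<^sup>2 = A\<^sup>2 / R\<^sup>2" by (simp add: eval_nat_numeral)
    thus ?thesis by (simp only: left_diff_distrib right_diff_distrib distrib_left)
   qed
   moreover have "(R + K / R\<^sup>2)\<^sup>2 = R\<^sup>2 + 2 * K / R + K\<^sup>2 / R ^ 4"
   proof -
    have "2 * R * (K / R\<^sup>2) = 2 * K / R" "(R\<^sup>2)\<^sup>2 = R ^ 4"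
     using Rp by (simp_all add: power2_eq_square power4_eq_xxxx)
    thus ?thesis by (simp add: power2_sum power_divide)
   qed
   ultimately show ?case by linarith
  qed
 qed
 ultimately have "Sinf - r\<^sup>2 - 0 + 0 * (r\<^sup>2 - Sinf) - 0 - 0 \<le> 0" by (rule tendsto_upperbound) simp
 hence "Sinf - r\<^sup>2 \<le> 0" by simp
 have "(\<Sum>k=1..<N. (2 * real k - 1) * (norm (c k))\<^sup>2 / r ^ (4 * k)) = Sinf / r\<^sup>2"
 proof -
  have "r powr (?e k) / r\<^sup>2 = 1 / r ^ (4 * k)" for k
  proof -
   have "r powr (?e k) = r powr 2 / r powr (real (4 * k))" by (simp add: powr_diff)
   also have "r powr real (4 * k) = r ^ (4 * k)" by (rule powr_realpow[OF r(1)])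
   also have "r powr 2 = r\<^sup>2" using r(1) by simp
   finally show ?thesis using r(1) by simp
  qed
  note e = this
  show ?thesis unfolding Sinf_def sum_divide_distrib times_divide_eq_right[symmetric] e by simp
 qed
 also have "... \<le> 1" using \<open>Sinf - r\<^sup>2 \<le> 0\<close> r(1) by simp
 finally show ?thesis .
qed

section \<open>The square root transform\<close>

text \<open>At \<open>x\<close> these are the coefficients of the power series square root
  \<open>C\<close> of \<open>Abs_fps a - x * X\<close>, obtained by solving \<open>C^2\<close> for
  its top coefficient. They are kept as polynomials in \<open>x\<close> because one family must
  serve all the points that enter a determinant.\<close>

function sqrt_poly :: "(nat => 'a :: field_char_0) => nat => 'a poly" where
 "sqrt_poly a 0 = 1"
| "sqrt_poly a (Suc k) = smult (1 / 2) ([:a (Suc k):] - (if k = 0 then [:0, 1:] else 0)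
   - (\<Sum>i\<in>{1..k}. sqrt_poly a i * sqrt_poly a (Suc k - i)))"
 by pat_completeness auto
termination by (relation "inv_image less_than snd") auto

declare sqrt_poly.simps(2) [simp del]

lemma coeff_mult_le:
 fixes p q :: "'a :: comm_semiring_0 poly"
 assumes "degree p \<le> m" "degree q \<le> n"
 shows "coeff (p * q) (m + n) = coeff p m * coeff q n"
proof -
 have "coeff (p * q) (m + n) = (\<Sum>i\<le>m + n. if i = m then coeff p m * coeff q n else 0)"
  unfolding coeff_mult
 proof (rule sum.cong[OF refl])
  fix i assume "i \<in> {..m + n}"
  show "coeff p i * coeff q (m + n - i) = (if i = m then coeff p m * coeff q n else 0)"
   using assms by (cases i m rule: linorder_cases) (auto simp: coeff_eq_0)
 qed
 thus ?thesis by simp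
qed

lemma gbinomial_half_convolution:
 "(\<Sum>i\<in>{1..k}. ((1 / 2 :: 'a :: field_char_0) gchoose i) * (1 / 2 gchoose (Suc k - i)))
  = (if k = 0 then 1 else 0) - 2 * (1 / 2 gchoose Suc k)"
proof -
 have "(\<Sum>i\<in>{0..Suc k}. ((1 / 2 :: 'a) gchoose i) * (1 / 2 gchoose (Suc k - i))) = (1 gchoose Suc k)"
  using gbinomial_Vandermonde[of "1 / 2 :: 'a" "1 / 2" "Suc k"] by simp
 moreover have "{0..Suc k} = insert 0 (insert (Suc k) {1..k})" by auto
 moreover have "((1 :: 'a) gchoose Suc k) = (if k = 0 then 1 else 0)"
  using binomial_gbinomial[of 1 "Suc k", where 'a = 'a] by (cases k) auto
 ultimately show ?thesis by (simp add: algebra_simps)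
qed

text \<open>The part of top degree in \<open>x\<close> is that of the square root of
  \<open>1 - x * X\<close>, hence a binomial coefficient; its recursion is Vandermonde's identity
  for \<open>1/2 + 1/2 = 1\<close>.\<close>

lemma sqrt_poly_lead:
 fixes a :: "nat => 'a :: field_char_0"
 shows "degree (sqrt_poly a k) \<le> k \<and>
  coeff (sqrt_poly a k) k = (- 1) ^ k * (1 / 2 gchoose k)"
proof (induction k rule: less_induct)
 case (less n)
 show ?case
 proof (cases n)
  case (Suc k)
  have IH: "degree (sqrt_poly a i) \<le> i" "coeff (sqrt_poly a i) i = (- 1) ^ i * (1 / 2 gchoose i)"
   if "i \<le> k" for i using less[of i] that Suc by auto
  have d: "degree (sqrt_poly a i * sqrt_poly a (Suc k - i)) \<le> Suc k" if "i \<in> {1..k}" for i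
  proof -
   have "degree (sqrt_poly a i * sqrt_poly a (Suc k - i)) \<le> i + (Suc k - i)"
    by (rule order_trans[OF degree_mult_le add_mono[OF IH(1) IH(1)]]) (use that in auto)
   thus ?thesis using that by simp
  qed
  have c: "coeff (sqrt_poly a i * sqrt_poly a (Suc k - i)) (Suc k)
    = (- 1) ^ Suc k * ((1 / 2 gchoose i) * (1 / 2 gchoose (Suc k - i)))" if i: "i \<in> {1..k}" for i
  proof -
   have "coeff (sqrt_poly a i * sqrt_poly a (Suc k - i)) (i + (Suc k - i))
     = coeff (sqrt_poly a i) i * coeff (sqrt_poly a (Suc k - i)) (Suc k - i)"
    using i by (intro coeff_mult_le IH(1)) auto
   also have "... = ((- 1) ^ i * (- 1) ^ (Suc k - i)) * ((1 / 2 gchoose i) * (1 / 2 gchoose (Suc k - i)))"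
   proof -
    have "i \<le> k" "Suc k - i \<le> k" using i by auto
    thus ?thesis by (simp only: IH(2) mult_ac)
   qed
   finally show ?thesis using i by (simp flip: power_add)
  qed
  have "degree (sqrt_poly a (Suc k)) \<le> Suc k" unfolding sqrt_poly.simps(2)
   by (intro order_trans[OF degree_smult_le] degree_diff_le degree_sum_le d) auto
  moreover have "coeff (sqrt_poly a (Suc k)) (Suc k) = (- 1) ^ Suc k * (1 / 2 gchoose Suc k)"
  proof -
   have "coeff (sqrt_poly a (Suc k)) (Suc k) = (1 / 2) * ((if k = 0 then - 1 else 0)
     - (- 1) ^ Suc k * (\<Sum>i\<in>{1..k}. (1 / 2 gchoose i) * (1 / 2 gchoose (Suc k - i))))"
   proof -
    have "coeff (\<Sum>i\<in>{1..k}. sqrt_poly a i * sqrt_poly a (Suc k - i)) (Suc k)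
     = (\<Sum>i\<in>{1..k}. (- 1) ^ Suc k * ((1 / 2 gchoose i) * (1 / 2 gchoose (Suc k - i))))"
     unfolding coeff_sum by (rule sum.cong[OF refl c])
    moreover have "coeff ([:a (Suc k):] - (if k = 0 then [:0, 1:] else 0)) (Suc k) = (if k = 0 then - 1 else 0)"
     by (cases k) (auto simp: coeff_pCons)
    ultimately show ?thesis unfolding sqrt_poly.simps(2) sum_distrib_left
     by (simp only: coeff_smult coeff_diff)
   qed
   thus ?thesis unfolding gbinomial_half_convolution by (cases k) simp_all
  qed
  ultimately show ?thesis using Suc by blast
 qed simp
qed

lemma fps_sqrt_poly:
 fixes C :: "'a :: field_char_0 fps"
 assumes "fps_nth C 0 = 1" "C ^ 2 = Abs_fps a - fps_const x * fps_X"
 shows "fps_nth C k = poly (sqrt_poly a k) x"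
proof (induction k rule: less_induct)
 case (less n)
 show ?case
 proof (cases n)
  case (Suc k)
  let ?S = "\<Sum>i\<in>{1..k}. poly (sqrt_poly a i) x * poly (sqrt_poly a (Suc k - i)) x"
  have IH: "fps_nth C i = poly (sqrt_poly a i) x" if "i \<le> k" for i using less[of i] that Suc by auto
  have "fps_nth (C ^ 2) (Suc k) = (\<Sum>i\<in>{0..Suc k}. fps_nth C i * fps_nth C (Suc k - i))"
   by (simp only: power2_eq_square fps_mult_nth)
  also have "{0..Suc k} = insert 0 (insert (Suc k) {1..k})" by auto
  also have "(\<Sum>i\<in>insert 0 (insert (Suc k) {1..k}). fps_nth C i * fps_nth C (Suc k - i))
   = 2 * fps_nth C (Suc k) + ?S"
  proof -
   have "(\<Sum>i\<in>{1..k}. fps_nth C i * fps_nth C (Suc k - i)) = ?S"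
    by (intro sum.cong refl) (auto simp: IH)
   thus ?thesis using assms(1) by simp
  qed
  finally have "2 * fps_nth C (Suc k) = a (Suc k) - (if k = 0 then x else 0)
    - ?S"
   unfolding assms(2) by (simp add: algebra_simps)
  hence "fps_nth C (Suc k) = (1 / 2) * (a (Suc k) - (if k = 0 then x else 0)
    - ?S)"
   by (metis (no_types, lifting) mult.commute mult_1_right nonzero_mult_div_cancel_left times_divide_eq_right zero_neq_numeral)
  thus ?thesis unfolding Suc sqrt_poly.simps(2) by (simp add: poly_sum)
 qed (use assms in simp)
qed

text \<open>The function \<open>h u / u\<close> omits \<open>x\<close>, because \<open>P\<close> has
  modulus above \<open>\<rho> ^ degree P\<close> on its values but not at \<open>x\<close>. So
  \<open>h u - x * u\<close> has a holomorphic square root \<open>s\<close> on the disc. The odd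
  function \<open>y = z * s (inverse (z\<^sup>2))\<close> satisfies
  \<open>y\<^sup>2 = h u / u - x\<close> at \<open>u = inverse (z\<^sup>2)\<close> and inherits
  injectivity, so the area theorem applies to it.\<close>

lemma sqrt_transform:
 fixes P :: "complex poly" and \<rho> :: real and h :: "complex => complex"
 defines "a \<equiv> \<lambda>k. (deriv ^^ k) h 0 / fact k"
 assumes rho: "\<rho> > 0" and hol: "h holomorphic_on ball 0 (1 / \<rho>)" and h0: "h 0 = 1"
  and Ph: "\<And>u. u \<in> ball 0 (1 / \<rho>) ==> u \<noteq> 0 ==> poly P (h u / u) = inverse (u ^ degree P)"
  and inj: "inj_on (\<lambda>u. h u / u) (ball 0 (1 / \<rho>) - {0})"
  and deg: "degree P > 0"
  and x: "norm (poly P x) \<le> \<rho> ^ degree P" and r: "r > 0" "r\<^sup>2 > \<rho>"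
 obtains s where "\<And>u. norm u < 1 / \<rho> ==> (\<lambda>k. poly (sqrt_poly a k) x * u ^ k) sums s u"
  "\<And>u. norm u < 1 / \<rho> ==> h u = x * u + (s u)\<^sup>2"
  "\<And>N. (\<Sum>k=1..<N. (2 * real k - 1) * (norm (poly (sqrt_poly a k) x))\<^sup>2 / r ^ (4 * k)) \<le> 1"
proof -
 define B where "B = ball (0::complex) (1 / \<rho>)"
 have B: "open B" "convex B" "0 \<in> B" using rho by (auto simp: B_def)
 have khol: "(\<lambda>u. h u - x * u) holomorphic_on B"
  using hol by (auto simp: B_def intro!: holomorphic_intros)
 have knz: "h u - x * u \<noteq> 0" if "u \<in> B" for u
 proof
  assume eq: "h u - x * u = 0"
  hence unz: "u \<noteq> 0" using h0 by auto
  hence "poly P x = inverse (u ^ degree P)" using eq Ph[of u] that unz by (simp add: B_def)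
  hence "inverse (norm u) ^ degree P \<le> \<rho> ^ degree P"
   using x by (simp add: norm_inverse norm_power power_inverse)
  moreover have "\<rho> < inverse (norm u)" using that unz rho by (simp add: B_def field_simps)
  hence "\<rho> ^ degree P < inverse (norm u) ^ degree P" using rho deg by (intro power_strict_mono) auto
  ultimately show False by simp
 qed
 obtain g where g: "g holomorphic_on B" "\<And>u. u \<in> B ==> h u - x * u = (g u)\<^sup>2"
  using contractible_imp_holomorphic_sqrt[OF khol convex_imp_contractible[OF B(2)] knz] by metis
 define s where "s u = g u / g 0" for u
 have g0: "(g 0)\<^sup>2 = 1" using g(2)[OF B(3)] h0 by simp
 hence g0nz: "g 0 \<noteq> 0" by auto
 have shol: "s holomorphic_on B" unfolding s_def using g(1) g0nz by (intro holomorphic_intros) auto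
 have s2: "(s u)\<^sup>2 = h u - x * u" if "u \<in> B" for u
  using g(2)[OF that] g0 by (simp add: s_def power_divide)
 have s0: "s 0 = 1" using g0nz by (simp add: s_def)
 define c where "c k = (deriv ^^ k) s 0 / fact k" for k
 have csums: "(\<lambda>k. c k * u ^ k) sums s u" if "norm u < 1 / \<rho>" for u
  using holomorphic_power_series[of s 0 "1 / \<rho>" u] shol that by (simp add: c_def B_def)
 have "fps_expansion s 0 ^ 2 = fps_expansion h 0 - fps_const x * fps_X"
 proof (rule fps_ext)
  fix n
  have "s has_fps_expansion fps_expansion s 0"
   using B(1,3) shol by (rule has_fps_expansion_fps_expansion)
  from has_fps_expansion_power[OF this, of 2]
  have 1: "(\<lambda>u. (s u)\<^sup>2) has_fps_expansion fps_expansion s 0 ^ 2" .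
  have "h has_fps_expansion fps_expansion h 0"
   using B(1,3) hol unfolding B_def by (rule has_fps_expansion_fps_expansion)
  hence "(\<lambda>u. h u - x * u) has_fps_expansion fps_expansion h 0 - fps_const x * fps_X"
   by (intro fps_expansion_intros)
  moreover have "eventually (\<lambda>u. h u - x * u = (s u)\<^sup>2) (nhds 0)"
   using s2 B(1,3) by (auto simp: eventually_nhds)
  ultimately have 2: "(\<lambda>u. (s u)\<^sup>2) has_fps_expansion fps_expansion h 0 - fps_const x * fps_X"
   by (subst (asm) has_fps_expansion_cong[OF _ refl])
  show "fps_nth (fps_expansion s 0 ^ 2) n = fps_nth (fps_expansion h 0 - fps_const x * fps_X) n"
   unfolding fps_nth_fps_expansion[OF 1] fps_nth_fps_expansion[OF 2] ..
 qed
 hence "fps_expansion s 0 ^ 2 = Abs_fps a - fps_const x * fps_X"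
  by (simp add: a_def fps_expansion_def)
 hence cp: "c k = poly (sqrt_poly a k) x" for k
  using fps_sqrt_poly[of "fps_expansion s 0" a x k] s0 by (simp add: c_def fps_expansion_def)
 have uB: "inverse (z\<^sup>2) \<in> B - {0}" if "norm z \<ge> r" for z :: complex
 proof -
  have "\<rho> < (norm z)\<^sup>2" using that r by (meson less_le_trans power_mono less_imp_le)
  hence "1 / (norm z)\<^sup>2 < 1 / \<rho>" using rho by (simp add: frac_less2)
  hence "norm (inverse (z\<^sup>2)) < 1 / \<rho>" by (simp add: norm_power inverse_eq_divide norm_divide)
  moreover have "z \<noteq> 0" using that r by auto
  ultimately show ?thesis by (simp add: B_def)
 qed
 have y2: "(z * s (inverse (z\<^sup>2)))\<^sup>2 = h (inverse (z\<^sup>2)) / inverse (z\<^sup>2) - x" if "norm z \<ge> r" for z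
 proof -
  have "z \<noteq> 0" using that r by auto
  thus ?thesis
   unfolding power_mult_distrib s2[OF DiffD1[OF uB[OF that]]] by (simp add: right_diff_distrib divide_inverse)
 qed
 have yinj: "inj_on (\<lambda>z. z * s (inverse (z\<^sup>2))) {z. norm z \<ge> r}"
 proof (rule inj_onI)
  fix z w :: complex assume zw: "z \<in> {z. norm z \<ge> r}" "w \<in> {z. norm z \<ge> r}"
   "z * s (inverse (z\<^sup>2)) = w * s (inverse (w\<^sup>2))"
  have "inverse (z\<^sup>2) = inverse (w\<^sup>2)"
   using y2[of z] y2[of w] zw inj uB[of z] uB[of w] zw(1,2) unfolding B_def by (auto dest: inj_onD)
  hence "z\<^sup>2 = w\<^sup>2" by simp
  moreover have "s (inverse (z\<^sup>2)) \<noteq> 0"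
   using s2[of "inverse (z\<^sup>2)"] knz[of "inverse (z\<^sup>2)"] uB[of z] zw(1) by auto
  moreover have "z \<noteq> 0" using zw(1) r by auto
  ultimately show "z = w" using zw(3) by (auto simp: power2_eq_iff)
 qed
 show ?thesis
 proof (rule that[of s])
  show "(\<lambda>k. poly (sqrt_poly a k) x * u ^ k) sums s u" if "norm u < 1 / \<rho>" for u
   using csums[OF that] by (simp add: cp)
  show "h u = x * u + (s u)\<^sup>2" if "norm u < 1 / \<rho>" for u using s2[of u] that by (simp add: B_def)
  have "1 / r\<^sup>2 < 1 / \<rho>" using r rho by (simp add: divide_strict_left_mono)
  from area_theorem_odd[OF r(1) this _ csums yinj]
  show "(\<Sum>k=1..<N. (2 * real k - 1) * (norm (poly (sqrt_poly a k) x))\<^sup>2 / r ^ (4 * k)) \<le> 1" for N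
   by (simp add: cp[symmetric] c_def s0)
 qed
qed

section \<open>Discriminants\<close>

lemma prod_le_mean_power:
 fixes x :: "nat => real"
 assumes "n > 0" "\<And>i. i < n ==> x i \<ge> 0"
 shows "(\<Prod>i<n. x i) \<le> ((\<Sum>i<n. x i) / n) ^ n"
proof -
 have "(\<Prod>i<n. x i) powr (1 / n) \<le> (\<Sum>i<n. x i / n)"
  using arith_geom_mean[of "{..<n}" x] assms by auto
 hence "((\<Prod>i<n. x i) powr (1 / n)) ^ n \<le> (\<Sum>i<n. x i / n) ^ n" by (rule power_mono) simp
 moreover have "((\<Prod>i<n. x i) powr (1 / n)) ^ n = (\<Prod>i<n. x i)"
 proof (cases "(\<Prod>i<n. x i) = 0")
  case False
  moreover have "(\<Prod>i<n. x i) \<ge> 0" using assms by (intro prod_nonneg) auto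
  ultimately show ?thesis using assms(1) by (simp add: powr_powr flip: powr_realpow)
 next
  case True
  show ?thesis unfolding True using assms(1) by simp
 qed
 ultimately show ?thesis by (simp add: sum_divide_distrib)
qed

lemma mat_trace_similar:
 fixes A B :: "'a :: comm_ring_1 mat"
 assumes "similar_mat_wit A B P Q" "A \<in> carrier_mat n n"
 shows "(\<Sum>i<n. A $$ (i, i)) = (\<Sum>i<n. B $$ (i, i))"
proof -
 have c: "B \<in> carrier_mat n n" "P \<in> carrier_mat n n" "Q \<in> carrier_mat n n" "A = P * B * Q" "Q * P = 1\<^sub>m n"
  using similar_mat_witD2[OF assms(2,1)] by auto
 have "A $$ (i, i) = (\<Sum>j<n. \<Sum>k<n. P $$ (i, j) * B $$ (j, k) * Q $$ (k, i))" if "i < n" for i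
 proof -
  show ?thesis using c that c(1-3) by (simp add: scalar_prod_def sum_distrib_left atLeast0LessThan mult.assoc)
 qed
 hence "(\<Sum>i<n. A $$ (i, i)) = (\<Sum>i<n. \<Sum>j<n. \<Sum>k<n. P $$ (i, j) * B $$ (j, k) * Q $$ (k, i))" by simp
 also have "... = (\<Sum>j<n. \<Sum>i<n. \<Sum>k<n. P $$ (i, j) * B $$ (j, k) * Q $$ (k, i))" by (rule sum.swap)
 also have "... = (\<Sum>j<n. \<Sum>k<n. \<Sum>i<n. P $$ (i, j) * B $$ (j, k) * Q $$ (k, i))"
  by (intro sum.cong refl sum.swap)
 also have "... = (\<Sum>j<n. \<Sum>k<n. B $$ (j, k) * (Q * P) $$ (k, j))"
  using c(1-3) by (intro sum.cong refl) (simp add: scalar_prod_def sum_distrib_left atLeast0LessThan mult_ac)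
 also have "... = (\<Sum>j<n. \<Sum>k<n. if k = j then B $$ (j, j) else 0)"
  unfolding c(5) by (intro sum.cong refl) auto
 finally show ?thesis by simp
qed

text \<open>Arithmetic-geometric mean inequality for the eigenvalues of \<open>A\<close> times its
  adjoint: they are nonnegative, their product is \<open>|det A|^2\<close>, and their sum is the
  squared Frobenius norm.\<close>

lemma norm_det_le:
 fixes A :: "complex mat"
 assumes A: "A \<in> carrier_mat n n" and n: "n > 0"
 shows "(norm (Determinant.det A))\<^sup>2 \<le> ((\<Sum>i<n. \<Sum>j<n. (norm (A $$ (i, j)))\<^sup>2) / n) ^ n"
proof -
 define H where "H = transpose_mat (map_mat cnj A)"
 define M where "M = A * H"
 have H: "H \<in> carrier_mat n n" and M: "M \<in> carrier_mat n n" using A by (auto simp: H_def M_def)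
 interpret cnj: comm_ring_hom cnj by unfold_locales auto
 have detM: "Determinant.det M = of_real ((norm (Determinant.det A))\<^sup>2)"
 proof -
  have "Determinant.det M = Determinant.det A * Determinant.det H"
   unfolding M_def by (rule det_mult[OF A H])
  also have "Determinant.det H = cnj (Determinant.det A)"
   unfolding H_def using A by (subst det_transpose) (auto simp: cnj.hom_det)
  finally show ?thesis by (simp only: complex_norm_square)
 qed
 have Mij: "M $$ (i, j) = (\<Sum>k<n. A $$ (i, k) * cnj (A $$ (j, k)))" if "i < n" "j < n" for i j
  using that A by (simp add: M_def H_def scalar_prod_def atLeast0LessThan)
 obtain es where es: "char_poly M = (\<Prod>a\<leftarrow>es. [:- a, 1:])" "length es = n"
  using char_poly_factorized[OF M] by blast
 obtain B P Q where "schur_decomposition M es = (B, P, Q)" by (metis prod_cases3)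
 from schur_decomposition[OF M es(1) this]
 have B: "similar_mat_wit M B P Q" "upper_triangular B" "diag_mat B = es" by auto
 have Bc: "B \<in> carrier_mat n n" using similar_mat_witD2[OF M B(1)] by auto
 have esi: "es ! i = B $$ (i, i)" if "i < n" for i
  unfolding B(3)[symmetric] using that Bc by (simp add: diag_mat_def)
 have detB: "Determinant.det M = (\<Prod>i<n. es ! i)"
 proof -
  have "similar_mat M B" using B(1) by (auto simp: similar_mat_def)
  hence "Determinant.det M = Determinant.det B" by (rule det_similar)
  also have "... = prod_list es" using det_upper_triangular[OF B(2) Bc] B(3) by simp
  finally show ?thesis using es(2) by (simp add: prod.list_conv_set_nth atLeast0LessThan)
 qed
 have tr: "(\<Sum>i<n. es ! i) = of_real (\<Sum>i<n. \<Sum>j<n. (norm (A $$ (i, j)))\<^sup>2)"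
 proof -
  have "(\<Sum>i<n. es ! i) = (\<Sum>i<n. M $$ (i, i))" using mat_trace_similar[OF B(1) M] esi by simp
  also have "... = (\<Sum>i<n. \<Sum>k<n. of_real ((norm (A $$ (i, k)))\<^sup>2))"
   using Mij by (simp only: complex_norm_square) simp
  finally show ?thesis by (simp only: of_real_sum)
 qed
 have real: "es ! i = of_real (Re (es ! i)) \<and> Re (es ! i) \<ge> 0" if i: "i < n" for i
 proof -
  define l where "l = es ! i"
  have "l \<in> set es" using i es(2) by (simp add: l_def)
  hence "poly (char_poly M) l = 0" unfolding es(1) by (simp add: poly_prod_list prod_list_zero_iff)
  then obtain v where v: "eigenvector M v l"
   using eigenvalue_root_char_poly[OF M] by (auto simp: eigenvalue_def)
  hence vc: "v \<in> carrier_vec n" "v \<noteq> 0\<^sub>v n" "M *\<^sub>v v = l \<cdot>\<^sub>v v"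
   using M by (auto simp: eigenvector_def)
  have Mv: "(\<Sum>j<n. M $$ (i, j) * vec_index v j) = l * vec_index v i" if "i < n" for i
  proof -
   have "vec_index (M *\<^sub>v v) i = l * vec_index v i" using vc that by simp
   thus ?thesis using that M vc(1) by (simp add: scalar_prod_def atLeast0LessThan)
  qed
  \<comment> \<open>\<open>W\<close> is the squared norm of the eigenvector, \<open>Z\<close> that
    of the adjoint of \<open>A\<close> applied to it; they will satisfy
    \<open>l * W = Z\<close>.\<close>
  define W where "W = (\<Sum>i<n. (norm (vec_index v i))\<^sup>2)"
  define Z where "Z = (\<Sum>k<n. (norm (\<Sum>j<n. cnj (A $$ (j, k)) * vec_index v j))\<^sup>2)"
  have cell: "l * of_real ((norm (vec_index v i))\<^sup>2) = cnj (vec_index v i) * (\<Sum>j<n. M $$ (i, j) * vec_index v j)"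
   if "i < n" for i
   unfolding complex_norm_square Mv[OF that] by simp
  have "l * of_real W = (\<Sum>i<n. l * of_real ((norm (vec_index v i))\<^sup>2))"
   unfolding W_def of_real_sum sum_distrib_left ..
  also have "... = (\<Sum>i<n. cnj (vec_index v i) * (\<Sum>j<n. M $$ (i, j) * vec_index v j))"
   by (rule sum.cong[OF refl cell]) simp
  also have "... = (\<Sum>i<n. \<Sum>j<n. \<Sum>k<n. (cnj (vec_index v i) * A $$ (i, k)) * (cnj (A $$ (j, k)) * vec_index v j))"
   by (intro sum.cong refl) (simp add: Mij sum_distrib_left sum_distrib_right mult_ac)
  also have "... = (\<Sum>i<n. \<Sum>k<n. \<Sum>j<n. (cnj (vec_index v i) * A $$ (i, k)) * (cnj (A $$ (j, k)) * vec_index v j))"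
   by (intro sum.cong refl sum.swap)
  also have "... = (\<Sum>k<n. \<Sum>i<n. \<Sum>j<n. (cnj (vec_index v i) * A $$ (i, k)) * (cnj (A $$ (j, k)) * vec_index v j))"
   by (rule sum.swap)
  also have "... = of_real Z" unfolding Z_def of_real_sum complex_norm_square
   by (intro sum.cong refl) (simp add: sum_product mult_ac, rule sum.swap)
  finally have lW: "l * of_real W = of_real Z" .
  have "\<exists>i<n. vec_index v i \<noteq> 0"
  proof (rule ccontr)
   assume "\<not> ?thesis"
   hence "v = 0\<^sub>v n" using vc(1) by (intro eq_vecI) auto
   thus False using vc(2) by simp
  qed
  then obtain i0 where "i0 < n" "vec_index v i0 \<noteq> 0" by blast
  hence "W > 0" unfolding W_def by (intro sum_pos2[of _ i0]) auto
  hence "l = of_real (Z / W)" using lW by (simp add: field_simps)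
  moreover have "Z \<ge> 0" by (simp add: Z_def sum_nonneg)
  ultimately show ?thesis using \<open>W > 0\<close> by (simp add: l_def[symmetric])
 qed
 have "(norm (Determinant.det A))\<^sup>2 = (\<Prod>i<n. Re (es ! i))"
 proof -
  have "of_real ((norm (Determinant.det A))\<^sup>2) = (\<Prod>i<n. es ! i)" using detM detB by simp
  also have "... = of_real (\<Prod>i<n. Re (es ! i))"
   unfolding of_real_prod using real by (intro prod.cong) auto
  finally show ?thesis by (simp only: of_real_eq_iff)
 qed
 also have "... \<le> ((\<Sum>i<n. Re (es ! i)) / n) ^ n" using real n by (intro prod_le_mean_power) auto
 also have "(\<Sum>i<n. Re (es ! i)) = Re (\<Sum>i<n. es ! i)" by simp
 also have "... = (\<Sum>i<n. \<Sum>j<n. (norm (A $$ (i, j)))\<^sup>2)" unfolding tr by simp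
 finally show ?thesis .
qed

lemma det_poly_mat_aux:
 fixes x :: "nat => 'a :: idom" and q :: "nat => 'a poly"
 assumes "\<And>j. j < n ==> degree (q j) \<le> j"
 shows "Determinant.det (mat n n (\<lambda>(i, j). poly (q j) (x i)))
  = Determinant.det (mat n n (\<lambda>(i, j). x i ^ j)) * (\<Prod>j<n. coeff (q j) j)"
proof -
 define U where "U = mat n n (\<lambda>(k, j). coeff (q j) k)"
 define V where "V = mat n n (\<lambda>(i, j). x i ^ j)"
 have U: "U \<in> carrier_mat n n" and V: "V \<in> carrier_mat n n" by (auto simp: U_def V_def)
 have "mat n n (\<lambda>(i, j). poly (q j) (x i)) = V * U"
 proof (rule eq_matI)
  fix i j assume ij: "i < dim_row (V * U)" "j < dim_col (V * U)"
  hence ij': "i < n" "j < n" using U V by auto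
  have "poly (q j) (x i) = (\<Sum>k\<le>degree (q j). coeff (q j) k * x i ^ k)" by (rule poly_altdef)
  also have "... = (\<Sum>k<n. coeff (q j) k * x i ^ k)"
   using assms[OF ij'(2)] ij'(2) by (intro sum.mono_neutral_left) (auto simp: coeff_eq_0 not_le)
  finally show "mat n n (\<lambda>(i, j). poly (q j) (x i)) $$ (i, j) = (V * U) $$ (i, j)"
   using ij' by (simp add: U_def V_def scalar_prod_def atLeast0LessThan mult.commute)
 qed (use U V in auto)
 hence "Determinant.det (mat n n (\<lambda>(i, j). poly (q j) (x i))) = Determinant.det V * Determinant.det U"
  using det_mult[OF V U] by simp
 also have "Determinant.det U = prod_list (diag_mat U)"
  by (rule det_upper_triangular[OF _ U]) (use order_le_less_trans[OF assms] in \<open>auto simp: U_def upper_triangular_def intro!: coeff_eq_0\<close>)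
 also have "... = (\<Prod>j<n. coeff (q j) j)"
  unfolding prod.list_conv_set_nth using U by (simp add: diag_mat_def U_def atLeast0LessThan)
 finally show ?thesis by (simp add: V_def)
qed

text \<open>The Vandermonde determinant is itself obtained from the preceding factorisation, applied
  to the Newton basis \<open>N\<close>, whose matrix of values is lower triangular.\<close>

lemma det_poly_mat:
 fixes x :: "nat => 'a :: idom" and q :: "nat => 'a poly"
 assumes "\<And>j. j < n ==> degree (q j) \<le> j"
 shows "Determinant.det (mat n n (\<lambda>(i, j). poly (q j) (x i)))
  = (\<Prod>i<n. \<Prod>k<i. x i - x k) * (\<Prod>j<n. coeff (q j) j)"
proof -
 define N where "N j = (\<Prod>k<j. [:- x k, 1:])" for j
 have Nd: "degree (N j) = j \<and> coeff (N j) j = 1" for j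
 proof -
  have "degree (N j) = j" unfolding N_def by (subst degree_prod_eq_sum_degree) auto
  moreover have "lead_coeff (N j) = 1" unfolding N_def lead_coeff_prod by simp
  ultimately show ?thesis by simp
 qed
 define L where "L = mat n n (\<lambda>(i, j). poly (N j) (x i))"
 have L: "L \<in> carrier_mat n n" by (simp add: L_def)
 have "Determinant.det L = prod_list (diag_mat L)"
 proof (rule det_lower_triangular[OF _ L])
  fix i j assume "i < j" "j < n"
  thus "L $$ (i, j) = 0" by (auto simp: L_def N_def poly_prod)
 qed
 also have "... = (\<Prod>i<n. \<Prod>k<i. x i - x k)" unfolding prod.list_conv_set_nth using L
  by (simp add: diag_mat_def L_def N_def poly_prod atLeast0LessThan)
 finally show ?thesis using det_poly_mat_aux[of n N x] Nd det_poly_mat_aux[OF assms, of n x] by (simp add: L_def)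
qed

text \<open>The weight \<open>2 * k - 1\<close> of the area theorem times the squared leading
  coefficient of \<open>sqrt_poly a k\<close>.\<close>

definition half_weight :: "nat => real"
 where "half_weight k = (2 * real k - 1) * (1 / 2 gchoose k)\<^sup>2"

lemma half_weight_Suc:
 assumes "k \<ge> 1"
 shows "half_weight (Suc k) = half_weight k * ((2 * real k + 1) * (2 * real k - 1) / (2 * real k + 2)\<^sup>2)"
proof -
 have "((1 / 2 :: real) gchoose Suc k) = (1 / 2 - real k) / (real k + 1) * (1 / 2 gchoose k)"
  using gbinomial_mult_1[of "1 / 2 :: real" k] by (simp add: field_simps)
 hence "((1 / 2 :: real) gchoose Suc k)\<^sup>2 = ((2 * real k - 1) / (2 * real k + 2))\<^sup>2 * (1 / 2 gchoose k)\<^sup>2"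
 proof -
  have "(1 / 2 - real k) / (real k + 1) = - ((2 * real k - 1) / (2 * real k + 2))"
   by (simp add: field_simps)
  moreover assume "((1 / 2 :: real) gchoose Suc k) = (1 / 2 - real k) / (real k + 1) * (1 / 2 gchoose k)"
  ultimately show ?thesis by (simp only: power_mult_distrib power2_minus)
 qed
 thus ?thesis unfolding half_weight_def by (simp add: power_divide power2_eq_square)
qed

lemma half_weight_values: "half_weight 1 = 1 / 4" "half_weight 2 = 3 / 64" "half_weight 3 = 5 / 256"
proof -
 show 1: "half_weight 1 = 1 / 4" by (simp add: half_weight_def power2_eq_square)
 show 2: "half_weight 2 = 3 / 64" using half_weight_Suc[of 1] 1 by (simp add: numeral_2_eq_2)
 show "half_weight 3 = 5 / 256" using half_weight_Suc[of 2] 2 by (simp add: numeral_3_eq_3)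
qed

lemma half_weight_ge:
 assumes "k \<ge> 4"
 shows "half_weight k \<ge> 1 / 4 ^ k"
 using assms
proof (induction k rule: nat_induct_at_least)
 case base
 have "half_weight 4 = 175 / 16384"
  using half_weight_Suc[of 3] half_weight_values(3) by (simp add: eval_nat_numeral)
 thus ?case by simp
next
 case (Suc n)
 have "(2 * real n + 2)\<^sup>2 \<le> 4 * ((2 * real n + 1) * (2 * real n - 1))"
 proof -
  have "real n * real n \<ge> 4 * real n" using Suc(1) by (intro mult_right_mono) auto
  moreover have "(2 * real n + 2)\<^sup>2 = 4 * (real n * real n) + 8 * real n + 4"
   "4 * ((2 * real n + 1) * (2 * real n - 1)) = 16 * (real n * real n) - 4"
   by (simp_all add: power2_eq_square algebra_simps)
  moreover have "real n \<ge> 4" using Suc(1) by simp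
  ultimately show ?thesis by linarith
 qed
 hence "1 / 4 \<le> (2 * real n + 1) * (2 * real n - 1) / (2 * real n + 2)\<^sup>2"
  by (simp add: divide_simps)
 hence "1 / 4 ^ n * (1 / 4) \<le> half_weight n * ((2 * real n + 1) * (2 * real n - 1) / (2 * real n + 2)\<^sup>2)"
 proof (intro mult_mono)
  show "0 \<le> half_weight n" using Suc(2) by (rule order_trans[rotated]) simp
 qed (use Suc in simp_all)
 thus ?case using half_weight_Suc[of n] Suc(1) by simp
qed

lemma half_weight_pos: "k \<ge> 1 ==> half_weight k > 0"
proof (cases "k \<ge> 4")
 case True
 have "0 < 1 / (4::real) ^ k" by simp
 also have "... \<le> half_weight k" by (rule half_weight_ge[OF True])
 finally show ?thesis .
next
 case False
 assume "k \<ge> 1"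
 hence "k = 1 \<or> k = 2 \<or> k = 3" using False by auto
 thus ?thesis using half_weight_values by auto
qed

text \<open>For \<open>N = 4\<close> the two sides are 12 and 15, for \<open>N = 3\<close> they
  would be 9 and 6; hence the threshold. In the induction step the right side grows by the factor
  \<open>2 * 4 ^ n * half_weight n\<close>, which is at least 2.\<close>

lemma three_mul_lt_half_weight_prod:
 assumes "N \<ge> 4"
 shows "3 * real N < 2 ^ (N\<^sup>2) * (\<Prod>k=1..<N. half_weight k)"
 using assms
proof (induction N rule: nat_induct_at_least)
 case base
 have "{1..<4::nat} = {1, 2, 3}" by auto
 thus ?case by (simp add: half_weight_values[unfolded One_nat_def])
next
 case (Suc n)
 have pos: "(\<Prod>k=1..<n. half_weight k) > 0" by (intro prod_pos) (auto intro: half_weight_pos)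
 have "3 * real (Suc n) \<le> (3 * real n) * 2" using Suc(1) by simp
 also have "... < 2 ^ (n\<^sup>2) * (\<Prod>k=1..<n. half_weight k) * 2"
  using Suc(2) by (intro mult_strict_right_mono) auto
 also have "... = 2 ^ (n\<^sup>2) * (\<Prod>k=1..<n. half_weight k) * (2 * 4 ^ n * (1 / 4 ^ n))" by simp
 also have "... \<le> 2 ^ (n\<^sup>2) * (\<Prod>k=1..<n. half_weight k) * (2 * 4 ^ n * half_weight n)"
  using half_weight_ge[OF Suc(1)] pos by (intro mult_left_mono) auto
 also have "... = 2 ^ ((Suc n)\<^sup>2) * (\<Prod>k=1..<Suc n. half_weight k)"
 proof -
  have "(2::real) ^ ((Suc n)\<^sup>2) = 2 ^ (n\<^sup>2) * (2 * 4 ^ n)"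
  proof -
   have "(Suc n)\<^sup>2 = n\<^sup>2 + (1 + 2 * n)" by (simp add: power2_eq_square)
   hence "(2::real) ^ ((Suc n)\<^sup>2) = 2 ^ (n\<^sup>2) * (2 ^ 1 * 2 ^ (2 * n))" by (simp only: power_add)
   also have "(2::real) ^ (2 * n) = 4 ^ n" by (simp add: power_mult)
   finally show ?thesis by simp
  qed
  thus ?thesis using Suc(1) by (simp add: prod.atLeastLessThan_Suc)
 qed
 finally show ?case .
qed

text \<open>Determinant bound for the values of the scaled polynomials \<open>q j\<close> at the
  points: the area inequality bounds each row, while the determinant is the Vandermonde product
  times the leading coefficients, in which \<open>a\<close> no longer occurs.\<close>

lemma prod_diff_bound:
 fixes x :: "nat => complex" and a :: "nat => complex"
 assumes N: "N \<ge> 2" and r: "r > 0"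
  and bound: "\<And>i. i < N ==> (\<Sum>k=1..<N. (2 * real k - 1) * (norm (poly (sqrt_poly a k) (x i)))\<^sup>2 / r ^ (4 * k)) \<le> 1"
 shows "(\<Prod>i<N. \<Prod>k<i. (norm (x i - x k))\<^sup>2) * (\<Prod>k=1..<N. half_weight k / r ^ (4 * k)) \<le> 3 * real N"
proof -
 let ?P = "\<Prod>k=1..<N. half_weight k / r ^ (4 * k)" and ?D = "\<Prod>i<N. \<Prod>k<i. (norm (x i - x k))\<^sup>2"
 \<comment> \<open>This weight of the constant column minimises
   \<open>(\<theta>\<^sup>2 + 1) ^ N / \<theta>\<^sup>2\<close>, the resulting upper bound.\<close>
 define \<theta> where "\<theta> = sqrt (1 / (real N - 1))"
 have th2: "\<theta>\<^sup>2 = 1 / (real N - 1)" using N by (simp add: \<theta>_def)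
 define b where "b k = (if k = 0 then \<theta> else sqrt (2 * real k - 1) / r ^ (2 * k))" for k
 define q where "q k = smult (of_real (b k)) (sqrt_poly a k)" for k
 define A where "A = mat N N (\<lambda>(i, j). poly (q j) (x i))"
 have A: "A \<in> carrier_mat N N" by (simp add: A_def)
 have b2: "(b k)\<^sup>2 = (2 * real k - 1) / r ^ (4 * k)" if "k \<ge> 1" for k
  using that by (simp add: b_def power_divide flip: power_mult)
 have sp: "{..<N} = insert 0 {1..<N}" using N by auto
 have row: "(\<Sum>j<N. (norm (A $$ (i, j)))\<^sup>2) \<le> real N / (real N - 1)" if i: "i < N" for i
 proof -
  have "(\<Sum>j<N. (norm (A $$ (i, j)))\<^sup>2) = (\<Sum>j<N. (b j)\<^sup>2 * (norm (poly (sqrt_poly a j) (x i)))\<^sup>2)"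
   using i by (intro sum.cong refl) (simp add: A_def q_def norm_mult power_mult_distrib)
  also have "... = \<theta>\<^sup>2 + (\<Sum>k=1..<N. (2 * real k - 1) * (norm (poly (sqrt_poly a k) (x i)))\<^sup>2 / r ^ (4 * k))"
   unfolding sp using b2 by (simp add: b_def)
  also have "... \<le> 1 / (real N - 1) + 1" using bound[OF i] th2 by simp
  also have "... = real N / (real N - 1)" using N by (simp add: field_simps)
  finally show ?thesis .
 qed
 have "(norm (Determinant.det A))\<^sup>2 \<le> ((\<Sum>i<N. \<Sum>j<N. (norm (A $$ (i, j)))\<^sup>2) / N) ^ N"
  by (rule norm_det_le[OF A]) (use N in simp)
 also have "... \<le> (real N / (real N - 1)) ^ N"
 proof (rule power_mono)
  have "(\<Sum>i<N. \<Sum>j<N. (norm (A $$ (i, j)))\<^sup>2) \<le> (\<Sum>i<N. real N / (real N - 1))"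
   by (intro sum_mono row) simp
  thus "(\<Sum>i<N. \<Sum>j<N. (norm (A $$ (i, j)))\<^sup>2) / N \<le> real N / (real N - 1)"
   using N by (simp add: divide_le_eq mult.commute)
 qed (auto intro!: divide_nonneg_nonneg sum_nonneg)
 finally have le: "(norm (Determinant.det A))\<^sup>2 \<le> (real N / (real N - 1)) ^ N" .
 have "Determinant.det A = (\<Prod>i<N. \<Prod>k<i. x i - x k) * (\<Prod>j<N. coeff (q j) j)" unfolding A_def
  by (intro det_poly_mat) (use sqrt_poly_lead[of a] in \<open>auto simp: q_def intro: order_trans[OF degree_smult_le]\<close>)
 hence "(norm (Determinant.det A))\<^sup>2 = ?D * (\<Prod>j<N. (norm (coeff (q j) j))\<^sup>2)"
  by (simp add: norm_mult prod_norm[symmetric] power_mult_distrib prod_power_distrib)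
 also have "(\<Prod>j<N. (norm (coeff (q j) j))\<^sup>2) = 1 / (real N - 1) * ?P"
 proof -
  have c: "(norm (coeff (q j) j))\<^sup>2 = (b j)\<^sup>2 * (1 / 2 gchoose j)\<^sup>2" for j
  proof -
   have "((1 / 2 :: complex) gchoose j) = of_real (1 / 2 gchoose j)"
    by (simp add: gbinomial_prod_rev)
   hence "norm ((1 / 2 :: complex) gchoose j) = \<bar>1 / 2 gchoose j\<bar>" by (simp only: norm_of_real)
   thus ?thesis using sqrt_poly_lead[of a j]
    by (simp add: q_def norm_mult norm_power power_mult_distrib)
  qed
  have "(b k)\<^sup>2 * (1 / 2 gchoose k)\<^sup>2 = half_weight k / r ^ (4 * k)" if "k \<ge> 1" for k
   using b2[OF that] by (simp add: half_weight_def)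
  hence "(\<Prod>k=1..<N. (b k)\<^sup>2 * (1 / 2 gchoose k)\<^sup>2) = ?P" by (intro prod.cong refl) auto
  moreover have "(b 0)\<^sup>2 = 1 / (real N - 1)" by (simp add: b_def th2)
  ultimately show ?thesis unfolding c sp by (subst prod.insert) auto
 qed
 finally have eq: "(norm (Determinant.det A))\<^sup>2 = ?D * (1 / (real N - 1) * ?P)" .
 have "?D * ?P = (norm (Determinant.det A))\<^sup>2 * (real N - 1)" unfolding eq using N by simp
 also have "... \<le> (real N / (real N - 1)) ^ N * (real N - 1)"
  by (rule mult_right_mono[OF le]) (use N in simp)
 finally have "?D * ?P \<le> (real N / (real N - 1)) ^ N * (real N - 1)" .
 also have "... \<le> 3 * real N"
 proof -
  define m where "m = N - 1"
  have m: "m \<ge> 1" "real N = real m + 1" "N = Suc m" using N by (auto simp: m_def)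
  have "(1 + 1 / real m) ^ m \<le> exp 1" using exp_ge_one_plus_x_over_n_power_n[of m 1] m by simp
  also have "exp 1 \<le> (3::real)" by (rule exp_le)
  finally have "((real m + 1) / real m) ^ m \<le> 3" using m by (simp add: add_divide_distrib)
  hence "((real m + 1) / real m) ^ m * (real m + 1) \<le> 3 * (real m + 1)"
   by (intro mult_right_mono) auto
  moreover have "(real N / (real N - 1)) ^ N * (real N - 1) = ((real m + 1) / real m) ^ m * (real m + 1)"
   unfolding m(2) using m(1) by (simp add: m(3) mult.commute)
  ultimately show ?thesis using m by simp
 qed
 finally show ?thesis .
qed

section \<open>Uniformisation of postcritically finite polynomials\<close>

definition iter_poly :: "'a :: comm_semiring_1 poly => nat => 'a poly"
 where "iter_poly f n = (pcompose f ^^ n) [:0, 1:]"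

lemma iter_poly_0 [simp]: "iter_poly f 0 = [:0, 1:]"
 and iter_poly_Suc: "iter_poly f (Suc n) = pcompose f (iter_poly f n)"
 by (simp_all add: iter_poly_def)

lemma poly_iter_poly: "poly (iter_poly f n) x = (poly f ^^ n) x"
 by (induction n) (simp_all add: iter_poly_Suc poly_pcompose)

lemma degree_iter_poly:
 fixes f :: "'a :: idom poly"
 shows "degree (iter_poly f n) = degree f ^ n"
 by (induction n) (simp_all add: iter_poly_Suc degree_pcompose)

lemma lead_coeff_iter_poly:
 fixes f :: "'a :: idom poly"
 assumes "lead_coeff f = 1" "degree f > 0"
 shows "lead_coeff (iter_poly f n) = 1"
proof (induction n)
 case (Suc n)
 have "degree (iter_poly f n) > 0" using assms(2) by (simp add: degree_iter_poly)
 thus ?case using Suc assms(1) unfolding iter_poly_Suc by (subst lead_coeff_comp) auto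
qed simp

lemma pderiv_iter_poly_root:
 fixes f :: "'a :: idom poly"
 assumes "poly (pderiv (iter_poly f n)) y = 0"
 shows "\<exists>i<n. poly (pderiv f) ((poly f ^^ i) y) = 0"
 using assms
proof (induction n)
 case (Suc n)
 hence "poly (pderiv f) ((poly f ^^ n) y) = 0 \<or> poly (pderiv (iter_poly f n)) y = 0"
  by (auto simp: iter_poly_Suc pderiv_pcompose poly_pcompose poly_iter_poly)
 thus ?case using Suc.IH by (meson less_Suc_eq)
qed (simp add: pderiv_pCons)

text \<open>Every critical value of the \<open>n\<close>-th iterate lies on the orbit of a critical
  point of \<open>f\<close>, and these orbits together with those of \<open>A\<close> lie in one
  disc of radius \<open>R\<close>. So the \<open>degree f ^ n\<close>-th root of \<open>R\<close>
  can serve as \<open>\<rho> n\<close>, and it tends to 1. The functions \<open>h n\<close>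
  approximate the uniformisation of the exterior of the filled Julia set.\<close>

lemma pcf_uniformisation:
 fixes f :: "complex poly"
 assumes lead: "lead_coeff f = 1" and deg: "degree f \<ge> 2"
  and pcf: "\<And>c. poly (pderiv f) c = 0 ==> preperiodic f c"
  and A: "finite A" "\<And>x. x \<in> A ==> preperiodic f x"
 obtains \<rho> :: "nat => real" and h :: "nat => complex => complex" where
  "\<And>n. \<rho> n \<ge> 1" "\<rho> \<longlonglongrightarrow> 1"
  "\<And>n. h n holomorphic_on ball 0 (1 / \<rho> n)" "\<And>n. h n 0 = 1"
  "\<And>n u. u \<in> ball 0 (1 / \<rho> n) ==> u \<noteq> 0 ==>
   poly (iter_poly f n) (h n u / u) = inverse (u ^ degree (iter_poly f n))"
  "\<And>n. inj_on (\<lambda>u. h n u / u) (ball 0 (1 / \<rho> n) - {0})"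
  "\<And>n x. x \<in> A ==> norm (poly (iter_poly f n) x) \<le> \<rho> n ^ degree (iter_poly f n)"
proof -
 define C where "C = {c. poly (pderiv f) c = 0}"
 have "pderiv f \<noteq> 0" using deg by (auto simp: pderiv_eq_0_iff)
 hence finC: "finite C" unfolding C_def by (rule poly_roots_finite)
 define S where "S = (\<Union>c\<in>C \<union> A. {(poly f ^^ n) c | n. n \<ge> 0})"
 have "finite S" unfolding S_def using finC A pcf by (auto simp: C_def preperiodic_def)
 hence "bounded S" by (rule finite_imp_bounded)
 then obtain R0 where R0: "\<And>x. x \<in> S ==> norm x \<le> R0" by (auto simp: bounded_iff)
 define R where "R = max R0 1"
 define D where "D n = degree (iter_poly f n)" for n
 have D: "D n = degree f ^ n" for n by (simp add: D_def degree_iter_poly)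
 have D0: "D n > 0" for n using deg by (simp add: D)
 define \<rho> where "\<rho> n = root (D n) R" for n
 have \<rho>1: "\<rho> n \<ge> 1" for n using D0[of n] by (simp add: \<rho>_def R_def)
 have \<rho>D: "\<rho> n ^ D n = R" for n using D0[of n] by (simp add: \<rho>_def R_def)
 have "filterlim D at_top sequentially"
  unfolding D using deg by (intro filterlim_pow_at_top filterlim_ident | real_asymp)+
 hence "(\<lambda>n. root (D n) R) \<longlonglongrightarrow> 1"
  by (rule filterlim_compose[OF LIMSEQ_root_const, rotated]) (simp add: R_def)
 hence \<rho>lim: "\<rho> \<longlonglongrightarrow> 1" by (simp add: \<rho>_def[abs_def])
 have ex: "\<exists>h. h holomorphic_on ball 0 (1 / \<rho> n) \<and> h 0 = 1 \<and>
   (\<forall>u. u \<in> ball 0 (1 / \<rho> n) --> u \<noteq> 0 --> poly (iter_poly f n) (h u / u) = inverse (u ^ D n)) \<and>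
   inj_on (\<lambda>u. h u / u) (ball 0 (1 / \<rho> n) - {0})" for n
 proof (rule poly_inverse_at_infinity)
  show "degree (iter_poly f n) > 0" using D0[of n] by (simp add: D_def)
  show "lead_coeff (iter_poly f n) = 1" by (rule lead_coeff_iter_poly) (use lead deg in auto)
  show "\<rho> n > 0" using \<rho>1[of n] by simp
  fix y assume "poly (pderiv (iter_poly f n)) y = 0"
  then obtain i where i: "i < n" "poly (pderiv f) ((poly f ^^ i) y) = 0"
   using pderiv_iter_poly_root by blast
  have "(poly f ^^ n) y = (poly f ^^ (n - i)) ((poly f ^^ i) y)"
   using i(1) by (simp flip: funpow_add comp_apply[of "poly f ^^ _" "poly f ^^ _"])
  hence "(poly f ^^ n) y \<in> S" using i(2) by (auto simp: S_def C_def)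
  hence "norm ((poly f ^^ n) y) \<le> R" using R0 by (force simp: R_def)
  thus "norm (poly (iter_poly f n) y) \<le> \<rho> n ^ degree (iter_poly f n)"
   using \<rho>D[of n] by (simp add: D_def poly_iter_poly)
 qed (auto simp: D_def)
 have "\<forall>n. \<exists>h. h holomorphic_on ball 0 (1 / \<rho> n) \<and> h 0 = 1 \<and>
   (\<forall>u. u \<in> ball 0 (1 / \<rho> n) --> u \<noteq> 0 --> poly (iter_poly f n) (h u / u) = inverse (u ^ D n)) \<and>
   inj_on (\<lambda>u. h u / u) (ball 0 (1 / \<rho> n) - {0})"
  using ex by (rule allI)
 from choice[OF this] obtain h where h: "\<And>n. h n holomorphic_on ball 0 (1 / \<rho> n)" "\<And>n. h n 0 = 1"
  "\<And>n u. u \<in> ball 0 (1 / \<rho> n) ==> u \<noteq> 0 ==> poly (iter_poly f n) (h n u / u) = inverse (u ^ D n)"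
  "\<And>n. inj_on (\<lambda>u. h n u / u) (ball 0 (1 / \<rho> n) - {0})"
  by blast
 show ?thesis
 proof (rule that[of \<rho> h])
  fix n x assume "x \<in> A"
  hence "(poly f ^^ n) x \<in> S" by (auto simp: S_def)
  hence "norm ((poly f ^^ n) x) \<le> R" using R0 by (force simp: R_def)
  thus "norm (poly (iter_poly f n) x) \<le> \<rho> n ^ degree (iter_poly f n)"
   using \<rho>D[of n] by (simp add: D_def poly_iter_poly)
 qed (use \<rho>1 \<rho>lim h in \<open>auto simp: D_def\<close>)
qed

text \<open>The same \<open>a\<close> serves all points of \<open>A\<close>: it consists of the
  Taylor coefficients of one \<open>h n\<close>, with \<open>n\<close> so large that
  \<open>\<rho> n < r\<^sup>2\<close>.\<close>

lemma pcf_coeff_bounds: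
 fixes f :: "complex poly"
 assumes lead: "lead_coeff f = 1" and deg: "degree f \<ge> 2"
  and pcf: "\<And>c. poly (pderiv f) c = 0 ==> preperiodic f c"
  and A: "finite A" "\<And>x. x \<in> A ==> preperiodic f x" and r: "r > 1"
 shows "\<exists>a. \<forall>x\<in>A. \<forall>N. (\<Sum>k=1..<N. (2 * real k - 1) * (norm (poly (sqrt_poly a k) x))\<^sup>2 / r ^ (4 * k)) \<le> 1"
proof -
 obtain \<rho> h where h: "\<And>n. \<rho> n \<ge> 1" "\<rho> \<longlonglongrightarrow> 1"
  "\<And>n. h n holomorphic_on ball 0 (1 / \<rho> n)" "\<And>n. h n 0 = 1"
  "\<And>n u. u \<in> ball 0 (1 / \<rho> n) ==> u \<noteq> 0 ==>
   poly (iter_poly f n) (h n u / u) = inverse (u ^ degree (iter_poly f n))"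
  "\<And>n. inj_on (\<lambda>u. h n u / u) (ball 0 (1 / \<rho> n) - {0})"
  "\<And>n x. x \<in> A ==> norm (poly (iter_poly f n) x) \<le> \<rho> n ^ degree (iter_poly f n)"
  using pcf_uniformisation[OF lead deg pcf A] by blast
 have "\<forall>\<^sub>F n in sequentially. \<rho> n < r\<^sup>2" by (rule order_tendstoD(2)[OF h(2)]) (use r in simp)
 then obtain n where n: "\<rho> n < r\<^sup>2" by (auto simp: eventually_sequentially)
 show ?thesis
 proof (intro exI ballI allI)
  fix x N assume x: "x \<in> A"
  show "(\<Sum>k=1..<N. (2 * real k - 1) * (norm (poly (sqrt_poly (\<lambda>k. (deriv ^^ k) (h n) 0 / fact k) k) x))\<^sup>2 / r ^ (4 * k)) \<le> 1"
  proof (rule sqrt_transform[of "\<rho> n" "h n" "iter_poly f n" x r])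
   show "degree (iter_poly f n) > 0" using deg by (simp add: degree_iter_poly)
   show "\<rho> n > 0" using h(1)[of n] by linarith
  qed (use h x n r in auto)
 qed
qed

text \<open>Let \<open>r\<close> tend to 1. The sequence \<open>a\<close> varies with
  \<open>r\<close>, but it has dropped out of \<open>prod_diff_bound\<close>.\<close>

theorem pcf_prod_diff_less:
 fixes f :: "complex poly" and x :: "nat => complex"
 assumes lead: "lead_coeff f = 1" and deg: "degree f \<ge> 2"
  and pcf: "\<And>c. poly (pderiv f) c = 0 ==> preperiodic f c"
  and x: "\<And>i. i < N ==> preperiodic f (x i)" and N: "N \<ge> 4"
 shows "(\<Prod>i<N. \<Prod>k<i. (norm (x i - x k))\<^sup>2) < 2 ^ (N\<^sup>2)"
proof -
 define V where "V = (\<Prod>i<N. \<Prod>k<i. (norm (x i - x k))\<^sup>2)"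
 have le: "V * (\<Prod>k=1..<N. half_weight k / r ^ (4 * k)) \<le> 3 * real N" if r: "r > 1" for r
 proof -
  obtain a where "\<forall>y\<in>x ` {..<N}. \<forall>N. (\<Sum>k=1..<N. (2 * real k - 1) * (norm (poly (sqrt_poly a k) y))\<^sup>2 / r ^ (4 * k)) \<le> 1"
   using pcf_coeff_bounds[OF lead deg pcf _ _ r, of "x ` {..<N}"] x by auto
  thus ?thesis unfolding V_def using N r by (intro prod_diff_bound) auto
 qed
 have "((\<lambda>r. V * (\<Prod>k=1..<N. half_weight k / r ^ (4 * k))) \<longlongrightarrow> V * (\<Prod>k=1..<N. half_weight k / 1 ^ (4 * k))) (at_right 1)"
  by (intro tendsto_intros) auto
 moreover have "\<forall>\<^sub>F r in at_right 1. V * (\<Prod>k=1..<N. half_weight k / r ^ (4 * k)) \<le> 3 * real N"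
  using le by (auto simp: eventually_at_right_field intro!: exI[of _ 2])
 ultimately have "V * (\<Prod>k=1..<N. half_weight k / 1 ^ (4 * k)) \<le> 3 * real N"
  by (rule tendsto_upperbound) simp
 also have "... < 2 ^ (N\<^sup>2) * (\<Prod>k=1..<N. half_weight k)"
  by (rule three_mul_lt_half_weight_prod[OF N])
 finally have "V * (\<Prod>k=1..<N. half_weight k) < 2 ^ (N\<^sup>2) * (\<Prod>k=1..<N. half_weight k)" by simp
 moreover have "(\<Prod>k=1..<N. half_weight k) > 0" by (intro prod_pos) (auto intro: half_weight_pos)
 ultimately show ?thesis by (simp add: V_def)
qed

lemma poly_sqrt_poly_1: "poly (sqrt_poly a (Suc 0)) x = (a 1 - x) / 2"
 by (simp add: sqrt_poly.simps(2) field_simps)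

text \<open>The coefficient \<open>k = 1\<close> alone puts both points into the disc of radius
  \<open>2 * r\<^sup>2\<close> around \<open>a 1\<close>.\<close>

theorem pcf_diff_le:
 fixes f :: "complex poly"
 assumes lead: "lead_coeff f = 1" and deg: "degree f \<ge> 2"
  and pcf: "\<And>c. poly (pderiv f) c = 0 ==> preperiodic f c"
  and x: "preperiodic f x" "preperiodic f y"
 shows "norm (x - y) \<le> 4"
proof -
 have le: "norm (x - y) \<le> 4 * r\<^sup>2" if r: "r > 1" for r
 proof -
  obtain a where a: "\<forall>z\<in>{x, y}. \<forall>N. (\<Sum>k=1..<N. (2 * real k - 1) * (norm (poly (sqrt_poly a k) z))\<^sup>2 / r ^ (4 * k)) \<le> 1"
   using pcf_coeff_bounds[OF lead deg pcf _ _ r, of "{x, y}"] x by auto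
  have "norm (a 1 - z) \<le> 2 * r\<^sup>2" if "z \<in> {x, y}" for z
  proof -
   have "(norm ((a 1 - z) / 2))\<^sup>2 / r ^ 4 \<le> 1"
    using a[rule_format, OF that, of 2] by (simp add: poly_sqrt_poly_1 numeral_2_eq_2)
   hence "(norm ((a 1 - z) / 2))\<^sup>2 \<le> (r\<^sup>2)\<^sup>2" using r by (simp add: divide_le_eq flip: power_mult)
   hence "norm ((a 1 - z) / 2) \<le> r\<^sup>2" by (rule power2_le_imp_le) simp
   thus ?thesis by (simp add: norm_divide)
  qed
  hence "norm ((a 1 - y) - (a 1 - x)) \<le> 2 * r\<^sup>2 + 2 * r\<^sup>2"
   by (intro order_trans[OF norm_triangle_ineq4 add_mono]) auto
  thus ?thesis by simp
 qed
 have "((\<lambda>r::real. 4 * r\<^sup>2) \<longlongrightarrow> 4 * 1\<^sup>2) (at_right 1)" by (intro tendsto_intros)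
 moreover have "\<forall>\<^sub>F r in at_right (1::real). norm (x - y) \<le> 4 * r\<^sup>2"
  using le by (auto simp: eventually_at_right_field intro!: exI[of _ 2])
 ultimately have "norm (x - y) \<le> 4 * 1\<^sup>2" by (rule tendsto_lowerbound) simp
 thus ?thesis by simp
qed

section \<open>Pairs of preperiodic points at maximal distance\<close>

text \<open>
 Since \<open>P(X) - P(Y) = (X - Y) E(X, Y)\<close> and \<open>E\<close> is dominated by \<open>degree P\<close> terms of equal size.
\<close>

lemma inverse_at_infinity_unique:
 fixes P :: "complex poly" and A B :: "complex => complex"
 assumes P: "degree P > 0" and AB: "isCont A 0" "A 0 = 1" "isCont B 0" "B 0 = 1" and k: "k > 0"
  and eq: "\<And>u. norm u < e ==> u \<noteq> 0 ==> poly P (A u / u ^ k) = poly P (B u / u ^ k)" and e: "e > 0"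
 shows "\<exists>\<delta>>0. \<forall>u. norm u < \<delta> --> A u = B u"
proof -
 define D where "D = degree P"
 define T where "T m u = (\<Sum>i<m. B u ^ (m - Suc i) * A u ^ i)" for m u
 define E where "E u = (\<Sum>m\<le>D. coeff P m * (u ^ k) ^ (D - m) * T m u)" for u
 have "isCont E 0" unfolding E_def T_def by (intro continuous_intros AB)
 moreover have "E 0 = (\<Sum>m\<le>D. if m = D then lead_coeff P * of_nat D else 0)"
  unfolding E_def T_def using k by (intro sum.cong refl) (auto simp: AB D_def power_0_left)
 hence "E 0 \<noteq> 0" using P by (auto simp: D_def)
 ultimately obtain d where d: "d > 0" "\<And>u. norm u < d ==> E u \<noteq> 0"
  using continuous_at_avoid[of 0 E 0] by auto
 show ?thesis
 proof (intro exI[of _ "min d e"] conjI allI impI)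
  fix u :: complex assume u: "norm u < min d e"
  show "A u = B u"
  proof (cases "u = 0")
   case False
   have pw: "(u ^ k) ^ D * (x / u ^ k) ^ m = (u ^ k) ^ (D - m) * x ^ m" if "m \<le> D" for x m
    using that False by (simp add: power_divide power_diff)
   have "(A u - B u) * E u = (\<Sum>m\<le>D. coeff P m * (u ^ k) ^ (D - m) * (A u ^ m - B u ^ m))"
    unfolding E_def T_def sum_distrib_left power_diff_sumr2 by (simp add: mult_ac)
   also have "... = (u ^ k) ^ D * (poly P (A u / u ^ k) - poly P (B u / u ^ k))"
    unfolding poly_altdef D_def[symmetric] sum_subtractf[symmetric] sum_distrib_left
    by (intro sum.cong refl) (simp add: pw right_diff_distrib mult.left_commute)
   finally show ?thesis using eq[of u] d(2)[of u] u False by auto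
  qed (simp add: AB)
 qed (use d e in auto)
qed

text \<open>Both sides have the same image under the \<open>n\<close>-th iterate and the same
  behaviour at infinity, so they agree near 0 by uniqueness of the inverse branch, and on the whole
  disc by analytic continuation. In the limit this becomes Boettcher's equation.\<close>

lemma pcf_uniformisation_functional_eq:
 fixes f :: "complex poly"
 assumes lead: "lead_coeff f = 1" and deg: "degree f \<ge> 2"
  and e: "0 < e" "e \<le> 1"
  and hol: "h holomorphic_on ball 0 e" "h' holomorphic_on ball 0 e" and h0: "h 0 = 1" "h' 0 = 1"
  and Ph: "\<And>u. u \<in> ball 0 e ==> u \<noteq> 0 ==>
   poly (iter_poly f n) (h u / u) = inverse (u ^ degree (iter_poly f n))"
  and Ph': "\<And>u. u \<in> ball 0 e ==> u \<noteq> 0 ==>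
   poly (iter_poly f (Suc n)) (h' u / u) = inverse (u ^ degree (iter_poly f (Suc n)))"
  and u: "u \<in> ball 0 e" "u \<noteq> 0"
 shows "poly f (h' u / u) = h (u ^ degree f) / u ^ degree f"
proof -
 define d where "d = degree f"
 \<comment> \<open>The numerator of \<open>poly f (h' u / u)\<close> over \<open>u ^ d\<close>,
   which is holomorphic at 0.\<close>
 define A where "A u = (\<Sum>i\<le>d. coeff f i * h' u ^ i * u ^ (d - i))" for u
 have Aeq: "A u = u ^ d * poly f (h' u / u)" if "u \<noteq> 0" for u
  unfolding A_def poly_altdef sum_distrib_left d_def[symmetric]
  using that by (intro sum.cong refl) (simp add: power_divide power_diff field_simps)
 have Ahol: "A holomorphic_on ball 0 e" unfolding A_def by (intro holomorphic_intros hol)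
 have A0: "A 0 = 1"
 proof -
  have "A 0 = (\<Sum>i\<le>d. if i = d then 1 else 0)"
   unfolding A_def using lead by (intro sum.cong refl) (auto simp: h0 d_def power_0_left)
  thus ?thesis by simp
 qed
 have powb: "u ^ d \<in> ball 0 e" if "u \<in> ball 0 e" for u :: complex
 proof -
  have "norm u ^ d \<le> norm u" using that e deg power_decreasing[of 1 d "norm u"] by (simp add: d_def)
  thus ?thesis using that by (simp add: norm_power)
 qed
 have Bhol: "(\<lambda>u. h (u ^ d)) holomorphic_on ball 0 e"
 proof -
  have "h \<circ> (\<lambda>u. u ^ d) holomorphic_on ball 0 e"
   by (rule holomorphic_on_compose_gen[OF _ hol(1)]) (use powb in \<open>auto intro!: holomorphic_intros\<close>)
  thus ?thesis by (simp add: o_def)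
 qed
 have fit: "poly (iter_poly f (Suc n)) x = poly (iter_poly f n) (poly f x)" for x
  by (simp add: poly_iter_poly funpow_swap1)
 have dn: "degree (iter_poly f n) > 0" using deg by (simp add: degree_iter_poly)
 have ds: "degree (iter_poly f (Suc n)) = d * degree (iter_poly f n)" by (simp add: degree_iter_poly d_def)
 have cont: "isCont g 0" if "g holomorphic_on ball 0 e" for g
  using holomorphic_on_imp_continuous_on[OF that] e by (simp add: continuous_on_eq_continuous_at)
 have "\<exists>\<delta>>0. \<forall>u. norm u < \<delta> --> A u = h (u ^ d)"
 proof (rule inverse_at_infinity_unique[OF dn cont[OF Ahol] A0 cont[OF Bhol] _ _ _ e(1)])
  fix u :: complex assume u: "norm u < e" "u \<noteq> 0"
  show "poly (iter_poly f n) (A u / u ^ d) = poly (iter_poly f n) (h (u ^ d) / u ^ d)"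
   using powb[of u] u Ph'[of u] Ph[of "u ^ d"] by (simp add: Aeq fit ds power_mult)
 qed (use deg d_def h0 in \<open>auto simp: power_0_left\<close>)
 then obtain \<delta> where \<delta>: "\<delta> > 0" "\<And>u. norm u < \<delta> ==> A u = h (u ^ d)" by blast
 have "A u = h (u ^ d)"
 proof (rule analytic_continuation_open[of "ball 0 (min \<delta> e)" "ball 0 e" A "\<lambda>u. h (u ^ d)"])
  show "ball (0::complex) (min \<delta> e) \<noteq> {}" using \<delta>(1) e(1) by simp
 qed (use \<delta> Ahol Bhol u in auto)
 thus ?thesis using Aeq[OF u(2)] u(2) by (simp add: d_def field_simps)
qed

lemma exists_add_inverse:
 fixes t :: complex
 shows "\<exists>v. v \<noteq> 0 \<and> v + 1 / v = t"
proof -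
 have "\<exists>v. poly [:1, - t, 1:] v = 0" by (rule alg_closed_imp_poly_has_root) simp
 then obtain v where v: "v * v - t * v + 1 = 0" by (auto simp: algebra_simps)
 have "v \<noteq> 0" using v by auto
 thus ?thesis using v by (intro exI[of _ v]) (auto simp: field_simps)
qed

lemma poly_chebyshev_rec_add_inverse:
 fixes v :: complex
 assumes "v \<noteq> 0"
 shows "poly (map_poly of_int (chebyshev_rec n)) (v + 1 / v) = v ^ n + 1 / v ^ n"
proof (induction n rule: chebyshev_rec.induct)
 case (3 n)
 have hom: "map_poly complex_of_int (p - q) = map_poly of_int p - map_poly of_int q" for p q
  by (intro poly_eqI) (simp add: coeff_map_poly)
 have "(v + 1 / v) * (v ^ Suc n + 1 / v ^ Suc n) - (v ^ n + 1 / v ^ n) = v ^ Suc (Suc n) + 1 / v ^ Suc (Suc n)"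
 proof -
  define w where "w = 1 / v"
  have vw: "v * (w * c) = c" "w * (v * c) = c" for c using assms by (simp_all add: w_def)
  have "(v + w) * (v ^ Suc n + w ^ Suc n) - (v ^ n + w ^ n) = v ^ Suc (Suc n) + w ^ Suc (Suc n)"
   by (simp add: distrib_left distrib_right vw mult.assoc)
  thus ?thesis by (simp only: w_def power_one_over)
 qed
 moreover have "poly (map_poly of_int (chebyshev_rec (Suc (Suc n)))) (v + 1 / v) =
   (v + 1 / v) * poly (map_poly of_int (chebyshev_rec (Suc n))) (v + 1 / v) - poly (map_poly of_int (chebyshev_rec n)) (v + 1 / v)"

 proof -
  have "map_poly complex_of_int (pCons 0 q) = pCons 0 (map_poly of_int q)" for q
   by (intro poly_eqI) (simp add: coeff_map_poly coeff_pCons split: nat.splits)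
  thus ?thesis unfolding chebyshev_rec.simps(3) hom by (simp del: chebyshev_rec.simps)
 qed
 ultimately show ?case using 3 by simp
qed (simp_all add: map_poly_pCons)

text \<open>The substitution \<open>u = 1 / (\<kappa> * v)\<close> turns the hypothesis into
  \<open>g (v + 1/v) = b + \<kappa>^d v^d + \<mu> / v^d\<close> for large \<open>v\<close>, hence
  for all nonzero \<open>v\<close>. The left side is invariant under \<open>v \<mapsto> 1/v\<close>;
  this forces \<open>\<kappa>^d = \<mu>\<close>, so \<open>\<kappa>^d\<close> is
  \<open>\<kappa>\<close> or \<open>- \<kappa>\<close>, and \<open>g\<close> is a Chebyshev
  polynomial up to that sign and the shift.\<close>

lemma joukowski_semiconjugate_imp_chebyshev:
 fixes f :: "complex poly" and b \<kappa> :: complex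
 assumes deg: "degree f \<ge> 2" and \<kappa>: "\<kappa> \<noteq> 0" and e: "e > 0"
  and eq: "\<And>u. norm u < e ==> u \<noteq> 0 ==>
   poly f (b + 1 / u + \<kappa>\<^sup>2 * u) = b + 1 / u ^ degree f + \<kappa>\<^sup>2 * u ^ degree f"
 shows "\<exists>\<epsilon>\<in>{1, - 1}. pcompose f [:b, \<kappa>:] = [:b:] + smult (\<epsilon> * \<kappa>) (map_poly of_int (chebyshev_rec (degree f)))"
proof -
 let ?r = "norm \<kappa> * e"
 define d where "d = degree f"
 define g where "g = pcompose f [:b, \<kappa>:]"
 define \<mu> where "\<mu> = \<kappa>\<^sup>2 / \<kappa> ^ d"
 have dg: "degree g = d" using \<kappa> by (simp add: g_def d_def degree_pcompose)
 \<comment> \<open>\<open>G1\<close> and \<open>G2\<close> are the two sides multiplied by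
   \<open>v ^ d\<close>, as polynomials in \<open>v\<close>.\<close>
 define G1 where "G1 = (\<Sum>i\<le>d. smult (coeff g i) ([:1, 0, 1:] ^ i * monom 1 (d - i)))"
 define G2 where "G2 = monom b d + monom (\<kappa> ^ d) (2 * d) + [:\<mu>:]"
 have G1: "poly G1 v = v ^ d * poly g (v + 1 / v)" if "v \<noteq> 0" for v
 proof -
  have "v ^ d * poly g (v + 1 / v) = (\<Sum>i\<le>d. v ^ d * (coeff g i * (v + 1 / v) ^ i))"
   by (simp add: poly_altdef dg sum_distrib_left)
  also have "... = (\<Sum>i\<le>d. coeff g i * ((1 + v * v) ^ i * v ^ (d - i)))"
  proof (rule sum.cong[OF refl])
   fix i assume "i \<in> {..d}"
   hence "v ^ d = v ^ i * v ^ (d - i)" by (simp flip: power_add)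
   moreover have "(1 + v * v) ^ i = v ^ i * (v + 1 / v) ^ i"
    using that by (simp add: distrib_left add.commute flip: power_mult_distrib)
   ultimately show "v ^ d * (coeff g i * (v + 1 / v) ^ i) = coeff g i * ((1 + v * v) ^ i * v ^ (d - i))"
    by simp
  qed
  finally show ?thesis by (simp add: G1_def poly_sum poly_monom)
 qed
 have G2: "poly G2 v = v ^ d * (b + \<kappa> ^ d * v ^ d + \<mu> / v ^ d)" if "v \<noteq> 0" for v
 proof -
  have "v ^ d * (\<mu> / v ^ d) = \<mu>" using that by simp
  moreover have "v ^ (2 * d) = v ^ d * v ^ d" by (simp add: mult_2 power_add)
  ultimately show ?thesis by (simp add: G2_def poly_monom distrib_left)
 qed
 have large: "poly g (v + 1 / v) = b + \<kappa> ^ d * v ^ d + \<mu> / v ^ d" if v: "norm v > 1 / ?r" for v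
 proof -
  have "1 / ?r > 0" using \<kappa> e by simp
  hence "v \<noteq> 0" using v by auto
  define u where "u = 1 / (\<kappa> * v)"
  have "norm u < e" using v \<kappa> e \<open>v \<noteq> 0\<close> by (simp add: u_def norm_divide norm_mult field_simps)
  moreover have "u \<noteq> 0" using \<kappa> \<open>v \<noteq> 0\<close> by (simp add: u_def)
  ultimately have "poly f (b + 1 / u + \<kappa>\<^sup>2 * u) = b + 1 / u ^ d + \<kappa>\<^sup>2 * u ^ d" unfolding d_def by (rule eq)
  moreover have "b + 1 / u + \<kappa>\<^sup>2 * u = b + (v + 1 / v) * \<kappa>"
  proof -
   have "1 / u = v * \<kappa>" "\<kappa>\<^sup>2 * u = 1 / v * \<kappa>"
    using \<kappa> \<open>v \<noteq> 0\<close> by (simp_all add: u_def power2_eq_square)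
   thus ?thesis by (simp only: distrib_right add.assoc)
  qed
  moreover have "b + 1 / u ^ d + \<kappa>\<^sup>2 * u ^ d = b + \<kappa> ^ d * v ^ d + \<mu> / v ^ d"
   unfolding u_def \<mu>_def power_divide power_one using \<kappa> \<open>v \<noteq> 0\<close> by (simp add: u_def \<mu>_def power_divide power_mult_distrib)
  ultimately show ?thesis by (simp only: g_def poly_pcompose poly_pCons poly_0 mult_zero_right add_0_right)
 qed
 have "G1 = G2"
 proof (rule ccontr)
  assume "G1 \<noteq> G2"
  hence "finite {v. poly (G1 - G2) v = 0}" by (intro poly_roots_finite) simp
  moreover have "{v. norm v > 1 / ?r} \<subseteq> {v. poly (G1 - G2) v = 0}"
  proof
   fix v :: complex assume v: "v \<in> {v. norm v > 1 / ?r}"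
   have "1 / ?r > 0" using \<kappa> e by simp
  hence "v \<noteq> 0" using v by auto
   thus "v \<in> {v. poly (G1 - G2) v = 0}" using large[of v] v by (simp add: G1 G2)
  qed
  ultimately have "finite {v::complex. norm v > 1 / ?r}" by (rule finite_subset[rotated])
  moreover have "(\<lambda>n. of_nat n + of_real (1 / ?r + 1)) ` UNIV \<subseteq> {v::complex. norm v > 1 / ?r}"
  proof safe
   fix n
   have "(of_nat n + of_real (1 / ?r + 1) :: complex) = of_real (real n + (1 / ?r + 1))" by simp
   hence "norm (of_nat n + of_real (1 / ?r + 1) :: complex) = \<bar>real n + (1 / ?r + 1)\<bar>"
    by (simp only: norm_of_real)
   thus "norm (of_nat n + of_real (1 / ?r + 1) :: complex) > 1 / ?r" by linarith
  qed
  ultimately have "finite ((\<lambda>n. of_nat n + of_real (1 / ?r + 1) :: complex) ` (UNIV :: nat set))"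
   by (rule finite_subset[rotated])
  hence "finite (UNIV :: nat set)" by (rule finite_imageD) (auto intro: inj_onI)
  thus False by simp
 qed
 hence all: "poly g (v + 1 / v) = b + \<kappa> ^ d * v ^ d + \<mu> / v ^ d" if "v \<noteq> 0" for v
  using G1[OF that] G2[OF that] that by simp
 have "\<kappa> ^ d = \<mu>"
 proof -
  \<comment> \<open>The invariance under \<open>v \<mapsto> 1/v\<close>, tested on the pair 2 and
    1/2.\<close>
  have "\<kappa> ^ d * 2 ^ d + \<mu> / 2 ^ d = \<kappa> ^ d * (1 / 2) ^ d + \<mu> / (1 / 2) ^ d"
   using all[of 2] all[of "1 / 2"] by simp
  hence "(\<kappa> ^ d - \<mu>) * ((2 ^ d)\<^sup>2 - 1) = 0" by (simp add: field_simps power2_eq_square)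
  moreover have "(2 ^ d)\<^sup>2 \<noteq> (1 :: complex)"
  proof -
   have "(2::real) ^ (d * 2) > 1" using deg by (intro one_less_power) (auto simp: d_def)
   hence "(2::real) ^ (d * 2) \<noteq> 1" by simp
   thus ?thesis by (metis of_real_1 of_real_eq_iff of_real_numeral of_real_power power_mult)
  qed
  ultimately show ?thesis by simp
 qed
 hence kd: "\<kappa> ^ d * \<kappa> ^ d = \<kappa> * \<kappa>" using \<kappa> by (simp add: \<mu>_def field_simps power2_eq_square)
 hence "\<kappa> ^ d = \<kappa> \<or> \<kappa> ^ d = - \<kappa>" by (simp add: square_eq_iff)
 then obtain \<epsilon> where \<epsilon>: "\<epsilon> \<in> {1, - 1}" "\<kappa> ^ d = \<epsilon> * \<kappa>" by (metis insertI1 insertI2 mult_1 mult_minus1)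
 have "poly g t = poly ([:b:] + smult (\<epsilon> * \<kappa>) (map_poly of_int (chebyshev_rec d))) t" for t
 proof -
  obtain v where v: "v \<noteq> 0" "v + 1 / v = t" using exists_add_inverse by blast
  show ?thesis using all[OF v(1)] \<open>\<kappa> ^ d = \<mu>\<close> \<epsilon>(2) v(2) poly_chebyshev_rec_add_inverse[OF v(1), of d] by (simp add: algebra_simps)
 qed
 thus ?thesis using \<epsilon>(1) by (auto simp: g_def d_def)
qed


text \<open>If \<open>c 1\<close> has modulus near 1, its term nearly exhausts the area inequality
  and little is left for the other coefficients. The bound \<open>\<delta> r\<close> tends to 0 as
  \<open>r\<close> tends to 1; the conditions \<open>r ^ 4 \<le> 2\<close> and
  \<open>norm u \<le> 1 / 4\<close> make the tail geometric with ratio 1/2.\<close>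

lemma extremal_series_close:
 fixes c :: "nat => complex"
 defines "\<delta> \<equiv> \<lambda>r::real. sqrt (r ^ 4 - 1) + sqrt (1 - (1 - sqrt (r ^ 4 - 1))\<^sup>2 / r ^ 4)"
 assumes c0: "c 0 = 1" and r: "r \<ge> 1" "r ^ 4 \<le> 2"
  and bound: "\<And>N. (\<Sum>k=1..<N. (2 * real k - 1) * (norm (c k))\<^sup>2 / r ^ (4 * k)) \<le> 1"
  and c1: "norm (c 1 - \<kappa>) \<le> sqrt (r ^ 4 - 1)" and \<kappa>: "norm \<kappa> = 1" and u: "norm u \<le> 1 / 4"
  and s: "(\<lambda>k. c k * u ^ k) sums s"
 shows "norm (s - (1 + \<kappa> * u)) \<le> \<delta> r"
proof -
 define \<epsilon> where "\<epsilon> = sqrt (r ^ 4 - 1)"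
 define \<eta> where "\<eta> = sqrt (1 - (1 - \<epsilon>)\<^sup>2 / r ^ 4)"
 have r1: "r ^ 4 \<ge> 1" using r(1) by simp
 have e: "0 \<le> \<epsilon>" "\<epsilon> \<le> 1" using r(2) r1 by (auto simp: \<epsilon>_def)
 have le1: "(1 - \<epsilon>)\<^sup>2 / r ^ 4 \<le> 1" using e r1 power_le_one[of "1 - \<epsilon>" 2] by (simp add: divide_le_eq)
 hence eta0: "\<eta> \<ge> 0" by (simp add: \<eta>_def)
 have "norm \<kappa> - norm (c 1 - \<kappa>) \<le> norm (c 1)"
  using norm_triangle_ineq2[of \<kappa> "\<kappa> - c 1"] by (simp add: norm_minus_commute)
 hence "(1 - \<epsilon>)\<^sup>2 \<le> (norm (c 1))\<^sup>2" using c1 e \<kappa> by (intro power_mono) (auto simp: \<epsilon>_def)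
 hence c1': "(1 - \<epsilon>)\<^sup>2 / r ^ 4 \<le> (norm (c 1))\<^sup>2 / r ^ 4" using r1 by (intro divide_right_mono) auto
 have ck: "norm (c k * u ^ k) \<le> \<eta> * (1 / 2) ^ k" if k: "k \<ge> 2" for k
 proof -
  have "(\<Sum>j\<in>{1, k}. (2 * real j - 1) * (norm (c j))\<^sup>2 / r ^ (4 * j)) \<le> (\<Sum>j=1..<Suc k. (2 * real j - 1) * (norm (c j))\<^sup>2 / r ^ (4 * j))"
   using k r by (intro sum_mono2) auto
  also have "... \<le> 1" by (rule bound)
  finally have "(norm (c 1))\<^sup>2 / r ^ 4 + (2 * real k - 1) * (norm (c k))\<^sup>2 / r ^ (4 * k) \<le> 1"
   using k by simp
  moreover have "1 * (norm (c k))\<^sup>2 / r ^ (4 * k) \<le> (2 * real k - 1) * (norm (c k))\<^sup>2 / r ^ (4 * k)"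
   using k r by (intro divide_right_mono mult_right_mono) auto
  ultimately have "(norm (c k))\<^sup>2 / r ^ (4 * k) \<le> 1 - (1 - \<epsilon>)\<^sup>2 / r ^ 4" using c1' by simp
  also have "... = \<eta>\<^sup>2" using le1 by (simp add: \<eta>_def)
  finally have "(norm (c k))\<^sup>2 \<le> \<eta>\<^sup>2 * r ^ (4 * k)" using r by (simp add: divide_le_eq)
  also have "... = (\<eta> * (r\<^sup>2) ^ k)\<^sup>2" by (simp add: power_mult_distrib flip: power_mult)
  finally have "norm (c k) \<le> \<eta> * (r\<^sup>2) ^ k" by (rule power2_le_imp_le) (use eta0 in simp)
  also have "(r\<^sup>2) ^ k \<le> 2 ^ k"
  proof (rule power_mono)
   have "(r\<^sup>2)\<^sup>2 \<le> 2\<^sup>2" using r(2) by (simp flip: power_mult)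
   thus "r\<^sup>2 \<le> 2" by (rule power2_le_imp_le) simp
  qed simp
  finally have "norm (c k) \<le> \<eta> * 2 ^ k" using eta0 by (simp add: mult_left_mono)
  moreover have "norm u ^ k \<le> (1 / 4) ^ k" using u by (intro power_mono) auto
  ultimately have "norm (c k) * norm u ^ k \<le> (\<eta> * 2 ^ k) * (1 / 4) ^ k"
   using eta0 by (intro mult_mono) auto
  also have "... = \<eta> * (2 * (1 / 4)) ^ k" by (simp only: power_mult_distrib mult.assoc)
  also have "2 * (1 / 4) = (1 / 2 :: real)" by simp
  finally show ?thesis by (simp add: norm_mult norm_power)
 qed
 have "(\<lambda>k. c (k + 2) * u ^ (k + 2)) sums (s - (\<Sum>k<2. c k * u ^ k))"
  by (subst sums_iff_shift) (use s in simp)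
 hence tail: "(\<lambda>k. c (k + 2) * u ^ (k + 2)) sums (s - (1 + c 1 * u))"
  by (simp add: numeral_2_eq_2 c0)
 have geo: "(\<lambda>k. \<eta> * (1 / 2) ^ (k + 2)) sums (\<eta> / 2)"
  using sums_mult[OF geometric_sums[of "1 / 2 :: real"], of "\<eta> / 4"] by simp
 have "norm (s - (1 + c 1 * u)) \<le> \<eta> / 2"
  using norm_suminf_le[OF ck[of "_ + 2"] sums_summable[OF geo]] tail geo by (simp add: sums_iff)
 moreover have "norm ((c 1 - \<kappa>) * u) \<le> \<epsilon> * 1"
  unfolding norm_mult using c1 u e by (intro mult_mono) (auto simp: \<epsilon>_def)
 ultimately have "norm ((s - (1 + c 1 * u)) + (c 1 - \<kappa>) * u) \<le> \<eta> / 2 + \<epsilon>"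
  by (intro norm_triangle_mono) simp_all
 moreover have "(s - (1 + c 1 * u)) + (c 1 - \<kappa>) * u = s - (1 + \<kappa> * u)" by (simp add: algebra_simps)
 ultimately have "norm (s - (1 + \<kappa> * u)) \<le> \<eta> / 2 + \<epsilon>" by (simp only:)
 also have "... \<le> \<epsilon> + \<eta>" using eta0 by simp
 finally show ?thesis by (simp add: \<delta>_def \<epsilon>_def \<eta>_def)
qed

text \<open>The first coefficients at \<open>x\<close> and \<open>y\<close> are
  \<open>e + \<kappa>\<close> and \<open>e - \<kappa>\<close> with \<open>\<kappa>\<close> of
  modulus 1, and both have modulus at most \<open>(r n)\<^sup>2\<close>; by the parallelogram law
  \<open>e\<close> tends to 0. Hence the square roots at \<open>x\<close> converge to
  \<open>1 + \<kappa> * u\<close>, the functions \<open>h n\<close> to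
  \<open>1 + b * u + \<kappa>\<^sup>2 * u\<^sup>2\<close>, and the functional equation passes to the
  limit.\<close>

theorem pcf_diff_eq_4_imp_chebyshev:
 fixes f :: "complex poly"
 assumes lead: "lead_coeff f = 1" and deg: "degree f \<ge> 2"
  and pcf: "\<And>c. poly (pderiv f) c = 0 ==> preperiodic f c"
  and x: "preperiodic f x" "preperiodic f y" and eq4: "norm (x - y) = 4"
 defines "b \<equiv> (x + y) / 2" and "\<kappa> \<equiv> (y - x) / 4"
 shows "\<exists>\<epsilon>\<in>{1, - 1}. pcompose f [:b, \<kappa>:] = [:b:] + smult (\<epsilon> * \<kappa>) (map_poly of_int (chebyshev_rec (degree f)))"
proof -
 define \<delta> where "\<delta> = (\<lambda>r::real. sqrt (r ^ 4 - 1) + sqrt (1 - (1 - sqrt (r ^ 4 - 1))\<^sup>2 / r ^ 4))"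
 have \<kappa>: "norm \<kappa> = 1" using eq4 by (simp add: \<kappa>_def norm_divide norm_minus_commute)
 obtain \<rho> h where h: "\<And>n. \<rho> n \<ge> 1" "\<rho> \<longlonglongrightarrow> 1"
  "\<And>n. h n holomorphic_on ball 0 (1 / \<rho> n)" "\<And>n. h n 0 = 1"
  "\<And>n u. u \<in> ball 0 (1 / \<rho> n) ==> u \<noteq> 0 ==>
   poly (iter_poly f n) (h n u / u) = inverse (u ^ degree (iter_poly f n))"
  "\<And>n. inj_on (\<lambda>u. h n u / u) (ball 0 (1 / \<rho> n) - {0})"
  "\<And>n z. z \<in> {x, y} ==> norm (poly (iter_poly f n) z) \<le> \<rho> n ^ degree (iter_poly f n)"
  by (rule pcf_uniformisation[OF lead deg pcf, of "{x, y}"]) (use x in auto)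
 \<comment> \<open>\<open>sqrt_transform\<close> wants \<open>(r n)\<^sup>2 > \<rho> n\<close>
   strictly; the added term vanishes in the limit.\<close>
 define r where "r n = sqrt (\<rho> n + 1 / (real n + 1))" for n
 have r2: "(r n)\<^sup>2 = \<rho> n + 1 / (real n + 1)" for n using h(1)[of n] by (simp add: r_def)
 have rgt: "(r n)\<^sup>2 > \<rho> n" for n by (simp add: r2)
 have r0: "r n > 0" for n using h(1)[of n] by (simp add: r_def add_pos_nonneg)
 have r1: "r n \<ge> 1" for n
 proof -
  have "1\<^sup>2 \<le> (r n)\<^sup>2" using rgt[of n] h(1)[of n] by simp
  thus ?thesis by (rule power2_le_imp_le) (use r0[of n] in simp)
 qed
 have "(\<lambda>n. \<rho> n + 1 / (real n + 1)) \<longlonglongrightarrow> 1 + 0" by (intro tendsto_add h(2)) real_asymp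
 hence rlim: "r \<longlonglongrightarrow> 1" unfolding r_def using tendsto_real_sqrt by fastforce
 have \<delta>lim: "(\<lambda>n. \<delta> (r n)) \<longlonglongrightarrow> 0"
 proof -
  have "(\<lambda>n. \<delta> (r n)) \<longlonglongrightarrow> sqrt (1 ^ 4 - 1) + sqrt (1 - (1 - sqrt (1 ^ 4 - 1))\<^sup>2 / 1 ^ 4)"
   unfolding \<delta>_def by (intro tendsto_intros rlim) simp
  thus ?thesis by simp
 qed
 have r4: "\<forall>\<^sub>F n in sequentially. r n ^ 4 < 2"
  by (rule order_tendstoD(2)[OF tendsto_power[OF rlim]]) simp
 have \<rho>2: "\<forall>\<^sub>F n in sequentially. \<rho> n < 2" by (rule order_tendstoD(2)[OF h(2)]) simp
 have close: "\<exists>\<sigma>. h n u = x * u + \<sigma>\<^sup>2 \<and> norm (\<sigma> - (1 + \<kappa> * u)) \<le> \<delta> (r n)"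
  if n: "r n ^ 4 < 2" "\<rho> n < 2" and u: "norm u \<le> 1 / 4" for n u
 proof -
  have dg: "degree (iter_poly f n) > 0" using deg by (simp add: degree_iter_poly)
  have rho0: "\<rho> n > 0" using h(1)[of n] by linarith
  let ?a = "\<lambda>k. (deriv ^^ k) (h n) 0 / fact k"
  obtain s where s: "\<And>u. norm u < 1 / \<rho> n ==> (\<lambda>k. poly (sqrt_poly ?a k) x * u ^ k) sums s u"
    "\<And>u. norm u < 1 / \<rho> n ==> h n u = x * u + (s u)\<^sup>2"
    "\<And>N. (\<Sum>k=1..<N. (2 * real k - 1) * (norm (poly (sqrt_poly ?a k) x))\<^sup>2 / r n ^ (4 * k)) \<le> 1"
   by (rule sqrt_transform[OF rho0 h(3,4,5,6) dg h(7)[of x] r0 rgt]) auto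
  have sy: "(\<Sum>k=1..<N. (2 * real k - 1) * (norm (poly (sqrt_poly ?a k) y))\<^sup>2 / r n ^ (4 * k)) \<le> 1" for N
   by (rule sqrt_transform[OF rho0 h(3,4,5,6) dg h(7)[of y] r0 rgt]) auto
  define e where "e = poly (sqrt_poly ?a 1) x - \<kappa>"
  have e1: "poly (sqrt_poly ?a (Suc 0)) x = e + \<kappa>" by (simp add: e_def)
  have e2: "poly (sqrt_poly ?a (Suc 0)) y = e - \<kappa>"
   using e1 by (simp add: poly_sqrt_poly_1 \<kappa>_def field_simps)
  have "(norm (e + \<kappa>))\<^sup>2 / r n ^ 4 \<le> 1" using s(3)[of 2] by (simp add: e1 numeral_2_eq_2)
  moreover have "(norm (e - \<kappa>))\<^sup>2 / r n ^ 4 \<le> 1" using sy[of 2] by (simp add: e2 numeral_2_eq_2)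
  moreover have "(norm (e + \<kappa>))\<^sup>2 + (norm (e - \<kappa>))\<^sup>2 = 2 * (norm e)\<^sup>2 + 2 * (norm \<kappa>)\<^sup>2"
   unfolding cmod_power2 by (simp add: power2_eq_square algebra_simps)
  ultimately have "(norm e)\<^sup>2 \<le> r n ^ 4 - 1" using r0[of n] \<kappa> by (simp add: divide_le_eq)
  hence ele: "norm e \<le> sqrt (r n ^ 4 - 1)" by (rule real_le_rsqrt)
  have ur: "norm u < 1 / \<rho> n"
  proof -
   have "1 / 4 < 1 / \<rho> n" using n(2) rho0 by (simp add: field_simps)
   thus ?thesis using u by linarith
  qed
  have "norm (s u - (1 + \<kappa> * u)) \<le> \<delta> (r n)" unfolding \<delta>_def
  proof (rule extremal_series_close[OF _ r1 _ s(3) _ \<kappa> u s(1)[OF ur]])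
   show "poly (sqrt_poly ?a 0) x = 1" by (simp add: sqrt_poly.simps(1))
  qed (use n ele in \<open>auto simp: e_def\<close>)
  thus ?thesis using s(2)[OF ur] by blast
 qed
 have hlim: "(\<lambda>n. h n u) \<longlonglongrightarrow> 1 + b * u + \<kappa>\<^sup>2 * u\<^sup>2" if u: "norm u \<le> 1 / 4" for u
 proof -
  have "\<forall>n. \<exists>\<sigma>. r n ^ 4 < 2 \<and> \<rho> n < 2 --> h n u = x * u + \<sigma>\<^sup>2 \<and> norm (\<sigma> - (1 + \<kappa> * u)) \<le> \<delta> (r n)"
   using close[OF _ _ u] by blast
  then obtain \<sigma> where \<sigma>: "\<And>n. r n ^ 4 < 2 ==> \<rho> n < 2 ==> h n u = x * u + (\<sigma> n)\<^sup>2 \<and> norm (\<sigma> n - (1 + \<kappa> * u)) \<le> \<delta> (r n)"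
   by metis
  have "\<forall>\<^sub>F n in sequentially. norm (\<sigma> n - (1 + \<kappa> * u)) \<le> \<delta> (r n)"
   using r4 \<rho>2 by eventually_elim (use \<sigma> in blast)
  hence "(\<lambda>n. \<sigma> n - (1 + \<kappa> * u)) \<longlonglongrightarrow> 0" by (rule Lim_null_comparison[OF _ \<delta>lim])
  hence "\<sigma> \<longlonglongrightarrow> 1 + \<kappa> * u" by (rule LIM_zero_cancel)
  hence "(\<lambda>n. x * u + (\<sigma> n)\<^sup>2) \<longlonglongrightarrow> x * u + (1 + \<kappa> * u)\<^sup>2" by (intro tendsto_intros)
  moreover have "\<forall>\<^sub>F n in sequentially. x * u + (\<sigma> n)\<^sup>2 = h n u"
   using r4 \<rho>2 by eventually_elim (use \<sigma> in simp)
  ultimately have "(\<lambda>n. h n u) \<longlonglongrightarrow> x * u + (1 + \<kappa> * u)\<^sup>2" by (rule Lim_transform_eventually)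
  moreover have "b = x + 2 * \<kappa>" by (simp add: b_def \<kappa>_def field_simps)
  ultimately show ?thesis by (simp add: power2_eq_square algebra_simps)
 qed
 show ?thesis
 proof (rule joukowski_semiconjugate_imp_chebyshev[OF deg])
  show "\<kappa> \<noteq> 0" using \<kappa> by auto
  show "(1 / 4 :: real) > 0" by simp
  fix u :: complex assume u: "norm u < 1 / 4" "u \<noteq> 0"
  define d where "d = degree f"
  have ud: "norm (u ^ d) \<le> 1 / 4"
   using u deg power_decreasing[of 1 d "norm u"] by (simp add: norm_power d_def)
  have lhs: "(\<lambda>n. poly f (h (Suc n) u / u)) \<longlonglongrightarrow> poly f ((1 + b * u + \<kappa>\<^sup>2 * u\<^sup>2) / u)"
   using u by (intro tendsto_poly tendsto_divide LIMSEQ_Suc[OF hlim]) auto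
  have rhs: "(\<lambda>n. h n (u ^ d) / u ^ d) \<longlonglongrightarrow> (1 + b * u ^ d + \<kappa>\<^sup>2 * (u ^ d)\<^sup>2) / u ^ d"
   using u by (intro tendsto_divide hlim ud) auto
  have "\<forall>\<^sub>F n in sequentially. \<rho> (Suc n) < 2" using \<rho>2 eventually_sequentially_Suc[of "\<lambda>n. \<rho> n < 2"] by simp
  hence "\<forall>\<^sub>F n in sequentially. poly f (h (Suc n) u / u) = h n (u ^ d) / u ^ d" using \<rho>2
  proof eventually_elim
   fix n assume n: "\<rho> (Suc n) < 2" "\<rho> n < 2"
   have b: "ball (0::complex) (1 / 2) \<subseteq> ball 0 (1 / \<rho> m)" if "\<rho> m < 2" for m
   proof -
    have "1 / 2 \<le> 1 / \<rho> m" using that h(1)[of m] by (intro frac_le) auto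
    thus ?thesis by auto
   qed
   show "poly f (h (Suc n) u / u) = h n (u ^ d) / u ^ d" unfolding d_def
   proof (rule pcf_uniformisation_functional_eq[OF lead deg, of "1 / 2" "h n" "h (Suc n)" n u])
    show "h n holomorphic_on ball 0 (1 / 2)" by (rule holomorphic_on_subset[OF h(3) b[OF n(2)]])
    show "h (Suc n) holomorphic_on ball 0 (1 / 2)" by (rule holomorphic_on_subset[OF h(3) b[OF n(1)]])
    show "poly (iter_poly f n) (h n u / u) = inverse (u ^ degree (iter_poly f n))"
     if "u \<in> ball 0 (1 / 2)" "u \<noteq> 0" for u using h(5)[of u n] b[OF n(2)] that by blast
    show "poly (iter_poly f (Suc n)) (h (Suc n) u / u) = inverse (u ^ degree (iter_poly f (Suc n)))"
     if "u \<in> ball 0 (1 / 2)" "u \<noteq> 0" for u using h(5)[of u "Suc n"] b[OF n(1)] that by blast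
   qed (use u h(4) in auto)
  qed
  hence "(\<lambda>n. h n (u ^ d) / u ^ d) \<longlonglongrightarrow> poly f ((1 + b * u + \<kappa>\<^sup>2 * u\<^sup>2) / u)"
   by (rule Lim_transform_eventually[OF lhs])
  hence "poly f ((1 + b * u + \<kappa>\<^sup>2 * u\<^sup>2) / u) = (1 + b * u ^ d + \<kappa>\<^sup>2 * (u ^ d)\<^sup>2) / u ^ d"
   by (rule LIMSEQ_unique[OF _ rhs])
  thus "poly f (b + 1 / u + \<kappa>\<^sup>2 * u) = b + 1 / u ^ degree f + \<kappa>\<^sup>2 * u ^ degree f"
   using u by (simp add: d_def[symmetric] add_divide_distrib power2_eq_square mult.assoc add.commute add.left_commute)
 qed
qed

section \<open>Subfields and minimal polynomials\<close>

lemma degree_pos_if_root: "h \<noteq> 0 ==> poly h x = 0 ==> degree h > 0"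
 by (rule ccontr) (auto elim: degree_eq_zeroE)

text \<open>Subrings and subfields are sets inside one type, so that all polynomials keep the type
  of the large field and a smaller coefficient ring is a membership condition.\<close>

locale closed_subring =
 fixes R :: "'a :: comm_ring_1 set"
 assumes one_mem: "1 \<in> R"
  and diff_mem: "x \<in> R ==> y \<in> R ==> x - y \<in> R"
  and mult_mem: "x \<in> R ==> y \<in> R ==> x * y \<in> R"
begin

lemma zero_mem: "0 \<in> R"
 using diff_mem[OF one_mem one_mem] by simp

lemma uminus_mem: "x \<in> R ==> - x \<in> R"
 using diff_mem[OF zero_mem] by simp

lemma add_mem: "x \<in> R ==> y \<in> R ==> x + y \<in> R"
 using diff_mem[of x "- y"] uminus_mem by simp

lemma power_mem: "x \<in> R ==> x ^ n \<in> R"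
 by (induction n) (auto intro: one_mem mult_mem)

lemma sum_mem: "(\<And>i. i \<in> A ==> f i \<in> R) ==> sum f A \<in> R"
 by (induction A rule: infinite_finite_induct) (auto intro: zero_mem add_mem)

lemma prod_mem: "(\<And>i. i \<in> A ==> f i \<in> R) ==> prod f A \<in> R"
 by (induction A rule: infinite_finite_induct) (auto intro: one_mem mult_mem)

lemma of_nat_mem: "of_nat n \<in> R"
 by (induction n) (auto intro: zero_mem one_mem add_mem)

lemma of_int_mem: "of_int n \<in> R"
 by (cases n) (auto intro!: of_nat_mem uminus_mem diff_mem one_mem)

lemmas mem_intros = one_mem zero_mem diff_mem mult_mem uminus_mem add_mem power_mem sum_mem prod_mem
 of_nat_mem of_int_mem

end

section \<open>Polynomials with coefficients in a subring\<close>

definition polys :: "'a :: zero set => 'a poly set"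
 where "polys R = {h. \<forall>i. coeff h i \<in> R}"

lemma polysD: "h \<in> polys R ==> coeff h i \<in> R"
 by (simp add: polys_def)

lemma polys_mono: "R \<subseteq> S ==> polys R \<subseteq> polys S"
 by (auto simp: polys_def)

context closed_subring
begin

lemma polys_0: "0 \<in> polys R"
 by (simp add: polys_def zero_mem)

lemma polys_monom: "c \<in> R ==> monom c n \<in> polys R"
 by (simp add: polys_def zero_mem)

lemma polys_pCons: "c \<in> R ==> h \<in> polys R ==> pCons c h \<in> polys R"
 by (auto simp: polys_def coeff_pCons split: nat.splits)

lemma polys_const: "c \<in> R ==> [:c:] \<in> polys R"
 by (intro polys_pCons polys_0)

lemma polys_1: "1 \<in> polys R"
 using polys_const[OF one_mem] by (simp add: one_pCons)

lemma polys_smult: "c \<in> R ==> h \<in> polys R ==> smult c h \<in> polys R"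
 by (simp add: polys_def mult_mem)

lemma polys_diff: "g \<in> polys R ==> h \<in> polys R ==> g - h \<in> polys R"
 by (simp add: polys_def diff_mem)

lemma polys_add: "g \<in> polys R ==> h \<in> polys R ==> g + h \<in> polys R"
 by (simp add: polys_def add_mem)

lemma polys_mult: "g \<in> polys R ==> h \<in> polys R ==> g * h \<in> polys R"
 by (simp add: polys_def coeff_mult sum_mem mult_mem)

lemma polys_power: "g \<in> polys R ==> g ^ n \<in> polys R"
 by (induction n) (auto intro: polys_1 polys_mult)

lemma polys_pcompose:
 assumes "g \<in> polys R" "h \<in> polys R"
 shows "pcompose g h \<in> polys R"
 using assms(1)
proof (induction g)
 case (pCons a g)
 have "a \<in> R" using polysD[OF pCons.prems, of 0] by simp
 moreover have "g \<in> polys R"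
  unfolding polys_def using polysD[OF pCons.prems, of "Suc _"] by simp
 ultimately show ?case
  using pCons.IH assms(2) by (simp add: pcompose_pCons polys_add polys_const polys_mult)
qed (simp add: polys_0)

lemma poly_mem: "h \<in> polys R ==> x \<in> R ==> poly h x \<in> R"
 unfolding poly_altdef by (intro sum_mem mult_mem power_mem polysD)

lemma polys_iter: "f \<in> polys R ==> x \<in> R ==> (poly f ^^ n) x \<in> R"
 by (induction n) (auto intro: poly_mem)

lemma monic_division:
 assumes g: "g \<in> polys R" "lead_coeff g = 1" and h: "h \<in> polys R"
 shows "\<exists>q\<in>polys R. \<exists>r\<in>polys R. h = g * q + r \<and> (r = 0 \<or> degree r < degree g)"
 using h
proof (induction h)
 case (pCons a h)
 have "h \<in> polys R" "a \<in> R" using polysD[OF pCons.prems, of 0] polysD[OF pCons.prems, of "Suc _"]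
  by (auto simp: polys_def)
 then obtain q r where qr: "q \<in> polys R" "r \<in> polys R" "h = g * q + r" "r = 0 \<or> degree r < degree g" and a: "a \<in> R"
  using pCons.IH by blast
 define c where "c = coeff (pCons a r) (degree g)"
 define r' where "r' = pCons a r - smult c g"
 have c: "c \<in> R" "pCons a r \<in> polys R" using polys_pCons[OF a qr(2)] by (auto simp: c_def polys_def)
 have "pCons a h = g * (pCons 0 q + [:c:]) + r'" by (simp add: qr(3) r'_def algebra_simps)
 moreover have "r' = 0 \<or> degree r' < degree g"
 proof -
  have "degree r' \<le> degree g" unfolding r'_def using qr(4) by (intro degree_diff_le) (auto intro: degree_smult_le)
  moreover have "coeff r' (degree g) = 0" using g(2) by (simp add: r'_def c_def)
  ultimately show ?thesis by (metis leading_coeff_0_iff order.not_eq_order_implies_strict)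
 qed
 moreover have "r' \<in> polys R" "pCons 0 q + [:c:] \<in> polys R"
  unfolding r'_def by (intro polys_diff polys_smult polys_add polys_pCons polys_0 zero_mem c qr g)+
 ultimately show ?case by blast
qed (intro bexI[of _ 0], auto intro: polys_0)

lemma polys_synthetic_div:
 assumes "h \<in> polys R" "c \<in> R"
 shows "synthetic_div h c \<in> polys R"
proof -
 have "coeff (synthetic_div h c) i \<in> R" for i using assms(1)
 proof (induction h arbitrary: i)
  case (pCons a h)
  have h: "h \<in> polys R"
   unfolding polys_def using polysD[OF pCons.prems, of "Suc _"] by simp
  show ?case using pCons.IH[OF h] poly_mem[OF h assms(2)] by (cases i) auto
 qed (simp add: zero_mem)
 thus ?thesis by (simp add: polys_def)
qed

end

lemma polys_pderiv:
 fixes g :: "'b :: idom poly"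
 assumes "closed_subring S" "g \<in> polys S"
 shows "pderiv g \<in> polys S"
 using closed_subring.mult_mem[OF assms(1) closed_subring.of_nat_mem[OF assms(1)] polysD[OF assms(2)]]
 by (simp only: polys_def mem_Collect_eq coeff_pderiv) blast

locale closed_subfield = closed_subring K for K :: "'a :: field set" +
 assumes inverse_mem: "x \<in> K ==> inverse x \<in> K"
begin

lemma divide_mem: "x \<in> K ==> y \<in> K ==> x / y \<in> K"
 by (simp add: field_class.field_divide_inverse mult_mem inverse_mem)

end

section \<open>Minimal polynomials\<close>

definition is_minpoly :: "'a :: field set => 'a => 'a poly => bool"
 where "is_minpoly K x g \<longleftrightarrow> g \<in> polys K \<and> lead_coeff g = 1 \<and> poly g x = 0 \<and>
  (\<forall>h\<in>polys K. h \<noteq> 0 --> poly h x = 0 --> degree g \<le> degree h)"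

context closed_subfield
begin

lemma minpoly_exists:
 assumes h: "h \<in> polys K" "h \<noteq> 0" "poly h x = 0"
 shows "\<exists>g. is_minpoly K x g"
proof -
 let ?P = "\<lambda>h. h \<in> polys K \<and> h \<noteq> 0 \<and> poly h x = 0"
 define g where "g = arg_min degree ?P"
 have g: "?P g" "\<And>h. ?P h ==> degree g \<le> degree h"
  using arg_min_nat_lemma[of ?P h degree] h by (auto simp: g_def)
 have "is_minpoly K x (smult (inverse (lead_coeff g)) g)"
  unfolding is_minpoly_def using g by (auto intro!: polys_smult inverse_mem polysD)
 thus ?thesis by blast
qed

lemma minpoly_dvd:
 assumes g: "is_minpoly K x g" and h: "h \<in> polys K" "poly h x = 0"
 shows "\<exists>q\<in>polys K. h = g * q"
proof -
 obtain q r where qr: "q \<in> polys K" "r \<in> polys K" "h = g * q + r" "r = 0 \<or> degree r < degree g"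
  using monic_division[of g h] g h by (auto simp: is_minpoly_def)
 have "poly r x = 0" using h(2) g by (simp add: qr(3) is_minpoly_def)
 hence "r = 0" using qr(2,4) g by (auto simp: is_minpoly_def not_le[symmetric])
 thus ?thesis using qr by auto
qed

lemma minpoly_degree_pos:
 assumes "is_minpoly K x g"
 shows "degree g > 0"
 using assms by (intro degree_pos_if_root[of g x]) (auto simp: is_minpoly_def)

text \<open>Irreducibility of \<open>g\<close>: the minimal polynomial \<open>h\<close> of
  \<open>y\<close> divides \<open>g\<close>, and \<open>x\<close> is a root of \<open>h\<close> or
  of the cofactor. The cofactor is ruled out by its degree.\<close>

lemma minpoly_conjugate:
 assumes g: "is_minpoly K x g" and y: "poly g y = 0"
 shows "is_minpoly K y g"
proof -
 have gg: "g \<in> polys K" "lead_coeff g = 1" "poly g x = 0" "g \<noteq> 0" using g by (auto simp: is_minpoly_def)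
 obtain h where h: "is_minpoly K y h" using minpoly_exists[OF gg(1,4) y] by blast
 hence hh: "h \<in> polys K" "lead_coeff h = 1" "h \<noteq> 0" by (auto simp: is_minpoly_def)
 obtain q where q: "q \<in> polys K" "g = h * q" using minpoly_dvd[OF h gg(1) y] by blast
 have qnz: "q \<noteq> 0" using gg(4) q(2) by auto
 have dg: "degree g = degree h + degree q" using q(2) hh(3) qnz by (simp add: degree_mult_eq)
 have "poly h x = 0" using g q qnz gg(3) dg minpoly_degree_pos[OF h] by (auto simp: is_minpoly_def)
 hence "degree g = degree h" using g hh dg by (auto simp: is_minpoly_def)
 thus ?thesis using h gg y by (auto simp: is_minpoly_def)
qed

lemma minpoly_conjugate_root:
 assumes "is_minpoly K x g" "poly g y = 0" "h \<in> polys K" "poly h x = 0"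
 shows "poly h y = 0"
 using minpoly_dvd[OF assms(1,3,4)] assms(2) by auto

end

lemma minpoly_simple_root:
 fixes K :: "'a :: field_char_0 set"
 assumes K: "closed_subfield K" and g: "is_minpoly K x g" and y: "poly g y = 0"
 shows "poly (pderiv g) y \<noteq> 0"
proof
 interpret closed_subfield K by fact
 assume "poly (pderiv g) y = 0"
 moreover have "pderiv g \<noteq> 0" using minpoly_degree_pos[OF g] by (simp add: pderiv_eq_0_iff)
 moreover have "pderiv g \<in> polys K"
  using polys_pderiv[OF closed_subring_axioms] g by (simp add: is_minpoly_def)
 ultimately have "degree g \<le> degree (pderiv g)"
  using minpoly_conjugate[OF g y] by (simp add: is_minpoly_def)
 thus False using minpoly_degree_pos[OF g] by (simp add: degree_pderiv)
qed

lemma card_roots_eq_degree: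
 fixes g :: "'a :: {field_char_0, alg_closed_field} poly"
 assumes g: "g \<noteq> 0" and simple: "\<And>y. poly g y = 0 ==> poly (pderiv g) y \<noteq> 0"
 shows "card {y. poly g y = 0} = degree g"
proof -
 obtain A where A: "size A = degree g" "g = smult (lead_coeff g) (\<Prod>x\<in>#A. [:-x, 1:])"
  using alg_closed_imp_factorization[OF g] by blast
 have roots: "{y. poly g y = 0} = set_mset A"
 proof -
  have "poly g y = 0 \<longleftrightarrow> poly (\<Prod>x\<in>#A. [:-x, 1:]) y = 0" for y using g by (subst A(2)) simp
  also have "poly (\<Prod>x\<in>#A. [:-x, 1:]) y = 0 \<longleftrightarrow> y \<in># A" for y
   by (auto simp: poly_prod_mset prod_mset_zero_iff)
  finally show ?thesis by auto
 qed
 have "count A x \<le> 1" for x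
 proof (rule ccontr)
  assume "\<not> count A x \<le> 1"
  hence "{#x, x#} \<subseteq># A" by (simp add: subseteq_mset_def)
  then obtain B where B: "A = {#x, x#} + B" by (metis subset_mset.less_eqE)
  have "g = [:-x, 1:] * ([:-x, 1:] * smult (lead_coeff g) (\<Prod>x\<in>#B. [:-x, 1:]))"
   by (subst A(2)) (simp add: B)
  then obtain q where q: "g = [:-x, 1:] * ([:-x, 1:] * q)" by blast
  have "poly g x = 0" "poly (pderiv g) x = 0" unfolding q pderiv_mult by simp_all
  thus False using simple by blast
 qed
 hence "mset_set (set_mset A) = A"
  by (intro multiset_eqI) (metis count_mset_set(1,3) count_eq_zero_iff finite_set_mset le_antisym less_one not_le)
 hence "card (set_mset A) = size A" by (metis size_mset_set)
 thus ?thesis by (simp add: roots A(1))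
qed

section \<open>Simple extensions\<close>

definition adjoin :: "'a :: comm_semiring_0 set => 'a => 'a set"
 where "adjoin K x = {poly h x | h. h \<in> polys K}"

context closed_subring
begin

lemma adjoin_mem: "h \<in> polys R ==> poly h x \<in> adjoin R x"
 by (auto simp: adjoin_def)

lemma subset_adjoin: "R \<subseteq> adjoin R x"
proof
 fix y assume "y \<in> R"
 thus "y \<in> adjoin R x" using adjoin_mem[OF polys_const, of y x] by simp
qed

lemma self_mem_adjoin: "x \<in> adjoin R x"
 using adjoin_mem[of "[:0, 1:]" x] by (simp add: polys_pCons polys_0 zero_mem one_mem)

lemma adjoin_subset:
 assumes "closed_subring S" "R \<subseteq> S" "x \<in> S"
 shows "adjoin R x \<subseteq> S"
 using closed_subring.poly_mem[OF assms(1)] polys_mono[OF assms(2)] assms(3)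
 by (auto simp: adjoin_def)

lemma closed_subring_adjoin: "closed_subring (adjoin R x)"
proof
 show "1 \<in> adjoin R x" using subset_adjoin one_mem by auto
next
 fix y z assume "y \<in> adjoin R x" "z \<in> adjoin R x"
 then obtain g h where gh: "g \<in> polys R" "h \<in> polys R" "y = poly g x" "z = poly h x"
  by (auto simp: adjoin_def)
 show "y - z \<in> adjoin R x" "y * z \<in> adjoin R x"
  using adjoin_mem[OF polys_diff[OF gh(1,2)], of x] adjoin_mem[OF polys_mult[OF gh(1,2)], of x]
  by (simp_all add: gh)
qed

end

text \<open>Bezout for the minimal polynomial \<open>m\<close> and the polynomial \<open>h\<close>
  to be inverted at \<open>x\<close>. A nonzero combination \<open>u\<close> of least degree divides
  both, and it is constant, because its cofactor in \<open>m\<close> kills \<open>x\<close> and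
  cannot have smaller degree than \<open>m\<close>.\<close>

lemma (in closed_subfield) closed_subfield_adjoin:
 assumes g: "g \<in> polys K" "g \<noteq> 0" "poly g x = 0"
 shows "closed_subfield (adjoin K x)"
proof -
 interpret S: closed_subring "adjoin K x" by (rule closed_subring_adjoin)
 show ?thesis
 proof
  fix y assume "y \<in> adjoin K x"
  then obtain h where h: "h \<in> polys K" "y = poly h x" by (auto simp: adjoin_def)
  show "inverse y \<in> adjoin K x"
  proof (cases "y = 0")
   case True thus ?thesis using S.zero_mem by simp
  next
   case False
   obtain m where m: "is_minpoly K x m" using minpoly_exists[OF g] by blast
   hence mm: "m \<in> polys K" "m \<noteq> 0" "poly m x = 0" by (auto simp: is_minpoly_def)
   define P where "P u \<longleftrightarrow> u \<noteq> 0 \<and> (\<exists>a\<in>polys K. \<exists>b\<in>polys K. u = m * a + h * b)" for u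
   have "P m" unfolding P_def using mm polys_0 polys_1
    by (intro conjI bexI[of _ 1] bexI[of _ 0]) auto
   define u where "u = arg_min degree P"
   have u: "P u" "\<And>w. P w ==> degree u \<le> degree w"
    using arg_min_nat_lemma[of P m degree] \<open>P m\<close> by (auto simp: u_def)
   obtain a b where ab: "a \<in> polys K" "b \<in> polys K" "u = m * a + h * b" and unz: "u \<noteq> 0"
    using u(1) by (auto simp: P_def)
   have uK: "u \<in> polys K" unfolding ab by (intro polys_add polys_mult mm h ab)
   define c where "c = inverse (lead_coeff u)"
   have cK: "c \<in> K" unfolding c_def by (intro inverse_mem polysD uK)
   have cnz: "c \<noteq> 0" using unz by (simp add: c_def)
   define u' where "u' = smult c u"
   have u': "u' \<in> polys K" "lead_coeff u' = 1" "degree u' = degree u"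
    unfolding u'_def using cK uK unz by (auto simp: c_def intro: polys_smult)
   have dvd: "\<exists>q\<in>polys K. w = u' * q"
    if w: "w = m * a' + h * b'" "a' \<in> polys K" "b' \<in> polys K" for w a' b'
   proof -
    have wK: "w \<in> polys K" unfolding w by (intro polys_add polys_mult mm h w)
    obtain q r where qr: "q \<in> polys K" "r \<in> polys K" "w = u' * q + r" "r = 0 \<or> degree r < degree u'"
     using monic_division[OF u'(1,2) wK] by blast
    have "r = w - u' * q" using qr(3) by simp
    also have "... = m * (a' - smult c (a * q)) + h * (b' - smult c (b * q))"
     by (simp add: w u'_def ab(3) algebra_simps smult_add_right)
    finally have "r = m * (a' - smult c (a * q)) + h * (b' - smult c (b * q))" .
    moreover have "a' - smult c (a * q) \<in> polys K" "b' - smult c (b * q) \<in> polys K"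
     by (intro polys_diff polys_smult polys_mult w cK ab qr)+
    ultimately have "r \<noteq> 0 ==> P r" by (auto simp: P_def)
    hence "r = 0" using u(2)[of r] qr(4) u'(3) by (metis not_le)
    thus ?thesis using qr by auto
   qed
   have "\<exists>q\<in>polys K. m = u' * q" "\<exists>q\<in>polys K. h = u' * q"
    using dvd[of m 1 0] dvd[of h 0 1] polys_0 polys_1 by simp_all
   then obtain q1 q2 where q: "q1 \<in> polys K" "m = u' * q1" "h = u' * q2" by blast
   have "poly q1 x = 0" using False h(2) q(3) mm(3) q(2) by simp
   moreover have "q1 \<noteq> 0" using mm(2) q(2) by auto
   ultimately have "degree m \<le> degree q1" using m q(1) by (auto simp: is_minpoly_def)
   moreover have "degree m = degree u' + degree q1"
    unfolding q(2) using mm(2) q(2) by (intro degree_mult_eq) auto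
   ultimately obtain e where e: "u = [:e:]" using u'(3) by (auto elim: degree_eq_zeroE)
   hence enz: "e \<noteq> 0" and eK: "e \<in> K" using unz polysD[OF uK, of 0] by auto
   have "e = poly u x" by (simp add: e)
   also have "... = y * poly b x" by (simp add: ab(3) mm(3) h(2))
   finally have "inverse y = poly (smult (inverse e) b) x" using enz by (simp add: field_simps)
   moreover have "smult (inverse e) b \<in> polys K" by (intro polys_smult inverse_mem eK ab)
   ultimately show ?thesis using adjoin_mem by metis
  qed
 qed
qed

section \<open>Algebraic integers\<close>

definition int_span :: "'a :: ring_1 set => 'a set"
 where "int_span B = {\<Sum>b\<in>B. of_int (c b) * b | c. True}"

lemma int_span_0: "0 \<in> int_span B"
 unfolding int_span_def by (auto intro!: exI[of _ "\<lambda>_. 0"])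

lemma int_span_base: "finite B ==> b \<in> B ==> b \<in> int_span B"
 unfolding int_span_def
 by (intro CollectI exI[of _ "\<lambda>x. if x = b then 1 else 0"])
  (simp add: if_distrib[of of_int] if_distrib[of "\<lambda>c. c * _"] cong: if_cong)

lemma int_span_diff:
 assumes "x \<in> int_span B" "y \<in> int_span B"
 shows "x - y \<in> int_span B"
proof -
 obtain c e where "x = (\<Sum>b\<in>B. of_int (c b) * b)" "y = (\<Sum>b\<in>B. of_int (e b) * b)"
  using assms by (auto simp: int_span_def)
 hence "x - y = (\<Sum>b\<in>B. of_int (c b - e b) * b)" by (simp add: sum_subtractf algebra_simps)
 thus ?thesis unfolding int_span_def by (intro CollectI exI[of _ "\<lambda>b. c b - e b"]) simp
qed

lemma int_span_add: "x \<in> int_span B ==> y \<in> int_span B ==> x + y \<in> int_span B"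
 using int_span_diff[of x B "0 - y"] int_span_diff[of 0 B y] int_span_0[of B] by simp

lemma int_span_sum: "(\<And>i. i \<in> I ==> f i \<in> int_span B) ==> sum f I \<in> int_span B"
 by (induction I rule: infinite_finite_induct) (auto intro: int_span_0 int_span_add)

lemma int_span_scale:
 assumes "x \<in> int_span B"
 shows "of_int k * x \<in> int_span B"
proof -
 obtain c where "x = (\<Sum>b\<in>B. of_int (c b) * b)" using assms by (auto simp: int_span_def)
 hence "of_int k * x = (\<Sum>b\<in>B. of_int (k * c b) * b)" by (simp add: sum_distrib_left mult.assoc)
 thus ?thesis unfolding int_span_def by (intro CollectI exI[of _ "\<lambda>b. k * c b"]) simp
qed

lemma int_span_mult:
 fixes x :: "'a :: comm_ring_1"
 assumes "\<And>b. b \<in> B ==> x * b \<in> int_span C" "y \<in> int_span B"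
 shows "x * y \<in> int_span C"
proof -
 obtain c where "y = (\<Sum>b\<in>B. of_int (c b) * b)" using assms(2) by (auto simp: int_span_def)
 hence "x * y = (\<Sum>b\<in>B. of_int (c b) * (x * b))" by (simp add: sum_distrib_left mult_ac)
 thus ?thesis by (auto intro!: int_span_sum int_span_scale assms(1))
qed

text \<open>The Cayley--Hamilton trick: \<open>x\<close> is an eigenvalue of an integer matrix.\<close>

lemma algebraic_int_if_int_span_stable:
 fixes x :: "'a :: field_char_0"
 assumes B: "finite B" "b0 \<in> B" "b0 \<noteq> 0" and stable: "\<And>b. b \<in> B ==> x * b \<in> int_span B"
 shows "algebraic_int x"
proof -
 obtain n and f :: "nat => 'a" where f: "bij_betw f {..<n} B"
  using B(1) ex_bij_betw_nat_finite[OF B(1)] by (auto simp: atLeast0LessThan)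
 have "\<exists>c. x * b = (\<Sum>b'\<in>B. of_int (c b') * b')" if "b \<in> B" for b
  using stable[OF that] by (auto simp: int_span_def)
 then obtain c :: "'a => 'a => int" where c: "\<And>b. b \<in> B ==> x * b = (\<Sum>b'\<in>B. of_int (c b b') * b')"
  by metis
 define M where "M = mat n n (\<lambda>(i, j). c (f i) (f j))"
 define N where "N = map_mat (of_int :: int => 'a) M"
 define v where "v = vec n f"
 have M: "M \<in> carrier_mat n n" by (simp add: M_def)
 have N: "N \<in> carrier_mat n n" by (simp add: N_def M_def)
 have fB: "f i \<in> B" if "i < n" for i using f that by (auto simp: bij_betw_def)
 have "N *\<^sub>v v = x \<cdot>\<^sub>v v"
 proof (rule eq_vecI)
  fix i assume "i < dim_vec (x \<cdot>\<^sub>v v)"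
  hence i: "i < n" by (simp add: v_def)
  have "vec_index (N *\<^sub>v v) i = (\<Sum>j<n. of_int (c (f i) (f j)) * f j)"
   using i by (simp add: N_def M_def v_def scalar_prod_def atLeast0LessThan)
  also have "... = (\<Sum>b'\<in>B. of_int (c (f i) b') * b')" by (rule sum.reindex_bij_betw[OF f])
  also have "... = x * f i" using c[OF fB[OF i]] by simp
  finally show "vec_index (N *\<^sub>v v) i = vec_index (x \<cdot>\<^sub>v v) i" using i by (simp add: v_def)
 qed (simp add: v_def N_def M_def)
 moreover have "v \<noteq> 0\<^sub>v n"
 proof
  assume v: "v = 0\<^sub>v n"
  obtain i where "i < n" "f i = b0" using f B(2) by (auto simp: bij_betw_def)
  hence "vec_index v i = b0" by (simp add: v_def)
  thus False using v B(3) \<open>i < n\<close> by simp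
 qed
 ultimately have "eigenvalue N x"
  unfolding eigenvalue_def eigenvector_def using N by (intro exI[of _ v]) (auto simp: v_def)
 hence "poly (char_poly N) x = 0" using eigenvalue_root_char_poly[OF N] by simp
 moreover have "char_poly N = map_poly of_int (char_poly M)"
  unfolding N_def by (rule of_int_hom.char_poly_hom[OF M])
 ultimately show ?thesis using degree_monic_char_poly[OF M] unfolding algebraic_int_altdef_ipoly by (intro exI[of _ "char_poly M"]) auto
qed

text \<open>Multiplying the generators by the powers of \<open>x\<close> below the degree of its
  monic equation keeps the module finitely generated and makes it stable under \<open>x\<close> as
  well.\<close>

lemma int_span_extend:
 fixes x :: "'a :: comm_ring_1"
 assumes B: "finite B" and S: "\<And>s b. s \<in> S ==> b \<in> B ==> s * b \<in> int_span B"
  and n: "n > 0" and r: "\<And>j. j < n ==> r j \<in> S" "x ^ n = (\<Sum>j<n. r j * x ^ j)"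
 defines "B' \<equiv> (\<lambda>(b, j). b * x ^ j) ` (B \<times> {..<n})"
 shows "finite B'" "B \<subseteq> B'" "\<And>s b. s \<in> insert x S ==> b \<in> B' ==> s * b \<in> int_span B'"
proof -
 show fin: "finite B'" using B by (simp add: B'_def)
 show "B \<subseteq> B'" unfolding B'_def using n by (intro subsetI) (rule image_eqI[of _ _ "(_, 0)"], auto)
 have S': "s * (b * x ^ j) \<in> int_span B'" if "s \<in> S" "b \<in> B" "j < n" for s b j
 proof -
  have "x ^ j * b' \<in> int_span B'" if "b' \<in> B" for b'
   using that \<open>j < n\<close> by (intro int_span_base fin) (auto simp: B'_def mult.commute)
  hence "x ^ j * (s * b) \<in> int_span B'" by (rule int_span_mult[of B]) (use S that in auto)
  thus ?thesis by (simp add: mult_ac)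
 qed
 fix s b assume s: "s \<in> insert x S" and "b \<in> B'"
 then obtain b' j where b: "b' \<in> B" "j < n" "b = b' * x ^ j" by (auto simp: B'_def)
 show "s * b \<in> int_span B'"
 proof (cases "s \<in> S")
  case True
  thus ?thesis using S' b by simp
 next
  case False
  hence sx: "s = x" using s by simp
  show ?thesis
  proof (cases "Suc j < n")
   case True
   hence "s * b \<in> B'" unfolding B'_def sx b(3)
    using b(1) by (intro image_eqI[of _ _ "(b', Suc j)"]) (auto simp: mult_ac)
   thus ?thesis by (intro int_span_base fin)
  next
   case False
   hence "n = Suc j" using b(2) by simp
   hence "s * b = b' * x ^ n" by (simp add: sx b(3) mult_ac)
   also have "... = (\<Sum>j<n. r j * (b' * x ^ j))" by (simp add: r(2) sum_distrib_left mult_ac)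
   also have "... \<in> int_span B'" by (intro int_span_sum S' r(1) b) auto
   finally show ?thesis .
  qed
 qed
qed

lemma monic_root_power_eq:
 fixes h :: "'a :: comm_ring_1 poly"
 assumes "lead_coeff h = 1" "poly h x = 0"
 shows "x ^ degree h = (\<Sum>j<degree h. (- coeff h j) * x ^ j)"
proof -
 have "0 = (\<Sum>j<degree h. coeff h j * x ^ j) + x ^ degree h"
  using assms by (simp add: poly_altdef lessThan_Suc_atMost[symmetric])
 thus ?thesis by (simp add: sum_negf eq_neg_iff_add_eq_0 add.commute)
qed

text \<open>A common stable module for all of \<open>S\<close> is automatically stable under
  differences and products of its elements; the closure properties of algebraic integers follow from
  it.\<close>

lemma finite_int_span_stable_exists:
 fixes S :: "'a :: field_char_0 set"
 assumes "finite S" "\<And>s. s \<in> S ==> algebraic_int s"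
 shows "\<exists>B. finite B \<and> 1 \<in> B \<and> (\<forall>s\<in>S \<union> \<int>. \<forall>b\<in>B. s * b \<in> int_span B)"
 using assms
proof (induction S rule: finite_induct)
 case empty
 show ?case by (intro exI[of _ "{1}"]) (auto simp: int_span_def elim!: Ints_cases)
next
 case (insert x S)
 then obtain B where B: "finite B" "1 \<in> B" "\<And>s b. s \<in> S \<union> \<int> ==> b \<in> B ==> s * b \<in> int_span B" by auto
 obtain h where h: "poly (map_poly of_int h) x = 0" "lead_coeff h = 1"
  using insert.prems unfolding algebraic_int_altdef_ipoly by blast
 define g where "g = map_poly (of_int :: int => 'a) h"
 have g: "poly g x = 0" "lead_coeff g = 1" using h by (auto simp: g_def)
 have n: "degree g > 0" using g by (intro degree_pos_if_root[of g x]) auto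
 have r: "- coeff g j \<in> S \<union> \<int>" for j by (auto simp: g_def)
 define B' where "B' = (\<lambda>(b, j). b * x ^ j) ` (B \<times> {..<degree g})"
 have "finite B'" "B \<subseteq> B'" "\<And>s b. s \<in> insert x (S \<union> \<int>) ==> b \<in> B' ==> s * b \<in> int_span B'"
  unfolding B'_def using int_span_extend[where S = "S \<union> \<int>", OF B(1,3) n r monic_root_power_eq[OF g(2,1)]] by blast+
 thus ?case using B(2) by (intro exI[of _ B']) auto
qed

lemma algebraic_int_diff_mult:
 fixes x y :: "'a :: field_char_0"
 assumes "algebraic_int x" "algebraic_int y"
 shows "algebraic_int (x - y)" "algebraic_int (x * y)"
proof -
 obtain B where B: "finite B" "1 \<in> B" "\<And>s b. s \<in> {x, y} \<union> \<int> ==> b \<in> B ==> s * b \<in> int_span B"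
 proof -
  have "\<exists>B. finite B \<and> 1 \<in> B \<and> (\<forall>s\<in>{x, y} \<union> \<int>. \<forall>b\<in>B. s * b \<in> int_span B)"
   by (rule finite_int_span_stable_exists) (use assms in auto)
  thus ?thesis using that by blast
 qed
 have "(x - y) * b \<in> int_span B" if "b \<in> B" for b
  using B(3)[of x b] B(3)[of y b] that by (simp add: left_diff_distrib int_span_diff)
 thus "algebraic_int (x - y)" by (rule algebraic_int_if_int_span_stable[OF B(1,2) one_neq_zero])
 have "(x * y) * b \<in> int_span B" if "b \<in> B" for b
 proof -
  have "x * (y * b) \<in> int_span B" by (rule int_span_mult[OF B(3) B(3)]) (use that in auto)
  thus ?thesis by (simp only: mult.assoc)
 qed
 thus "algebraic_int (x * y)" by (rule algebraic_int_if_int_span_stable[OF B(1,2) one_neq_zero])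
qed

lemma closed_subring_algebraic_int: "closed_subring {x :: 'a :: field_char_0. algebraic_int x}"
 by unfold_locales (auto intro: algebraic_int_diff_mult)

lemma algebraic_int_monic_root:
 fixes x :: "'a :: field_char_0"
 assumes h: "lead_coeff h = 1" "\<And>i. algebraic_int (coeff h i)" "poly h x = 0"
 shows "algebraic_int x"
proof (cases "degree h = 0")
 case True
 then obtain c where "h = [:c:]" by (auto elim: degree_eq_zeroE)
 thus ?thesis using h by auto
next
 case False
 define S where "S = (\<lambda>j. - coeff h j) ` {..<degree h}"
 obtain B where B: "finite B" "1 \<in> B" "\<And>s b. s \<in> S \<union> \<int> ==> b \<in> B ==> s * b \<in> int_span B"
 proof -
  have "finite S" "\<And>s. s \<in> S ==> algebraic_int s" using h(2) by (auto simp: S_def)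
  thus ?thesis using finite_int_span_stable_exists[of S] that by blast
 qed
 have r: "- coeff h j \<in> S \<union> \<int>" if "j < degree h" for j using that by (auto simp: S_def)
 define B' where "B' = (\<lambda>(b, j). b * x ^ j) ` (B \<times> {..<degree h})"
 have B': "finite B'" "B \<subseteq> B'" "\<And>s b. s \<in> insert x (S \<union> \<int>) ==> b \<in> B' ==> s * b \<in> int_span B'"
  unfolding B'_def using int_span_extend[where S = "S \<union> \<int>", OF B(1,3) _ r monic_root_power_eq[OF h(1,3)]] False by blast+
 show ?thesis by (rule algebraic_int_if_int_span_stable[OF B'(1), of 1]) (use B B' in auto)
qed

text \<open>The partial sums of a Horner scheme at a root.\<close>

lemma algebraic_int_horner:
 fixes u :: "'a :: field_char_0" and c :: "int poly"
 assumes root: "poly (map_poly of_int c) u = 0" and k: "k < degree c"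
 shows "algebraic_int (\<Sum>i\<le>k. of_int (coeff c (degree c - i)) * u ^ (k - i))"
proof -
 define n where "n = degree c"
 define s where "s = (\<Sum>i\<le>k. of_int (coeff c (n - i)) * u ^ (k - i))"
 define B where "B = (\<lambda>j. u ^ j) ` {..<n}"
 have kn: "k < n" using k by (simp add: n_def)
 have fin: "finite B" by (simp add: B_def)
 have pw: "of_int a * u ^ j \<in> int_span B" if "j < n" for a j
  using that by (intro int_span_scale int_span_base fin) (auto simp: B_def)
 have root': "(\<Sum>i\<le>n. of_int (coeff c i) * u ^ i) = 0" using root by (simp add: poly_altdef n_def)
 \<comment> \<open>The equation of \<open>u\<close> trades the high part of the sum for the low
   part. This keeps the products of \<open>s\<close> with high powers of \<open>u\<close> inside the
   span of \<open>B\<close>; for low powers the degree stays below \<open>n\<close> anyway.\<close>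
 have split: "u ^ (n - k) * s = - (\<Sum>i<n - k. of_int (coeff c i) * u ^ i)"
 proof -
  have "u ^ (n - k) * s = (\<Sum>i\<le>k. of_int (coeff c (n - i)) * u ^ (n - i))"
   unfolding s_def sum_distrib_left
  proof (rule sum.cong[OF refl])
   fix i assume "i \<in> {..k}"
   thus "u ^ (n - k) * (of_int (coeff c (n - i)) * u ^ (k - i)) = of_int (coeff c (n - i)) * u ^ (n - i)"
    using kn by (simp flip: power_add)
  qed
  also have "... = (\<Sum>i\<in>{n - k..n}. of_int (coeff c i) * u ^ i)"
   by (rule sum.reindex_bij_witness[of _ "\<lambda>i. n - i" "\<lambda>i. n - i"]) (use kn in auto)
  finally have "u ^ (n - k) * s = (\<Sum>i\<in>{n - k..n}. of_int (coeff c i) * u ^ i)" .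
  moreover have "{..n} = {..<n - k} \<union> {n - k..n}" by auto
  hence "(\<Sum>i\<le>n. of_int (coeff c i) * u ^ i) =
    (\<Sum>i<n - k. of_int (coeff c i) * u ^ i) + (\<Sum>i\<in>{n - k..n}. of_int (coeff c i) * u ^ i)"
   by (simp add: sum.union_disjoint ivl_disj_int)
  ultimately show ?thesis using root' by (simp add: add_eq_0_iff)
 qed
 have "s * b \<in> int_span B" if "b \<in> B" for b
 proof -
  obtain j where j: "j < n" "b = u ^ j" using \<open>b \<in> B\<close> by (auto simp: B_def)
  show ?thesis
  proof (cases "j < n - k")
   case True
   have "s * b = (\<Sum>i\<le>k. of_int (coeff c (n - i)) * u ^ (k - i + j))"
    unfolding s_def j(2) sum_distrib_right power_add mult.assoc ..
   also have "... \<in> int_span B" using True by (intro int_span_sum pw) auto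
   finally show ?thesis .
  next
   case False
   hence "s * b = u ^ (j - (n - k)) * (u ^ (n - k) * s)" unfolding j(2) by (simp flip: power_add)
   also have "... = (\<Sum>i<n - k. of_int (- coeff c i) * u ^ (i + (j - (n - k))))"
    unfolding split by (simp add: sum_negf sum_distrib_left power_add mult_ac del: diff_diff_right)
   also have "... \<in> int_span B" using False j(1) by (intro int_span_sum pw) auto
   finally show ?thesis .
  qed
 qed
 moreover have "1 \<in> B" using kn by (auto simp: B_def intro!: image_eqI[of _ _ 0])
 ultimately have "algebraic_int s" by (intro algebraic_int_if_int_span_stable[OF fin, of 1]) auto
 thus ?thesis by (simp add: s_def n_def)
qed

text \<open>The Horner sum for \<open>k = 1\<close> is integral and equals the leading coefficient
  times \<open>x\<close> plus an integer. A linear equation is treated apart, since the sum requires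
  \<open>k\<close> below the degree.\<close>

lemma algebraic_imp_int_multiple:
 fixes x :: "'a :: field_char_0"
 assumes "algebraic x"
 shows "\<exists>m. m \<noteq> 0 \<and> algebraic_int (of_int m * x)"
proof -
 obtain c where c: "poly (map_poly of_int c) x = 0" "c \<noteq> 0" using assms by (elim algebraicE')
 have "degree c > 0" using degree_pos_if_root[OF _ c(1)] c(2) by simp
 show ?thesis
 proof (cases "degree c = 1")
  case True
  hence "of_int (lead_coeff c) * x = - of_int (coeff c 0)"
   using c(1) by (simp add: poly_altdef eq_neg_iff_add_eq_0 add.commute)
  hence "algebraic_int (of_int (lead_coeff c) * x)" by simp
  moreover have "lead_coeff c \<noteq> 0" using c(2) by simp
  ultimately show ?thesis by blast
 next
  case False
  hence "algebraic_int (\<Sum>i\<le>1. of_int (coeff c (degree c - i)) * x ^ (1 - i))"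
   using c(1) \<open>degree c > 0\<close> by (intro algebraic_int_horner) auto
  hence "algebraic_int ((of_int (lead_coeff c) * x + of_int (coeff c (degree c - 1))) - of_int (coeff c (degree c - 1)))"
   by (intro algebraic_int_diff_mult) auto
  hence "algebraic_int (of_int (lead_coeff c) * x)" by simp
  moreover have "lead_coeff c \<noteq> 0" using c(2) by simp
  ultimately show ?thesis by blast
 qed
qed

lemma int_multiple_imp_algebraic:
 fixes x :: "'a :: field_char_0"
 assumes "m \<noteq> 0" "algebraic_int (of_int m * x)"
 shows "algebraic x"
proof -
 have "algebraic (of_int m * x)" using assms(2) by (rule algebraic_int_imp_algebraic)
 then obtain h where h: "\<And>i. coeff h i \<in> \<int>" "h \<noteq> 0" "poly h (of_int m * x) = 0" by (auto simp: algebraic_def)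
 show ?thesis
 proof (rule algebraicI)
  show "coeff (pcompose h [:0, of_int m:]) i \<in> \<int>" for i using h(1) by (simp add: coeff_pcompose_linear)
  show "pcompose h [:0, of_int m:] \<noteq> 0" using h(2) assms(1) by (simp add: pcompose_eq_0_iff)
  show "poly (pcompose h [:0, of_int m:]) x = 0" using h(3) by (simp add: poly_pcompose mult.commute)
 qed
qed

lemma closed_subfield_algebraic: "closed_subfield {x :: 'a :: field_char_0. algebraic x}"
proof
 fix x y :: 'a assume "x \<in> {x. algebraic x}" "y \<in> {x. algebraic x}"
 then obtain a b where ab: "a \<noteq> 0" "algebraic_int (of_int a * x)" "b \<noteq> 0" "algebraic_int (of_int b * y)"
  using algebraic_imp_int_multiple[of x] algebraic_imp_int_multiple[of y] by auto
 have "algebraic_int (of_int b * (of_int a * x) - of_int a * (of_int b * y))"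
  by (intro algebraic_int_diff_mult(1) algebraic_int_diff_mult(2)[OF algebraic_int_of_int] ab)
 hence "algebraic_int (of_int (a * b) * (x - y))" by (simp add: algebra_simps)
 thus "x - y \<in> {x. algebraic x}" using int_multiple_imp_algebraic[of "a * b"] ab by auto
 have "algebraic_int ((of_int a * x) * (of_int b * y))"
  by (rule algebraic_int_diff_mult(2)[OF ab(2,4)])
 hence "algebraic_int (of_int (a * b) * (x * y))" by (simp add: algebra_simps)
 thus "x * y \<in> {x. algebraic x}" using int_multiple_imp_algebraic[of "a * b"] ab by auto
qed auto

text \<open>Make the polynomial monic, let the integer \<open>M\<close> clear the denominators of
  its coefficients, and rescale the variable: \<open>M * x\<close> is a root of the monic polynomial
  \<open>k\<close>, whose coefficients are integral.\<close>

lemma algebraic_root_of_algebraic_poly: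
 fixes x :: "'a :: field_char_0"
 assumes "\<And>i. algebraic (coeff h i)" "h \<noteq> 0" "poly h x = 0"
 shows "algebraic x"
proof -
 interpret A: closed_subfield "{x :: 'a. algebraic x}" by (rule closed_subfield_algebraic)
 define n where "n = degree h"
 define g where "g = smult (inverse (lead_coeff h)) h"
 have g: "lead_coeff g = 1" "poly g x = 0" "degree g = n" using assms by (auto simp: g_def n_def)
 have galg: "algebraic (coeff g i)" for i
  using A.mult_mem[of "inverse (lead_coeff h)" "coeff h i"] A.inverse_mem[of "lead_coeff h"] assms(1)
  by (simp add: g_def)
 have "\<forall>i. \<exists>m. m \<noteq> 0 \<and> algebraic_int (of_int m * coeff g i)" using algebraic_imp_int_multiple galg by blast
 then obtain m :: "nat => int" where m: "\<And>i. m i \<noteq> 0" "\<And>i. algebraic_int (of_int (m i) * coeff g i)" by metis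
 define M where "M = (\<Prod>i\<le>n. m i)"
 have M0: "M \<noteq> 0" using m(1) by (simp add: M_def)
 have Mint: "algebraic_int (of_int M * coeff g i)" for i
 proof (cases "i \<le> n")
  case True
  hence "of_int M * coeff g i = of_int (\<Prod>j\<in>{..n} - {i}. m j) * (of_int (m i) * coeff g i)" by (simp add: M_def prod.remove[of _ i])
  thus ?thesis by (simp only: algebraic_int_diff_mult(2)[OF algebraic_int_of_int m(2)])
 qed (simp add: coeff_eq_0 g(3))
 define k where "k = (\<Sum>i\<le>n. monom (of_int M ^ (n - i) * coeff g i) i)"
 have ck: "coeff k i = of_int M ^ (n - i) * coeff g i" for i
  using coeff_eq_0[of g i] by (auto simp: k_def coeff_sum g(3) if_distrib cong: if_cong)
 have dk: "degree k = n"
 proof (rule antisym)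
  show "degree k \<le> n" by (rule degree_le) (simp add: ck coeff_eq_0 g(3))
  show "n \<le> degree k" by (rule le_degree) (use g in \<open>simp add: ck\<close>)
 qed
 have "algebraic_int (of_int M * x)"
 proof (rule algebraic_int_monic_root)
  show "lead_coeff k = 1" using g by (simp add: dk ck)
  show "algebraic_int (coeff k i)" for i
  proof (cases "i < n")
   case True
   hence "of_int M ^ (n - i) * coeff g i = of_int (M ^ (n - i - 1)) * (of_int M * coeff g i)"
    by (cases "n - i") auto
   thus ?thesis by (simp only: ck algebraic_int_diff_mult(2)[OF algebraic_int_of_int Mint])
  next
   case False
   thus ?thesis using g coeff_eq_0[of g i] by (cases "i = n") (auto simp: ck)
  qed
  have "poly k (of_int M * x) = (\<Sum>i\<le>n. of_int M ^ (n - i) * coeff g i * (of_int M * x) ^ i)"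
   by (simp add: poly_altdef dk ck)
  also have "... = (\<Sum>i\<le>n. of_int M ^ n * (coeff g i * x ^ i))"
  proof (rule sum.cong[OF refl])
   fix i assume "i \<in> {..n}"
   hence "of_int M ^ n = (of_int M ^ (n - i) * of_int M ^ i :: 'a)" by (simp flip: power_add)
   thus "of_int M ^ (n - i) * coeff g i * (of_int M * x) ^ i = of_int M ^ n * (coeff g i * x ^ i)"
    by (simp add: power_mult_distrib)
  qed
  also have "... = of_int M ^ n * poly g x" by (simp add: poly_altdef g(3) sum_distrib_left)
  finally show "poly k (of_int M * x) = 0" by (simp add: g(2))
 qed
 thus ?thesis using M0 by (rule int_multiple_imp_algebraic[rotated])
qed

lemma algebraic_root_over_subring:
 fixes S :: "'b :: field_char_0 set"
 assumes S: "closed_subring S" and x: "algebraic x"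
 shows "\<exists>h\<in>polys S. h \<noteq> 0 \<and> poly h x = 0"
proof -
 obtain c where "poly (map_poly of_int c) x = 0" "c \<noteq> 0" using x by (elim algebraicE')
 moreover have "map_poly of_int c \<in> polys S" using closed_subring.of_int_mem[OF S] by (simp add: polys_def coeff_map_poly)
 ultimately show ?thesis by (intro bexI[of _ "map_poly of_int c"]) auto
qed

section \<open>Valuations at primes above \<open>p\<close>\<close>

text \<open>\<open>Q\<close> is a prime ideal above \<open>p\<close> of the ring of all algebraic
  integers of \<open>'k\<close>. Primes of subfields are its traces, so a valuation never has to be
  extended from one field to another.\<close>

locale alg_prime =
 fixes Q :: "'k :: field_char_0 set" and p :: nat
 assumes prime_p: "Factorial_Ring.prime p"
  and integral: "x \<in> Q ==> algebraic_int x"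
  and p_mem: "of_nat p \<in> Q"
  and diff: "x \<in> Q ==> y \<in> Q ==> x - y \<in> Q"
  and absorb: "algebraic_int a ==> x \<in> Q ==> a * x \<in> Q"
  and prime_ideal: "algebraic_int a ==> algebraic_int b ==> a * b \<in> Q ==> a \<in> Q \<or> b \<in> Q"
  and one_notin: "1 \<notin> Q"
begin

sublocale AI: closed_subring "{x :: 'k. algebraic_int x}" by (rule closed_subring_algebraic_int)
sublocale AL: closed_subfield "{x :: 'k. algebraic x}" by (rule closed_subfield_algebraic)

lemmas ai = AI.mem_intros[unfolded mem_Collect_eq]
lemmas al = AL.mem_intros[unfolded mem_Collect_eq] AL.inverse_mem[unfolded mem_Collect_eq] AL.divide_mem[unfolded mem_Collect_eq]

lemma zero: "0 \<in> Q" using diff[OF p_mem p_mem] by simp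
lemma uminus: "x \<in> Q ==> - x \<in> Q" using diff[OF zero] by simp
lemma add: "x \<in> Q ==> y \<in> Q ==> x + y \<in> Q" using diff[of x "- y"] uminus by simp

lemma absorb_right: "x \<in> Q ==> algebraic_int a ==> x * a \<in> Q"
 using absorb[of a x] by (simp add: mult.commute)

lemma sum: "(\<And>i. i \<in> I ==> f i \<in> Q) ==> sum f I \<in> Q"
 by (induction I rule: infinite_finite_induct) (auto intro: zero add)

lemma power_mem_iff: "algebraic_int x ==> n > 0 ==> x ^ n \<in> Q \<longleftrightarrow> x \<in> Q"
proof (induction n)
 case (Suc n)
 show ?case
 proof
  assume "x ^ Suc n \<in> Q"
  thus "x \<in> Q" using prime_ideal[of x "x ^ n"] ai Suc one_notin by (cases "n = 0") auto
 qed (use absorb_right[of x "x ^ n"] ai Suc.prems in auto)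
qed simp

lemma of_int_mem_iff: "of_int c \<in> Q \<longleftrightarrow> int p dvd c"
proof
 assume "int p dvd c"
 then obtain e where "c = int p * e" by auto
 thus "of_int c \<in> Q" using absorb_right[OF p_mem, of "of_int e"] by simp
next
 assume c: "of_int c \<in> Q"
 show "int p dvd c"
 proof (rule ccontr)
  assume "\<not> int p dvd c"
  hence "coprime (int p) c" using prime_p by (intro prime_imp_coprime) auto
  then obtain u v where uv: "u * int p + v * c = 1" using bezout_int[of "int p" c] by auto
  have "of_int u * of_nat p + of_int v * of_int c \<in> Q" by (intro add absorb p_mem c) auto
  also have "of_int u * of_nat p + of_int v * of_int c = (of_int (u * int p + v * c) :: 'k)" by simp
  finally show False using one_notin by (simp add: uv)
 qed
qed

section \<open>Localisation at \<open>Q\<close>\<close>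

definition vring :: "'k set" ("\<O>")
 where "vring = {a / s | a s. algebraic_int a \<and> algebraic_int s \<and> s \<notin> Q}"

definition vmax :: "'k set" ("\<M>")
 where "vmax = {a / s | a s. a \<in> Q \<and> algebraic_int s \<and> s \<notin> Q}"

lemma nz_if_notin: "s \<notin> Q ==> s \<noteq> 0" using zero by auto

lemma notin_mult: "s \<notin> Q ==> t \<notin> Q ==> algebraic_int s ==> algebraic_int t ==> s * t \<notin> Q"
 using prime_ideal by blast

lemma vringI: "algebraic_int a ==> algebraic_int s ==> s \<notin> Q ==> a / s \<in> \<O>"
 by (auto simp: vring_def)

lemma vmaxI: "a \<in> Q ==> algebraic_int s ==> s \<notin> Q ==> a / s \<in> \<M>"
 by (auto simp: vmax_def)

lemma integral_vring: "algebraic_int a ==> a \<in> \<O>"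
 using vringI[of a 1] one_notin by simp

sublocale VR: closed_subring \<O>
proof
 show "1 \<in> \<O>" by (rule integral_vring) simp
next
 fix x y assume "x \<in> \<O>" "y \<in> \<O>"
 then obtain a s b t where x: "x = a / s" "algebraic_int a" "algebraic_int s" "s \<notin> Q"
  and y: "y = b / t" "algebraic_int b" "algebraic_int t" "t \<notin> Q" by (auto simp: vring_def)
 have "x - y = (a * t - b * s) / (s * t)" "x * y = (a * b) / (s * t)"
  using nz_if_notin x y by (auto simp: diff_frac_eq)
 thus "x - y \<in> \<O>" "x * y \<in> \<O>"
  using x y notin_mult[OF x(4) y(4) x(3) y(3)] by (auto simp only: intro!: vringI ai)
qed

lemma vmax_subset: "x \<in> \<M> ==> x \<in> \<O>"
 using integral by (auto simp: vmax_def vring_def)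

lemma vmax_diff: "x \<in> \<M> ==> y \<in> \<M> ==> x - y \<in> \<M>"
proof -
 assume "x \<in> \<M>" "y \<in> \<M>"
 then obtain a s b t where x: "x = a / s" "a \<in> Q" "algebraic_int s" "s \<notin> Q"
  and y: "y = b / t" "b \<in> Q" "algebraic_int t" "t \<notin> Q" by (auto simp: vmax_def)
 have "x - y = (a * t - b * s) / (s * t)" using nz_if_notin x y by (auto simp: diff_frac_eq)
 thus "x - y \<in> \<M>"
  by (simp only:) (intro vmaxI diff absorb_right notin_mult[OF x(4) y(4) x(3) y(3)] ai x(2,3) y(2,3))
qed

lemma vmax_0: "0 \<in> \<M>" using vmaxI[of 0 1] zero one_notin by simp

lemma vmax_add: "x \<in> \<M> ==> y \<in> \<M> ==> x + y \<in> \<M>"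
 using vmax_diff[of x "0 - y"] vmax_diff[OF vmax_0, of y] by simp

lemma vmax_sum: "(\<And>i. i \<in> I ==> f i \<in> \<M>) ==> sum f I \<in> \<M>"
 by (induction I rule: infinite_finite_induct) (auto intro: vmax_0 vmax_add)

lemma vmax_mult: "x \<in> \<O> ==> y \<in> \<M> ==> x * y \<in> \<M>"
proof -
 assume "x \<in> \<O>" "y \<in> \<M>"
 then obtain a s b t where x: "x = a / s" "algebraic_int a" "algebraic_int s" "s \<notin> Q"
  and y: "y = b / t" "b \<in> Q" "algebraic_int t" "t \<notin> Q" by (auto simp: vmax_def vring_def)
 have "x * y = (a * b) / (s * t)" using x y by auto
 thus "x * y \<in> \<M>"
  by (simp only:) (intro vmaxI absorb notin_mult[OF x(4) y(4) x(3) y(3)] ai x(2,3) y(2,3))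
qed

lemma vmax_mult_right: "y \<in> \<M> ==> x \<in> \<O> ==> y * x \<in> \<M>"
 using vmax_mult[of x y] by (simp add: mult.commute)

lemma vmax_integral_iff: "algebraic_int x ==> x \<in> \<M> \<longleftrightarrow> x \<in> Q"
proof
 assume x: "algebraic_int x" "x \<in> \<M>"
 then obtain a s where a: "x = a / s" "a \<in> Q" "algebraic_int s" "s \<notin> Q" by (auto simp: vmax_def)
 thus "x \<in> Q" using nz_if_notin[OF a(4)] prime_ideal[OF x(1) a(3)] a(4) by simp
qed (use vmaxI[of x 1] one_notin in auto)

lemma one_notin_vmax: "1 \<notin> \<M>" using vmax_integral_iff[of 1] one_notin by simp

lemma inverse_mem_vring: "x \<in> \<O> ==> x \<notin> \<M> ==> inverse x \<in> \<O>"
proof -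
 assume x: "x \<in> \<O>" "x \<notin> \<M>"
 obtain a s where a: "x = a / s" "algebraic_int a" "algebraic_int s" "s \<notin> Q"
  using x(1) by (auto simp: vring_def)
 thus ?thesis using x(2) vmaxI[of a s] vringI[of s a] a by auto
qed

lemma inverse_notin_vring: "x \<in> \<M> ==> x \<noteq> 0 ==> inverse x \<notin> \<O>"
 using vmax_mult[of "inverse x" x] one_notin_vmax by auto

lemma inverse_mem_vmax: "inverse x \<in> \<O> ==> x \<notin> \<O> ==> inverse x \<in> \<M>"
 using inverse_mem_vring[of "inverse x"] by auto

text \<open>Take a primitive integer equation of \<open>u\<close> and its Horner sums
  \<open>s k\<close>. All \<open>s k\<close> and \<open>u * s k\<close> are integral, and each
  coefficient is a difference of two of them; if all were in \<open>Q\<close>, then \<open>p\<close>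
  would divide every coefficient. That \<open>s\<close> lies in each subring containing
  \<open>u\<close> will provide denominators inside \<open>F\<close>.\<close>

lemma denominator_exists:
 assumes "algebraic u"
 shows "\<exists>s. (\<forall>R. closed_subring R --> u \<in> R --> s \<in> R) \<and> algebraic_int s \<and> algebraic_int (u * s) \<and>
  (s \<notin> Q \<or> u * s \<notin> Q)"
proof -
 obtain c0 where c0: "poly (map_poly of_int c0) u = 0" "c0 \<noteq> 0" using assms by (elim algebraicE')
 define c where "c = primitive_part c0"
 have "map_poly of_int c0 = smult (of_int (Polynomial.content c0)) (map_poly (of_int :: int => 'k) c)"
  by (metis c_def content_times_primitive_part of_int_hom.map_poly_hom_smult)
 hence root: "poly (map_poly of_int c) u = 0" using c0 by simp
 have cnz: "c \<noteq> 0" using c0(2) by (simp add: c_def)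
 define n where "n = degree c"
 have n: "n > 0" using degree_pos_if_root[OF _ root] cnz by (simp add: n_def)
 obtain i where i: "\<not> int p dvd coeff c i"
 proof (rule ccontr)
  assume "\<not> thesis"
  hence "\<And>i. int p dvd coeff c i" using that by blast
  hence "[:int p:] dvd c" by (simp add: const_poly_dvd_iff)
  hence "int p dvd Polynomial.content c" by (simp add: const_poly_dvd_iff_dvd_content)
  hence "int p dvd 1" using c0(2) by (simp add: c_def)
  thus False using prime_p prime_gt_1_nat[of p] by simp
 qed
 have "i \<le> n" using i coeff_eq_0[of c i] by (force simp: n_def)
 define s where "s k = (\<Sum>i\<le>k. of_int (coeff c (n - i)) * u ^ (k - i))" for k
 have s_Suc: "s (Suc k) = u * s k + of_int (coeff c (n - Suc k))" for k
  unfolding s_def by (simp add: sum_distrib_left mult_ac Suc_diff_le)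
 have s_int: "algebraic_int (s k)" if "k < n" for k
  using algebraic_int_horner[OF root, of k] that by (simp add: s_def n_def)
 have sn: "s n = 0"
 proof -
  have "s n = (\<Sum>i\<le>n. of_int (coeff c i) * u ^ i)"
   unfolding s_def by (rule sum.reindex_bij_witness[of _ "\<lambda>i. n - i" "\<lambda>i. n - i"]) auto
  thus ?thesis using root by (simp add: poly_altdef n_def)
 qed
 have us_int: "algebraic_int (u * s k)" if "k < n" for k
 proof -
  have "algebraic_int (s (Suc k))" using that s_int sn by (cases "Suc k = n") auto
  hence "algebraic_int (s (Suc k) - of_int (coeff c (n - Suc k)))" by (intro ai) auto
  thus ?thesis by (simp add: s_Suc)
 qed
 have "\<exists>k<n. s k \<notin> Q \<or> u * s k \<notin> Q"
 proof (rule ccontr)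
  assume *: "\<not> (\<exists>k<n. s k \<notin> Q \<or> u * s k \<notin> Q)"
  have "of_int (coeff c (n - k)) \<in> Q" if "k \<le> n" for k
  proof (cases k)
   case 0
   thus ?thesis using *[simplified, rule_format, of 0] n by (simp add: s_def)
  next
   case (Suc l)
   hence "u * s l \<in> Q" using * that by simp
   moreover have "s k \<in> Q" using * that sn zero by (cases "k = n") auto
   moreover have "of_int (coeff c (n - k)) = s k - u * s l" by (simp add: Suc s_Suc)
   ultimately show ?thesis by (simp only: diff)
  qed
  from this[of "n - i"] show False using i \<open>i \<le> n\<close> by (simp add: of_int_mem_iff)
 qed
 then obtain k where k: "k < n" "s k \<notin> Q \<or> u * s k \<notin> Q" by blast
 have "s k \<in> R" if "closed_subring R" "u \<in> R" for R
 proof -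
  interpret closed_subring R by fact
  show ?thesis unfolding s_def by (intro mem_intros that)
 qed
 thus ?thesis by (intro exI[of _ "s k"] conjI allI impI s_int us_int k)
qed

lemma vring_or_inverse:
 assumes "algebraic u"
 shows "u \<in> \<O> \<or> inverse u \<in> \<O>"
proof -
 obtain s where s: "algebraic_int s" "algebraic_int (u * s)" "s \<notin> Q \<or> u * s \<notin> Q"
  using denominator_exists[OF assms] by (elim exE conjE) (rule that)
 have snz: "s \<noteq> 0" using s(3) zero by auto
 show ?thesis using s(3)
 proof
  assume "s \<notin> Q"
  hence "u * s / s \<in> \<O>" by (intro vringI s)
  thus ?thesis using snz by simp
 next
  assume "u * s \<notin> Q"
  hence "s / (u * s) \<in> \<O>" by (intro vringI s)
  thus ?thesis using snz by (cases "u = 0") (simp_all add: field_simps)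
 qed
qed

lemma vring_denominator:
 assumes u: "u \<in> \<O>" "algebraic u" and R: "closed_subring R" "u \<in> R"
 shows "\<exists>s\<in>R. algebraic_int s \<and> s \<notin> Q \<and> algebraic_int (u * s)"
proof -
 obtain s where s: "s \<in> R" "algebraic_int s" "algebraic_int (u * s)" "s \<notin> Q \<or> u * s \<notin> Q"
  using denominator_exists[OF u(2)] R by blast
 have "s \<notin> Q"
 proof
  assume "s \<in> Q"
  thus False using vmax_mult[OF u(1)] vmax_integral_iff[OF s(2)] s vmax_integral_iff by blast
 qed
 thus ?thesis using s by blast
qed

lemma vring_or_inverse_vmax: "algebraic u ==> u \<notin> \<O> ==> inverse u \<in> \<M>"
 using vring_or_inverse[of u] inverse_mem_vmax by blast

definition vunit :: "'k => bool"
 where "vunit x \<longleftrightarrow> x \<in> \<O> \<and> x \<notin> \<M>"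

lemma vunit_nz: "vunit x ==> x \<noteq> 0" using vmax_0 by (auto simp: vunit_def)

lemma vunit_1: "vunit 1" using one_notin_vmax VR.one_mem by (simp add: vunit_def)

lemma vunit_inverse: "vunit x ==> vunit (inverse x)"
 using inverse_mem_vring[of x] inverse_notin_vring[of "inverse x"] vunit_nz[of x] by (auto simp: vunit_def)

lemma vunit_mult: "vunit x ==> vunit y ==> vunit (x * y)"
proof -
 assume x: "vunit x" and y: "vunit y"
 have "x * y \<notin> \<M>"
 proof
  assume "x * y \<in> \<M>"
  moreover have "inverse x \<in> \<O>" using vunit_inverse[OF x] by (simp add: vunit_def)
  ultimately have "inverse x * (x * y) \<in> \<M>" using vmax_mult by blast
  thus False using y vunit_nz[OF x] by (simp add: vunit_def mult.assoc[symmetric])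
 qed
 thus ?thesis using x y VR.mult_mem by (simp add: vunit_def)
qed

lemma vunit_power: "vunit x ==> vunit (x ^ n)"
 by (induction n) (auto intro: vunit_1 vunit_mult)

lemma p_nz: "(of_nat p :: 'k) \<noteq> 0" using prime_p by auto

lemma p_vmax: "of_nat p \<in> \<M>" by (simp add: vmax_integral_iff p_mem)

lemma vunit_p_powi: "vunit (of_nat p powi j) \<longleftrightarrow> j = 0"
proof
 assume u: "vunit (of_nat p powi j)"
 have pos: "of_nat p ^ n \<in> \<M>" if "n > 0" for n
  using that p_vmax vmax_mult_right[OF p_vmax, of "of_nat p ^ (n - 1)"] VR.power_mem[OF vmax_subset[OF p_vmax]]
  by (cases n) auto
 show "j = 0"
 proof (rule ccontr)
  assume "j \<noteq> 0"
  then consider "j > 0" | "- j > 0" by linarith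
  thus False
  proof cases
   case 1
   thus ?thesis using u pos[of "nat j"] by (simp add: vunit_def power_int_def)
  next
   case 2
   have "vunit (of_nat p powi (- j))" using vunit_inverse[OF u] by (simp add: power_int_minus)
   thus ?thesis using 2 pos[of "nat (- j)"] by (simp add: vunit_def power_int_def)
  qed
 qed
qed (simp add: vunit_1)

text \<open>Otherwise the largest term would dominate.\<close>

lemma sum_eq_0_imp_vunit_quotient:
 assumes I: "finite I" and t: "\<And>i. i \<in> I ==> algebraic (t i)" and sum: "sum t I = 0"
  and nz: "i0 \<in> I" "t i0 \<noteq> 0"
 shows "\<exists>i\<in>I. \<exists>j\<in>I. i \<noteq> j \<and> t i \<noteq> 0 \<and> t j \<noteq> 0 \<and> vunit (t i / t j)"
proof -
 define J where "J = {i\<in>I. t i \<noteq> 0}"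
 have J: "finite J" "i0 \<in> J" "\<And>i. i \<in> J ==> algebraic (t i) \<and> t i \<noteq> 0" using I t nz by (auto simp: J_def)
 have "\<exists>m\<in>S. \<forall>x\<in>S. t x / t m \<in> \<O>" if "finite S" "S \<noteq> {}" "S \<subseteq> J" for S using that
 proof (induction S rule: finite_ne_induct)
  case (singleton x)
  thus ?case using J(3)[of x] VR.one_mem by simp
 next
  case (insert y S)
  then obtain m where m: "m \<in> S" "\<And>x. x \<in> S ==> t x / t m \<in> \<O>" by auto
  have ym: "algebraic (t y)" "t y \<noteq> 0" "algebraic (t m)" "t m \<noteq> 0" using J(3) insert.prems m(1) by auto
  show ?case
  proof (cases "t y / t m \<in> \<O>")
   case True
   thus ?thesis using m by auto
  next
   case False
   moreover have "algebraic (t y / t m)" by (intro al ym)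
   ultimately have *: "t m / t y \<in> \<O>" using vring_or_inverse[of "t y / t m"] by simp
   have "t x / t y \<in> \<O>" if "x \<in> S" for x using VR.mult_mem[OF m(2)[OF that] *] ym by simp
   thus ?thesis using ym VR.one_mem by (intro bexI[of _ y]) auto
  qed
 qed
 from this[of J] obtain m where m: "m \<in> J" "\<And>x. x \<in> J ==> t x / t m \<in> \<O>" using J(1,2) by blast
 have mnz: "t m \<noteq> 0" using J(3) m(1) by blast
 show ?thesis
 proof (rule ccontr)
  assume *: "\<not> ?thesis"
  have "t i / t m \<in> \<M>" if "i \<in> I - {m}" for i
  proof (cases "t i = 0")
   case False
   hence "i \<in> J" using that by (simp add: J_def)
   moreover have "\<not> vunit (t i / t m)" using * that False mnz m(1) by (auto simp: J_def)
   ultimately show ?thesis using m(2) by (simp add: vunit_def)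
  qed (simp add: vmax_0)
  hence "(\<Sum>i\<in>I - {m}. t i / t m) \<in> \<M>" by (rule vmax_sum)
  moreover have "(\<Sum>i\<in>I - {m}. t i / t m) = - 1"
  proof -
   have "t m + sum t (I - {m}) = 0" using sum sum.remove[OF I, of m t] m(1) by (simp add: J_def)
   hence "sum t (I - {m}) = - t m" by (simp add: eq_neg_iff_add_eq_0 add.commute)
   thus ?thesis using mnz by (simp add: sum_divide_distrib[symmetric])
  qed
  ultimately show False using vmax_diff[OF vmax_0, of "- 1"] one_notin_vmax by simp
 qed
qed

text \<open>The Newton polygon argument, phrased with units before a valuation is available: two
  terms of the vanishing sum have equal size, and \<open>i\<close> is the difference of their
  exponents.\<close>

lemma root_imp_vunit_power:
 assumes K: "\<And>a. a \<in> K ==> algebraic a" and x: "algebraic x" "x \<noteq> 0"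
  and h: "h \<in> polys K" "h \<noteq> 0" "poly h x = 0"
 shows "\<exists>i a b. 1 \<le> i \<and> i \<le> degree h \<and> a \<in> K \<and> b \<in> K \<and> a \<noteq> 0 \<and> b \<noteq> 0 \<and> vunit (x ^ i * a / b)"
proof -
 let ?t = "\<lambda>i. coeff h i * x ^ i"
 have ex: "\<exists>i\<in>{..degree h}. \<exists>j\<in>{..degree h}. i \<noteq> j \<and> ?t i \<noteq> 0 \<and> ?t j \<noteq> 0 \<and> vunit (?t i / ?t j)"
 proof (rule sum_eq_0_imp_vunit_quotient)
  show "algebraic (?t i)" for i using K polysD[OF h(1)] x by (intro al) auto
  show "sum ?t {..degree h} = 0" using h(3) by (simp add: poly_altdef)
  show "?t (degree h) \<noteq> 0" using h(2) x by simp
 qed auto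
 have main: ?thesis if ij: "i \<le> degree h" "j < i" "?t i \<noteq> 0" "?t j \<noteq> 0" "vunit (?t i / ?t j)" for i j
 proof -
  have "x ^ i = x ^ (i - j) * x ^ j" using ij(2) by (simp flip: power_add)
  hence "?t i / ?t j = x ^ (i - j) * coeff h i / coeff h j" using x(2) by simp
  thus ?thesis using ij polysD[OF h(1)]
   by (intro exI[of _ "i - j"] exI[of _ "coeff h i"] exI[of _ "coeff h j"]) auto
 qed
 from ex obtain i j where ij: "i \<le> degree h" "j \<le> degree h" "i \<noteq> j" "?t i \<noteq> 0" "?t j \<noteq> 0" "vunit (?t i / ?t j)" by auto
 then consider "j < i" | "i < j" by linarith
 thus ?thesis
 proof cases
  case 2
  show ?thesis using vunit_inverse[OF ij(6)] main[of j i] ij 2 by simp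
 qed (use main ij in blast)
qed

section \<open>The valuation with \<open>v p = 1\<close>\<close>

lemma of_int_eq_p_powi_unit:
 assumes "c \<noteq> 0"
 shows "\<exists>j u. vunit u \<and> of_int c = of_nat p powi j * u"
proof -
 have "\<not> is_unit (int p)" using prime_p prime_gt_1_nat[of p] by simp
 then obtain k e where k: "c = int p ^ k * e" "\<not> int p dvd e"
  using multiplicity_decompose'[of c "int p"] assms by metis
 have "vunit (of_int e)" using k(2) of_int_mem_iff[of e] vmax_integral_iff[of "of_int e"] integral_vring[of "of_int e"]
  by (simp add: vunit_def)
 moreover have "(of_int c :: 'k) = of_nat p powi int k * of_int e" by (simp add: k(1))
 ultimately show ?thesis by blast
qed

text \<open>Values are rational because some power of \<open>x\<close> is a power of
  \<open>p\<close> up to a unit; so \<open>v\<close> can be real-valued without constructing a value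
  group.\<close>

definition has_val :: "'k => real => bool"
 where "has_val x r \<longleftrightarrow> (\<exists>k>0. \<exists>j u. r = real_of_int j / real k \<and> vunit u \<and> x ^ k = of_nat p powi j * u)"

lemma has_val_unique:
 assumes "has_val x r" "has_val x s"
 shows "r = s"
proof -
 obtain k j u where r: "k > 0" "r = real_of_int j / real k" "vunit u" "x ^ k = of_nat p powi j * u"
  using assms(1) by (auto simp: has_val_def)
 obtain l i w where s: "l > 0" "s = real_of_int i / real l" "vunit w" "x ^ l = of_nat p powi i * w"
  using assms(2) by (auto simp: has_val_def)
 have "x ^ (k * l) = of_nat p powi (j * int l) * u ^ l"
  by (simp add: power_mult r(4) power_mult_distrib power_int_mult)
 moreover have "x ^ (l * k) = of_nat p powi (i * int k) * w ^ k"
  by (simp add: power_mult s(4) power_mult_distrib power_int_mult)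
 ultimately have "of_nat p powi (j * int l - i * int k) = w ^ k * inverse (u ^ l)"
  using p_nz vunit_nz[OF r(3)] by (simp add: power_int_diff field_simps)
 moreover have "vunit (w ^ k * inverse (u ^ l))" by (intro vunit_mult vunit_power vunit_inverse r s)
 ultimately have "j * int l - i * int k = 0" by (simp only: vunit_p_powi[symmetric])
 hence "real_of_int j * real l = real_of_int i * real k"
  by (metis eq_iff_diff_eq_0 of_int_mult of_int_of_nat_eq)
 thus ?thesis using r(1) s(1) unfolding r(2) s(2) by (simp add: frac_eq_eq)
qed

lemma has_val_exists:
 assumes x: "algebraic x" "x \<noteq> 0"
 shows "\<exists>r. has_val x r"
proof -
 have Z: "closed_subring (\<int> :: 'k set)" by unfold_locales auto
 obtain h where h: "h \<in> polys \<int>" "h \<noteq> 0" "poly h x = 0" using algebraic_root_over_subring[OF Z x(1)] by blast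
 have "\<exists>i a b. 1 \<le> i \<and> i \<le> degree h \<and> a \<in> \<int> \<and> b \<in> \<int> \<and> a \<noteq> 0 \<and> b \<noteq> 0 \<and> vunit (x ^ i * a / b)"
  by (rule root_imp_vunit_power[OF _ x h]) (auto elim: Ints_cases)
 then obtain i a b where i: "1 \<le> i" "a \<noteq> 0" "b \<noteq> 0" "vunit (x ^ i * of_int a / of_int b)"
  by (auto elim!: Ints_cases)
 obtain j u where u: "vunit u" "of_int a = of_nat p powi j * u" using of_int_eq_p_powi_unit[OF i(2)] by blast
 obtain l w where w: "vunit w" "of_int b = of_nat p powi l * w" using of_int_eq_p_powi_unit[OF i(3)] by blast
 define y where "y = x ^ i * of_int a / of_int b"
 have "x ^ i = y * of_int b / of_int a" using i by (simp add: y_def)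
 also have "... = of_nat p powi (l - j) * (y * w * inverse u)"
  using p_nz vunit_nz[OF u(1)] by (simp add: u w power_int_diff field_simps)
 finally have "x ^ i = of_nat p powi (l - j) * (y * w * inverse u)" .
 moreover have "vunit (y * w * inverse u)" using i(4) by (intro vunit_mult vunit_inverse u w) (simp add: y_def)
 ultimately show ?thesis using i(1) unfolding has_val_def
  by (intro exI[of _ "real_of_int (l - j) / real i"] exI[of _ i] conjI exI[of _ "l - j"] exI[of _ "y * w * inverse u"]) auto
qed

definition v :: "'k => real"
 where "v x = (THE r. has_val x r)"

lemma v_eqI: "has_val x r ==> v x = r"
 unfolding v_def using has_val_unique by blast

lemma has_val_v: "algebraic x ==> x \<noteq> 0 ==> has_val x (v x)"
 using has_val_exists[of x] v_eqI by auto

lemma v_unit: "vunit u ==> v u = 0"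
 by (rule v_eqI, unfold has_val_def, rule exI[of _ 1]) (auto intro!: exI[of _ 0])

lemma v_p: "v (of_nat p) = 1"
 by (rule v_eqI, unfold has_val_def, rule exI[of _ 1]) (auto intro!: exI[of _ 1] vunit_1)

lemma v_mult:
 assumes "algebraic x" "x \<noteq> 0" "algebraic y" "y \<noteq> 0"
 shows "v (x * y) = v x + v y"
proof -
 obtain k j u where r: "k > 0" "v x = real_of_int j / real k" "vunit u" "x ^ k = of_nat p powi j * u"
  using has_val_v[OF assms(1,2)] by (auto simp: has_val_def)
 obtain l i w where s: "l > 0" "v y = real_of_int i / real l" "vunit w" "y ^ l = of_nat p powi i * w"
  using has_val_v[OF assms(3,4)] by (auto simp: has_val_def)
 have 1: "x ^ (k * l) = of_nat p powi (j * int l) * u ^ l"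
  by (simp add: power_mult r(4) power_mult_distrib power_int_mult)
 have "y ^ (l * k) = of_nat p powi (i * int k) * w ^ k"
  by (simp add: power_mult s(4) power_mult_distrib power_int_mult)
 hence "(x * y) ^ (k * l) = of_nat p powi (j * int l + i * int k) * (u ^ l * w ^ k)"
  using 1 p_nz by (simp add: power_mult_distrib power_int_add mult.commute[of l k])
 hence "has_val (x * y) (real_of_int (j * int l + i * int k) / real (k * l))"
  unfolding has_val_def using r s
  by (intro exI[of _ "k * l"] exI[of _ "j * int l + i * int k"] exI[of _ "u ^ l * w ^ k"] conjI)
   (auto intro!: vunit_mult vunit_power)
 thus ?thesis using r s by (simp add: v_eqI field_simps)
qed

lemma v_1: "v 1 = 0" by (rule v_unit[OF vunit_1])

lemma v_power: "algebraic x ==> x \<noteq> 0 ==> v (x ^ n) = real n * v x"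
 by (induction n) (auto simp: v_1 v_mult al algebra_simps)

lemma v_inverse: "algebraic x ==> x \<noteq> 0 ==> v (inverse x) = - v x"
 using v_mult[of x "inverse x"] by (simp add: al v_1)

lemma v_divide: "algebraic x ==> x \<noteq> 0 ==> algebraic y ==> y \<noteq> 0 ==> v (x / y) = v x - v y"
 using v_mult[of x "inverse y"] by (simp add: al v_inverse field_class.field_divide_inverse)

lemma vunit_iff:
 assumes "algebraic x" "x \<noteq> 0"
 shows "vunit x \<longleftrightarrow> v x = 0" "x \<in> \<M> \<longleftrightarrow> v x > 0" "x \<in> \<O> \<longleftrightarrow> v x \<ge> 0"
proof -
 have pos: "v x > 0" if x: "algebraic x" "x \<noteq> 0" "x \<in> \<M>" for x
 proof (rule ccontr)
  assume neg: "\<not> v x > 0"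
  obtain k j u where r: "k > 0" "v x = real_of_int j / real k" "vunit u" "x ^ k = of_nat p powi j * u"
   using has_val_v[OF x(1,2)] by (auto simp: has_val_def)
  have "j \<le> 0" using neg r by (simp add: not_less divide_le_0_iff)
  have "x ^ k \<in> \<M>"
   using r(1) vmax_mult_right[OF x(3) VR.power_mem[OF vmax_subset[OF x(3)]], of "k - 1"] by (cases k) auto
  moreover have "of_nat p powi (- j) \<in> \<O>"
   using \<open>j \<le> 0\<close> VR.power_mem[OF VR.of_nat_mem] by (simp add: power_int_def)
  ultimately have "of_nat p powi (- j) * x ^ k \<in> \<M>" by (intro vmax_mult)
  moreover have "of_nat p powi (- j) * x ^ k = u" using p_nz by (simp add: r(4) power_int_minus)
  ultimately show False using r(3) by (simp add: vunit_def)
 qed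
 have neg: "v x < 0" if "x \<notin> \<O>"
  using pos[of "inverse x"] vring_or_inverse_vmax[of x] that assms v_inverse[of x] by (simp add: al)
 have x: "x \<in> \<M> \<or> vunit x \<or> x \<notin> \<O>" by (auto simp: vunit_def)
 have s: "x \<in> \<M> ==> x \<in> \<O>" by (rule vmax_subset)
 show "vunit x \<longleftrightarrow> v x = 0" "x \<in> \<M> \<longleftrightarrow> v x > 0" "x \<in> \<O> \<longleftrightarrow> v x \<ge> 0"
  using x s pos[OF assms] neg v_unit[of x] by (auto simp: vunit_def)
qed

text \<open>Lower bounds for the valuation that also make sense at \<open>0\<close>, whose valuation is infinite.\<close>

definition vge :: "real => 'k => bool"
 where "vge c x \<longleftrightarrow> x = 0 \<or> v x \<ge> c"

lemma vge_0 [simp]: "vge c 0" by (simp add: vge_def)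

lemma vge_mono: "vge c x ==> c' \<le> c ==> vge c' x" by (auto simp: vge_def)

lemma vge_0_iff: "algebraic x ==> vge 0 x \<longleftrightarrow> x \<in> \<O>"
 using vunit_iff(3)[of x] VR.zero_mem by (auto simp: vge_def)

lemma vge_integral: "algebraic_int x ==> vge 0 x"
 using vge_0_iff[of x] integral_vring by auto

lemma vge_mult: "algebraic x ==> algebraic y ==> vge a x ==> vge b y ==> vge (a + b) (x * y)"
 by (cases "x = 0 \<or> y = 0") (auto simp: vge_def v_mult)

lemma vge_power: "algebraic x ==> vge a x ==> vge (real n * a) (x ^ n)"
 by (cases "x = 0"; cases "n = 0") (auto simp: vge_def v_power v_1 intro: mult_left_mono)

lemma v_add_ge:
 assumes xy: "algebraic x" "x \<noteq> 0" "algebraic y" "y \<noteq> 0" "x + y \<noteq> 0" and le: "v x \<le> v y"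
 shows "v x \<le> v (x + y)"
proof -
 have "v (y / x) \<ge> 0" using xy le by (simp add: v_divide)
 hence "y / x \<in> \<O>" using xy by (subst vunit_iff(3)) (auto intro: al)
 hence "1 + y / x \<in> \<O>" by (intro VR.mem_intros)
 moreover have "1 + y / x = (x + y) / x" using xy by (simp add: field_simps)
 ultimately show ?thesis using xy vunit_iff(3)[of "(x + y) / x"] by (simp add: v_divide al)
qed

lemma vge_add:
 assumes "algebraic x" "algebraic y" "vge c x" "vge c y"
 shows "vge c (x + y)"
proof (cases "x = 0 \<or> y = 0 \<or> x + y = 0")
 case False
 thus ?thesis
  using v_add_ge[of x y] v_add_ge[of y x] assms by (cases "v x \<le> v y") (auto simp: vge_def add.commute)
qed (use assms in auto)

lemma vge_minus: "algebraic x ==> vge c x ==> vge c (- x)"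
 using vge_mult[of "- 1" x 0 c] vge_integral[of "- 1"] by (simp add: al)

lemma vge_diff: "algebraic x ==> algebraic y ==> vge c x ==> vge c y ==> vge c (x - y)"
 using vge_add[of x "- y" c] vge_minus[of y c] by (simp add: al)

lemma vge_sum: "(\<And>i. i \<in> I ==> algebraic (f i) \<and> vge c (f i)) ==> vge c (sum f I)"
proof (induction I rule: infinite_finite_induct)
 case (insert x F)
 hence "algebraic (sum f F)" using AL.sum_mem[of F f] by auto
 thus ?case using insert by (auto intro!: vge_add)
qed auto

lemma v_add_eq:
 assumes x: "algebraic x" "x \<noteq> 0" and y: "algebraic y" "vge c y" "v x < c"
 shows "x + y \<noteq> 0" "v (x + y) = v x"
proof -
 have *: "v x < v y" if "y \<noteq> 0" using that y by (auto simp: vge_def)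
 have **: "v (- y) = v y" if "y \<noteq> 0"
  using v_mult[of "- 1" y] y that v_unit[of "- 1"] v_power[of "- 1" 2] by (simp add: al v_1)
 show nz: "x + y \<noteq> 0"
 proof
  assume "x + y = 0"
  hence "x = - y" by (simp add: eq_neg_iff_add_eq_0)
  thus False using * ** x by auto
 qed
 show "v (x + y) = v x"
 proof (cases "y = 0")
  case False
  have "v x \<le> v (x + y)" using v_add_ge[of x y] x y False nz * by auto
  moreover have "v (x + y) \<le> v x"
  proof (rule ccontr)
   assume gt: "\<not> v (x + y) \<le> v x"
   show False using vge_add[of "x + y" "- y" "min (v (x + y)) (v y)"] x y False nz ** gt by (auto simp: vge_def al)
  qed
  ultimately show ?thesis by simp
 qed simp
qed

text \<open>The source of all bounds on denominators of valuations in an extension of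
  \<open>K\<close>. Only some multiplier up to the degree is produced, not a divisor of it.\<close>

lemma root_imp_v_multiple:
 assumes K: "closed_subfield K" "\<And>a. a \<in> K ==> algebraic a" and x: "algebraic x" "x \<noteq> 0"
  and h: "h \<in> polys K" "h \<noteq> 0" "poly h x = 0"
 shows "\<exists>i\<in>{1..degree h}. \<exists>y\<in>K. y \<noteq> 0 \<and> real i * v x = v y"
proof -
 obtain i a b where i: "1 \<le> i" "i \<le> degree h" "a \<in> K" "b \<in> K" "a \<noteq> 0" "b \<noteq> 0" "vunit (x ^ i * a / b)"
  using root_imp_vunit_power[OF K(2) x h] by blast
 have "real i * v x = v (b / a)" using i x K(2) v_unit[OF i(7)] by (simp add: v_divide v_mult v_power al)
 moreover have "b / a \<in> K" "b / a \<noteq> 0" using closed_subfield.divide_mem[OF K(1) i(4,3)] i by auto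
 ultimately show ?thesis using i by (intro bexI[of _ i] bexI[of _ "b / a"]) auto
qed

lemma v_Rats: "x \<in> \<rat> ==> x \<noteq> 0 ==> v x \<in> \<int>"
proof -
 assume x: "x \<in> \<rat>" "x \<noteq> 0"
 then obtain a b :: int where ab: "x = of_int a / of_int b" "b \<noteq> 0" by (auto elim: Rats_cases')
 have int: "v (of_int c) \<in> \<int>" if "c \<noteq> 0" for c
 proof -
  obtain j u where "vunit u" "of_int c = of_nat p powi j * u" using of_int_eq_p_powi_unit[OF \<open>c \<noteq> 0\<close>] by blast
  hence "v (of_int c) = real_of_int j" by (intro v_eqI, unfold has_val_def, intro exI[of _ 1]) (auto intro!: exI[of _ j])
  thus ?thesis by simp
 qed
 show ?thesis using x ab int by (simp add: v_divide)
qed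

text \<open>Divide by a coefficient \<open>a\<close> of least valuation. The quotients lie in
  \<open>\<O>\<close>, so each becomes integral after multiplication by some \<open>s i\<close>
  outside \<open>Q\<close>. The product \<open>S\<close> clears them all, and the chosen coefficient
  becomes \<open>S\<close> itself, which is outside \<open>Q\<close>.\<close>

lemma primitive_scaling:
 assumes K: "closed_subfield K" "\<And>x. x \<in> K ==> algebraic x" and h: "h \<in> polys K" "h \<noteq> 0"
 shows "\<exists>c\<in>K. c \<noteq> 0 \<and> smult c h \<in> polys {x \<in> K. algebraic_int x} \<and> (\<exists>i. coeff (smult c h) i \<notin> Q)"
proof -
 interpret K: closed_subfield K by fact
 define I where "I = {i. coeff h i \<noteq> 0}"
 have "I \<subseteq> {..degree h}" by (auto simp: I_def le_degree)
 hence fin: "finite I" using finite_subset by blast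
 have "degree h \<in> I" using h(2) by (simp add: I_def)
 then obtain m where "is_arg_min (\<lambda>i. v (coeff h i)) (\<lambda>i. i \<in> I) m"
  using ex_is_arg_min_if_finite[OF fin] by blast
 hence m: "m \<in> I" "\<And>i. i \<in> I ==> v (coeff h m) \<le> v (coeff h i)"
  by (simp_all add: is_arg_min_linorder)
 define a where "a = coeff h m"
 have a: "a \<in> K" "a \<noteq> 0" using m(1) polysD[OF h(1)] by (auto simp: a_def I_def)
 have hK: "coeff h i \<in> K" for i using polysD[OF h(1)] .
 have O: "coeff h i / a \<in> \<O>" for i
 proof (cases "i \<in> I")
  case True
  hence nz: "coeff h i \<noteq> 0" by (simp add: I_def)
  show ?thesis using m(2)[OF True] K(2)[OF hK] K(2)[OF a(1)] a(2) nz vunit_iff(3)[of "coeff h i / a"] K(2)[OF K.divide_mem[OF hK a(1)]] by (simp add: v_divide a_def)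
 qed (use VR.zero_mem in \<open>simp add: I_def\<close>)
 have "\<exists>s\<in>K. algebraic_int s \<and> s \<notin> Q \<and> algebraic_int (coeff h i / a * s)" for i
  by (rule vring_denominator[OF O K(2)[OF K.divide_mem[OF hK a(1)]] K.closed_subring_axioms K.divide_mem[OF hK a(1)]])
 then obtain s where s: "\<And>i. s i \<in> K" "\<And>i. algebraic_int (s i)" "\<And>i. s i \<notin> Q" "\<And>i. algebraic_int (coeff h i / a * s i)"
  by metis
 define S where "S = (\<Prod>i\<le>degree h. s i)"
 have Sprod: "(\<Prod>i\<in>A. s i) \<notin> Q" if "finite A" for A
  using that by (induction A rule: finite_induct) (use one_notin notin_mult s AI.prod_mem[of _ s] in auto)
 have S: "S \<in> K" "S \<notin> Q" unfolding S_def by (intro K.prod_mem s) (rule Sprod, simp)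
 have int: "algebraic_int (S / a * coeff h i)" for i
 proof (cases "i \<le> degree h")
  case True
  hence "S = s i * (\<Prod>j\<in>{..degree h} - {i}. s j)" by (simp add: S_def prod.remove[of _ i])
  hence eq: "S / a * coeff h i = (\<Prod>j\<in>{..degree h} - {i}. s j) * (coeff h i / a * s i)" by simp
  have "algebraic_int (\<Prod>j\<in>{..degree h} - {i}. s j)" using AI.prod_mem[of _ s] s(2) by simp
  thus ?thesis unfolding eq by (rule algebraic_int_diff_mult(2)[OF _ s(4)])
 qed (simp add: coeff_eq_0)
 show ?thesis
 proof (intro bexI[of _ "S / a"] conjI exI[of _ m])
  show "S / a \<in> K" by (rule K.divide_mem[OF S(1) a(1)])
  show "S / a \<noteq> 0" using nz_if_notin[OF S(2)] a(2) by simp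
  show "smult (S / a) h \<in> polys {x \<in> K. algebraic_int x}"
   using int K.mult_mem[OF K.divide_mem[OF S(1) a(1)] hK] by (simp add: polys_def)
  show "coeff (smult (S / a) h) m \<notin> Q" using S(2) a(2) by (simp add: a_def[symmetric])
 qed
qed

text \<open>Since \<open>Q\<close> is prime, the usual bound on the number of roots holds modulo
  \<open>Q\<close>: split off one root at a time by synthetic division.\<close>

lemma poly_roots_mod:
 assumes "\<And>i. algebraic_int (coeff h i)" "degree h \<le> n" "finite S" "card S > n"
  "\<And>x. x \<in> S ==> algebraic_int x" "\<And>x. x \<in> S ==> poly h x \<in> Q"
  "\<And>x y. x \<in> S ==> y \<in> S ==> x \<noteq> y ==> x - y \<notin> Q"
 shows "coeff h i \<in> Q"
 using assms
proof (induction n arbitrary: h S i)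
 case 0
 then obtain c where h: "h = [:c:]" by (auto elim: degree_eq_zeroE)
 obtain x where "x \<in> S" using 0 by fastforce
 hence "c \<in> Q" using 0(6)[of x] by (simp add: h)
 thus ?case using zero by (cases i) (auto simp: h)
next
 case (Suc n)
 obtain a where a: "a \<in> S" using Suc.prems(3,4) by fastforce
 define g where "g = synthetic_div h a"
 have hg: "poly h x = (x - a) * poly g x + poly h a" for x
  using arg_cong[OF synthetic_div_correct[of h a], of "\<lambda>h. poly h x"] by (simp add: g_def algebra_simps)
 have h_eq: "h + smult a g = pCons (poly h a) g" unfolding g_def by (rule synthetic_div_correct)
 have aa: "algebraic_int a" using Suc.prems(5) a by blast
 have g_int: "algebraic_int (coeff g i)" for i
  using AI.polys_synthetic_div[of h a] Suc.prems(1) aa by (auto simp: g_def polys_def)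
 have gQ: "coeff g i \<in> Q" for i
 proof (rule Suc.IH[of g "S - {a}"])
  show "degree g \<le> n" using Suc.prems(2) by (simp add: g_def degree_synthetic_div)
  show "card (S - {a}) > n" using Suc.prems(3,4) a by simp
  show "poly g x \<in> Q" if "x \<in> S - {a}" for x
  proof -
   have "(x - a) * poly g x = poly h x - poly h a" by (simp add: hg[of x])
   also have "... \<in> Q" using that a by (intro diff Suc.prems(6)) auto
   finally have "(x - a) * poly g x \<in> Q" .
   moreover have "x - a \<notin> Q" using Suc.prems(7) that a by auto
   moreover have "algebraic_int (x - a)" "algebraic_int (poly g x)"
    using that Suc.prems(5) aa AI.poly_mem[of g x] g_int by (auto simp: polys_def intro!: ai(3))
   ultimately show ?thesis using prime_ideal by blast
  qed
 qed (use g_int Suc.prems in auto)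
 have "coeff h i = coeff (pCons (poly h a) g) i - a * coeff g i"
  using arg_cong[OF h_eq, of "\<lambda>h. coeff h i"] by (simp add: algebra_simps)
 moreover have "coeff (pCons (poly h a) g) i \<in> Q" using gQ Suc.prems(6)[OF a] by (cases i) auto
 ultimately show ?case using gQ absorb[OF aa] diff by simp
qed

section \<open>Frobenius modulo \<open>Q\<close>\<close>

lemma frobenius_add:
 assumes "algebraic_int x" "algebraic_int y"
 shows "(x + y) ^ (p ^ a) - (x ^ (p ^ a) + y ^ (p ^ a)) \<in> Q"
proof (induction a)
 case 0
 thus ?case by (simp add: zero)
next
 case (Suc a)
 have base: "(z + w) ^ p - (z ^ p + w ^ p) \<in> Q" if zw: "algebraic_int z" "algebraic_int w" for z w
 proof -
  have p0: "p > 0" using prime_p prime_gt_0_nat by blast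
  have "(z + w) ^ p = (\<Sum>k\<le>p. of_nat (p choose k) * z ^ k * w ^ (p - k))" by (rule binomial_ring)
  also have "{..p} = insert 0 (insert p {0<..<p})" by auto
  also have "(\<Sum>k\<in>insert 0 (insert p {0<..<p}). of_nat (p choose k) * z ^ k * w ^ (p - k)) =
    w ^ p + (z ^ p + (\<Sum>k\<in>{0<..<p}. of_nat (p choose k) * z ^ k * w ^ (p - k)))"
   using p0 by (subst sum.insert; simp)+
  finally have "(z + w) ^ p - (z ^ p + w ^ p) = (\<Sum>k\<in>{0<..<p}. of_nat (p choose k) * z ^ k * w ^ (p - k))"
   by simp
  also have "... \<in> Q"
  proof (rule sum)
   fix k assume "k \<in> {0<..<p}"
   hence "p dvd (p choose k)" using prime_p by (intro dvd_choose_prime) auto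
   hence "of_int (int (p choose k)) \<in> Q" unfolding of_int_mem_iff by simp
   hence "of_nat (p choose k) \<in> Q" by simp
   thus "of_nat (p choose k) * z ^ k * w ^ (p - k) \<in> Q" by (intro absorb_right ai zw)
  qed
  finally show ?thesis .
 qed
 define e where "e = (x + y) ^ (p ^ a) - (x ^ (p ^ a) + y ^ (p ^ a))"
 have e: "e \<in> Q" "algebraic_int e" using Suc integral by (auto simp: e_def)
 have xy: "(x + y) ^ (p ^ a) = (x ^ (p ^ a) + y ^ (p ^ a)) + e" by (simp add: e_def)
 define s where "s = x ^ (p ^ a) + y ^ (p ^ a)"
 have s: "algebraic_int s" unfolding s_def by (intro ai assms)
 have 1: "(s + e) ^ p - (s ^ p + e ^ p) \<in> Q" by (rule base[OF s e(2)])
 have 2: "s ^ p - ((x ^ (p ^ a)) ^ p + (y ^ (p ^ a)) ^ p) \<in> Q"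
  unfolding s_def by (intro base ai assms)
 have 3: "e ^ p \<in> Q" using power_mem_iff[OF e(2), of p] e(1) prime_gt_0_nat[OF prime_p] by simp
 have "(x + y) ^ (p ^ Suc a) - (x ^ (p ^ Suc a) + y ^ (p ^ Suc a)) =
  ((s + e) ^ p - (s ^ p + e ^ p)) + (s ^ p - ((x ^ (p ^ a)) ^ p + (y ^ (p ^ a)) ^ p)) + e ^ p"
  using xy by (simp add: s_def power_mult mult.commute[of p])
 thus ?case using add[OF add[OF 1 2] 3] by simp
qed

lemma frobenius_cong_iff:
 assumes x: "algebraic_int x" "algebraic_int y"
 shows "x ^ (p ^ a) - y ^ (p ^ a) \<in> Q \<longleftrightarrow> x - y \<in> Q"
proof -
 have "(y + (x - y)) ^ (p ^ a) - (y ^ (p ^ a) + (x - y) ^ (p ^ a)) \<in> Q"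
  by (intro frobenius_add ai x)
 hence e: "(x ^ (p ^ a) - y ^ (p ^ a)) - (x - y) ^ (p ^ a) \<in> Q" by (simp add: algebra_simps)
 have "x ^ (p ^ a) - y ^ (p ^ a) \<in> Q \<longleftrightarrow> (x - y) ^ (p ^ a) \<in> Q"
  using diff[OF _ e] add[OF e] by force
 also have "... \<longleftrightarrow> x - y \<in> Q" using prime_gt_0_nat[OF prime_p] by (intro power_mem_iff ai x) auto
 finally show ?thesis .
qed

lemma frobenius_sum:
 assumes "\<And>i. i \<in> I ==> algebraic_int (f i)" "finite I"
 shows "(sum f I) ^ (p ^ a) - (\<Sum>i\<in>I. f i ^ (p ^ a)) \<in> Q"
 using assms(2,1)
proof (induction I rule: finite_induct)
 case empty
 thus ?case using prime_gt_0_nat[OF prime_p] zero by (simp add: power_0_left)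
next
 case (insert i I)
 have "(f i + sum f I) ^ (p ^ a) - (f i ^ (p ^ a) + sum f I ^ (p ^ a)) \<in> Q"
  using insert.prems by (intro frobenius_add ai) auto
 from add[OF this insert.IH] show ?case using insert by (simp add: algebra_simps)
qed

text \<open>
 Modulo \<open>Q\<close>, the Frobenius \<open>x \<mapsto> x ^ q\<close> permutes the at most \<open>n\<close> roots of \<open>h\<close>.
\<close>

lemma frobenius_period:
 assumes x: "algebraic_int x" and h: "\<And>i. algebraic_int (coeff h i)" "poly h x \<in> Q" "degree h \<le> n"
  and frob: "\<And>i. coeff h i ^ (p ^ a) - coeff h i \<in> Q" and nz: "coeff h i0 \<notin> Q"
 shows "\<exists>m\<in>{1..n}. x ^ (p ^ (a * m)) - x \<in> Q"
proof -
 define F where "F m = x ^ (p ^ (a * m))" for m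
 have F_int: "algebraic_int (F m)" for m unfolding F_def by (intro ai x)
 have F_Suc: "F (Suc m) = F m ^ (p ^ a)" for m
  by (simp add: F_def power_add mult.commute flip: power_mult)
 have root: "poly h (F m) \<in> Q" for m
 proof (induction m)
  case 0
  thus ?case using h(2) by (simp add: F_def)
 next
  case (Suc m)
  define y where "y = F m"
  have y: "algebraic_int y" by (simp add: y_def F_int)
  have "(\<Sum>i\<le>degree h. coeff h i * y ^ i) ^ (p ^ a) - (\<Sum>i\<le>degree h. (coeff h i * y ^ i) ^ (p ^ a)) \<in> Q"
   by (intro frobenius_sum ai h y) auto
  moreover have "(\<Sum>i\<le>degree h. coeff h i * y ^ i) ^ (p ^ a) \<in> Q"
   using Suc power_mem_iff[of "poly h y" "p ^ a"] prime_gt_0_nat[OF prime_p] AI.poly_mem[of h y] h y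
   by (simp add: y_def[symmetric] poly_altdef[symmetric] polys_def)
  ultimately have "(\<Sum>i\<le>degree h. (coeff h i * y ^ i) ^ (p ^ a)) \<in> Q" using diff by fastforce
  moreover have "(\<Sum>i\<le>degree h. (coeff h i ^ (p ^ a) - coeff h i) * (y ^ i) ^ (p ^ a)) \<in> Q"
   by (intro sum absorb_right frob ai y)
  ultimately have "(\<Sum>i\<le>degree h. (coeff h i * y ^ i) ^ (p ^ a)) - (\<Sum>i\<le>degree h. (coeff h i ^ (p ^ a) - coeff h i) * (y ^ i) ^ (p ^ a)) \<in> Q"
   by (rule diff)
  moreover have "(\<Sum>i\<le>degree h. (coeff h i * y ^ i) ^ (p ^ a)) - (\<Sum>i\<le>degree h. (coeff h i ^ (p ^ a) - coeff h i) * (y ^ i) ^ (p ^ a))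
    = poly h (y ^ (p ^ a))"
   unfolding sum_subtractf[symmetric] poly_altdef
  proof (intro sum.cong refl)
   fix i
   have "(y ^ i) ^ (p ^ a) = (y ^ (p ^ a)) ^ i" by (simp add: mult.commute flip: power_mult)
   thus "(coeff h i * y ^ i) ^ (p ^ a) - (coeff h i ^ (p ^ a) - coeff h i) * (y ^ i) ^ (p ^ a) = coeff h i * (y ^ (p ^ a)) ^ i"
    by (simp add: power_mult_distrib left_diff_distrib)
  qed
  ultimately show ?case by (simp add: F_Suc y_def)
 qed
 \<comment> \<open>Pigeonhole: \<open>n + 1\<close> roots distinct modulo \<open>Q\<close> would put
   every coefficient of \<open>h\<close> into \<open>Q\<close>.\<close>
 have "\<exists>i\<le>n. \<exists>j\<le>n. i < j \<and> F i - F j \<in> Q"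
 proof (rule ccontr)
  assume no: "\<not> ?thesis"
  have distinct: "F i - F j \<notin> Q" if ij: "i \<le> n" "j \<le> n" "i \<noteq> j" for i j
  proof -
   consider "i < j" | "j < i" using ij(3) by linarith
   thus ?thesis
   proof cases
    case 2
    thus ?thesis using no ij uminus[of "F i - F j"] by auto
   qed (use no ij in blast)
  qed
  hence inj: "inj_on F {..n}" using zero by (intro inj_onI) fastforce
  have "coeff h i0 \<in> Q" by (rule poly_roots_mod[OF h(1) h(3), of "F ` {..n}"])
    (use F_int root distinct card_image[OF inj] in auto)
  thus False using nz by blast
 qed
 then obtain i j where ij: "i < j" "j \<le> n" "F i - F j \<in> Q" by blast
 \<comment> \<open>Frobenius is injective modulo \<open>Q\<close>, so the coincidence of
   \<open>F i\<close> and \<open>F j\<close> can be pulled back to \<open>x\<close>.\<close>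
 have "F i = x ^ (p ^ (a * i))" "F j = (x ^ (p ^ (a * (j - i)))) ^ (p ^ (a * i))"
  using ij(1) by (simp_all add: F_def flip: power_mult power_add distrib_left)
 hence "x - x ^ (p ^ (a * (j - i))) \<in> Q"
  using ij(3) frobenius_cong_iff[of x "x ^ (p ^ (a * (j - i)))" "a * i"] x ai by auto
 hence "x ^ (p ^ (a * (j - i))) - x \<in> Q" using uminus by fastforce
 thus ?thesis using ij by (intro bexI[of _ "j - i"]) auto
qed

end

text \<open>The prime arises by enlarging the denominator ideal of \<open>y\<close> to a maximal one.\<close>

lemma alg_prime_exists:
 fixes y :: "'k :: field_char_0"
 assumes p: "Factorial_Ring.prime p" and py: "algebraic_int (of_nat p ^ k * y)" and y: "\<not> algebraic_int y"
 shows "\<exists>Q. alg_prime Q p \<and> y \<notin> alg_prime.vring Q"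
proof -
 interpret AI: closed_subring "{x :: 'k. algebraic_int x}" by (rule closed_subring_algebraic_int)
 note ai = AI.mem_intros[unfolded mem_Collect_eq]
 \<comment> \<open>If \<open>y\<close> were in the localisation at \<open>Q\<close>, it would have a
   denominator in \<open>D\<close> outside \<open>Q\<close>. So a prime containing \<open>D\<close>
   excludes \<open>y\<close>, and \<open>D\<close> contains a power of \<open>p\<close> by
   hypothesis.\<close>
 define D where "D = {a. algebraic_int a \<and> algebraic_int (a * y)}"
 define ideal where "ideal I \<longleftrightarrow> (\<forall>x\<in>I. algebraic_int x) \<and> (\<forall>x\<in>I. \<forall>z\<in>I. x - z \<in> I) \<and>
  (\<forall>a. \<forall>x\<in>I. algebraic_int a --> a * x \<in> I)" for I :: "'k set"
 define \<A> where "\<A> = {I. ideal I \<and> D \<subseteq> I \<and> 1 \<notin> I}"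
 have D: "ideal D" unfolding ideal_def D_def by (auto intro: ai simp: left_diff_distrib mult.assoc)
 have "1 \<notin> D" using y by (simp add: D_def)
 have "\<exists>M\<in>\<A>. \<forall>I\<in>\<A>. M \<subseteq> I --> I = M"
 proof (rule subset_Zorn_nonempty)
  show "\<A> \<noteq> {}" using D \<open>1 \<notin> D\<close> by (auto simp: \<A>_def)
  fix \<C> assume C: "\<C> \<noteq> {}" "subset.chain \<A> \<C>"
  hence CA: "\<C> \<subseteq> \<A>" by (simp add: subset_chain_def)
  have "ideal (\<Union>\<C>)" unfolding ideal_def
  proof (intro conjI ballI allI impI)
   show "algebraic_int x" if "x \<in> \<Union>\<C>" for x using that CA by (auto simp: \<A>_def ideal_def)
   show "a * x \<in> \<Union>\<C>" if x: "x \<in> \<Union>\<C>" and a: "algebraic_int a" for a x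
   proof -
    obtain I where I: "I \<in> \<C>" "x \<in> I" using x by blast
    hence "a * x \<in> I" using CA a by (auto simp: \<A>_def ideal_def)
    thus ?thesis using I(1) by blast
   qed
   fix x z assume "x \<in> \<Union>\<C>" "z \<in> \<Union>\<C>"
   then obtain I J where IJ: "I \<in> \<C>" "J \<in> \<C>" "x \<in> I" "z \<in> J" by blast
   hence "I \<subseteq> J \<or> J \<subseteq> I" using C(2) by (auto simp: subset_chain_def)
   then obtain K where "K \<in> \<C>" "x \<in> K" "z \<in> K" using IJ by blast
   moreover from this have "x - z \<in> K" using CA by (auto simp: \<A>_def ideal_def)
   ultimately show "x - z \<in> \<Union>\<C>" by blast
  qed
  moreover have "D \<subseteq> \<Union>\<C>" "1 \<notin> \<Union>\<C>" using C(1) CA by (auto simp: \<A>_def)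
  ultimately show "\<Union>\<C> \<in> \<A>" by (simp add: \<A>_def)
 qed
 then obtain Q where Q: "Q \<in> \<A>" "\<And>I. I \<in> \<A> ==> Q \<subseteq> I ==> I = Q" by blast
 have Qi: "\<And>x. x \<in> Q ==> algebraic_int x" "\<And>x z. x \<in> Q ==> z \<in> Q ==> x - z \<in> Q"
  "\<And>a x. x \<in> Q ==> algebraic_int a ==> a * x \<in> Q" "1 \<notin> Q" "D \<subseteq> Q"
  using Q(1) by (auto simp: \<A>_def ideal_def)
 have "0 \<in> D" by (simp add: D_def)
 hence Q0: "0 \<in> Q" using Qi(5) by blast
 have Qadd: "x + z \<in> Q" if "x \<in> Q" "z \<in> Q" for x z
  using Qi(2)[OF that(1) Qi(2)[OF Q0 that(2)]] by simp
 have ext: "\<exists>q c. q \<in> Q \<and> algebraic_int c \<and> 1 = q + c * a" if a: "algebraic_int a" "a \<notin> Q" for a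
 proof -
  define I where "I = {q + c * a | q c. q \<in> Q \<and> algebraic_int c}"
  have "ideal I" unfolding ideal_def
  proof (intro conjI ballI allI impI)
   fix x assume "x \<in> I"
   then obtain q c where x: "x = q + c * a" "q \<in> Q" "algebraic_int c" by (auto simp: I_def)
   show "algebraic_int x" unfolding x by (intro ai Qi(1) x a)
   {
    fix z assume "z \<in> I"
    then obtain q' c' where z: "z = q' + c' * a" "q' \<in> Q" "algebraic_int c'" by (auto simp: I_def)
    have "x - z = (q - q') + (c - c') * a" by (simp add: x z algebra_simps)
    thus "x - z \<in> I" unfolding I_def using Qi(2)[OF x(2) z(2)] ai(3)[OF x(3) z(3)] by blast
   }
   fix b :: 'k assume b: "algebraic_int b"
   have "b * x = b * q + (b * c) * a" by (simp add: x algebra_simps)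
   thus "b * x \<in> I" unfolding I_def using Qi(3)[OF x(2) b] ai(4)[OF b x(3)] by blast
  qed
  moreover have "Q \<subseteq> I"
  proof
   fix q assume "q \<in> Q"
   thus "q \<in> I" unfolding I_def by (intro CollectI exI[of _ q] exI[of _ 0]) simp
  qed
  moreover have "a \<in> I" unfolding I_def using Q0 by (intro CollectI exI[of _ 0] exI[of _ 1]) simp
  ultimately have "1 \<in> I" using Q(2)[of I] Qi(5) a(2) by (auto simp: \<A>_def)
  thus ?thesis unfolding I_def by blast
 qed
 have prime: "a \<in> Q \<or> b \<in> Q" if ab: "algebraic_int a" "algebraic_int b" "a * b \<in> Q" for a b
 proof (rule ccontr)
  assume "\<not> (a \<in> Q \<or> b \<in> Q)"
  then obtain q c q' c' where e: "q \<in> Q" "algebraic_int c" "1 = q + c * a" "q' \<in> Q" "algebraic_int c'" "1 = q' + c' * b"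
   using ext ab by metis
  have "1 = (q + c * a) * (q' + c' * b)" using e(3,6) by simp
  also have "... = (q' + c' * b) * q + (c * a) * q' + (c * c') * (a * b)" by (simp add: algebra_simps)
  also have "... \<in> Q" by (intro Qadd Qi(3) ai e ab Qi(1))
  finally show False using Qi(4) by simp
 qed
 have pw: "of_nat p \<in> Q" if "of_nat p ^ n \<in> Q" for n using that
 proof (induction n)
  case (Suc n)
  thus ?case using prime[of "of_nat p" "of_nat p ^ n"] ai(7) by auto
 qed (use Qi(4) in simp)
 have "of_nat p ^ k \<in> D" using py by (simp add: D_def ai(7))
 hence pQ: "of_nat p \<in> Q" using pw Qi(5) by blast
 have loc: "alg_prime Q p" by unfold_locales (use p Qi prime pQ in auto)
 moreover have "y \<notin> alg_prime.vring Q"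
 proof
  assume "y \<in> alg_prime.vring Q"
  then obtain a s where "y = a / s" "algebraic_int a" "algebraic_int s" "s \<notin> Q"
   unfolding alg_prime.vring_def[OF loc] by blast
  moreover from this have "s \<noteq> 0" using Q0 by auto
  ultimately have "s \<in> D" by (simp add: D_def)
  thus False using Qi(5) \<open>s \<notin> Q\<close> by blast
 qed
 ultimately show ?thesis by blast
qed

text \<open>The bridge from local to global: lower bounds for valuations at all primes above
  \<open>p\<close> become integrality, to which complex embeddings can be applied.\<close>

lemma algebraic_int_if_vge_0:
 fixes y :: "'k :: field_char_0"
 assumes p: "Factorial_Ring.prime p" and py: "algebraic_int (of_nat p ^ k * y)"
  and vge: "\<And>Q. alg_prime Q p ==> alg_prime.vge Q p 0 y"
 shows "algebraic_int y"
proof (rule ccontr)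
 assume "\<not> algebraic_int y"
 then obtain Q where Q: "alg_prime Q p" "y \<notin> alg_prime.vring Q" using alg_prime_exists[OF p py] by blast
 have "algebraic y" using int_multiple_imp_algebraic[of "int p ^ k" y] py p by auto
 thus False using alg_prime.vge_0_iff[OF Q(1)] vge[OF Q(1)] Q(2) by blast
qed

text \<open>Apply the construction to \<open>1 / p\<close>, which is rational but not an
  integer.\<close>

lemma alg_prime_above_exists:
 assumes p: "Factorial_Ring.prime p"
 shows "\<exists>Q :: 'k :: field_char_0 set. alg_prime Q p"
proof -
 have "(inverse (of_nat p) :: 'k) \<in> \<rat>" by simp
 moreover have "inverse (of_nat p) \<notin> (\<int> :: 'k set)"
 proof
  assume "(inverse (of_nat p) :: 'k) \<in> \<int>"
  then obtain a where "(inverse (of_nat p) :: 'k) = of_int a" by (auto elim: Ints_cases)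
  hence "(of_int (a * int p) :: 'k) = of_int 1" using p by (simp add: field_simps)
  hence "a * int p = 1" by (simp only: of_int_eq_iff)
  hence "int p dvd 1" by (metis dvd_triv_right)
  thus False using p prime_gt_1_nat[of p] by simp
 qed
 ultimately have "\<not> algebraic_int (inverse (of_nat p) :: 'k)" using rational_algebraic_int_is_int by blast
 moreover have "algebraic_int (of_nat p ^ 1 * inverse (of_nat p) :: 'k)" using p by simp
 ultimately show ?thesis using alg_prime_exists[OF p] by blast
qed

section \<open>Number fields\<close>

lemma ambient_simps:
 "carrier (ambient :: 'k :: field ring) = UNIV" "(x :: 'k) \<otimes>\<^bsub>ambient\<^esub> y = x * y" "x \<oplus>\<^bsub>ambient\<^esub> y = x + y"
 "\<one>\<^bsub>ambient\<^esub> = (1 :: 'k)" "\<zero>\<^bsub>ambient\<^esub> = (0 :: 'k)"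
 by (simp_all add: ring_of_type_algebra_def)

lemma field_ambient: "field (ambient :: 'k :: field ring)"
 by (rule field_from_type_algebra)

lemma ambient_a_inv: "\<ominus>\<^bsub>ambient\<^esub> x = - (x :: 'k :: field)"
proof -
 interpret field "ambient :: 'k ring" by (rule field_ambient)
 show ?thesis by (rule minus_equality) (simp_all add: ambient_simps)
qed

lemma ambient_m_inv: "x \<noteq> 0 ==> inv\<^bsub>ambient\<^esub> x = inverse (x :: 'k :: field)"
proof -
 interpret field "ambient :: 'k ring" by (rule field_ambient)
 assume "x \<noteq> 0"
 thus ?thesis by (intro comm_inv_char) (simp_all add: ambient_simps)
qed

lemma subfield_ambient_iff: "subfield K (ambient :: 'k :: field ring) \<longleftrightarrow> closed_subfield K"
proof
 interpret A: field "ambient :: 'k ring" by (rule field_ambient)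
 assume K: "subfield K (ambient :: 'k ring)"
 note S = A.subring_props[OF K]
 show "closed_subfield K"
 proof
  show "1 \<in> K" using S(3) by (simp add: ambient_simps)
  fix x y assume xy: "x \<in> K" "y \<in> K"
  have "- y \<in> K" using S(5)[OF xy(2)] by (simp add: ambient_a_inv)
  from S(7)[OF xy(1) this] show "x - y \<in> K" by (simp add: ambient_simps)
  show "x * y \<in> K" using S(6)[OF xy] by (simp add: ambient_simps)
  show "inverse x \<in> K"
  proof (cases "x = 0")
   case False
   thus ?thesis using A.subfield_m_inv(1)[OF K, of x] xy by (simp add: ambient_simps ambient_m_inv)
  qed (use xy in simp)
 qed
next
 interpret A: field "ambient :: 'k ring" by (rule field_ambient)
 assume "closed_subfield K"
 then interpret K: closed_subfield K .
 show "subfield K (ambient :: 'k ring)"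
 proof (rule A.subfieldI')
  show "subring K ambient"
   by (rule A.subringI) (auto simp: ambient_simps ambient_a_inv intro: K.mem_intros)
  show "inv\<^bsub>ambient\<^esub> k \<in> K" if "k \<in> K - {\<zero>\<^bsub>ambient\<^esub>}" for k
   using that by (simp add: ambient_simps ambient_m_inv K.inverse_mem)
 qed
qed

lemma combine_ambient:
 "ring.combine (ambient :: 'k :: field ring) Ks Us = (\<Sum>i<min (length Ks) (length Us). Ks ! i * Us ! i)"
proof -
 interpret A: field "ambient :: 'k ring" by (rule field_ambient)
 show ?thesis
  by (induction Ks Us rule: A.combine.induct) (simp_all add: ambient_simps sum.lessThan_Suc_shift del: sum.lessThan_Suc)
qed

lemma dimension_imp_dependent:
 fixes x :: "nat => 'k :: field"
 assumes K: "closed_subfield K" and dim: "ring.dimension ambient n K E" and x: "\<And>i. i \<le> n ==> x i \<in> E"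
 shows "\<exists>c. (\<forall>i. c i \<in> K) \<and> (\<exists>i\<le>n. c i \<noteq> 0) \<and> (\<Sum>i\<le>n. c i * x i) = 0"
proof -
 interpret A: field "ambient :: 'k ring" by (rule field_ambient)
 interpret K: closed_subfield K by fact
 have sf: "subfield K ambient" using K by (simp add: subfield_ambient_iff)
 define Us where "Us = map x [0..<Suc n]"
 have "set Us \<subseteq> E" using x by (auto simp: Us_def)
 moreover have "length Us = Suc n" by (simp add: Us_def)
 ultimately have "A.dependent K Us" using A.independent_length_le_dimension[OF sf dim] by fastforce
 then obtain Ks where Ks: "length Ks = length Us" "A.combine Ks Us = \<zero>\<^bsub>ambient\<^esub>" "set Ks \<subseteq> K" "set Ks \<noteq> {\<zero>\<^bsub>ambient\<^esub>}"
  using A.dependent_imp_non_trivial_combine[OF sf, of Us] by (metis ambient_simps(1) subset_UNIV)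
 define c where "c i = (if i \<le> n then Ks ! i else 0)" for i
 have len: "length Ks = Suc n" using Ks(1) by (simp add: Us_def)
 have "(\<Sum>i\<le>n. c i * x i) = (\<Sum>i<Suc n. Ks ! i * Us ! i)"
  unfolding lessThan_Suc_atMost by (intro sum.cong refl) (auto simp: c_def Us_def simp del: upt_Suc)
 also have "... = 0" using Ks(2) by (simp add: combine_ambient len Us_def ambient_simps)
 finally have "(\<Sum>i\<le>n. c i * x i) = 0" .
 moreover have "c i \<in> K" for i using Ks(3) len K.zero_mem by (auto simp: c_def intro!: subsetD[OF Ks(3)] nth_mem)
 moreover have "\<exists>i\<le>n. c i \<noteq> 0"
 proof (rule ccontr)
  assume "\<not> (\<exists>i\<le>n. c i \<noteq> 0)"
  hence "\<And>y. y \<in> set Ks ==> y = 0" using len by (auto simp: in_set_conv_nth c_def)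
  hence "set Ks = {0}" using len by (cases Ks) auto
  thus False using Ks(4) by (simp add: ambient_simps)
 qed
 ultimately show ?thesis by blast
qed

lemma dimension_imp_root:
 fixes x :: "'k :: field"
 assumes K: "closed_subfield K" and dim: "ring.dimension ambient n K E" and x: "\<And>i. x ^ i \<in> E"
 shows "\<exists>h\<in>polys K. h \<noteq> 0 \<and> degree h \<le> n \<and> poly h x = 0"
proof -
 obtain c where c: "\<forall>i. c i \<in> K" "\<exists>i\<le>n. c i \<noteq> 0" "(\<Sum>i\<le>n. c i * x ^ i) = 0"
  using dimension_imp_dependent[OF K dim, of "\<lambda>i. x ^ i"] x by blast
 interpret K: closed_subfield K by fact
 define h where "h = (\<Sum>i\<le>n. monom (c i) i)"
 have co: "coeff h i = (if i \<le> n then c i else 0)" for i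
  by (simp add: h_def coeff_sum coeff_monom cong: if_cong)
 show ?thesis
 proof (intro bexI[of _ h] conjI)
  show "h \<in> polys K" using c(1) K.zero_mem by (simp add: polys_def co)
  show "h \<noteq> 0" using c(2) co by (metis coeff_0)
  show "degree h \<le> n" by (rule degree_le) (simp add: co)
  show "poly h x = 0" using c(3) by (simp add: h_def poly_sum poly_monom)
 qed
qed

section \<open>Number fields and their rings of integers\<close>

locale num_field =
 fixes F :: "'k :: field_char_0 set"
 assumes number_field: "number_field F"
begin

sublocale closed_subfield F
 using number_field by (simp add: number_field_def subfield_ambient_iff)

lemma closed_subfield_Rats: "closed_subfield (\<rat> :: 'k set)"
 by unfold_locales auto

definition deg :: nat where "deg = (SOME n. ring.dimension ambient n \<rat> F)"

lemma dimension_deg: "ring.dimension ambient deg \<rat> F"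
proof -
 interpret A: field "ambient :: 'k ring" by (rule field_ambient)
 have "\<exists>n. A.dimension n \<rat> F"
  using number_field by (simp add: number_field_def A.finite_dimension_def)
 thus ?thesis unfolding deg_def by (rule someI_ex)
qed

lemma root_over_Rats:
 assumes "x \<in> F"
 shows "\<exists>h\<in>polys \<rat>. h \<noteq> 0 \<and> degree h \<le> deg \<and> poly h x = 0"
 using assms by (intro dimension_imp_root[OF closed_subfield_Rats dimension_deg]) (rule power_mem)

lemma algebraic_mem: "x \<in> F ==> algebraic x"
 using root_over_Rats[of x] by (auto intro!: algebraicI' simp: polys_def)

abbreviation OF :: "'k ring" where "OF \<equiv> ring_of_integers F"

lemma OF_simps:
 "carrier OF = {x \<in> F. algebraic_int x}" "x \<otimes>\<^bsub>OF\<^esub> y = x * y" "x \<oplus>\<^bsub>OF\<^esub> y = x + y" "\<one>\<^bsub>OF\<^esub> = 1" "\<zero>\<^bsub>OF\<^esub> = 0"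
 by (simp_all add: ring_of_integers_def ring_of_type_algebra_def)

sublocale AI: closed_subring "{x :: 'k. algebraic_int x}" by (rule closed_subring_algebraic_int)
sublocale OFs: closed_subring "{x \<in> F. algebraic_int x}"
 by unfold_locales (auto intro: mem_intros algebraic_int_diff_mult)

lemma cring_OF: "cring OF"
proof (rule cringI)
 show "abelian_group OF"
 proof (rule abelian_groupI)
  fix x assume "x \<in> carrier OF"
  thus "\<exists>y\<in>carrier OF. y \<oplus>\<^bsub>OF\<^esub> x = \<zero>\<^bsub>OF\<^esub>"
   using OFs.uminus_mem[of x] by (intro bexI[of _ "- x"]) (auto simp: OF_simps)
 qed (use OFs.zero_mem OFs.add_mem in \<open>auto simp: OF_simps add_ac\<close>)
 show "comm_monoid OF"
  by (rule comm_monoidI) (use OFs.one_mem OFs.mult_mem in \<open>auto simp: OF_simps mult_ac\<close>)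
qed (auto simp: OF_simps distrib_right)

lemma OF_a_inv: "x \<in> carrier OF ==> \<ominus>\<^bsub>OF\<^esub> x = - x"
proof -
 interpret R: cring OF by (rule cring_OF)
 assume "x \<in> carrier OF"
 thus ?thesis using OFs.uminus_mem[of x] by (intro R.minus_equality) (auto simp: OF_simps)
qed

text \<open>
 At most \<open>deg\<close> integers of \<open>F\<close> can be linearly independent modulo \<open>p\<close>, as a rational relation
 can be made primitive.
\<close>

lemma finite_mod_prime:
 assumes p: "Factorial_Ring.prime p"
 shows "\<exists>S. finite S \<and> S \<subseteq> carrier OF \<and> (\<forall>y\<in>carrier OF. \<exists>s\<in>S. \<exists>w\<in>carrier OF. y - s = of_nat p * w)"
proof -
 define dep where "dep xs \<longleftrightarrow> (\<exists>c :: nat => int. (\<exists>i<length xs. \<not> int p dvd c i) \<and>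
  (\<exists>w\<in>carrier OF. (\<Sum>i<length xs. of_int (c i) * xs ! i) = of_nat p * w))" for xs :: "'k list"
 have long: "dep xs" if xs: "set xs \<subseteq> carrier OF" "length xs = Suc deg" for xs
 proof -
  have "xs ! i \<in> F" if "i \<le> deg" for i using subsetD[OF xs(1) nth_mem[of i xs]] that xs(2) by (auto simp: OF_simps)
  then obtain c where c: "\<forall>i. c i \<in> \<rat>" "\<exists>i\<le>deg. c i \<noteq> 0" "(\<Sum>i\<le>deg. c i * xs ! i) = 0"
   using dimension_imp_dependent[OF closed_subfield_Rats dimension_deg, of "\<lambda>i. xs ! i"] by blast
  define h where "h = (\<Sum>i\<le>deg. monom (c i) i)"
  have co: "coeff h i = (if i \<le> deg then c i else 0)" for i
   by (simp add: h_def coeff_sum coeff_monom cong: if_cong)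
  \<comment> \<open>Any prime above \<open>p\<close> will do; it serves to scale the rational
    relation to integer coefficients that are not all divisible by \<open>p\<close>.\<close>
  obtain Q :: "'k set" where "alg_prime Q p" using alg_prime_above_exists[OF p] by blast
  then interpret Q: alg_prime Q p .
  have "h \<in> polys \<rat>" "h \<noteq> 0" using c(1,2) by (auto simp: polys_def co poly_eq_iff)
  then obtain w k where w: "w \<noteq> 0" "smult w h \<in> polys {x \<in> \<rat>. algebraic_int x}" "coeff (smult w h) k \<notin> Q"
   using Q.primitive_scaling[OF closed_subfield_Rats rat_imp_algebraic] by blast
  have "\<exists>b :: int. coeff (smult w h) i = of_int b" for i
   using polysD[OF w(2), of i] rational_algebraic_int_is_int by (auto elim: Ints_cases)
  then obtain b :: "nat => int" where b: "\<And>i. coeff (smult w h) i = of_int (b i)" by metis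
  have "k \<le> deg" using w(3) Q.zero by (auto simp: co split: if_splits)
  hence "\<exists>i\<le>deg. \<not> int p dvd b i" using w(3) b[of k] Q.of_int_mem_iff by metis
  moreover have "(\<Sum>i\<le>deg. of_int (b i) * xs ! i) = w * (\<Sum>i\<le>deg. c i * xs ! i)"
   unfolding sum_distrib_left b[symmetric] by (intro sum.cong refl) (simp add: co)
  hence "(\<Sum>i\<le>deg. of_int (b i) * xs ! i) = 0" using c(3) by simp
  ultimately show ?thesis unfolding dep_def xs(2) lessThan_Suc_atMost
   using OFs.zero_mem by (intro exI[of _ b]) (auto simp: OF_simps less_Suc_eq_le intro!: bexI[of _ 0])
 qed
 define P where "P xs \<longleftrightarrow> set xs \<subseteq> carrier OF \<and> \<not> dep xs" for xs
 have mono: "length xs \<le> deg" if "P xs" for xs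
 proof (rule ccontr)
  assume "\<not> length xs \<le> deg"
  hence len: "length (take (Suc deg) xs) = Suc deg" by simp
  have "set (take (Suc deg) xs) \<subseteq> carrier OF" using that set_take_subset[of "Suc deg" xs] by (auto simp: P_def)
  from long[OF this len] obtain c w where c: "\<exists>i<Suc deg. \<not> int p dvd c i" "w \<in> carrier OF"
    "(\<Sum>i<Suc deg. of_int (c i) * take (Suc deg) xs ! i) = of_nat p * w"
   unfolding dep_def len by blast
  define e where "e i = (if i < Suc deg then c i else 0)" for i
  have "(\<Sum>i<length xs. of_int (e i) * xs ! i) = (\<Sum>i<Suc deg. of_int (e i) * xs ! i)"
   using len by (intro sum.mono_neutral_right) (auto simp: e_def)
  also have "... = of_nat p * w" unfolding c(3)[symmetric] by (intro sum.cong refl) (auto simp: e_def)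
  finally have "(\<Sum>i<length xs. of_int (e i) * xs ! i) = of_nat p * w" .
  moreover have "\<exists>i<length xs. \<not> int p dvd e i"
  proof -
   obtain i where "i < Suc deg" "\<not> int p dvd c i" using c(1) by blast
   moreover from this have "i < length xs" using len by simp
   ultimately show ?thesis by (intro exI[of _ i]) (simp add: e_def)
  qed
  ultimately have "dep xs" unfolding dep_def using c(2) by blast
  thus False using that by (simp add: P_def)
 qed
 have "P []" by (simp add: P_def dep_def)
 \<comment> \<open>A longest list independent modulo \<open>p\<close> spans modulo \<open>p\<close>:
   appending \<open>y\<close> creates a relation in which the coefficient of \<open>y\<close> is
   invertible modulo \<open>p\<close>.\<close>
 then obtain xs where xs: "P xs" "\<And>ys. P ys ==> length ys \<le> length xs"
  using ex_has_greatest_nat[of P "[]" length "Suc deg"] mono by (auto simp: less_Suc_eq_le)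
 have xsO: "set xs \<subseteq> carrier OF" using xs(1) by (simp add: P_def)
 define S where "S = (\<lambda>c. \<Sum>i<length xs. of_int (c i) * xs ! i) ` (PiE {..<length xs} (\<lambda>_. {0..<int p}))"
 let ?L = "\<lambda>c. \<Sum>i<length xs. of_int (c i) * xs ! i"
 have xsi: "i < length xs ==> xs ! i \<in> carrier OF" for i using xsO by auto
 have lin: "(?L c) \<in> carrier OF" for c
  unfolding OF_simps using xsi by (intro OFs.sum_mem OFs.mult_mem OFs.of_int_mem) (auto simp: OF_simps)
 have p0: "p > 0" using p prime_gt_0_nat by blast
 show ?thesis
 proof (intro exI[of _ S] conjI ballI)
  show "finite S" unfolding S_def by (intro finite_imageI finite_PiE) auto
  show "S \<subseteq> carrier OF" using lin by (auto simp: S_def)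
  fix y assume y: "y \<in> carrier OF"
  have "dep (xs @ [y])" using xs(2)[of "xs @ [y]"] xsO y by (auto simp: P_def)
  then obtain c w where c: "\<exists>i<Suc (length xs). \<not> int p dvd c i" "w \<in> carrier OF"
   "(\<Sum>i<Suc (length xs). of_int (c i) * (xs @ [y]) ! i) = of_nat p * w"
   unfolding dep_def by auto
  have split: "(?L c) + of_int (c (length xs)) * y = of_nat p * w"
   using c(3) by (simp add: nth_append)
  define e where "e = c (length xs)"
  have "\<not> int p dvd e"
  proof
   assume "int p dvd e"
   then obtain e' where e': "e = int p * e'" by auto
   have "(?L c) = of_nat p * (w - of_int e' * y)"
    using split by (simp add: e_def[symmetric] e' algebra_simps)
   moreover have "w - of_int e' * y \<in> carrier OF"
    using c(2) y unfolding OF_simps by (intro OFs.diff_mem OFs.mult_mem OFs.of_int_mem)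
   moreover have "\<exists>i<length xs. \<not> int p dvd c i"
    using c(1) \<open>int p dvd e\<close> by (auto simp: less_Suc_eq e_def)
   ultimately have "dep xs" unfolding dep_def by blast
   thus False using xs(1) by (simp add: P_def)
  qed
  hence "coprime (int p) e" using p by (intro prime_imp_coprime) auto
  then obtain u v where uv: "u * int p + v * e = 1" using bezout_int[of "int p" e] by auto
  define t where "t = restrict (\<lambda>i. (- v * c i) mod int p) {..<length xs}"
  define s where "s = (?L t)"
  have t: "- v * c i = int p * ((- v * c i) div int p) + t i" if "i < length xs" for i
   using that by (simp add: t_def)
  define z where "z = (\<Sum>i<length xs. of_int ((- v * c i) div int p) * xs ! i)"
  have "of_int (- v) * (?L c) = (\<Sum>i<length xs. of_int (- v * c i) * xs ! i)"
   by (simp add: sum_distrib_left mult.assoc)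
  also have "... = (\<Sum>i<length xs. of_nat p * (of_int ((- v * c i) div int p) * xs ! i) + of_int (t i) * xs ! i)"
   by (intro sum.cong refl, subst t) (simp_all add: algebra_simps)
  also have "... = of_nat p * z + s" by (simp add: z_def s_def sum.distrib sum_distrib_left)
  finally have 1: "of_int (- v) * (?L c) = of_nat p * z + s" .
  have "of_int (v * e) = (1 - of_int u * of_nat p :: 'k)"
  proof -
   have "v * e = 1 - u * int p" using uv by simp
   thus ?thesis by simp
  qed
  hence "y = of_int (v * e) * y + of_int u * of_nat p * y" by (simp only: left_diff_distrib mult_1) simp
  also have "of_int (v * e) * y = of_int v * (of_nat p * w - (?L c))"
  proof -
   show ?thesis using split by (simp add: e_def[symmetric] eq_diff_eq add.commute)
  qed
  also have "... = of_int v * of_nat p * w + of_nat p * z + s"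
  proof -
   have "of_int v * (of_nat p * w - B) = of_int v * of_nat p * w + of_int (- v) * B" for B :: 'k
    by (simp add: algebra_simps)
   thus ?thesis by (simp only: 1 add.assoc)
  qed
  finally have "y - s = of_nat p * (of_int v * w + z + of_int u * y)" by (simp add: algebra_simps)
  moreover have "of_int v * w + z + of_int u * y \<in> carrier OF"
   using lin[of "\<lambda>i. (- v * c i) div int p"] c(2) y unfolding z_def[symmetric] OF_simps
   by (intro OFs.add_mem OFs.mult_mem OFs.of_int_mem)
  moreover have "s \<in> S" unfolding S_def s_def
   using p0 by (intro image_eqI[of _ _ t]) (auto simp: t_def)
  ultimately show "\<exists>s\<in>S. \<exists>w\<in>carrier OF. y - s = of_nat p * w" by blast
 qed
qed

end

context num_field
begin

lemma mem_alg_closure_inI: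
 assumes h: "h \<in> polys F" "h \<noteq> 0" "poly h x = 0"
 shows "x \<in> alg_closure_in F"
proof -
 interpret A: field "ambient :: 'k ring" by (rule field_ambient)
 have ev: "A.eval (rev (coeffs g)) x = poly g x" for g
 proof (induction g)
  case 0
  thus ?case by (simp add: ambient_simps)
 next
  case (pCons a g)
  show ?case
  proof (cases "g = 0 \<and> a = 0")
   case False
   hence "coeffs (pCons a g) = a # coeffs g" by (auto simp: cCons_def)
   thus ?thesis using pCons A.eval_append_aux[of "rev (coeffs g)" a x] by (simp add: ambient_simps)
  qed (simp add: ambient_simps)
 qed
 have "A.algebraic F x"
 proof (rule A.algebraicI[unfolded over_def])
  have ne: "coeffs h \<noteq> []" using h(2) by simp
  have "set (coeffs h) \<subseteq> F" using h(1) zero_mem by (auto simp: polys_def coeffs_def)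
  moreover have "hd (rev (coeffs h)) \<noteq> 0" using ne h(2) by (simp add: hd_rev last_coeffs_eq_coeff_degree)
  ultimately show "rev (coeffs h) \<in> carrier (F [X]\<^bsub>ambient\<^esub>)"
   unfolding univ_poly_def polynomial_def by (simp add: ambient_simps)
  show "rev (coeffs h) \<noteq> []" using ne by simp
  show "A.eval (rev (coeffs h)) x = \<zero>\<^bsub>ambient\<^esub>" by (simp add: ev h(3) ambient_simps)
 qed
 thus ?thesis by (simp add: alg_closure_in_def)
qed

text \<open>The generated field is the simple extension, finite-dimensional since
  \<open>\<alpha>\<close> is algebraic, and the powers of any of its elements are dependent over
  \<open>F\<close>.\<close>

lemma adjoin_degree_root:
 assumes "\<alpha> \<in> alg_closure_in F"
 shows "adjoin_degree F \<alpha> > 0"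
  "x \<in> adjoin F \<alpha> ==> \<exists>h\<in>polys F. h \<noteq> 0 \<and> degree h \<le> adjoin_degree F \<alpha> \<and> poly h x = 0"
proof -
 interpret A: field "ambient :: 'k ring" by (rule field_ambient)
 have sf: "subfield F (ambient :: 'k ring)" using closed_subfield_axioms by (simp add: subfield_ambient_iff)
 have carr: "\<alpha> \<in> carrier ambient" by (simp add: ambient_simps)
 have alg: "(A.algebraic over F) \<alpha>" using assms by (simp add: alg_closure_in_def over_def)
 define G where "G = generate_field ambient (insert \<alpha> F)"
 have G: "subfield G ambient" unfolding G_def by (rule A.generate_field_is_subfield) (simp add: ambient_simps)
 have GF: "insert \<alpha> F \<subseteq> G" unfolding G_def by (auto intro: generate_field.incl)
 have S: "subfield (A.simple_extension F \<alpha>) ambient" using A.simple_extension_is_subfield[OF sf carr] alg by simp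
 have "G = A.simple_extension F \<alpha>"
 proof (rule antisym)
  show "G \<subseteq> A.simple_extension F \<alpha>" unfolding G_def by (rule A.generate_field_min_subfield1[OF _ S])
    (use A.simple_extension_incl[OF _ carr] A.simple_extension_mem[OF subfieldE(1)[OF sf] carr] in \<open>auto simp: ambient_simps\<close>)
  show "A.simple_extension F \<alpha> \<subseteq> G"
   by (rule A.simple_extension_subring_incl[OF subfieldE(1)[OF G]]) (use GF in auto)
 qed
 hence dim: "A.dimension (adjoin_degree F \<alpha>) F G"
  using A.finite_dimension_simple_extension[OF sf carr] alg A.finite_dimensionE[OF sf] by (simp add: adjoin_degree_def G_def over_def)
 have cG: "closed_subfield G" using G by (simp add: subfield_ambient_iff)
 have sub: "adjoin F \<alpha> \<subseteq> G" using cG GF by (intro adjoin_subset) (auto simp: closed_subfield_def)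
 have root: "\<exists>h\<in>polys F. h \<noteq> 0 \<and> degree h \<le> adjoin_degree F \<alpha> \<and> poly h x = 0" if "x \<in> G" for x
  using closed_subring.power_mem[OF closed_subfield.axioms(1)[OF cG] that]
  by (intro dimension_imp_root[OF closed_subfield_axioms dim])
 show "x \<in> adjoin F \<alpha> ==> \<exists>h\<in>polys F. h \<noteq> 0 \<and> degree h \<le> adjoin_degree F \<alpha> \<and> poly h x = 0"
  using root sub by blast
 show "adjoin_degree F \<alpha> > 0"
 proof (rule ccontr)
  assume "\<not> adjoin_degree F \<alpha> > 0"
  moreover have "1 \<in> G" using closed_subring.one_mem[OF closed_subfield.axioms(1)[OF cG]] .
  from root[OF this] obtain h :: "'k poly" where "h \<noteq> 0 \<and> degree h \<le> adjoin_degree F \<alpha> \<and> poly h 1 = 0"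
   by metis
  ultimately show False using degree_pos_if_root[of h 1] by auto
 qed
qed

lemma algebraic_mem_alg_closure_in:
 assumes "algebraic x"
 shows "x \<in> alg_closure_in F"
 using algebraic_root_over_subring[OF closed_subring_axioms assms] mem_alg_closure_inI by blast

text \<open>A prime above \<open>p\<close> contains all multiples of \<open>p\<close>, so it is
  determined by its trace on a finite set \<open>S\<close> of representatives modulo
  \<open>p\<close>.\<close>

lemma finite_places_above:
 assumes p: "Factorial_Ring.prime p"
 shows "finite (places_above F p)"
proof -
 obtain S where S: "finite S" "S \<subseteq> carrier OF" "\<And>y. y \<in> carrier OF ==> \<exists>s\<in>S. \<exists>w\<in>carrier OF. y - s = of_nat p * w"
  using finite_mod_prime[OF p] by blast
 have P: "P = {y \<in> carrier OF. \<exists>s\<in>P \<inter> S. \<exists>w\<in>carrier OF. y - s = of_nat p * w}" if P: "P \<in> places_above F p" for P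
 proof -
  interpret P: primeideal P OF using P by (simp add: places_above_def)
  have pw: "of_nat p * w \<in> P" if "w \<in> carrier OF" for w
   using P.I_r_closed[of "of_nat p" w] that P by (simp add: places_above_def OF_simps)
  have PO: "P \<subseteq> carrier OF" using P.Icarr by blast
  have Padd: "x + y \<in> P" if "x \<in> P" "y \<in> P" for x y using additive_subgroup.a_closed[OF P.additive_subgroup_axioms that] by (simp add: OF_simps)
  have Pneg: "- x \<in> P" if "x \<in> P" for x using additive_subgroup.a_inv_closed[OF P.additive_subgroup_axioms that] OF_a_inv[of x] PO that by auto
  show ?thesis
  proof (intro equalityI subsetI)
   fix y assume y: "y \<in> P"
   then obtain s w where s: "s \<in> S" "w \<in> carrier OF" "y - s = of_nat p * w" using S(3) PO by blast
   have "s \<in> P" using s(3) Padd[OF y Pneg[OF pw[OF s(2)]]] by (simp add: algebra_simps)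
   thus "y \<in> {y \<in> carrier OF. \<exists>s\<in>P \<inter> S. \<exists>w\<in>carrier OF. y - s = of_nat p * w}" using s y PO by blast
  next
   fix y assume "y \<in> {y \<in> carrier OF. \<exists>s\<in>P \<inter> S. \<exists>w\<in>carrier OF. y - s = of_nat p * w}"
   then obtain s w where s: "s \<in> P" "w \<in> carrier OF" "y - s = of_nat p * w" by blast
   thus "y \<in> P" using Padd[OF s(1) pw[OF s(2)]] by (simp add: algebra_simps)
  qed
 qed
 have "inj_on (\<lambda>P. P \<inter> S) (places_above F p)"
 proof (rule inj_onI)
  fix P P' assume PP: "P \<in> places_above F p" "P' \<in> places_above F p" "P \<inter> S = P' \<inter> S"
  have "P = {y \<in> carrier OF. \<exists>s\<in>P' \<inter> S. \<exists>w\<in>carrier OF. y - s = of_nat p * w}"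
   by (subst P[OF PP(1)]) (simp only: PP(3))
  also have "... = P'" by (rule P[OF PP(2), symmetric])
  finally show "P = P'" .
 qed
 moreover have "(\<lambda>P. P \<inter> S) ` places_above F p \<subseteq> Pow S" by blast
 ultimately show ?thesis using S(1) by (meson finite_Pow_iff inj_on_finite)
qed

end

section \<open>The valuation on \<open>F\<close> and the ramification index\<close>

locale num_field_prime = num_field F + alg_prime Q p for F Q :: "'k :: field_char_0 set" and p
begin

definition P :: "'k set" where "P = Q \<inter> F"

lemma P_place: "P \<in> places_above F p"
proof -
 interpret R: cring OF by (rule cring_OF)
 have "ideal P OF"
 proof (rule idealI[OF R.ring_axioms])
  show "subgroup P (add_monoid OF)"
  proof (rule R.add.subgroupI)
   show "P \<subseteq> carrier OF" using integral by (auto simp: P_def OF_simps)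
   show "P \<noteq> {}" using zero zero_mem by (auto simp: P_def)
   fix a b assume ab: "a \<in> P" "b \<in> P"
   have "a \<in> carrier OF" using ab integral by (auto simp: P_def OF_simps)
   thus "\<ominus>\<^bsub>OF\<^esub> a \<in> P" using ab by (simp add: OF_a_inv P_def uminus uminus_mem)
   show "a \<oplus>\<^bsub>OF\<^esub> b \<in> P" using ab by (auto simp: P_def OF_simps intro: add add_mem)
  qed
  fix a x assume "a \<in> P" "x \<in> carrier OF"
  thus "x \<otimes>\<^bsub>OF\<^esub> a \<in> P" "a \<otimes>\<^bsub>OF\<^esub> x \<in> P"
   by (auto simp: P_def OF_simps intro: absorb absorb_right mult_mem)
 qed
 moreover have "carrier OF \<noteq> P" using one_notin OFs.one_mem by (auto simp: P_def OF_simps)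
 ultimately have "primeideal P OF"
  by (rule primeidealI[OF _ cring_OF]) (use prime_ideal in \<open>auto simp: P_def OF_simps\<close>)
 thus ?thesis using p_mem of_nat_mem by (simp add: places_above_def P_def)
qed

sublocale PI: primeideal P OF using P_place by (simp add: places_above_def)

text \<open>The powers of \<open>a\<close> repeat modulo \<open>p\<close>; the smaller of two
  congruent powers is outside \<open>Q\<close> and can be cancelled.\<close>

lemma unit_mod_P:
 assumes a: "a \<in> carrier OF" "a \<notin> Q"
 shows "\<exists>k>0. a ^ k - 1 \<in> Q"
proof -
 obtain S where S: "finite S" "S \<subseteq> carrier OF" "\<And>y. y \<in> carrier OF ==> \<exists>s\<in>S. \<exists>w\<in>carrier OF. y - s = of_nat p * w"
  using finite_mod_prime[OF prime_p] by blast
 have ai_a: "algebraic_int a" using a by (simp add: OF_simps)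
 have "\<exists>s\<in>S. a ^ n - s \<in> Q" for n
 proof -
  have "a ^ n \<in> carrier OF" using a OFs.power_mem[of a n] by (simp add: OF_simps)
  then obtain s w where "s \<in> S" "w \<in> carrier OF" "a ^ n - s = of_nat p * w" using S(3) by blast
  thus ?thesis using absorb_right[OF p_mem, of w] by (auto simp: OF_simps intro!: bexI[of _ s])
 qed
 then obtain s where s: "\<And>n. s n \<in> S" "\<And>n. a ^ n - s n \<in> Q" by metis
 have "\<not> inj s" using S(1) s(1) finite_subset[of "range s" S] finite_imageD[of s UNIV] by (metis image_subsetI infinite_UNIV_nat)
 then obtain i j where ij: "i < j" "s i = s j" by (metis injI linorder_neqE_nat)
 have "(a ^ j - s j) - (a ^ i - s i) \<in> Q" by (intro diff s)
 hence "a ^ i * (a ^ (j - i) - 1) \<in> Q" using ij by (simp add: right_diff_distrib flip: power_add)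
 moreover have "a ^ i \<notin> Q" using power_mem_iff[OF ai_a, of i] a(2) one_notin by (cases "i = 0") auto
 ultimately have "a ^ (j - i) - 1 \<in> Q" using prime_ideal ai ai_a by meson
 thus ?thesis using ij by (intro exI[of _ "j - i"]) auto
qed

lemma v_denominators:
 "\<exists>N>0. \<forall>x\<in>F. x \<noteq> 0 --> real N * v x \<in> \<int>"
proof (intro exI[of _ "fact deg :: nat"] conjI ballI impI)
 show "(fact deg :: nat) > 0" by simp
 fix x assume x: "x \<in> F" "x \<noteq> 0"
 obtain h where h: "h \<in> polys \<rat>" "h \<noteq> 0" "degree h \<le> deg" "poly h x = 0"
  using root_over_Rats[OF x(1)] by blast
 have "\<exists>i\<in>{1..degree h}. \<exists>y\<in>\<rat>. y \<noteq> 0 \<and> real i * v x = v y"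
  by (rule root_imp_v_multiple[OF closed_subfield_Rats _ algebraic_mem[OF x(1)] x(2) h(1,2,4)])
   (rule rat_imp_algebraic)
 then obtain i y where i: "i \<in> {1..degree h}" "y \<in> \<rat>" "y \<noteq> 0" "real i * v x = v y" by blast
 have "i dvd fact deg" using i(1) h(3) by (intro dvd_fact) auto
 then obtain m where "fact deg = i * m" by auto
 hence "real (fact deg) * v x = real m * v y" unfolding i(4)[symmetric] by (simp del: of_nat_fact)
 thus "real (fact deg) * v x \<in> \<int>" using v_Rats[OF i(2,3)] by simp
qed

text \<open>The values on \<open>F\<close> have a common denominator, so there is a least positive
  one, and division with remainder shows that it generates the value group. As
  \<open>v p = 1\<close> is a value, the generator has the form \<open>1 / e'\<close>.\<close>

lemma uniformiser_exists:
 "\<exists>e'>0. (\<exists>\<pi>\<in>F. \<pi> \<noteq> 0 \<and> v \<pi> = 1 / real e') \<and> (\<forall>x\<in>F. x \<noteq> 0 --> real e' * v x \<in> \<int>)"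
proof -
 obtain N where N: "N > 0" "\<And>x. x \<in> F ==> x \<noteq> 0 ==> real N * v x \<in> \<int>" using v_denominators by blast
 define A where "A n \<longleftrightarrow> n > 0 \<and> (\<exists>x\<in>F. x \<noteq> 0 \<and> v x = real n / real N)" for n
 have "A N" unfolding A_def using N(1) p_nz of_nat_mem[of p] v_p by (intro conjI bexI[of _ "of_nat p"]) auto
 define n where "n = (LEAST n. A n)"
 have n: "A n" "\<And>m. A m ==> n \<le> m" unfolding n_def using \<open>A N\<close> by (auto intro: LeastI Least_le)
 obtain \<pi> where \<pi>: "\<pi> \<in> F" "\<pi> \<noteq> 0" "v \<pi> = real n / real N" and n0: "n > 0" using n(1) by (auto simp: A_def)
 have mult: "\<exists>k::int. v x = real_of_int k * v \<pi>" if x: "x \<in> F" "x \<noteq> 0" for x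
 proof -
  obtain j where j: "real N * v x = real_of_int j" using N(2)[OF x] by (auto elim: Ints_cases)
  define k where "k = j div int n"
  define y where "y = x * (if k \<ge> 0 then inverse (\<pi> ^ nat k) else \<pi> ^ nat (- k))"
  have vy: "v y = v x - real_of_int k * v \<pi>" and y: "y \<in> F" "y \<noteq> 0"
   unfolding y_def using x \<pi>(1,2) algebraic_mem
   by (auto simp: v_mult v_inverse v_power al intro!: mult_mem inverse_mem power_mem)
  have "real N * v y = real_of_int (j mod int n)"
   using N(1) j by (simp add: vy \<pi>(3) k_def right_diff_distrib minus_div_mult_eq_mod[symmetric])
  hence vy': "v y = real_of_int (j mod int n) / real N" using N(1) by (simp add: field_simps)
  have "j mod int n = 0"
  proof (rule ccontr)
   assume "j mod int n \<noteq> 0"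
   hence pos: "j mod int n > 0" using n0 pos_mod_sign[of "int n" j] by linarith
   hence "v y = real (nat (j mod int n)) / real N" using vy' by simp
   hence "A (nat (j mod int n))" unfolding A_def using y pos by (intro conjI bexI[of _ y]) simp_all
   hence "n \<le> nat (j mod int n)" by (rule n(2))
   thus False using n0 pos_mod_bound[of "int n" j] by linarith
  qed
  thus ?thesis using vy vy' by (intro exI[of _ k]) simp
 qed
 obtain k where k: "1 = real_of_int k * v \<pi>" using mult[of "of_nat p"] of_nat_mem p_nz v_p by auto
 have vpi: "v \<pi> > 0" using \<pi>(3) n0 N(1) by simp
 hence "k > 0" using k by (smt (verit) of_int_le_0_iff mult_nonpos_nonneg)
 hence v\<pi>: "v \<pi> = 1 / real (nat k)" using k by (simp add: field_simps)
 show ?thesis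
 proof (intro exI[of _ "nat k"] conjI ballI impI)
  show "nat k > 0" using \<open>k > 0\<close> by simp
  show "\<exists>\<pi>\<in>F. \<pi> \<noteq> 0 \<and> v \<pi> = 1 / real (nat k)" using \<pi> v\<pi> by blast
  fix x assume "x \<in> F" "x \<noteq> 0"
  then obtain l where "v x = real_of_int l * v \<pi>" using mult by blast
  thus "real (nat k) * v x \<in> \<int>" using \<open>k > 0\<close> by (simp add: v\<pi>)
 qed
qed

definition pw :: "nat => 'k set" where "pw e = P [^]\<^bsub>ideals_set OF\<^esub> e"

lemma pw_simps: "pw 0 = carrier OF" "pw (Suc e) = ideal_prod OF (pw e) P"
 by (simp_all add: pw_def nat_pow_def ideals_set_def)

lemma ideal_pw: "ideal (pw e) OF"
proof (induction e)
 case 0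
 show ?case using PI.oneideal by (simp add: pw_simps)
next
 case (Suc e)
 thus ?case unfolding pw_simps by (intro PI.ideal_prod_is_ideal PI.is_ideal)
qed

lemma pw_Suc_subset: "pw (Suc e) \<subseteq> pw e"
 using PI.ideal_prod_inter[OF ideal_pw PI.is_ideal] by (auto simp: pw_simps)

lemma pw_mono: "i \<le> j ==> pw j \<subseteq> pw i"
 by (rule lift_Suc_antimono_le[of pw]) (rule pw_Suc_subset)

lemma pw_add: "x \<in> pw e ==> y \<in> pw e ==> x + y \<in> pw e"
 using additive_subgroup.a_closed[OF ideal.axioms(1)[OF ideal_pw]] by (simp add: OF_simps)

lemma pw_absorb: "x \<in> pw e ==> a \<in> carrier OF ==> a * x \<in> pw e"
 using ideal.I_l_closed[OF ideal_pw] by (simp add: OF_simps)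

lemma pw_mult: "x \<in> pw e ==> y \<in> P ==> x * y \<in> pw (Suc e)"
 unfolding pw_simps using ideal_prod.prod[of x "pw e" y P OF] by (simp add: OF_simps)

lemma pw_power: "x \<in> P ==> x ^ e \<in> pw e"
 by (induction e) (auto simp: pw_simps(1) OF_simps OFs.one_mem mult.commute[of x] intro: pw_mult one_mem)

text \<open>At \<open>Q\<close> one has \<open>p = u * b ^ e'\<close> with \<open>b\<close> in
  \<open>P\<close> and a unit \<open>u\<close>, but in the ring only \<open>s * p\<close> is seen to
  lie in the \<open>e'\<close>-th power of \<open>P\<close>, for some \<open>s\<close> outside
  \<open>Q\<close>. Since \<open>1 - s ^ k\<close> lies in \<open>P\<close> for some
  \<open>k\<close>, the identity \<open>p = p * (1 - s ^ k) + s ^ k * p\<close> raises the exponent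
  of \<open>P\<close> one step at a time.\<close>

lemma p_in_pw:
 assumes \<pi>: "\<pi> \<in> F" "\<pi> \<noteq> 0" "v \<pi> = 1 / real e'" and e': "e' > 0"
 shows "of_nat p \<in> pw e'"
proof -
 have alg: "algebraic \<pi>" using \<pi>(1) by (rule algebraic_mem)
 have "\<pi> \<in> \<O>" using vunit_iff(3)[OF alg \<pi>(2)] \<pi>(3) by simp
 then obtain t where t: "t \<in> F" "algebraic_int t" "t \<notin> Q" "algebraic_int (\<pi> * t)"
  using vring_denominator[OF _ alg closed_subring_axioms \<pi>(1)] by blast
 have tu: "v t = 0" "t \<noteq> 0" using t vunit_iff(1)[of t] nz_if_notin integral_vring vmax_integral_iff by (auto simp: vunit_def)
 define b where "b = \<pi> * t"
 have b: "b \<in> F" "algebraic_int b" "b \<noteq> 0" "v b = 1 / real e'"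
  using t \<pi> tu alg mult_mem by (auto simp: b_def v_mult)
 have bP: "b \<in> P" using b vunit_iff(2)[of b] vmax_integral_iff[of b] e' by (auto simp: P_def)
 define u where "u = of_nat p / b ^ e'"
 have uF: "u \<in> F" unfolding u_def by (intro divide_mem power_mem of_nat_mem b)
 have unz: "u \<noteq> 0" using p_nz b(3) by (simp add: u_def)
 have "v u = 0" unfolding u_def using b e' p_nz by (simp add: v_divide v_p v_power al algebraic_int_imp_algebraic)
 hence "u \<in> \<O>" using vunit_iff(3)[OF algebraic_mem[OF uF] unz] by simp
 then obtain s where s: "s \<in> F" "algebraic_int s" "s \<notin> Q" "algebraic_int (u * s)"
  using vring_denominator[OF _ algebraic_mem[OF uF] closed_subring_axioms uF] by blast
 have "s * of_nat p = (u * s) * b ^ e'" using b(3) by (simp add: u_def)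
 also have "... \<in> pw e'" using s uF mult_mem by (intro pw_absorb pw_power bP) (auto simp: OF_simps)
 finally have sp: "s * of_nat p \<in> pw e'" .
 obtain k where k: "k > 0" "s ^ k - 1 \<in> Q" using unit_mod_P[of s] s by (auto simp: OF_simps)
 define m where "m = 1 - s ^ k"
 have mP: "m \<in> P" using uminus[OF k(2)] s by (auto simp: P_def m_def intro: mem_intros)
 have skp: "s ^ k * of_nat p \<in> pw e'"
 proof -
  have "s ^ (k - 1) * (s * of_nat p) \<in> pw e'"
   using s OFs.power_mem[of s "k - 1"] by (intro pw_absorb sp) (auto simp: OF_simps)
  moreover have "s ^ k = s ^ (k - 1) * s" using k(1) by (cases k) auto
  ultimately show ?thesis by (simp add: mult.assoc)
 qed
 have "of_nat p \<in> pw j" if "j \<le> e'" for j using that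
 proof (induction j)
  case 0
  show ?case using OFs.of_nat_mem by (simp add: pw_simps OF_simps)
 next
  case (Suc j)
  have "of_nat p * m \<in> pw (Suc j)" using Suc by (intro pw_mult mP) auto
  moreover have "s ^ k * of_nat p \<in> pw (Suc j)" using skp pw_mono[OF Suc.prems] by blast
  ultimately have "of_nat p * m + s ^ k * of_nat p \<in> pw (Suc j)" by (rule pw_add)
  thus ?case by (simp add: m_def algebra_simps)
 qed
 thus ?thesis by simp
qed

lemma pw_imp_vge:
 assumes "\<forall>x\<in>F. x \<noteq> 0 --> real e' * v x \<in> \<int>" "e' > 0" "x \<in> pw e"
 shows "vge (real e / real e') x"
 using assms(3)
proof (induction e arbitrary: x)
 case 0
 thus ?case using vge_integral[of x] by (simp add: pw_simps OF_simps)
next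
 case (Suc e)
 have carr: "pw e \<subseteq> carrier OF" using ideal.Icarr[OF ideal_pw] by blast
 have vP: "vge (1 / real e') y" if "y \<in> P" for y
 proof (cases "y = 0")
  case False
  have y: "y \<in> F" "y \<in> Q" using that by (auto simp: P_def)
  have "v y > 0" using y integral[of y] vunit_iff(2)[of y] vmax_integral_iff[of y] False by auto
  moreover obtain j where j: "real e' * v y = real_of_int j" using assms(1) y False by (auto elim: Ints_cases)
  ultimately have "j \<ge> 1" using assms(2) by (metis int_one_le_iff_zero_less mult_pos_pos of_int_0_less_iff of_nat_0_less_iff)
  hence "1 \<le> real e' * v y" by (simp add: j)
  thus ?thesis using assms(2) by (simp add: vge_def field_simps)
 qed simp
 have "x \<in> ideal_prod OF (pw e) P" using Suc.prems by (simp add: pw_simps)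
 hence "algebraic_int x \<and> vge (real (Suc e) / real e') x"
 proof (induction rule: ideal_prod.induct)
  case (prod i j)
  have ij: "algebraic_int i" "algebraic_int j" using prod carr integral by (auto simp: OF_simps P_def)
  have "vge (real e / real e' + 1 / real e') (i * j)"
   using ij by (intro vge_mult Suc.IH vP prod) auto
  thus ?case using ij ai by (simp add: OF_simps add_divide_distrib add.commute)
 next
  case (sum s1 s2)
  thus ?case using ai by (auto simp: OF_simps intro: vge_add)
 qed
 thus ?case by blast
qed

text \<open>The index \<open>e'\<close> of the value group satisfies the condition under the
  \<open>GREATEST\<close> by \<open>p_in_pw\<close>, and by \<open>pw_imp_vge\<close> no larger
  number does, so the \<open>GREATEST\<close> is well behaved.\<close>

lemma v_ramification:
 "\<exists>e'>0. e' \<le> ramification_index F p P \<and> (\<forall>x\<in>F. x \<noteq> 0 --> real e' * v x \<in> \<int>)"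
proof -
 obtain e' \<pi> where e': "e' > 0" "\<pi> \<in> F" "\<pi> \<noteq> 0" "v \<pi> = 1 / real e'" "\<forall>x\<in>F. x \<noteq> 0 --> real e' * v x \<in> \<int>"
  using uniformiser_exists by blast
 define R where "R e \<longleftrightarrow> PIdl\<^bsub>OF\<^esub> (of_nat p) \<subseteq> P [^]\<^bsub>ideals_set OF\<^esub> (e :: nat)" for e
 have "R e'" unfolding R_def pw_def[symmetric] cgenideal_def
  using pw_absorb[OF p_in_pw[OF e'(2-4,1)]] by (auto simp: OF_simps)
 moreover have "e \<le> e'" if "R e" for e
 proof -
  have "of_nat p \<in> PIdl\<^bsub>OF\<^esub> (of_nat p)"
   unfolding cgenideal_def using OFs.one_mem by (auto simp: OF_simps intro!: exI[of _ 1])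
  hence "of_nat p \<in> pw e" using that by (auto simp: R_def pw_def)
  hence "vge (real e / real e') (of_nat p)" by (rule pw_imp_vge[OF e'(5,1)])
  thus ?thesis using p_nz e'(1) by (simp add: vge_def v_p)
 qed
 ultimately have "e' \<le> (GREATEST e. R e)" by (rule Greatest_le_nat[where b = e'])
 thus ?thesis using e' by (auto simp: ramification_index_def R_def)
qed

end

section \<open>Residue fields and residue degrees\<close>

lemma (in domain) finite_domain_is_field:
 assumes "finite (carrier R)"
 shows "field R"
proof (rule cring_fieldI)
 show "Units R = carrier R - {\<zero>}"
 proof (intro equalityI subsetI)
  fix x assume x: "x \<in> Units R"
  then obtain y where y: "y \<in> carrier R" "x \<otimes> y = \<one>" unfolding Units_def by blast
  have "x \<noteq> \<zero>" using y l_null[OF y(1)] zero_not_one by metis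
  thus "x \<in> carrier R - {\<zero>}" using Units_closed[OF x] by blast
 next
  fix x assume x: "x \<in> carrier R - {\<zero>}"
  have "inj_on (\<lambda>y. x \<otimes> y) (carrier R)" using x by (intro inj_onI) (simp add: m_lcancel)
  hence "(\<lambda>y. x \<otimes> y) ` carrier R = carrier R" using x by (intro endo_inj_surj assms) auto
  then obtain y where y: "y \<in> carrier R" "x \<otimes> y = \<one>" using one_closed by (metis imageE)
  thus "x \<in> Units R" unfolding Units_def using x m_comm[of x y] by auto
 qed
qed

lemma (in ring) finite_carrier_imp_finite_dimension:
 assumes K: "subfield K R" and fin: "finite (carrier R)"
 shows "finite_dimension K (carrier R)"
proof -
 obtain xs where xs: "set xs = carrier R" using fin finite_list by blast
 have "carrier R \<subseteq> Span K xs" using Span_base_incl[OF K, of xs] xs by simp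
 moreover have "Span K xs \<subseteq> carrier R" using Span_in_carrier[OF subfieldE(3)[OF K], of xs] xs by simp
 ultimately show ?thesis using Span_finite_dimension[OF K, of xs] xs by simp
qed

context num_field
begin

lemma finite_residue_ring:
 assumes p: "Factorial_Ring.prime p" and P: "P \<in> places_above F p"
 shows "finite (carrier (OF Quot P))"
proof -
 interpret P: primeideal P OF using P by (simp add: places_above_def)
 obtain S where S: "finite S" "S \<subseteq> carrier OF" "\<And>y. y \<in> carrier OF ==> \<exists>s\<in>S. \<exists>w\<in>carrier OF. y - s = of_nat p * w"
  using finite_mod_prime[OF p] by blast
 have "carrier (OF Quot P) \<subseteq> a_r_coset OF P ` S"
 proof
  fix x assume "x \<in> carrier (OF Quot P)"
  then obtain y where y: "y \<in> carrier OF" "x = a_r_coset OF P y"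
   unfolding FactRing_def A_RCOSETS_def' by auto
  then obtain s w where s: "s \<in> S" "w \<in> carrier OF" "y - s = of_nat p * w" using S(3) by blast
  have sO: "s \<in> carrier OF" using s(1) S(2) by blast
  have "of_nat p * w \<in> P" using P.I_r_closed[of "of_nat p" w] s(2) P by (simp add: places_above_def OF_simps)
  moreover have "y \<ominus>\<^bsub>OF\<^esub> s = y - s" using sO by (simp add: a_minus_def OF_a_inv OF_simps)
  ultimately show "x \<in> a_r_coset OF P ` S" using P.quotient_eq_iff_same_a_r_cos[OF P.is_ideal y(1) sO] s(3) y(2) s(1) by simp
 qed
 thus ?thesis using S(1) finite_subset by blast
qed

text \<open>A residue degree 0 would make the least common multiple of all of them 0.\<close>

lemma residue_degree_pos:
 assumes p: "Factorial_Ring.prime p" and P: "P \<in> places_above F p"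
 shows "residue_degree F P > 0"
proof (rule ccontr)
 assume "\<not> residue_degree F P > 0"
 hence f0: "residue_degree F P = 0" by simp
 interpret P: primeideal P OF using P by (simp add: places_above_def)
 interpret D: domain "OF Quot P" by (rule P.quotient_is_domain)
 interpret D: field "OF Quot P" by (rule D.finite_domain_is_field[OF finite_residue_ring[OF p P]])
 have K0: "subfield (generate_field (OF Quot P) {}) (OF Quot P)" by (rule D.generate_field_is_subfield) simp
 have "D.dimension (residue_degree F P) (generate_field (OF Quot P) {}) (carrier (OF Quot P))"
  using D.finite_dimensionE[OF K0 D.finite_carrier_imp_finite_dimension[OF K0 finite_residue_ring[OF p P]]]
  by (simp add: residue_degree_def over_def Let_def)
 hence "carrier (OF Quot P) = {\<zero>\<^bsub>OF Quot P\<^esub>}" unfolding f0 by (rule D.dimension_zero[OF K0])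
 thus False using D.zero_not_one by blast
qed

end

context num_field_prime
begin

abbreviation residue :: "'k => 'k set" where "residue \<equiv> a_r_coset OF P"
abbreviation RF :: "'k set ring" where "RF \<equiv> OF Quot P"

sublocale RF: domain RF by (rule PI.quotient_is_domain)
sublocale RH: ring_hom_ring OF RF residue by (rule PI.rcos_ring_hom_ring)

lemma P_iff: "a \<in> carrier OF ==> a \<in> P \<longleftrightarrow> a \<in> Q"
 by (auto simp: P_def OF_simps)

lemma residue_eq_iff:
 assumes "a \<in> carrier OF" "b \<in> carrier OF"
 shows "residue a = residue b \<longleftrightarrow> a - b \<in> Q"
proof -
 have ab: "a - b \<in> carrier OF" using OFs.diff_mem assms by (simp add: OF_simps)
 have "residue a = residue b \<longleftrightarrow> a - b \<in> P"
  using assms PI.quotient_eq_iff_same_a_r_cos[OF PI.is_ideal assms] by (simp add: a_minus_def OF_a_inv OF_simps)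
 thus ?thesis using P_iff[OF ab] by simp
qed

lemma residue_zero_iff: "a \<in> carrier OF ==> residue a = \<zero>\<^bsub>RF\<^esub> \<longleftrightarrow> a \<in> Q"
 using residue_eq_iff[of a 0] RH.hom_zero OFs.zero_mem by (simp add: OF_simps)

lemma residue_hom:
 assumes "a \<in> carrier OF" "b \<in> carrier OF"
 shows "residue (a * b) = residue a \<otimes>\<^bsub>RF\<^esub> residue b" "residue (a + b) = residue a \<oplus>\<^bsub>RF\<^esub> residue b"
 using RH.hom_mult[OF assms] RH.hom_add[OF assms] by (simp_all add: OF_simps)

lemma carrier_RF: "carrier RF = residue ` carrier OF"
 unfolding FactRing_def A_RCOSETS_def' by (simp add: UNION_singleton_eq_range)

lemma residue_power: "a \<in> carrier OF ==> residue (a ^ n) = residue a [^]\<^bsub>RF\<^esub> (n :: nat)"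
proof (induction n)
 case 0
 show ?case using RH.hom_one by (simp add: OF_simps)
next
 case (Suc n)
 hence "a ^ n \<in> carrier OF" using OFs.power_mem[of a n] by (simp add: OF_simps)
 thus ?case using Suc residue_hom(1)[of "a ^ n" a] by (simp add: mult.commute)
qed

lemma finite_RF: "finite (carrier RF)"
 by (rule finite_residue_ring[OF prime_p P_place])

lemma residue_inverse:
 assumes "a \<in> carrier OF" "a \<notin> Q"
 shows "\<exists>k. residue a \<otimes>\<^bsub>RF\<^esub> residue (a ^ k) = \<one>\<^bsub>RF\<^esub>"
proof -
 obtain k where k: "k > 0" "a ^ k - 1 \<in> Q" using unit_mod_P[OF assms] by blast
 have pow: "a ^ n \<in> carrier OF" for n using assms OFs.power_mem[of a n] by (simp add: OF_simps)
 have "residue (a * a ^ (k - 1)) = residue 1"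
  using k residue_eq_iff[OF pow[of k] pow[of 0]] by (cases k) auto
 hence "residue a \<otimes>\<^bsub>RF\<^esub> residue (a ^ (k - 1)) = \<one>\<^bsub>RF\<^esub>"
  using residue_hom(1)[OF assms(1) pow] RH.hom_one by (simp add: OF_simps)
 thus ?thesis by blast
qed

lemma field_RF: "field RF"
 by (rule RF.finite_domain_is_field[OF finite_RF])

sublocale RF: field RF by (rule field_RF)

lemma prime_subfield_residue: "x \<in> generate_field RF {} ==> \<exists>n. x = residue (of_nat n)"
proof (induction rule: generate_field.induct)
 case one
 show ?case using RH.hom_one by (intro exI[of _ 1]) (simp add: OF_simps)
next
 case (a_inv x)
 then obtain n where n: "x = residue (of_nat n)" by blast
 have carr: "of_nat m \<in> carrier OF" for m using OFs.of_nat_mem by (simp add: OF_simps)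
 have neg: "- of_nat n \<in> carrier OF" using OFs.uminus_mem[OF OFs.of_nat_mem[of n]] by (simp add: OF_simps)
 have "\<ominus>\<^bsub>RF\<^esub> x = residue (- of_nat n)" using RH.hom_a_inv[OF carr[of n]] by (simp add: n OF_a_inv[OF carr])
 also have "... = residue (of_nat (n * (p - 1)))"
 proof -
  have "(- of_nat n) - of_nat (n * (p - 1)) = (of_nat p * (- of_nat n) :: 'k)"
   using prime_gt_0_nat[OF prime_p] by (simp add: of_nat_diff algebra_simps)
  also have "... \<in> Q" by (intro absorb_right p_mem ai)
  finally show ?thesis using residue_eq_iff[OF neg carr] by (simp only:)
 qed
 finally show ?case by blast
next
 case (m_inv x)
 then obtain n where n: "x = residue (of_nat n)" by blast
 have carr: "of_nat m \<in> carrier OF" for m using OFs.of_nat_mem by (simp add: OF_simps)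
 obtain k where k: "residue (of_nat n) \<otimes>\<^bsub>RF\<^esub> residue (of_nat n ^ k) = \<one>\<^bsub>RF\<^esub>"
  using m_inv residue_zero_iff[OF carr] n residue_inverse[OF carr] by blast
 have "residue (of_nat (n ^ k)) \<in> carrier RF" "x \<in> carrier RF"
  unfolding carrier_RF n by (rule imageI[OF carr])+
 hence "inv\<^bsub>RF\<^esub> x = residue (of_nat (n ^ k))" using k by (intro RF.comm_inv_char) (simp_all add: n)
 thus ?case by blast
next
 case (eng_add x y)
 then obtain n m where "x = residue (of_nat n)" "y = residue (of_nat m)" by blast
 hence "x \<oplus>\<^bsub>RF\<^esub> y = residue (of_nat (n + m))"
  using residue_hom(2)[of "of_nat n" "of_nat m"] OFs.of_nat_mem by (simp add: OF_simps)
 thus ?case by blast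
next
 case (eng_mult x y)
 then obtain n m where "x = residue (of_nat n)" "y = residue (of_nat m)" by blast
 hence "x \<otimes>\<^bsub>RF\<^esub> y = residue (of_nat (n * m))"
  using residue_hom(1)[of "of_nat n" "of_nat m"] OFs.of_nat_mem by (simp add: OF_simps)
 thus ?case by blast
qed simp

lemma combine_residue:
 assumes "set xs \<subseteq> carrier OF"
 shows "length cs = length xs ==> RF.combine (map (\<lambda>c. residue (of_nat c)) cs) (map residue xs)
   = residue (\<Sum>i<length xs. of_nat (cs ! i) * xs ! i)"
 using assms
proof (induction xs arbitrary: cs)
 case Nil
 thus ?case using RH.hom_zero by (simp add: OF_simps)
next
 case (Cons x xs)
 then obtain c cs' where cs: "cs = c # cs'" "length cs' = length xs" by (cases cs) auto
 have x: "x \<in> carrier OF" "\<And>i. i < length xs ==> xs ! i \<in> carrier OF" using Cons.prems by auto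
 have mem: "of_nat c \<in> carrier OF" "of_nat c * x \<in> carrier OF" "(\<Sum>i<length xs. of_nat (cs' ! i) * xs ! i) \<in> carrier OF"
  using x unfolding OF_simps by (intro OFs.sum_mem OFs.mult_mem OFs.of_nat_mem; simp)+
 show ?case using Cons x mem
  by (simp add: cs sum.lessThan_Suc_shift residue_hom del: sum.lessThan_Suc)
qed

text \<open>A generator \<open>g\<close> of the multiplicative group of the residue field satisfies
  a nontrivial relation of degree at most \<open>f\<close> with natural coefficients, which
  Frobenius fixes. \<open>frobenius_period\<close> yields an exponent for \<open>g\<close>, and
  every other residue is 0 or a power of \<open>g\<close>.\<close>

lemma residue_degree_bound:
 "\<exists>i\<in>{1..residue_degree F P}. \<forall>a\<in>carrier OF. a ^ (p ^ i) - a \<in> Q"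
proof -
 define K0 where "K0 = generate_field RF {}"
 have K0: "subfield K0 RF" unfolding K0_def by (rule RF.generate_field_is_subfield) simp
 define f where "f = residue_degree F P"
 have "RF.finite_dimension K0 (carrier RF)"
  by (rule RF.finite_carrier_imp_finite_dimension[OF K0 finite_RF])
 hence dim: "RF.dimension f K0 (carrier RF)"
  using RF.finite_dimensionE[OF K0] by (simp add: f_def residue_degree_def K0_def over_def Let_def)
 obtain gen where gen: "gen \<in> carrier RF - {\<zero>\<^bsub>RF\<^esub>}" "carrier RF - {\<zero>\<^bsub>RF\<^esub>} = {gen [^]\<^bsub>RF\<^esub> i | i :: nat. i \<in> UNIV}"
  using RF.finite_field_mult_group_has_gen[OF finite_RF] by auto
 obtain g where g: "g \<in> carrier OF" "gen = residue g" using gen(1) by (auto simp: carrier_RF)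
 have gint: "algebraic_int g" using g(1) by (simp add: OF_simps)
 have pow: "g ^ i \<in> carrier OF" for i using g OFs.power_mem[of g i] by (simp add: OF_simps)
 define xs where "xs = map (\<lambda>i. g ^ i) [0..<Suc f]"
 have xs: "set xs \<subseteq> carrier OF" "length xs = Suc f" using pow by (auto simp: xs_def)
 have xsR: "set (map residue xs) \<subseteq> carrier RF" using xs(1) by (auto simp: carrier_RF)
 have "RF.dependent K0 (map residue xs)"
  using RF.independent_length_le_dimension[OF K0 dim _ xsR] xs(2) by auto
 then obtain Ks where Ks: "length Ks = length (map residue xs)" "RF.combine Ks (map residue xs) = \<zero>\<^bsub>RF\<^esub>"
   "set Ks \<subseteq> K0" "set Ks \<noteq> {\<zero>\<^bsub>RF\<^esub>}"
  using RF.dependent_imp_non_trivial_combine[OF K0 xsR] by metis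
 have "\<forall>x. \<exists>n. x \<in> K0 --> x = residue (of_nat n)" using prime_subfield_residue by (auto simp: K0_def)
 then obtain nn where nn: "\<And>x. x \<in> K0 ==> x = residue (of_nat (nn x))" by metis
 define cs where "cs = map nn Ks"
 have Ks_eq: "Ks = map (\<lambda>c. residue (of_nat c)) cs"
  unfolding cs_def map_map o_def using nn Ks(3) by (intro map_idI[symmetric]) auto
 have len: "length cs = Suc f" using Ks(1) xs by (simp add: cs_def)
 define h where "h = (\<Sum>i\<le>f. monom (of_nat (cs ! i) :: 'k) i)"
 have co: "coeff h i = (if i \<le> f then of_nat (cs ! i) else 0)" for i
  by (simp add: h_def coeff_sum coeff_monom cong: if_cong)
 have "poly h g = (\<Sum>i<length xs. of_nat (cs ! i) * xs ! i)"
  unfolding h_def poly_sum poly_monom xs(2) lessThan_Suc_atMost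
  by (intro sum.cong refl) (simp add: xs_def nth_map del: upt_Suc)
 moreover have "residue (\<Sum>i<length xs. of_nat (cs ! i) * xs ! i) = \<zero>\<^bsub>RF\<^esub>"
  using combine_residue[OF xs(1), of cs] len xs(2) Ks(2) by (simp add: Ks_eq)
 moreover have "poly h g \<in> carrier OF"
  using OFs.poly_mem[of h g] g(1) OFs.of_nat_mem OFs.zero_mem by (simp add: polys_def co OF_simps)
 ultimately have hg: "poly h g \<in> Q" using residue_zero_iff by metis
 have "\<exists>i\<le>f. of_nat (cs ! i) \<notin> Q"
 proof (rule ccontr)
  assume no: "\<not> (\<exists>i\<le>f. of_nat (cs ! i) \<notin> Q)"
  have "x = \<zero>\<^bsub>RF\<^esub>" if "x \<in> set Ks" for x
  proof -
   obtain i where i: "i < Suc f" "x = residue (of_nat (cs ! i))"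
    using \<open>x \<in> set Ks\<close> len unfolding Ks_eq by (auto simp: in_set_conv_nth)
   show ?thesis unfolding i(2) using no i(1) residue_zero_iff[of "of_nat (cs ! i)"] OFs.of_nat_mem[of "cs ! i"] by (auto simp: OF_simps)
  qed
  moreover have "Ks \<noteq> []" using Ks(1) xs by auto
  ultimately show False using Ks(4) by (cases Ks) auto
 qed
 then obtain i0 where i0: "i0 \<le> f" "of_nat (cs ! i0) \<notin> Q" by blast
 \<comment> \<open>Fermat's little theorem, read off from Frobenius applied to a sum of
   ones.\<close>
 have fermat: "of_nat n ^ (p ^ 1) - of_nat n \<in> Q" for n
  using frobenius_sum[of "{..<n}" "\<lambda>_. 1" 1] by simp
 have "\<exists>m\<in>{1..f}. g ^ (p ^ (1 * m)) - g \<in> Q"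
 proof (rule frobenius_period[OF gint _ hg])
  show "coeff h i ^ (p ^ 1) - coeff h i \<in> Q" for i
   using fermat[of "cs ! i"] zero prime_gt_0_nat[OF prime_p] by (auto simp: co power_0_left)
  show "degree h \<le> f" by (rule degree_le) (simp add: co)
  show "coeff h i0 \<notin> Q" using i0 by (simp add: co)
 qed (simp add: co)
 then obtain m where m: "m \<in> {1..f}" "g ^ (p ^ m) - g \<in> Q" by auto
 have "a ^ (p ^ m) - a \<in> Q" if a: "a \<in> carrier OF" for a
 proof (cases "a \<in> Q")
  case True
  thus ?thesis using power_mem_iff[OF integral[OF True], of "p ^ m"] prime_gt_0_nat[OF prime_p] diff by simp
 next
  case False
  hence "residue a \<in> carrier RF - {\<zero>\<^bsub>RF\<^esub>}" using a residue_zero_iff by auto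
  then obtain j :: nat where "residue a = gen [^]\<^bsub>RF\<^esub> j" using gen(2) by auto
  hence j: "a - g ^ j \<in> Q" using residue_power[OF g(1)] g(2) residue_eq_iff[OF a pow] by blast
  have aint: "algebraic_int a" "algebraic_int (g ^ j)" using a gint by (auto simp: OF_simps intro: ai)
  have 1: "a ^ (p ^ m) - (g ^ j) ^ (p ^ m) \<in> Q" using j frobenius_cong_iff[OF aint] by simp
  have 2: "(g ^ (p ^ m)) ^ j - g ^ j \<in> Q"
  proof -
   have "residue (g ^ (p ^ m)) = residue g" using m(2) residue_eq_iff[OF pow g(1)] by simp
   hence "residue ((g ^ (p ^ m)) ^ j) = residue (g ^ j)" using residue_power[OF pow] residue_power[OF g(1)] by simp
   thus ?thesis using residue_eq_iff[of "(g ^ (p ^ m)) ^ j" "g ^ j"] pow by (simp flip: power_mult)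
  qed
  have "a ^ (p ^ m) - a = (a ^ (p ^ m) - (g ^ j) ^ (p ^ m)) + ((g ^ (p ^ m)) ^ j - g ^ j) - (a - g ^ j)" by (simp add: mult.commute flip: power_mult)
  thus ?thesis using diff[OF add[OF 1 2] j] by simp
 qed
 thus ?thesis using m(1) unfolding f_def by blast
qed

end

section \<open>Complex embeddings\<close>

text \<open>Only the values on \<open>L\<close> are constrained, so an embedding can be extended one
  element at a time without a change of type.\<close>

definition field_emb :: "'a :: field set => ('a => 'b :: field) => bool"
 where "field_emb L \<phi> \<longleftrightarrow> \<phi> 1 = 1 \<and> (\<forall>x\<in>L. \<forall>y\<in>L. \<phi> (x - y) = \<phi> x - \<phi> y \<and> \<phi> (x * y) = \<phi> x * \<phi> y)"

locale field_embedding = closed_subfield L for L :: "'a :: field set" +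
 fixes \<phi> :: "'a => 'b :: field"
 assumes emb: "field_emb L \<phi>"
begin

lemma hom_1: "\<phi> 1 = 1" and hom_diff: "x \<in> L ==> y \<in> L ==> \<phi> (x - y) = \<phi> x - \<phi> y"
 and hom_mult: "x \<in> L ==> y \<in> L ==> \<phi> (x * y) = \<phi> x * \<phi> y"
 using emb by (auto simp: field_emb_def)

lemma hom_0: "\<phi> 0 = 0" using hom_diff[OF one_mem one_mem] by simp
lemma hom_uminus: "x \<in> L ==> \<phi> (- x) = - \<phi> x" using hom_diff[OF zero_mem, of x] by (simp add: hom_0)
lemma hom_add: "x \<in> L ==> y \<in> L ==> \<phi> (x + y) = \<phi> x + \<phi> y"
 using hom_diff[of x "- y"] uminus_mem[of y] hom_uminus[of y] by simp
lemma hom_power: "x \<in> L ==> \<phi> (x ^ n) = \<phi> x ^ n"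
 by (induction n) (auto simp: hom_1 hom_mult power_mem)
lemma hom_sum: "(\<And>i. i \<in> I ==> f i \<in> L) ==> \<phi> (sum f I) = (\<Sum>i\<in>I. \<phi> (f i))"
 by (induction I rule: infinite_finite_induct) (auto simp: hom_0 hom_add sum_mem)
lemma hom_prod: "(\<And>i. i \<in> I ==> f i \<in> L) ==> \<phi> (prod f I) = (\<Prod>i\<in>I. \<phi> (f i))"
 by (induction I rule: infinite_finite_induct) (auto simp: hom_1 hom_mult prod_mem)
lemma hom_of_nat: "\<phi> (of_nat n) = of_nat n"
 by (induction n) (auto simp: hom_0 hom_1 hom_add one_mem of_nat_mem)
lemma hom_of_int: "\<phi> (of_int n) = of_int n"
 by (cases n) (simp_all add: hom_of_nat hom_uminus hom_diff hom_1 one_mem of_nat_mem uminus_mem)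

lemma hom_eq_0_iff: "x \<in> L ==> \<phi> x = 0 \<longleftrightarrow> x = 0"
proof
 assume x: "x \<in> L" "\<phi> x = 0"
 show "x = 0"
 proof (rule ccontr)
  assume "x \<noteq> 0"
  thus False using x hom_mult[OF x(1) inverse_mem[OF x(1)]] by (simp add: hom_1)
 qed
qed (simp add: hom_0)

lemma hom_eq_iff: "x \<in> L ==> y \<in> L ==> \<phi> x = \<phi> y \<longleftrightarrow> x = y"
 using hom_eq_0_iff[of "x - y"] hom_diff[of x y] diff_mem[of x y] by simp

lemma hom_inverse: "x \<in> L ==> \<phi> (inverse x) = inverse (\<phi> x)"
proof (cases "x = 0")
 case False
 assume x: "x \<in> L"
 have "\<phi> x * \<phi> (inverse x) = 1" using hom_mult[OF x inverse_mem[OF x]] False by (simp add: hom_1)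
 thus ?thesis by (metis inverse_unique)
qed (simp add: hom_0)

lemma hom_divide: "x \<in> L ==> y \<in> L ==> \<phi> (x / y) = \<phi> x / \<phi> y"
 by (simp add: field_class.field_divide_inverse hom_mult hom_inverse inverse_mem)

abbreviation map_emb :: "'a poly => 'b poly" where "map_emb \<equiv> map_poly \<phi>"

lemma coeff_emb: "coeff (map_emb h) i = \<phi> (coeff h i)"
 by (simp add: coeff_map_poly hom_0)

lemma poly_emb: "h \<in> polys L ==> x \<in> L ==> poly (map_emb h) (\<phi> x) = \<phi> (poly h x)"
proof (induction h)
 case (pCons a h)
 have "h \<in> polys L" "a \<in> L" using polysD[OF pCons.prems(1), of 0] polysD[OF pCons.prems(1), of "Suc _"]
  by (auto simp: polys_def)
 thus ?case using pCons by (simp add: map_poly_pCons hom_0 hom_add hom_mult mult_mem poly_mem)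
qed (simp add: hom_0)

lemma degree_emb: "h \<in> polys L ==> degree (map_emb h) = degree h"
proof (rule antisym[OF degree_map_poly_le])
 assume h: "h \<in> polys L"
 show "degree h \<le> degree (map_emb h)"
 proof (cases "h = 0")
  case False
  thus ?thesis using hom_eq_0_iff[OF polysD[OF h]] by (intro le_degree) (simp add: coeff_emb)
 qed simp
qed

lemma emb_diff: "g \<in> polys L ==> h \<in> polys L ==> map_emb (g - h) = map_emb g - map_emb h"
 by (intro poly_eqI) (simp add: coeff_emb hom_diff polysD)

lemma emb_add: "g \<in> polys L ==> h \<in> polys L ==> map_emb (g + h) = map_emb g + map_emb h"
 by (intro poly_eqI) (simp add: coeff_emb hom_add polysD)

lemma emb_mult: "g \<in> polys L ==> h \<in> polys L ==> map_emb (g * h) = map_emb g * map_emb h"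
 by (intro poly_eqI) (simp add: coeff_emb coeff_mult hom_sum hom_mult mult_mem polysD)

lemma emb_pCons: "map_emb (pCons a h) = pCons (\<phi> a) (map_emb h)"
 by (intro poly_eqI) (simp add: coeff_emb coeff_pCons split: nat.splits)

lemma emb_pcompose: "g \<in> polys L ==> h \<in> polys L ==> map_emb (pcompose g h) = pcompose (map_emb g) (map_emb h)"
proof (induction g)
 case (pCons a g)
 have g: "g \<in> polys L" "a \<in> L" using polysD[OF pCons.prems(1), of 0] polysD[OF pCons.prems(1), of "Suc _"]
  by (auto simp: polys_def)
 have "map_emb (pcompose (pCons a g) h) = map_emb [:a:] + map_emb (h * pcompose g h)"
  unfolding pcompose_pCons using g pCons.prems by (intro emb_add polys_const polys_mult polys_pcompose)
 also have "... = [:\<phi> a:] + map_emb h * pcompose (map_emb g) (map_emb h)"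
  using pCons.IH[OF g(1) pCons.prems(2)] g pCons.prems by (simp add: emb_mult polys_pcompose emb_pCons)
 finally show ?case by (simp add: emb_pCons pcompose_pCons)
qed simp

lemma emb_pderiv: "h \<in> polys L ==> map_emb (pderiv h) = pderiv (map_emb h)"
 unfolding poly_eq_iff coeff_emb coeff_pderiv
 using hom_mult[OF of_nat_mem polysD] hom_of_nat by metis

lemma emb_eq_iff: "g \<in> polys L ==> h \<in> polys L ==> map_emb g = map_emb h \<longleftrightarrow> g = h"
 using hom_eq_iff polysD coeff_emb by (metis poly_eq_iff)

text \<open>Evaluation at \<open>w\<close> is well defined: two polynomials with the same value at
  \<open>x\<close> differ by a multiple of \<open>g\<close>, whose image vanishes at
  \<open>w\<close>.\<close>

lemma extend:
 assumes g: "is_minpoly L x g" and w: "poly (map_emb g) w = 0"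
 shows "\<exists>\<psi>. field_embedding (adjoin L x) \<psi> \<and> \<psi> x = w \<and> (\<forall>a\<in>L. \<psi> a = \<phi> a)"
proof -
 have gg: "g \<in> polys L" "lead_coeff g = 1" "poly g x = 0" "g \<noteq> 0" using g by (auto simp: is_minpoly_def)
 interpret S: closed_subfield "adjoin L x" by (rule closed_subfield_adjoin[OF gg(1,4,3)])
 define \<psi> where "\<psi> y = poly (map_emb (SOME h. h \<in> polys L \<and> y = poly h x)) w" for y
 have \<psi>: "\<psi> (poly h x) = poly (map_emb h) w" if h: "h \<in> polys L" for h
 proof -
  define k where "k = (SOME k. k \<in> polys L \<and> poly h x = poly k x)"
  have k: "k \<in> polys L" "poly h x = poly k x"
   using someI_ex[of "\<lambda>k. k \<in> polys L \<and> poly h x = poly k x"] h unfolding k_def by blast+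
  have "poly (h - k) x = 0" using k by simp
  then obtain q where q: "q \<in> polys L" "h - k = g * q"
   using minpoly_dvd[OF g polys_diff[OF h k(1)]] by blast
  have "poly (map_emb h) w - poly (map_emb k) w = 0" using emb_diff[OF h k(1)] emb_mult[OF gg(1) q(1)] q(2) w by (metis poly_diff poly_mult mult_zero_left)
  thus ?thesis by (simp add: \<psi>_def k_def)
 qed
 have "field_emb (adjoin L x) \<psi>" unfolding field_emb_def
 proof (intro conjI ballI)
  show "\<psi> 1 = 1" using \<psi>[OF polys_const[OF one_mem]] by (simp add: hom_1)
  fix y z assume "y \<in> adjoin L x" "z \<in> adjoin L x"
  then obtain a b where ab: "a \<in> polys L" "y = poly a x" "b \<in> polys L" "z = poly b x"
   by (auto simp: adjoin_def)
  show "\<psi> (y - z) = \<psi> y - \<psi> z" using \<psi>[OF polys_diff[OF ab(1,3)]] by (simp add: ab \<psi> emb_diff)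
  show "\<psi> (y * z) = \<psi> y * \<psi> z" using \<psi>[OF polys_mult[OF ab(1,3)]] by (simp add: ab \<psi> emb_mult)
 qed
 hence "field_embedding (adjoin L x) \<psi>" by unfold_locales
 moreover have "\<psi> x = w"
  using \<psi>[of "[:0, 1:]"] polys_pCons[OF zero_mem polys_const[OF one_mem]] by (simp add: emb_pCons hom_0 hom_1)
 moreover have "\<psi> a = \<phi> a" if "a \<in> L" for a
  using \<psi>[OF polys_const[OF that]] by (simp add: emb_pCons)
 ultimately show ?thesis by blast
qed

lemma extend_algebraic:
 assumes alg: "h \<in> polys L" "h \<noteq> 0" "poly h x = 0"
  and closed: "\<And>g :: 'b poly. degree g > 0 ==> \<exists>w. poly g w = 0"
 shows "\<exists>L' \<psi>. field_embedding L' \<psi> \<and> x \<in> L' \<and> L \<subseteq> L' \<and> (\<forall>a\<in>L. (\<psi> :: 'a => 'b) a = \<phi> a)"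
proof -
 obtain g where g: "is_minpoly L x g" using minpoly_exists[OF alg] by blast
 hence "degree (map_emb g) > 0" using minpoly_degree_pos[OF g] degree_emb[of g] by (simp add: is_minpoly_def)
 then obtain w where "poly (map_emb g) w = 0" using closed by blast
 then obtain \<psi> where "field_embedding (adjoin L x) \<psi>" "\<forall>a\<in>L. \<psi> a = \<phi> a" using extend[OF g] by blast
 thus ?thesis using self_mem_adjoin subset_adjoin by blast
qed

end

lemma field_embedding_Rats:
 "\<exists>\<phi>. field_embedding (\<rat> :: 'k :: field_char_0 set) (\<phi> :: 'k => complex)"
proof -
 define \<phi> where "\<phi> x = (of_rat (THE r. x = of_rat r) :: complex)" for x :: 'k
 have \<phi>: "\<phi> (of_rat r) = of_rat r" for r by (simp add: \<phi>_def)
 have "field_embedding \<rat> \<phi>"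
 proof
  show "field_emb \<rat> \<phi>" unfolding field_emb_def
  proof (intro conjI ballI)
   show "\<phi> 1 = 1" using \<phi>[of 1] by simp
   fix x y :: 'k assume "x \<in> \<rat>" "y \<in> \<rat>"
   then obtain r s where "x = of_rat r" "y = of_rat s" by (auto elim!: Rats_cases)
   thus "\<phi> (x - y) = \<phi> x - \<phi> y" "\<phi> (x * y) = \<phi> x * \<phi> y"
    using \<phi>[of "r - s"] \<phi>[of "r * s"] by (simp_all add: \<phi> of_rat_diff of_rat_mult)
  qed
 qed auto
 thus ?thesis by blast
qed

lemma prod_mset_norm_less_1:
 fixes A :: "complex multiset"
 assumes "\<And>x. x \<in># A ==> norm x < 1" "A \<noteq> {#}"
 shows "norm (prod_mset A) < 1"
 using assms
proof (induction A)
 case (add x A)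
 show ?case
 proof (cases "A = {#}")
  case False
  hence "norm (prod_mset A) < 1" using add by simp
  moreover have "norm x < 1" using add by simp
  ultimately show ?thesis using mult_strict_mono'[of "norm x" 1 "norm (prod_mset A)" 1]
   by (simp add: norm_mult)
 qed (use add in simp)
qed simp

lemma prod_mset_roots:
 fixes A :: "'a :: comm_ring_1 multiset"
 shows "poly (\<Prod>x\<in>#A. [:-x, 1:]) 0 = (- 1) ^ size A * prod_mset A"
 by (induction A) (auto simp: algebra_simps)

text \<open>The constant term of the minimal polynomial of an algebraic integer is a rational integer.\<close>

lemma exists_large_conjugate:
 fixes y :: "'k :: {field_char_0, alg_closed_field}"
 assumes y: "algebraic_int y" "y \<noteq> 0" and emb: "field_embedding (\<rat> :: 'k set) (\<phi> :: 'k => complex)"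
  and g: "is_minpoly \<rat> y g"
 shows "\<exists>w. poly (map_poly \<phi> g) w = 0 \<and> norm w \<ge> 1"
proof -
 interpret \<phi>: field_embedding "\<rat> :: 'k set" \<phi> by fact
 interpret AI: closed_subring "{x :: 'k. algebraic_int x}" by (rule closed_subring_algebraic_int)
 have gg: "g \<in> polys \<rat>" "lead_coeff g = 1" "poly g y = 0" "g \<noteq> 0" using g by (auto simp: is_minpoly_def)
 obtain h where h: "poly (map_poly of_int h) y = 0" "lead_coeff h = 1"
  using y(1) unfolding algebraic_int_altdef_ipoly by blast
 have hQ: "map_poly of_int h \<in> polys (\<rat> :: 'k set)" by (simp add: polys_def)
 obtain A where A: "size A = degree g" "g = (\<Prod>x\<in>#A. [:-x, 1:])"
  using alg_closed_imp_factorization[OF gg(4)] gg(2) by auto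
 have "algebraic_int x" if "x \<in># A" for x
 proof -
  have "poly g x = 0" using that by (subst A(2)) (auto simp: poly_prod_mset prod_mset_zero_iff)
  hence "poly (map_poly of_int h) x = 0" by (rule \<phi>.minpoly_conjugate_root[OF g _ hQ h(1)])
  thus ?thesis using h(2) unfolding algebraic_int_altdef_ipoly by blast
 qed
 hence "algebraic_int (prod_mset A)" by (induction A) (auto intro: algebraic_int_diff_mult)
 moreover have c0: "coeff g 0 = (- 1) ^ degree g * prod_mset A"
  using prod_mset_roots[of A] A by (simp add: poly_0_coeff_0)
 ultimately have "algebraic_int (coeff g 0)"
  using AI.power_mem[of "- 1" "degree g"] AI.mult_mem[of "(- 1) ^ degree g" "prod_mset A"] by auto
 hence "coeff g 0 \<in> \<int>" using polysD[OF gg(1)] rational_algebraic_int_is_int by blast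
 then obtain c where c: "coeff g 0 = of_int c" by (auto elim: Ints_cases)
 have c_nz: "c \<noteq> 0"
 proof
  assume "c = 0"
  hence "poly g 0 = 0" using c by (simp add: poly_0_coeff_0)
  hence "is_minpoly \<rat> 0 g" by (rule \<phi>.minpoly_conjugate[OF g])
  hence "degree g \<le> degree [:0, 1 :: 'k:]" unfolding is_minpoly_def
   using \<phi>.polys_pCons[OF \<phi>.zero_mem \<phi>.polys_const[OF \<phi>.one_mem]] by fastforce
  hence "degree g = 1" using \<phi>.minpoly_degree_pos[OF g] by simp
  thus False using gg(2) c \<open>c = 0\<close> gg(3) y(2) by (simp add: poly_altdef)
 qed
 define G where "G = map_poly \<phi> g"
 have G: "degree G = degree g" "lead_coeff G = 1" "coeff G 0 = of_int c"
  using \<phi>.degree_emb[OF gg(1)] gg(2) c by (simp_all add: G_def \<phi>.coeff_emb \<phi>.hom_1 \<phi>.hom_of_int)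
 have "G \<noteq> 0" using G(2) by auto
 then obtain B where B: "size B = degree G" "G = (\<Prod>x\<in>#B. [:-x, 1:])"
  using alg_closed_imp_factorization[of G] G(2) by auto
 have "B \<noteq> {#}" using B(1) G(1) \<phi>.minpoly_degree_pos[OF g] by auto
 have "norm (prod_mset B) \<ge> 1"
 proof -
  have "of_int c = (- 1) ^ degree G * prod_mset B" using prod_mset_roots[of B] B G(3) by (simp add: poly_0_coeff_0)
  hence "norm (of_int c :: complex) = norm (prod_mset B)" by (simp add: norm_mult norm_power)
  moreover have "norm (of_int c :: complex) = real_of_int \<bar>c\<bar>" by simp
  moreover have "\<bar>c\<bar> \<ge> 1" using c_nz by simp
  ultimately show ?thesis by linarith
 qed
 then obtain w where w: "w \<in># B" "norm w \<ge> 1"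
  using prod_mset_norm_less_1[of B] \<open>B \<noteq> {#}\<close> by (meson not_le)
 have "poly G w = 0" using w(1) by (subst B(2)) (auto simp: poly_prod_mset prod_mset_zero_iff)
 thus ?thesis using w(2) by (auto simp: G_def)
qed

text \<open>Embed \<open>y\<close> alone with a large image, then adjoin the elements of
  \<open>S\<close> one after another without changing earlier values. This is the form in which the
  product formula is used.\<close>

theorem exists_large_embedding:
 fixes y :: "'k :: {field_char_0, alg_closed_field}"
 assumes y: "algebraic_int y" "y \<noteq> 0" and S: "finite S" "\<And>x. x \<in> S ==> algebraic x"
 shows "\<exists>L (\<phi> :: 'k => complex). field_embedding L \<phi> \<and> S \<subseteq> L \<and> y \<in> L \<and> norm (\<phi> y) \<ge> 1"
 using S
proof (induction S rule: finite_induct)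
 case empty
 obtain \<phi> where \<phi>: "field_embedding (\<rat> :: 'k set) (\<phi> :: 'k => complex)" using field_embedding_Rats by blast
 interpret \<phi>: field_embedding "\<rat> :: 'k set" \<phi> by fact
 obtain h where h: "poly (map_poly of_int h) y = 0" "lead_coeff h = 1"
  using y(1) unfolding algebraic_int_altdef_ipoly by blast
 have "map_poly of_int h \<in> polys (\<rat> :: 'k set)" by (simp add: polys_def)
 moreover have "map_poly of_int h \<noteq> (0 :: 'k poly)" using h(2) by auto
 ultimately obtain g where g: "is_minpoly \<rat> y g" using \<phi>.minpoly_exists h(1) by blast
 obtain w where w: "poly (map_poly \<phi> g) w = 0" "norm w \<ge> 1"
  using exists_large_conjugate[OF y \<phi> g] by blast
 obtain \<psi> where "field_embedding (adjoin \<rat> y) \<psi>" "\<psi> y = w" using \<phi>.extend[OF g w(1)] by blast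
 thus ?case using w(2) \<phi>.self_mem_adjoin by blast
next
 case (insert x S)
 then obtain L \<phi> where L: "field_embedding L (\<phi> :: 'k => complex)" "S \<subseteq> L" "y \<in> L" "norm (\<phi> y) \<ge> 1" by auto
 interpret \<phi>: field_embedding L \<phi> by fact
 obtain h where h: "h \<in> polys L" "h \<noteq> 0" "poly h x = 0"
  using insert.prems algebraic_root_over_subring[OF \<phi>.closed_subring_axioms] by blast
 then obtain L' \<psi> where "field_embedding L' \<psi>" "x \<in> L'" "L \<subseteq> L'" "\<forall>a\<in>L. (\<psi> :: 'k => complex) a = \<phi> a"
  using \<phi>.extend_algebraic[OF h] alg_closed_imp_poly_has_root by blast
 thus ?case using L by (intro exI[of _ L'] exI[of _ \<psi>]) auto
qed

section \<open>Dynamics at a prime above \<open>p\<close>\<close>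

lemma preperiodic_iff: "preperiodic f x \<longleftrightarrow> (\<exists>i j. i < j \<and> (poly f ^^ i) x = (poly f ^^ j) x)"
proof
 assume "preperiodic f x"
 hence "finite (range (\<lambda>n. (poly f ^^ n) x))" by (simp add: preperiodic_def full_SetCompr_eq)
 hence "\<not> inj (\<lambda>n. (poly f ^^ n) x)" using finite_imageD[of "\<lambda>n. (poly f ^^ n) x" UNIV] by auto
 then obtain a b where ab: "a \<noteq> b" "(poly f ^^ a) x = (poly f ^^ b) x" by (auto simp: inj_on_def)
 show "\<exists>i j. i < j \<and> (poly f ^^ i) x = (poly f ^^ j) x"
 proof (cases "a < b")
  case True
  thus ?thesis using ab(2) by blast
 next
  case False
  hence "b < a" using ab(1) by simp
  thus ?thesis using ab(2)[symmetric] by blast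
 qed
next
 assume "\<exists>i j. i < j \<and> (poly f ^^ i) x = (poly f ^^ j) x"
 then obtain i j where ij: "i < j" "(poly f ^^ i) x = (poly f ^^ j) x" by blast
 have "(poly f ^^ n) x \<in> (\<lambda>n. (poly f ^^ n) x) ` {..j}" for n
 proof (induction n rule: less_induct)
  case (less n)
  show ?case
  proof (cases "n \<le> j")
   case False
   hence "n = (n - j) + j" by simp
   hence "(poly f ^^ n) x = (poly f ^^ (n - j)) ((poly f ^^ j) x)" by (metis comp_apply funpow_add)
   also have "... = (poly f ^^ (n - j + i)) x" by (simp add: ij(2)[symmetric] funpow_add)
   finally show ?thesis using less[of "n - j + i"] ij(1) False by simp
  qed simp
 qed
 hence "{(poly f ^^ n) x | n. n \<ge> 0} \<subseteq> (\<lambda>n. (poly f ^^ n) x) ` {..j}" by auto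
 thus "preperiodic f x" unfolding preperiodic_def using finite_subset by blast
qed

lemma preperiodic_iter: "preperiodic f x ==> preperiodic f ((poly f ^^ n) x)"
proof -
 assume "preperiodic f x"
 then obtain i j where "i < j" "(poly f ^^ i) x = (poly f ^^ j) x" by (auto simp: preperiodic_iff)
 hence "(poly f ^^ i) ((poly f ^^ n) x) = (poly f ^^ j) ((poly f ^^ n) x)"
  using funpow_add[of i n "poly f"] funpow_add[of n i "poly f"] funpow_add[of j n "poly f"] funpow_add[of n j "poly f"]
  by (simp add: add.commute fun_eq_iff)
 thus ?thesis using \<open>i < j\<close> by (auto simp: preperiodic_iff)
qed

locale pcf_poly = num_field F for F :: "'k :: {field_char_0, alg_closed_field} set" +
 fixes p r :: nat and f :: "'k poly"
 assumes prime: "Factorial_Ring.prime p" and f_int: "f \<in> polys {x \<in> F. algebraic_int x}"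
  and monic: "lead_coeff f = 1" and degree: "degree f = p ^ r" and r: "r \<ge> 1"
  and pcf: "poly (pderiv f) c = 0 ==> preperiodic f c"
begin

lemma degree_ge_2: "degree f \<ge> 2"
 using prime_ge_2_nat[OF prime] r self_le_power[of p r] by (simp add: degree)

lemma f_alg_int: "f \<in> polys {x. algebraic_int x}"
 using f_int by (auto simp: polys_def)

text \<open>The point is a root of the difference of two iterates, which is monic because their
  degrees differ.\<close>

lemma preperiodic_integral:
 assumes "preperiodic f x"
 shows "algebraic_int x"
proof -
 obtain i j where ij: "i < j" "(poly f ^^ i) x = (poly f ^^ j) x" using assms by (auto simp: preperiodic_iff)
 define h where "h = iter_poly f j - iter_poly f i"
 have "degree (iter_poly f i) < degree (iter_poly f j)"
  using ij(1) degree_ge_2 by (simp add: degree_iter_poly)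
 hence dh: "degree h = degree (iter_poly f j)" "lead_coeff h = 1"
  using lead_coeff_iter_poly[OF monic, of j] unfolding h_def
  using degree_ge_2 degree_add_eq_left[of "- iter_poly f i" "iter_poly f j"] by (simp_all add: coeff_eq_0)
 have it: "iter_poly f n \<in> polys {x. algebraic_int x}" for n unfolding iter_poly_def
  by (induction n) (auto intro!: AI.polys_pcompose f_alg_int AI.polys_pCons AI.polys_0 AI.zero_mem)
 show ?thesis by (rule algebraic_int_monic_root[OF dh(2)])
   (use AI.polys_diff[OF it it, of j i] ij(2) in \<open>auto simp: h_def polys_def poly_iter_poly\<close>)
qed

text \<open>Up to a shift of the index this is a coefficient of the derivative of
  \<open>f (y + T)\<close> divided by its leading coefficient, that is, of the product of the
  \<open>y + T - c\<close> over the critical points \<open>c\<close>, and these are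
  integral.\<close>

lemma deriv_coeff_integral:
 assumes y: "algebraic_int y"
 shows "algebraic_int (of_nat j * coeff (pcompose f [:y, 1:]) j / of_nat (degree f))"
proof (cases j)
 case (Suc k)
 have d0: "pderiv f \<noteq> 0" using degree_ge_2 by (simp add: pderiv_eq_0_iff)
 have lead: "lead_coeff (pderiv f) = of_nat (degree f)"
  using degree_ge_2 monic by (simp add: degree_pderiv coeff_pderiv)
 obtain C where C: "pderiv f = smult (lead_coeff (pderiv f)) (\<Prod>c\<in>#C. [:-c, 1:])"
  using alg_closed_imp_factorization[OF d0] by blast
 have root: "algebraic_int c" if "c \<in># C" for c
 proof -
  have "poly (\<Prod>c\<in>#C. [:-c, 1:]) c = 0" using that by (auto simp: poly_prod_mset prod_mset_zero_iff)
  hence "poly (pderiv f) c = 0" by (subst C) simp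
  thus ?thesis by (intro preperiodic_integral pcf)
 qed
 define G where "G = (\<Prod>c\<in>#C. [:-c, 1:])"
 have "G \<in> polys {x. algebraic_int x}" unfolding G_def using root
  by (induction C) (auto intro!: AI.polys_mult AI.polys_pCons AI.polys_1 AI.polys_0
    simp del: mult_pCons_left)
 hence "pcompose G [:y, 1:] \<in> polys {x. algebraic_int x}"
  using y by (intro AI.polys_pcompose AI.polys_pCons AI.polys_0) auto
 hence "algebraic_int (coeff (pcompose G [:y, 1:]) k)" by (simp add: polys_def)
 moreover have "pderiv (pcompose f [:y, 1:]) = smult (of_nat (degree f)) (pcompose G [:y, 1:])"
  using C lead by (simp add: pderiv_pcompose pcompose_smult pderiv_pCons G_def)
 hence "of_nat (Suc k) * coeff (pcompose f [:y, 1:]) (Suc k) = of_nat (degree f) * coeff (pcompose G [:y, 1:]) k"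
  by (metis coeff_pderiv coeff_smult)
 ultimately show ?thesis using Suc degree_ge_2 by simp
qed simp

lemma shift_eq:
 "poly f x - poly f y = (x - y) ^ degree f + (\<Sum>j\<in>{1..<degree f}. coeff (pcompose f [:y, 1:]) j * (x - y) ^ j)"
proof -
 define g where "g = pcompose f [:y, 1:]"
 have dg: "degree g = degree f" by (simp add: g_def degree_pcompose)
 have lg: "coeff g (degree f) = 1" using lead_coeff_comp[of "[:y, 1:]" f] monic by (simp add: g_def)
 have "poly f x = poly g (x - y)" by (simp add: g_def poly_pcompose)
 also have "... = (\<Sum>j\<le>degree f. coeff g j * (x - y) ^ j)" by (simp add: poly_altdef dg)
 also have "{..degree f} = insert 0 (insert (degree f) {1..<degree f})" using degree_ge_2 by auto
 also have "(\<Sum>j\<in>.... coeff g j * (x - y) ^ j) = coeff g 0 + ((x - y) ^ degree f + (\<Sum>j\<in>{1..<degree f}. coeff g j * (x - y) ^ j))"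
  using degree_ge_2 lg by (subst sum.insert; simp)+
 also have "coeff g 0 = poly f y" by (simp add: g_def poly_pcompose flip: poly_0_coeff_0)
 finally show ?thesis by (simp add: g_def)
qed

lemma shift_coeff_integral: "algebraic_int y ==> algebraic_int (coeff (pcompose f [:y, 1:]) j)"
 using AI.polys_pcompose[OF f_alg_int, of "[:y, 1:]"] AI.polys_pCons AI.polys_0
 by (simp add: polys_def)

end

section \<open>Local behaviour of \<open>f\<close> at one prime\<close>

locale pcf_poly_prime = pcf_poly F p r f + alg_prime Q p
 for F Q :: "'k :: {field_char_0, alg_closed_field} set" and p r f
begin

sublocale num_field_prime F Q p by unfold_locales

lemma v_of_nat_p_power_mult:
 assumes "\<not> p dvd j"
 shows "v (of_nat (p ^ s * j)) = real s"
proof -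
 have "vunit (of_nat j)" using of_int_mem_iff[of "int j"] assms vmax_integral_iff[of "of_nat j"] integral_vring[of "of_nat j"] by (simp add: vunit_def)
 moreover have "j \<noteq> 0" using assms by (metis dvd_0_right)
 ultimately show ?thesis using p_nz by (simp add: v_mult v_unit v_power v_p al)
qed

text \<open>With \<open>j = p ^ s * j'\<close> and \<open>j'\<close> prime to \<open>p\<close>, the
  valuations of \<open>j\<close> and \<open>degree f\<close> are \<open>s\<close> and
  \<open>r\<close>; integrality of \<open>j * b / degree f\<close> does the rest.\<close>

lemma shift_coeff_vge:
 assumes y: "algebraic_int y" and j: "j \<in> {1..<degree f}"
 obtains s where "s < r" "p ^ s \<le> j" "vge (real (r - s)) (coeff (pcompose f [:y, 1:]) j)"
proof -
 have "j \<noteq> 0" "\<not> is_unit p" using j prime_ge_2_nat[OF prime] by auto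
 then obtain s j' where s: "j = p ^ s * j'" "\<not> p dvd j'" using multiplicity_decompose'[of j p] by metis
 have "j' \<noteq> 0" using s(2) by (metis dvd_0_right)
 hence le: "p ^ s \<le> j" by (simp add: s(1))
 hence "p ^ s < p ^ r" using j degree by simp
 hence sr: "s < r" using prime_ge_2_nat[OF prime] by (simp add: power_strict_increasing_iff)
 define b where "b = coeff (pcompose f [:y, 1:]) j"
 define e where "e = of_nat j * b / of_nat (degree f)"
 have e: "algebraic_int e" unfolding e_def b_def by (rule deriv_coeff_integral[OF y])
 have "vge (real (r - s)) b"
 proof (cases "b = 0")
  case False
  have "algebraic b" using shift_coeff_integral[OF y] by (auto simp: b_def)
  hence "v e = real s + v b - real r"
   using False v_of_nat_p_power_mult[OF s(2), of s] v_of_nat_p_power_mult[of 1 r] \<open>j \<noteq> 0\<close> degree degree_ge_2 prime_ge_2_nat[OF prime]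
   by (simp add: e_def v_divide v_mult al s(1)[symmetric])
  moreover have "e \<noteq> 0" using False \<open>j \<noteq> 0\<close> degree_ge_2 by (simp add: e_def)
  hence "v e \<ge> 0" using vge_integral[OF e] by (simp add: vge_def)
  ultimately show ?thesis using sr by (simp add: vge_def of_nat_diff)
 qed simp
 thus ?thesis using that sr le by (simp add: b_def)
qed

lemma shift_coeff_mem:
 assumes "algebraic_int y" "j \<in> {1..<degree f}"
 shows "coeff (pcompose f [:y, 1:]) j \<in> Q"
proof -
 define b where "b = coeff (pcompose f [:y, 1:]) j"
 obtain s where s: "s < r" "vge (real (r - s)) b" using shift_coeff_vge[OF assms] unfolding b_def by blast
 have b: "algebraic_int b" unfolding b_def by (rule shift_coeff_integral[OF assms(1)])
 have "b \<in> Q"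
 proof (cases "b = 0")
  case False
  thus ?thesis using s vunit_iff(2)[of b] vmax_integral_iff[OF b] b False by (auto simp: vge_def)
 qed (simp add: zero)
 thus ?thesis by (simp add: b_def)
qed

text \<open>The break of the Newton polygon: for \<open>v z < \<mu>\<close> the term
  \<open>z ^ degree f\<close> beats the one of degree \<open>p ^ (r - 1)\<close>, whose coefficient
  has valuation at least 1, and \<open>degree f * \<mu> = p / (p - 1)\<close>.\<close>

definition \<mu> :: real where "\<mu> = 1 / (real p ^ (r - 1) * (real p - 1))"

lemma p_frac_le_2: "real p / (real p - 1) \<le> 2" "real p / (real p - 1) > 1"
 using prime_ge_2_nat[OF prime] by (auto simp: field_simps)

lemma mu_mult: "real p ^ r * \<mu> = real p / (real p - 1)" "real p ^ (r - 1) * \<mu> = 1 / (real p - 1)" "\<mu> > 0"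
proof -
 have p: "real p > 1" using prime_ge_2_nat[OF prime] by simp
 thus "real p ^ (r - 1) * \<mu> = 1 / (real p - 1)" "\<mu> > 0" by (simp_all add: \<mu>_def)
 have "real p ^ r = real p * real p ^ (r - 1)" using r by (cases r) auto
 thus "real p ^ r * \<mu> = real p / (real p - 1)" by (simp add: \<mu>_def)
qed

text \<open>
 Comparison of the slopes of the Newton polygon of \<open>f(y + T) - f(y)\<close>: near \<open>y\<close> the map
 multiplies the valuation by the degree until it reaches \<open>p/(p-1)\<close>.
\<close>

lemma v_step:
 assumes x: "algebraic_int x" "algebraic_int y" and nz: "poly f x \<noteq> poly f y"
  and small: "v (poly f x - poly f y) < real p / (real p - 1)"
 shows "v (x - y) < \<mu>" "v (poly f x - poly f y) = real (degree f) * v (x - y)"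
proof -
 define z where "z = x - y"
 define b where "b j = coeff (pcompose f [:y, 1:]) j" for j
 let ?S = "\<Sum>j\<in>{1..<degree f}. b j * z ^ j"
 have z: "algebraic_int z" "z \<noteq> 0" using x nz by (auto simp: z_def intro: ai)
 have z': "poly f x - poly f y = z ^ degree f + ?S" unfolding z_def b_def by (rule shift_eq)
 have b: "algebraic_int (b j)" for j unfolding b_def by (rule shift_coeff_integral[OF x(2)])
 have alg: "algebraic (b j * z ^ j)" for j using ai(4)[OF b ai(7)[OF z(1)]] by auto
 have alz: "algebraic z" using z(1) by auto
 have vz0: "v z \<ge> 0" using vge_integral[OF z(1)] z(2) by (simp add: vge_def)
 have p1: "real p > 1" using prime_ge_2_nat[OF prime] by simp
 have tm: "\<exists>s<r. p ^ s \<le> j \<and> vge (real (r - s) + real j * t) (b j * z ^ j)"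
  if j: "j \<in> {1..<degree f}" and t: "t \<le> v z" for j t
 proof -
  obtain s where s: "s < r" "p ^ s \<le> j" "vge (real (r - s)) (b j)" unfolding b_def by (rule shift_coeff_vge[OF x(2) j])
  have "vge (real j * t) (z ^ j)" using t alz by (intro vge_power) (auto simp: vge_def)
  hence "vge (real (r - s) + real j * t) (b j * z ^ j)" using s(3) b alz by (intro vge_mult) (auto intro: al)
  thus ?thesis using s by blast
 qed
 \<comment> \<open>Only \<open>s = r - 1\<close> can matter: for smaller \<open>s\<close> the
   coefficient alone has valuation at least 2, and \<open>p / (p - 1) \<le> 2\<close>.\<close>
 have ge2: "real (r - s) \<ge> 2" if "s < r" "s \<noteq> r - 1" for s using that by linarith
 show "v (x - y) < \<mu>"
 proof (rule ccontr)
  assume "\<not> v (x - y) < \<mu>"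
  hence mu_le: "\<mu> \<le> v z" by (simp add: z_def)
  have "vge (real p / (real p - 1)) (b j * z ^ j)" if j: "j \<in> {1..<degree f}" for j
  proof -
   obtain s where s: "s < r" "p ^ s \<le> j" "vge (real (r - s) + real j * \<mu>) (b j * z ^ j)"
    using tm[OF j mu_le] by blast
   have "real p / (real p - 1) \<le> real (r - s) + real j * \<mu>"
   proof (cases "s = r - 1")
    case True
    have "real (p ^ s) * \<mu> \<le> real j * \<mu>" using s(2) mu_mult(3) by (intro mult_right_mono) (simp_all only: of_nat_le_iff less_imp_le)
    hence "1 / (real p - 1) \<le> real j * \<mu>" using mu_mult(2) True by simp
    moreover have "real (r - s) = 1" using True r by simp
    moreover have "real p / (real p - 1) = 1 + 1 / (real p - 1)" using p1 by (simp add: field_simps)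
    ultimately show ?thesis by linarith
   next
    case False
    have "real j * \<mu> \<ge> 0" using mu_mult(3) by simp
    thus ?thesis using ge2[OF s(1) False] p_frac_le_2(1) by linarith
   qed
   thus ?thesis using s(3) vge_mono by blast
  qed
  hence "vge (real p / (real p - 1)) ?S" using alg by (intro vge_sum) auto
  moreover have "vge (real p / (real p - 1)) (z ^ degree f)"
  proof -
   have "vge (real (degree f) * \<mu>) (z ^ degree f)" using mu_le z by (intro vge_power) (auto simp: vge_def)
   thus ?thesis using mu_mult(1) by (simp add: degree)
  qed
  ultimately have "vge (real p / (real p - 1)) (poly f x - poly f y)"
   unfolding z' by (intro vge_add al(7)[OF alz] AL.sum_mem[unfolded mem_Collect_eq] alg)
  thus False using small nz by (simp add: vge_def)
 qed
 hence lt: "v z < \<mu>" by (simp add: z_def)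
 \<comment> \<open>A bound common to all middle terms that still exceeds
   \<open>v (z ^ degree f)\<close> strictly, as needed for a dominant term.\<close>
 define c where "c = Min ((\<lambda>s. if s = r - 1 then 1 + real p ^ (r - 1) * v z else 2) ` {..<r})"
 have "vge c (b j * z ^ j)" if j: "j \<in> {1..<degree f}" for j
 proof -
  obtain s where s: "s < r" "p ^ s \<le> j" "vge (real (r - s) + real j * v z) (b j * z ^ j)"
   using tm[OF j order_refl] by blast
  have "c \<le> (if s = r - 1 then 1 + real p ^ (r - 1) * v z else 2)" unfolding c_def using s(1) by (intro Min_le) auto
  also have "... \<le> real (r - s) + real j * v z"
  proof (cases "s = r - 1")
   case True
   have "real (p ^ s) * v z \<le> real j * v z" using s(2) vz0 by (intro mult_right_mono) (simp_all only: of_nat_le_iff)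
   moreover have "real (r - s) = 1" using True r by simp
   ultimately show ?thesis using True by simp
  next
   case False
   have "real j * v z \<ge> 0" using vz0 by simp
   thus ?thesis using ge2[OF s(1) False] False by simp
  qed
  finally show ?thesis using s(3) vge_mono by blast
 qed
 hence "vge c ?S" using alg by (intro vge_sum) auto
 moreover have "v (z ^ degree f) < c"
 proof -
  have vzd: "v (z ^ degree f) = real p ^ r * v z" using z(2) by (simp add: v_power[OF alz] degree)
  have pr: "real p ^ r = real p * real p ^ (r - 1)" using r by (cases r) auto
  have 1: "real p ^ r * v z < 2"
   using mult_strict_left_mono[OF lt, of "real p ^ r"] p1 mu_mult(1) p_frac_le_2(1) by simp
  have "real p ^ (r - 1) * v z < 1 / (real p - 1)"
   using mult_strict_left_mono[OF lt, of "real p ^ (r - 1)"] p1 unfolding mu_mult(2) by simp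
  hence "(real p - 1) * (real p ^ (r - 1) * v z) < 1" using p1 by (simp add: field_simps)
  hence 2: "real p ^ r * v z < 1 + real p ^ (r - 1) * v z" unfolding pr by (simp add: algebra_simps)
  show ?thesis unfolding c_def vzd using 1 2 r by (subst Min_gr_iff) auto
 qed
 moreover have "algebraic ?S" using alg AL.sum_mem[of "{1..<degree f}"] by auto
 ultimately have "v (z ^ degree f + ?S) = v (z ^ degree f)"
  using z by (intro v_add_eq(2)) (auto intro: al)
 thus "v (poly f x - poly f y) = real (degree f) * v (x - y)"
  using v_power[OF alz z(2)] by (simp only: z'[folded z_def] z_def[symmetric])
qed

text \<open>All middle coefficients of \<open>f (y + T)\<close> lie in \<open>Q\<close>. So the
  difference of the values is congruent to \<open>(x - y) ^ degree f\<close>, and its cofactor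
  \<open>u\<close> lies in \<open>Q\<close> as soon as \<open>x - y\<close> does.\<close>

lemma step_factor:
 assumes x: "algebraic_int x" "algebraic_int y"
 shows "\<exists>u. poly f x - poly f y = (x - y) * u \<and> algebraic_int u \<and> (x - y \<in> Q --> u \<in> Q)"
  "poly f x - poly f y \<in> Q \<longleftrightarrow> x - y \<in> Q"
proof -
 define z where "z = x - y"
 define b where "b j = coeff (pcompose f [:y, 1:]) j" for j
 have b: "algebraic_int (b j)" for j unfolding b_def by (rule shift_coeff_integral[OF x(2)])
 have z: "algebraic_int z" using x by (auto simp: z_def intro: ai)
 have z': "poly f x - poly f y = z ^ degree f + (\<Sum>j\<in>{1..<degree f}. b j * z ^ j)"
  unfolding z_def b_def by (rule shift_eq)
 define u where "u = z ^ (degree f - 1) + (\<Sum>j\<in>{1..<degree f}. b j * z ^ (j - 1))"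
 have "z ^ degree f = z * z ^ (degree f - 1)" using degree_ge_2 by (simp flip: power_Suc)
 moreover have "(\<Sum>j\<in>{1..<degree f}. b j * z ^ j) = z * (\<Sum>j\<in>{1..<degree f}. b j * z ^ (j - 1))"
  unfolding sum_distrib_left
 proof (rule sum.cong[OF refl])
  fix j assume "j \<in> {1..<degree f}"
  thus "b j * z ^ j = z * (b j * z ^ (j - 1))" by (simp flip: power_Suc)
 qed
 ultimately have "poly f x - poly f y = z * u" unfolding z' u_def by (simp add: distrib_left)
 moreover have "algebraic_int u" unfolding u_def using z b by (intro ai AI.sum_mem[simplified]) auto
 moreover have sumQ: "(\<Sum>j\<in>{1..<degree f}. b j * z ^ (j - i)) \<in> Q" for i
  by (intro sum absorb_right ai z) (simp add: b_def shift_coeff_mem[OF x(2)])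
 hence "u \<in> Q" if "z \<in> Q"
  unfolding u_def using power_mem_iff[OF z, of "degree f - 1"] degree_ge_2 that by (intro add) auto
 ultimately show "\<exists>u. poly f x - poly f y = (x - y) * u \<and> algebraic_int u \<and> (x - y \<in> Q --> u \<in> Q)"
  by (auto simp: z_def)
 have "poly f x - poly f y \<in> Q \<longleftrightarrow> z ^ degree f \<in> Q"
  unfolding z' using sumQ[of 0] diff[of "z ^ degree f + (\<Sum>j\<in>{1..<degree f}. b j * z ^ j)" "\<Sum>j\<in>{1..<degree f}. b j * z ^ j"] add
  by auto
 thus "poly f x - poly f y \<in> Q \<longleftrightarrow> x - y \<in> Q"
  using power_mem_iff[OF z, of "degree f"] degree_ge_2 by (simp add: z_def)
qed

lemma iter_integral: "algebraic_int x ==> algebraic_int ((poly f ^^ n) x)"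
 using AI.polys_iter[OF f_alg_int, of x n] by simp

lemma iter_diff_mem_iff:
 assumes "algebraic_int x" "algebraic_int y"
 shows "(poly f ^^ n) x - (poly f ^^ n) y \<in> Q \<longleftrightarrow> x - y \<in> Q"
 using assms by (induction n) (auto simp: step_factor(2) iter_integral)

lemma iter_factor:
 assumes "algebraic_int x" "algebraic_int y" "x - y \<in> Q"
 shows "n > 0 ==> \<exists>u\<in>Q. (poly f ^^ n) x - (poly f ^^ n) y = (x - y) * u"
proof (induction n)
 case (Suc n)
 obtain u where u: "u \<in> Q" "(poly f ^^ Suc n) x - (poly f ^^ Suc n) y = ((poly f ^^ n) x - (poly f ^^ n) y) * u"
  using iter_diff_mem_iff assms step_factor(1)[OF iter_integral[OF assms(1), of n] iter_integral[OF assms(2), of n]] by auto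
 show ?case
 proof (cases "n = 0")
  case False
  then obtain w where "w \<in> Q" "(poly f ^^ n) x - (poly f ^^ n) y = (x - y) * w" using Suc.IH by auto
  thus ?thesis using u integral by (intro bexI[of _ "w * u"]) (auto simp: mult.assoc intro: absorb)
 qed (use u in auto)
qed simp

text \<open>For a common period \<open>n * m\<close> the cofactor in \<open>iter_factor\<close>
  would have to be 1, yet it lies in \<open>Q\<close>.\<close>

lemma periodic_cong_imp_eq:
 assumes x: "algebraic_int x" "periodic f x" and y: "algebraic_int y" "periodic f y" and xy: "x - y \<in> Q"
 shows "x = y"
proof (rule ccontr)
 assume ne: "x \<noteq> y"
 obtain n m where n: "n \<ge> 1" "(poly f ^^ n) x = x" and m: "m \<ge> 1" "(poly f ^^ m) y = y"
  using x y by (auto simp: periodic_def)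
 have fix_pow: "(poly f ^^ (k * l)) w = w" if "(poly f ^^ k) w = w" for k l w
  using that by (induction l) (simp_all add: funpow_add)
 have "(poly f ^^ (n * m)) x = x" "(poly f ^^ (n * m)) y = y"
  using fix_pow[OF n(2), of m] fix_pow[OF m(2), of n] by (simp_all add: mult.commute)
 moreover obtain u where "u \<in> Q" "(poly f ^^ (n * m)) x - (poly f ^^ (n * m)) y = (x - y) * u"
  using iter_factor[OF x(1) y(1) xy, of "n * m"] n m by auto
 ultimately have "u = 1" "u \<in> Q" using ne by auto
 thus False using one_notin by simp
qed

end

lemma periodic_imp_preperiodic: "periodic f x ==> preperiodic f x"
proof -
 assume "periodic f x"
 then obtain n where n: "n \<ge> 1" "(poly f ^^ n) x = x" by (auto simp: periodic_def)
 thus ?thesis unfolding preperiodic_iff by (intro exI[of _ 0] exI[of _ n]) auto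
qed

section \<open>The period\<close>

context pcf_poly_prime
begin

text \<open>Maps that are a Frobenius power followed by a translation are closed under composition.
  The translation stays in the integers of \<open>F\<close>, where the order of Frobenius is under
  control.\<close>

lemma iter_mod:
 assumes "algebraic_int x"
 shows "\<exists>c\<in>{x \<in> F. algebraic_int x}. \<forall>x. algebraic_int x --> (poly f ^^ k) x - (x ^ (p ^ (r * k)) + c) \<in> Q"
proof (induction k)
 case 0
 show ?case using zero OFs.zero_mem by (intro bexI[of _ 0]) auto
next
 case (Suc k)
 then obtain c where c: "c \<in> {x \<in> F. algebraic_int x}" "\<And>x. algebraic_int x ==> (poly f ^^ k) x - (x ^ (p ^ (r * k)) + c) \<in> Q"
  by blast
 define c0 where "c0 = coeff f 0"
 have c0: "c0 \<in> {x \<in> F. algebraic_int x}" unfolding c0_def by (rule polysD[OF f_int])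
 define c' where "c' = c ^ (p ^ r) + c0"
 have c': "c' \<in> {x \<in> F. algebraic_int x}" unfolding c'_def by (intro OFs.mem_intros c c0)
 have base: "poly f x - (x ^ (p ^ r) + c0) \<in> Q" if x: "algebraic_int x" for x
 proof -
  have "poly f x - poly f 0 - x ^ (p ^ r) = (\<Sum>j\<in>{1..<degree f}. coeff (pcompose f [:0, 1:]) j * x ^ j)"
   using shift_eq[of x 0] by (simp add: degree)
  also have "... \<in> Q" by (intro sum absorb_right shift_coeff_mem ai x) auto
  finally show ?thesis by (simp add: c0_def poly_0_coeff_0 diff_diff_eq add.commute)
 qed
 show ?case
 proof (intro bexI[OF _ c'] allI impI)
  fix x :: 'k assume x: "algebraic_int x"
  define y where "y = (poly f ^^ k) x"
  define w where "w = x ^ (p ^ (r * k))"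
  have y: "algebraic_int y" unfolding y_def by (rule iter_integral[OF x])
  have w: "algebraic_int w" unfolding w_def by (intro ai x)
  have ci: "algebraic_int c" using c by simp
  have 1: "poly f y - (y ^ (p ^ r) + c0) \<in> Q" by (rule base[OF y])
  have 2: "y ^ (p ^ r) - (w + c) ^ (p ^ r) \<in> Q"
   using c(2)[OF x] frobenius_cong_iff[OF y ai(6)[OF w ci], of r] by (simp add: y_def w_def)
  have 3: "(w + c) ^ (p ^ r) - (w ^ (p ^ r) + c ^ (p ^ r)) \<in> Q" by (rule frobenius_add[OF w ci])
  have 4: "w ^ (p ^ r) = x ^ (p ^ (r * Suc k))"
  proof -
   have "p ^ (r * k) * p ^ r = p ^ (r * Suc k)" by (simp add: power_add)
   thus ?thesis by (simp only: w_def power_mult[symmetric])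
  qed
  have eq: "poly f y - (x ^ (p ^ (r * Suc k)) + c') =
   (poly f y - (y ^ (p ^ r) + c0)) + (y ^ (p ^ r) - (w + c) ^ (p ^ r)) + ((w + c) ^ (p ^ r) - (w ^ (p ^ r) + c ^ (p ^ r)))"
   unfolding c'_def 4[symmetric] by simp
  have "poly f y - (x ^ (p ^ (r * Suc k)) + c') \<in> Q" unfolding eq by (rule add[OF add[OF 1 2] 3])
  thus "(poly f ^^ Suc k) x - (x ^ (p ^ (r * Suc k)) + c') \<in> Q" by (simp add: y_def)
 qed
qed

lemma frobenius_fixed_power:
 assumes x: "algebraic_int x" "x ^ (p ^ a) - x \<in> Q"
 shows "x ^ (p ^ (a * l)) - x \<in> Q"
proof (induction l)
 case (Suc l)
 have "p ^ (a * Suc l) = p ^ (a * l) * p ^ a" by (simp add: power_add)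
 hence e: "x ^ (p ^ (a * Suc l)) = (x ^ (p ^ (a * l))) ^ (p ^ a)" by (simp only: power_mult)
 have "(x ^ (p ^ (a * l))) ^ (p ^ a) - x ^ (p ^ a) \<in> Q" using frobenius_cong_iff[OF ai(7)[OF x(1)] x(1)] Suc by blast
 from add[OF this x(2)] show ?case unfolding e by simp
qed (simp add: zero)

text \<open>With \<open>M = i * m\<close>, raising to the power \<open>p ^ M\<close> fixes both
  \<open>\<gamma>\<close> and the integers of \<open>F\<close> modulo \<open>Q\<close>. So the
  \<open>M\<close>-th iterate moves along the orbit by a fixed translation \<open>e\<close>, and
  \<open>p\<close> such translations cancel modulo \<open>Q\<close>: after \<open>M * p\<close>
  steps the point is congruent, hence equal, to itself.\<close>

lemma period_bound:
 assumes \<gamma>: "periodic f \<gamma>" and h: "h \<in> polys F" "h \<noteq> 0" "degree h \<le> n" "poly h \<gamma> = 0"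
 shows "\<exists>M\<ge>1. M \<le> p * residue_degree F P * n \<and> (poly f ^^ M) \<gamma> = \<gamma>"
proof -
 have gi: "algebraic_int \<gamma>" by (rule preperiodic_integral[OF periodic_imp_preperiodic[OF \<gamma>]])
 obtain i where i: "i \<in> {1..residue_degree F P}" "\<And>a. a \<in> {x \<in> F. algebraic_int x} ==> a ^ (p ^ i) - a \<in> Q"
  using residue_degree_bound by (auto simp: OF_simps)
 obtain c k where c: "c \<noteq> 0" "smult c h \<in> polys {x \<in> F. algebraic_int x}" "coeff (smult c h) k \<notin> Q"
  using primitive_scaling[OF closed_subfield_axioms algebraic_mem h(1,2)] by blast
 have ci: "coeff (smult c h) j \<in> {x \<in> F. algebraic_int x}" for j by (rule polysD[OF c(2)])
 have "\<exists>m\<in>{1..n}. \<gamma> ^ (p ^ (i * m)) - \<gamma> \<in> Q"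
  by (rule frobenius_period[OF gi _ _ _ i(2)[OF ci] c(3)]) (use ci h zero in auto)
 then obtain m where m: "m \<in> {1..n}" "\<gamma> ^ (p ^ (i * m)) - \<gamma> \<in> Q" by blast
 define M where "M = i * m"
 have frobF: "a ^ (p ^ (r * M)) - a \<in> Q" if "a \<in> {x \<in> F. algebraic_int x}" for a
  using frobenius_fixed_power[of a i "r * m"] i(2)[OF that] that by (simp add: M_def mult_ac)
 have frob\<gamma>: "\<gamma> ^ (p ^ (r * M)) - \<gamma> \<in> Q"
  using frobenius_fixed_power[OF gi m(2), of r] by (simp add: M_def mult_ac)
 obtain e where e: "e \<in> {x \<in> F. algebraic_int x}" "\<And>x. algebraic_int x ==> (poly f ^^ M) x - (x ^ (p ^ (r * M)) + e) \<in> Q"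
  using iter_mod[OF gi, of M] by blast
 have step: "(poly f ^^ (M * l)) \<gamma> - (\<gamma> + of_nat l * e) \<in> Q" for l
 proof (induction l)
  case (Suc l)
  define y where "y = \<gamma> + of_nat l * e"
  have le: "of_nat l * e \<in> {x \<in> F. algebraic_int x}" by (intro OFs.mem_intros e)
  hence lei: "algebraic_int (of_nat l * e)" by simp
  have y: "algebraic_int y" unfolding y_def using gi lei by (rule ai(6))
  have 1: "(poly f ^^ M) ((poly f ^^ (M * l)) \<gamma>) - (poly f ^^ M) y \<in> Q"
   using Suc iter_diff_mem_iff[OF iter_integral[OF gi] y] by (simp add: y_def)
  have 2: "(poly f ^^ M) y - (y ^ (p ^ (r * M)) + e) \<in> Q" by (rule e(2)[OF y])
  have 3: "y ^ (p ^ (r * M)) - (\<gamma> ^ (p ^ (r * M)) + (of_nat l * e) ^ (p ^ (r * M))) \<in> Q"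
   unfolding y_def by (rule frobenius_add[OF gi lei])
  have "(poly f ^^ (M * Suc l)) \<gamma> = (poly f ^^ M) ((poly f ^^ (M * l)) \<gamma>)" by (simp add: funpow_add)
  hence eq: "(poly f ^^ (M * Suc l)) \<gamma> - (\<gamma> + of_nat (Suc l) * e) =
    ((poly f ^^ M) ((poly f ^^ (M * l)) \<gamma>) - (poly f ^^ M) y) + ((poly f ^^ M) y - (y ^ (p ^ (r * M)) + e))
    + (y ^ (p ^ (r * M)) - (\<gamma> ^ (p ^ (r * M)) + (of_nat l * e) ^ (p ^ (r * M)))) + (\<gamma> ^ (p ^ (r * M)) - \<gamma>)
    + ((of_nat l * e) ^ (p ^ (r * M)) - of_nat l * e)"
   by (simp add: algebra_simps)
  show ?case unfolding eq by (rule add[OF add[OF add[OF add[OF 1 2] 3] frob\<gamma>] frobF[OF le]])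
 qed (simp add: zero)
 define N where "N = M * p"
 have "of_nat p * e \<in> Q" using e by (intro absorb_right p_mem) auto
 from add[OF step[of p] this] have "(poly f ^^ N) \<gamma> - \<gamma> \<in> Q" by (simp add: N_def)
 moreover have "periodic f ((poly f ^^ N) \<gamma>)"
 proof -
  obtain l where l: "l \<ge> 1" "(poly f ^^ l) \<gamma> = \<gamma>" using \<gamma> by (auto simp: periodic_def)
  have "(poly f ^^ l) ((poly f ^^ N) \<gamma>) = (poly f ^^ N) ((poly f ^^ l) \<gamma>)"
   by (metis add.commute comp_apply funpow_add)
  thus ?thesis using l by (auto simp: periodic_def)
 qed
 ultimately have "(poly f ^^ N) \<gamma> = \<gamma>" using \<gamma> by (intro periodic_cong_imp_eq iter_integral gi)
 moreover have "N \<ge> 1" using i m prime_ge_2_nat[OF prime] by (simp add: N_def M_def)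
 moreover have "N \<le> p * residue_degree F P * n"
 proof -
  have "i * m \<le> residue_degree F P * n" using i m by (intro mult_mono) auto
  thus ?thesis by (simp add: N_def M_def mult_ac)
 qed
 ultimately show ?thesis by blast
qed

section \<open>Valuations of differences along two orbits\<close>

lemma diff_mem_of_iter_eq:
 assumes "algebraic_int x" "algebraic_int y" "(poly f ^^ k) x = (poly f ^^ k) y"
 shows "x - y \<in> Q"
 using iter_diff_mem_iff[OF assms(1,2), of k] assms(3) zero by simp

lemma mu_le: "\<mu> \<le> real p / (real p - 1)"
proof -
 have "1 * \<mu> \<le> real p ^ r * \<mu>" using prime_ge_2_nat[OF prime] mu_mult(3) by (intro mult_right_mono one_le_power) auto
 thus ?thesis by (simp add: mu_mult(1))
qed

text \<open>The induction reads \<open>v_step\<close> backwards: a small valuation after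
  \<open>Suc k\<close> steps forces one below \<open>\<mu>\<close>, hence a small one, after
  \<open>k\<close> steps.\<close>

lemma v_iter:
 assumes x: "algebraic_int x" "algebraic_int y" and ne: "(poly f ^^ k) x \<noteq> (poly f ^^ k) y"
  and small: "v ((poly f ^^ k) x - (poly f ^^ k) y) < real p / (real p - 1)"
 shows "v ((poly f ^^ k) x - (poly f ^^ k) y) = real (degree f ^ k) * v (x - y)"
 using ne small
proof (induction k)
 case (Suc k)
 have ne: "(poly f ^^ k) x \<noteq> (poly f ^^ k) y" using Suc.prems(1) by auto
 have 1: "v ((poly f ^^ k) x - (poly f ^^ k) y) < \<mu>"
  "v ((poly f ^^ Suc k) x - (poly f ^^ Suc k) y) = real (degree f) * v ((poly f ^^ k) x - (poly f ^^ k) y)"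
  using v_step[OF iter_integral[OF x(1), of k] iter_integral[OF x(2), of k]] Suc.prems by simp_all
 hence "v ((poly f ^^ k) x - (poly f ^^ k) y) < real p / (real p - 1)" using mu_le by linarith
 thus ?case using Suc.IH[OF ne] 1(2) by simp
qed simp

lemma v_multiple_of_degree:
 assumes z: "z \<noteq> 0" and h: "h \<in> polys F" "h \<noteq> 0" "degree h \<le> n" "poly h z = 0"
 shows "\<exists>i\<in>{1..n}. \<exists>y\<in>F. y \<noteq> 0 \<and> real i * v z = v y"
proof -
 have "algebraic z" by (rule algebraic_root_of_algebraic_poly[OF algebraic_mem[OF polysD[OF h(1)]] h(2,4)])
 hence "\<exists>i\<in>{1..degree h}. \<exists>y\<in>F. y \<noteq> 0 \<and> real i * v z = v y"
  using z h algebraic_mem by (intro root_imp_v_multiple[OF closed_subfield_axioms])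
 thus ?thesis using h(3) by fastforce
qed

text \<open>Some multiple of \<open>v z\<close> by at most \<open>n\<close> is a value of
  \<open>F\<close>, and positive values of \<open>F\<close> are at least
  \<open>1 / e'\<close>.\<close>

lemma v_lower_bound:
 assumes z: "z \<noteq> 0" "v z > 0" and h: "h \<in> polys F" "h \<noteq> 0" "degree h \<le> n" "poly h z = 0"
 shows "1 \<le> real (ramification_index F p P) * real n * v z"
proof -
 obtain i y where i: "i \<in> {1..n}" "y \<in> F" "y \<noteq> 0" "real i * v z = v y"
  using v_multiple_of_degree[OF z(1) h] by blast
 obtain e' where e': "e' > 0" "e' \<le> ramification_index F p P" "\<And>x. x \<in> F ==> x \<noteq> 0 ==> real e' * v x \<in> \<int>"
  using v_ramification by blast
 obtain j where j: "real e' * v y = real_of_int j" using e'(3)[OF i(2,3)] by (auto elim: Ints_cases)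
 have "v y > 0" unfolding i(4)[symmetric] using i(1) z(2) by simp
 hence "real_of_int j > 0" unfolding j[symmetric] using e'(1) by simp
 hence "1 \<le> real e' * (real i * v z)" using j i(4) by simp
 also have "... \<le> real (ramification_index F p P) * (real n * v z)"
  using i(1) e'(2) z(2) by (intro mult_mono) auto
 finally show ?thesis by (simp add: mult.assoc)
qed

end

context pcf_poly
begin

text \<open>Take for \<open>j\<close> a multiple of the period \<open>N\<close> reached that is at
  least \<open>Suc k\<close>: the \<open>j\<close>-th iterate lies on the cycle, and
  \<open>j\<close> more steps return the \<open>Suc k\<close>-th iterate to itself. Equality already
  at step \<open>k\<close> would make the \<open>k\<close>-th iterate periodic, against minimality
  of the preperiod.\<close>

lemma periodic_companion:
 assumes \<alpha>: "preperiodic f \<alpha>" and m: "preper f \<alpha> = Suc k"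
 shows "\<exists>j. periodic f ((poly f ^^ j) \<alpha>) \<and> (poly f ^^ Suc k) ((poly f ^^ j) \<alpha>) = (poly f ^^ Suc k) \<alpha> \<and>
  (poly f ^^ k) ((poly f ^^ j) \<alpha>) \<noteq> (poly f ^^ k) \<alpha>"
proof -
 have comm: "(poly f ^^ a) ((poly f ^^ b) x) = (poly f ^^ b) ((poly f ^^ a) x)" for a b x
  by (metis add.commute comp_apply funpow_add)
 obtain i j where ij: "i < j" "(poly f ^^ i) \<alpha> = (poly f ^^ j) \<alpha>" using \<alpha> by (auto simp: preperiodic_iff)
 have "periodic f ((poly f ^^ i) \<alpha>)" using ij funpow_add[of "j - i" i "poly f"] ij(1) by (auto simp: periodic_def intro!: exI[of _ "j - i"])
 hence per: "periodic f ((poly f ^^ Suc k) \<alpha>)" unfolding m[symmetric] preper_def by (rule LeastI)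
 have nper: "\<not> periodic f ((poly f ^^ k) \<alpha>)" using m not_less_Least[of k "\<lambda>m. periodic f ((poly f ^^ m) \<alpha>)"] by (simp add: preper_def)
 obtain N where N: "N \<ge> 1" "(poly f ^^ N) ((poly f ^^ Suc k) \<alpha>) = (poly f ^^ Suc k) \<alpha>"
  using per by (auto simp: periodic_def)
 define j where "j = N * Suc k"
 have fix_pow: "(poly f ^^ (N * l)) ((poly f ^^ Suc k) \<alpha>) = (poly f ^^ Suc k) \<alpha>" for l
  using N(2) by (induction l) (simp_all add: funpow_add del: funpow.simps)
 have 1: "(poly f ^^ Suc k) ((poly f ^^ j) \<alpha>) = (poly f ^^ Suc k) \<alpha>"
  by (subst comm[of "Suc k" j \<alpha>]) (simp only: j_def fix_pow)
 have pj: "periodic f ((poly f ^^ j) \<alpha>)"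
 proof -
  have "1 * Suc k \<le> j" unfolding j_def using N(1) by (intro mult_right_mono) auto
  hence "j = (j - Suc k) + Suc k" by simp
  hence e: "(poly f ^^ j) \<alpha> = (poly f ^^ (j - Suc k)) ((poly f ^^ Suc k) \<alpha>)" by (metis comp_apply funpow_add)
  have "(poly f ^^ N) ((poly f ^^ j) \<alpha>) = (poly f ^^ j) \<alpha>"
   unfolding e comm[of N "j - Suc k" "(poly f ^^ Suc k) \<alpha>"] N(2) ..
  thus ?thesis using N(1) by (auto simp: periodic_def)
 qed
 have "(poly f ^^ k) ((poly f ^^ j) \<alpha>) \<noteq> (poly f ^^ k) \<alpha>"
 proof
  assume "(poly f ^^ k) ((poly f ^^ j) \<alpha>) = (poly f ^^ k) \<alpha>"
  moreover obtain l where "l \<ge> 1" "(poly f ^^ l) ((poly f ^^ j) \<alpha>) = (poly f ^^ j) \<alpha>" using pj by (auto simp: periodic_def)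
  ultimately show False using nper by (metis comm periodic_def)
 qed
 thus ?thesis using 1 pj by blast
qed

end

section \<open>Archimedean estimates at preperiodic points\<close>

lemma (in alg_prime) v_prod:
 assumes "\<And>i. i \<in> I ==> algebraic (g i)" "\<And>i. i \<in> I ==> g i \<noteq> 0"
 shows "v (prod g I) = (\<Sum>i\<in>I. v (g i))"
 using assms
proof (induction I rule: infinite_finite_induct)
 case (insert x F)
 have "algebraic (prod g F)" using insert.prems AL.prod_mem[of F g] by auto
 thus ?case using insert by (simp add: v_mult)
qed (simp_all add: v_1)

lemma (in field_embedding) emb_iter:
 assumes "f \<in> polys L" "x \<in> L"
 shows "\<phi> ((poly f ^^ n) x) = (poly (map_emb f) ^^ n) (\<phi> x)"
 by (induction n) (simp_all add: poly_emb[OF assms(1) polys_iter[OF assms], symmetric])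

lemma (in field_embedding) emb_preperiodic:
 assumes "f \<in> polys L" "x \<in> L" "preperiodic f x"
 shows "preperiodic (map_emb f) (\<phi> x)"
proof -
 obtain i j where "i < j" "(poly f ^^ i) x = (poly f ^^ j) x" using assms(3) by (auto simp: preperiodic_iff)
 thus ?thesis unfolding preperiodic_iff using emb_iter[OF assms(1,2)] by metis
qed

lemma (in field_embedding) emb_prod_mset:
 assumes "\<And>c. c \<in># C ==> c \<in> L"
 shows "map_emb (\<Prod>c\<in>#C. [:-c, 1:]) = (\<Prod>c\<in>#C. [:- \<phi> c, 1:])"
  "(\<Prod>c\<in>#C. [:-c, 1:]) \<in> polys L"
proof -
 have "map_emb (\<Prod>c\<in>#C. [:-c, 1:]) = (\<Prod>c\<in>#C. [:- \<phi> c, 1:]) \<and> (\<Prod>c\<in>#C. [:-c, 1:]) \<in> polys L"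
  using assms
 proof (induction C)
  case empty
  show ?case using polys_1 emb_pCons[of 1 0] by (simp add: hom_1 one_pCons)
 next
  case (add c C)
  have c: "[:-c, 1:] \<in> polys L" using add.prems
   by (intro polys_pCons polys_0 uminus_mem one_mem) auto
  have IH: "map_emb (\<Prod>c\<in>#C. [:-c, 1:]) = (\<Prod>c\<in>#C. [:- \<phi> c, 1:])" "(\<Prod>c\<in>#C. [:-c, 1:]) \<in> polys L"
   using add by auto
  have "map_emb [:-c, 1:] = [:- \<phi> c, 1:]" using add.prems by (simp add: emb_pCons hom_uminus hom_1)
  thus ?case using IH c emb_mult[OF c IH(2)] polys_mult[OF c IH(2)] by (simp del: mult_pCons_left)
 qed
 thus "map_emb (\<Prod>c\<in>#C. [:-c, 1:]) = (\<Prod>c\<in>#C. [:- \<phi> c, 1:])" "(\<Prod>c\<in>#C. [:-c, 1:]) \<in> polys L" by auto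
qed

context pcf_poly
begin

text \<open>What the domain of an embedding must contain so that the image of \<open>f\<close> is
  defined and its critical points are the images of those of \<open>f\<close>.\<close>

definition support :: "'k set" where "support = coeff f ` {..degree f} \<union> {c. poly (pderiv f) c = 0}"

lemma finite_support: "finite support"
proof -
 have "pderiv f \<noteq> 0" using degree_ge_2 by (simp add: pderiv_eq_0_iff)
 thus ?thesis unfolding support_def using poly_roots_finite by blast
qed

lemma support_algebraic: "x \<in> support ==> algebraic x"
 using polysD[OF f_int] preperiodic_integral[OF pcf] by (auto simp: support_def)

lemma embed_pcf:
 assumes emb: "field_embedding L (\<phi> :: 'k => complex)" and L: "support \<subseteq> L"
 shows "f \<in> polys L" "lead_coeff (map_poly \<phi> f) = 1" "degree (map_poly \<phi> f) = degree f"
  "poly (pderiv (map_poly \<phi> f)) w = 0 ==> preperiodic (map_poly \<phi> f) w"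
proof -
 interpret \<phi>: field_embedding L \<phi> by fact
 have "coeff f i \<in> L" for i
  using L \<phi>.zero_mem coeff_eq_0[of f i] by (cases "i \<le> degree f") (auto simp: support_def)
 thus f: "f \<in> polys L" by (simp add: polys_def)
 show dg: "degree (map_poly \<phi> f) = degree f" by (rule \<phi>.degree_emb[OF f])
 show "lead_coeff (map_poly \<phi> f) = 1" using monic by (simp add: dg \<phi>.coeff_emb \<phi>.hom_1)
 assume w: "poly (pderiv (map_poly \<phi> f)) w = 0"
 have d0: "pderiv f \<noteq> 0" using degree_ge_2 by (simp add: pderiv_eq_0_iff)
 obtain C where C: "pderiv f = smult (lead_coeff (pderiv f)) (\<Prod>c\<in>#C. [:-c, 1:])"
  using alg_closed_imp_factorization[OF d0] by blast
 have root: "poly (pderiv f) c = 0" if "c \<in># C" for c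
 proof -
  have "poly (\<Prod>c\<in>#C. [:-c, 1:]) c = 0" using that by (auto simp: poly_prod_mset prod_mset_zero_iff)
  thus ?thesis by (subst C) simp
 qed
 hence CL: "c \<in> L" if "c \<in># C" for c using that L by (auto simp: support_def)
 define l where "l = lead_coeff (pderiv f)"
 have pf: "pderiv f \<in> polys L" by (rule polys_pderiv[OF \<phi>.closed_subring_axioms f])
 have l: "l \<in> L" "l \<noteq> 0" using polysD[OF pf] d0 by (auto simp: l_def)
 have "map_poly \<phi> (pderiv f) = map_poly \<phi> ([:l:] * (\<Prod>c\<in>#C. [:-c, 1:]))"
  by (subst C) (simp add: l_def)
 also have "... = [:\<phi> l:] * (\<Prod>c\<in>#C. [:- \<phi> c, 1:])"
  using \<phi>.emb_mult[OF \<phi>.polys_const[OF l(1)] \<phi>.emb_prod_mset(2)[of C]] \<phi>.emb_prod_mset(1)[of C] CL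
  by (simp add: \<phi>.emb_pCons)
 finally have "pderiv (map_poly \<phi> f) = [:\<phi> l:] * (\<Prod>c\<in>#C. [:- \<phi> c, 1:])"
  using \<phi>.emb_pderiv[OF f] by simp
 hence "\<phi> l * poly (\<Prod>c\<in>#C. [:- \<phi> c, 1:]) w = 0" using w by simp
 moreover have "\<phi> l \<noteq> 0" using \<phi>.hom_eq_0_iff l by blast
 ultimately obtain c where "c \<in># C" "w = \<phi> c" by (auto simp: poly_prod_mset prod_mset_zero_iff)
 thus "preperiodic (map_poly \<phi> f) w" using \<phi>.emb_preperiodic[OF f CL pcf[OF root]] by blast
qed

text \<open>If the valuation of \<open>x - y\<close> were at least \<open>p / (p - 1)\<close> at
  every prime above \<open>p\<close>, then \<open>u\<close> would be integral, and some embedding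
  would give \<open>|x - y|^(p-1) \<ge> p^p\<close>. Against the bound 4 this is impossible for odd
  \<open>p\<close>; for \<open>p = 2\<close> it forces distance exactly 4.\<close>

lemma good_prime_or_chebyshev:
 assumes x: "preperiodic f x" "preperiodic f y" "x \<noteq> y"
 shows "(\<exists>Q. alg_prime Q p \<and> alg_prime.v Q p (x - y) < real p / (real p - 1)) \<or>
  (\<exists>\<epsilon>\<in>{1, - 1}. pcompose f [:(x + y) / 2, (y - x) / 4:] =
   [:(x + y) / 2:] + smult (\<epsilon> * ((y - x) / 4)) (map_poly of_int (chebyshev_rec (degree f))))"
proof (rule disjCI)
 assume no: "\<not> (\<exists>\<epsilon>\<in>{1, - 1}. pcompose f [:(x + y) / 2, (y - x) / 4:] =
   [:(x + y) / 2:] + smult (\<epsilon> * ((y - x) / 4)) (map_poly of_int (chebyshev_rec (degree f))))"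
 show "\<exists>Q. alg_prime Q p \<and> alg_prime.v Q p (x - y) < real p / (real p - 1)"
 proof (rule ccontr)
  assume nQ: "\<not> (\<exists>Q. alg_prime Q p \<and> alg_prime.v Q p (x - y) < real p / (real p - 1))"
  have p2: "p \<ge> 2" by (rule prime_ge_2_nat[OF prime])
  have xi: "algebraic_int x" "algebraic_int y" using x by (auto intro: preperiodic_integral)
  define z where "z = x - y"
  have z: "algebraic_int z" "z \<noteq> 0" using xi x(3) by (auto simp: z_def intro: algebraic_int_diff_mult)
  have pnz: "(of_nat p :: 'k) \<noteq> 0" using p2 by simp
  define u where "u = z ^ (p - 1) / of_nat p ^ p"
  have unz: "u \<noteq> 0" using z pnz by (simp add: u_def)
  have u: "algebraic_int u"
  proof (rule algebraic_int_if_vge_0[OF prime])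
   show "algebraic_int (of_nat p ^ p * u)" using AI.power_mem[of z "p - 1"] z pnz by (simp add: u_def)
   fix Q :: "'k set" assume "alg_prime Q p"
   then interpret q: alg_prime Q p .
   have "q.v z \<ge> real p / (real p - 1)" using nQ q.alg_prime_axioms by (auto simp: z_def)
   hence "(real p - 1) * q.v z \<ge> real p" using p2 by (simp add: pos_divide_le_eq mult.commute)
   moreover have "q.v u = real (p - 1) * q.v z - real p"
    unfolding u_def using z pnz by (simp add: q.v_divide q.v_power q.v_p q.al algebraic_int_imp_algebraic)
   ultimately show "q.vge 0 u" using p2 by (simp add: q.vge_def of_nat_diff)
  qed
  have "\<exists>L (\<phi> :: 'k => complex). field_embedding L \<phi> \<and> support \<union> {x, y} \<subseteq> L \<and> u \<in> L \<and> norm (\<phi> u) \<ge> 1"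
   by (rule exists_large_embedding[OF u unz]) (use finite_support support_algebraic xi in auto)
  then obtain L and \<phi> :: "'k => complex" where L: "field_embedding L \<phi>" "support \<subseteq> L" "x \<in> L" "y \<in> L" "u \<in> L" "norm (\<phi> u) \<ge> 1"
   by auto
  interpret \<phi>: field_embedding L \<phi> by fact
  note e = embed_pcf[OF L(1,2)]
  have deg2: "degree (map_poly \<phi> f) \<ge> 2" using e(3) degree_ge_2 by simp
  have pre: "preperiodic (map_poly \<phi> f) (\<phi> x)" "preperiodic (map_poly \<phi> f) (\<phi> y)"
   using \<phi>.emb_preperiodic[OF e(1)] L x by auto
  have le4: "norm (\<phi> x - \<phi> y) \<le> 4" by (rule pcf_diff_le[OF e(2) deg2 e(4) pre])
  have zL: "z \<in> L" unfolding z_def using L by (intro \<phi>.diff_mem)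
  have "\<phi> u = \<phi> z ^ (p - 1) / of_nat p ^ p"
   unfolding u_def using zL by (simp add: \<phi>.hom_divide \<phi>.hom_power \<phi>.power_mem \<phi>.of_nat_mem \<phi>.hom_of_nat)
  hence "norm (\<phi> u) = norm (\<phi> z) ^ (p - 1) / real p ^ p" by (simp add: norm_divide norm_power)
  hence big: "real p ^ p \<le> norm (\<phi> z) ^ (p - 1)" using L(6) p2 by (simp add: le_divide_eq)
  have nz: "norm (\<phi> z) \<le> 4" using le4 L by (simp add: z_def \<phi>.hom_diff)
  have small: "norm (\<phi> z) ^ (p - 1) \<le> 4 ^ (p - 1)" using nz by (intro power_mono) auto
  show False
  proof (cases "p = 2")
   case True
   hence "norm (\<phi> x - \<phi> y) = 4" using big nz L by (simp add: z_def \<phi>.hom_diff)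
   from pcf_diff_eq_4_imp_chebyshev[OF e(2) deg2 e(4) pre this] obtain \<epsilon> where \<epsilon>: "\<epsilon> \<in> {1, - 1 :: complex}"
    "pcompose (map_poly \<phi> f) [:(\<phi> x + \<phi> y) / 2, (\<phi> y - \<phi> x) / 4:] =
     [:(\<phi> x + \<phi> y) / 2:] + smult (\<epsilon> * ((\<phi> y - \<phi> x) / 4)) (map_poly of_int (chebyshev_rec (degree f)))"
    unfolding e(3) by blast
   \<comment> \<open>Every ingredient of the complex identity is the image of something over
     \<open>L\<close>, so the identity descends along the injective embedding.\<close>
   define \<epsilon>' where "\<epsilon>' = (if \<epsilon> = 1 then 1 else - 1 :: 'k)"
   have \<epsilon>': "\<epsilon>' \<in> {1, - 1}" "\<phi> \<epsilon>' = \<epsilon>" "\<epsilon>' \<in> L"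
    using \<epsilon>(1) \<phi>.one_mem \<phi>.uminus_mem[OF \<phi>.one_mem] by (auto simp: \<epsilon>'_def \<phi>.hom_1 \<phi>.hom_uminus)
   have num: "numeral n \<in> L" "\<phi> (numeral n) = numeral n" for n
    using \<phi>.of_nat_mem[of "numeral n"] \<phi>.hom_of_nat[of "numeral n"] by simp_all
   define b where "b = (x + y) / 2"
   define \<kappa> where "\<kappa> = (y - x) / 4"
   have b: "b \<in> L" "\<phi> b = (\<phi> x + \<phi> y) / 2"
    unfolding b_def using L by (auto simp: \<phi>.hom_divide \<phi>.hom_add \<phi>.add_mem num intro!: \<phi>.divide_mem)
   have \<kappa>: "\<kappa> \<in> L" "\<phi> \<kappa> = (\<phi> y - \<phi> x) / 4"
    unfolding \<kappa>_def using L by (auto simp: \<phi>.hom_divide \<phi>.hom_diff \<phi>.diff_mem num intro!: \<phi>.divide_mem)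
   define T where "T = map_poly (of_int :: int => 'k) (chebyshev_rec (degree f))"
   have T: "T \<in> polys L" "map_poly \<phi> T = map_poly of_int (chebyshev_rec (degree f))"
    by (auto simp: T_def polys_def coeff_map_poly \<phi>.of_int_mem \<phi>.hom_of_int \<phi>.coeff_emb intro!: poly_eqI)
   have lin: "[:b, \<kappa>:] \<in> polys L" using b \<kappa> by (intro \<phi>.polys_pCons \<phi>.polys_0)
   have c: "[:\<epsilon>' * \<kappa>:] \<in> polys L" by (intro \<phi>.polys_const \<phi>.mult_mem \<epsilon>' \<kappa>)
   have "map_poly \<phi> (pcompose f [:b, \<kappa>:]) = map_poly \<phi> ([:b:] + [:\<epsilon>' * \<kappa>:] * T)"
    using \<epsilon>(2) \<phi>.emb_pcompose[OF e(1) lin] \<phi>.emb_add[OF \<phi>.polys_const[OF b(1)] \<phi>.polys_mult[OF c T(1)]]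
     \<phi>.emb_mult[OF c T(1)] \<epsilon>' b \<kappa> T
    by (simp add: \<phi>.emb_pCons \<phi>.hom_mult)
   hence "pcompose f [:b, \<kappa>:] = [:b:] + [:\<epsilon>' * \<kappa>:] * T"
    using \<phi>.emb_eq_iff[OF \<phi>.polys_pcompose[OF e(1) lin] \<phi>.polys_add[OF \<phi>.polys_const[OF b(1)] \<phi>.polys_mult[OF c T(1)]]]
    by blast
   hence "pcompose f [:b, \<kappa>:] = [:b:] + smult (\<epsilon>' * \<kappa>) T" by simp
   thus False using no \<epsilon>'(1) unfolding b_def \<kappa>_def T_def by blast
  next
   case False
   hence p3: "p \<ge> 3" using p2 by simp
   have "(4::nat) ^ (p - 1) < p ^ p"
   proof (cases "p = 3")
    case False
    hence "p \<ge> 4" using p3 by simp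
    have "(4::nat) ^ (p - 1) < 4 ^ p" using p3 by (intro power_strict_increasing) auto
    also have "... \<le> p ^ p" using \<open>p \<ge> 4\<close> by (intro power_mono) auto
    finally show ?thesis .
   qed simp
   hence "(4::real) ^ (p - 1) < real p ^ p" by (metis of_nat_less_iff of_nat_numeral of_nat_power)
   thus False using big small by linarith
  qed
 qed
qed

text \<open>Counting the squares, \<open>D\<close> has \<open>N * (N - 1)\<close> factors.
  Valuations of at least \<open>N / (N - 1)\<close> at every prime would make
  \<open>u = D / p^(N^2)\<close> integral, and an embedding with large image of \<open>u\<close>
  would contradict the strict bound \<open>2^(N^2)\<close>.\<close>

lemma discriminant_prime:
 fixes x :: "nat => 'k"
 assumes N: "N \<ge> 4" and x: "\<And>i. i < N ==> preperiodic f (x i)" and inj: "inj_on x {..<N}"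
 shows "\<exists>Q i j. alg_prime Q p \<and> j < i \<and> i < N \<and> alg_prime.v Q p (x i - x j) < real N / (real N - 1)"
proof (rule ccontr)
 assume nQ: "\<not> ?thesis"
 let ?D = "\<lambda>i. \<Prod>j<i. (x i - x j)\<^sup>2"
 have p2: "p \<ge> 2" by (rule prime_ge_2_nat[OF prime])
 have pnz: "(of_nat p :: 'k) \<noteq> 0" using p2 by simp
 have xi: "algebraic_int (x i)" if "i < N" for i using x[OF that] by (rule preperiodic_integral)
 have xd: "algebraic_int (x i - x j)" "x i - x j \<noteq> 0" if "i < N" "j < i" for i j
  using xi that inj by (auto intro!: algebraic_int_diff_mult dest!: inj_onD[OF inj])
 define D where "D = (\<Prod>i<N. \<Prod>j<i. (x i - x j)\<^sup>2)"
 have D: "algebraic_int D" "D \<noteq> 0"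
  unfolding D_def using xd AI.power_mem by (auto intro!: AI.prod_mem[unfolded mem_Collect_eq])
 define u where "u = D / of_nat p ^ (N\<^sup>2)"
 have unz: "u \<noteq> 0" using D pnz by (simp add: u_def)
 have u: "algebraic_int u"
 proof (rule algebraic_int_if_vge_0[OF prime])
  show "algebraic_int (of_nat p ^ (N\<^sup>2) * u)" using D by (simp add: u_def)
  fix Q :: "'k set" assume "alg_prime Q p"
  then interpret q: alg_prime Q p .
  have vge: "q.v (x i - x j) \<ge> real N / (real N - 1)" if "i < N" "j < i" for i j
   using nQ q.alg_prime_axioms that by (meson not_less)
  have alg2: "algebraic ((x i - x j)\<^sup>2)" if "i < N" "j < i" for i j
   by (rule q.al(7)[OF algebraic_int_imp_algebraic[OF xd(1)[OF that]]])
  have "q.v D = (\<Sum>i<N. q.v (?D i))"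
   unfolding D_def using xd alg2 by (intro q.v_prod) (auto intro!: q.AL.prod_mem[unfolded mem_Collect_eq])
  also have "... = (\<Sum>i<N. \<Sum>j<i. 2 * q.v (x i - x j))"
  proof (rule sum.cong[OF refl])
   fix i assume "i \<in> {..<N}"
   hence i: "i < N" by simp
   have "q.v (?D i) = (\<Sum>j<i. q.v ((x i - x j)\<^sup>2))"
    using alg2[OF i] xd(2)[OF i] by (intro q.v_prod) auto
   also have "... = (\<Sum>j<i. 2 * q.v (x i - x j))"
    using xd[OF i] by (intro sum.cong refl) (auto simp: q.v_power algebraic_int_imp_algebraic)
   finally show "q.v (?D i) = (\<Sum>j<i. 2 * q.v (x i - x j))" .
  qed
  also have "... \<ge> (\<Sum>i<N. \<Sum>j<i. 2 * (real N / (real N - 1)))"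
   using vge by (intro sum_mono mult_left_mono) auto
  also have "(\<Sum>i<N. \<Sum>j<i. 2 * c) = (\<Sum>i<N. 2 * real i) * c" for c :: real
   by (simp add: sum_distrib_right sum_distrib_left mult_ac)
  also have "(\<Sum>i<N. 2 * real i) = real N * (real N - 1)" by (induction N) (auto simp: algebra_simps)
  also have "real N * (real N - 1) * (real N / (real N - 1)) = real (N\<^sup>2)"
   using N by (simp add: power2_eq_square)
  finally have vD: "q.v D \<ge> real (N\<^sup>2)" .
  have "q.v u = q.v D - real (N\<^sup>2)"
   unfolding u_def using D pnz by (simp add: q.v_divide q.v_power q.v_p q.al algebraic_int_imp_algebraic)
  thus "q.vge 0 u" using vD by (simp add: q.vge_def)
 qed
 have "\<exists>L (\<phi> :: 'k => complex). field_embedding L \<phi> \<and> support \<union> x ` {..<N} \<subseteq> L \<and> u \<in> L \<and> norm (\<phi> u) \<ge> 1"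
  by (rule exists_large_embedding[OF u unz]) (use finite_support support_algebraic xi in auto)
 then obtain L and \<phi> :: "'k => complex" where L: "field_embedding L \<phi>" "support \<subseteq> L" "x ` {..<N} \<subseteq> L" "u \<in> L" "norm (\<phi> u) \<ge> 1"
  by auto
 interpret \<phi>: field_embedding L \<phi> by fact
 note e = embed_pcf[OF L(1,2)]
 have deg2: "degree (map_poly \<phi> f) \<ge> 2" using e(3) degree_ge_2 by simp
 have xL: "x i \<in> L" if "i < N" for i using L(3) that by auto
 have lt: "(\<Prod>i<N. \<Prod>k<i. (norm (\<phi> (x i) - \<phi> (x k)))\<^sup>2) < 2 ^ (N\<^sup>2)"
  by (rule pcf_prod_diff_less[OF e(2) deg2 _ _ N]) (erule e(4), intro \<phi>.emb_preperiodic e xL x)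
 have DL: "(?D i) \<in> L" if "i < N" for i
  using that xL by (intro \<phi>.prod_mem \<phi>.power_mem \<phi>.diff_mem) auto
 have "\<phi> D = (\<Prod>i<N. \<Prod>k<i. (\<phi> (x i) - \<phi> (x k))\<^sup>2)" unfolding D_def
 proof (subst \<phi>.hom_prod)
  show "(?D i) \<in> L" if "i \<in> {..<N}" for i using DL that by simp
  show "(\<Prod>i<N. \<phi> (?D i)) = (\<Prod>i<N. \<Prod>k<i. (\<phi> (x i) - \<phi> (x k))\<^sup>2)"
  proof (rule prod.cong[OF refl])
   fix i assume i: "i \<in> {..<N}"
   have "\<phi> (?D i) = (\<Prod>j<i. \<phi> ((x i - x j)\<^sup>2))"
    using i xL by (intro \<phi>.hom_prod \<phi>.power_mem \<phi>.diff_mem) auto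
   also have "... = (\<Prod>j<i. (\<phi> (x i) - \<phi> (x j))\<^sup>2)"
    using i xL by (intro prod.cong refl) (simp add: \<phi>.hom_power \<phi>.hom_diff \<phi>.diff_mem)
   finally show "\<phi> (?D i) = (\<Prod>j<i. (\<phi> (x i) - \<phi> (x j))\<^sup>2)" .
  qed
 qed
 hence nD: "norm (\<phi> D) = (\<Prod>i<N. \<Prod>k<i. (norm (\<phi> (x i) - \<phi> (x k)))\<^sup>2)"
  by (simp add: prod_norm[symmetric] norm_power)
 have DL': "D \<in> L" unfolding D_def by (rule \<phi>.prod_mem) (use DL in auto)
 have "\<phi> u = \<phi> D / of_nat p ^ (N\<^sup>2)"
  unfolding u_def using DL' by (simp add: \<phi>.hom_divide \<phi>.hom_power \<phi>.power_mem \<phi>.of_nat_mem \<phi>.hom_of_nat)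
 hence "norm (\<phi> u) = norm (\<phi> D) / real p ^ (N\<^sup>2)" by (simp add: norm_divide norm_power)
 hence "real p ^ (N\<^sup>2) \<le> norm (\<phi> D)" using L(5) p2 by (simp add: le_divide_eq)
 moreover have "(2::real) ^ (N\<^sup>2) \<le> real p ^ (N\<^sup>2)" using p2 by (intro power_mono) auto
 ultimately show False using lt nD by linarith
qed

text \<open>The definition of conjugacy wants the inverse affine map,
  \<open>t \<mapsto> (t - b) / \<kappa>\<close>; this is where the witnesses come from.\<close>

lemma chebyshev_imp_linearly_conjugate:
 assumes b: "algebraic b" "algebraic \<kappa>" "\<kappa> \<noteq> 0" and \<epsilon>: "\<epsilon> \<in> {1, - 1}"
  and eq: "pcompose f [:b, \<kappa>:] = [:b:] + smult (\<epsilon> * \<kappa>) (map_poly of_int (chebyshev_rec (degree f)))"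
 shows "linearly_conjugate (alg_closure_in F) f (map_poly of_int (chebyshev (degree f))) \<or>
  linearly_conjugate (alg_closure_in F) f (- map_poly of_int (chebyshev (degree f)))"
proof -
 interpret AL: closed_subfield "{x :: 'k. algebraic x}" by (rule closed_subfield_algebraic)
 define T where "T = map_poly (of_int :: int => 'k) (chebyshev_rec (degree f))"
 have T: "map_poly of_int (chebyshev (degree f)) = T"
  using is_chebyshev_chebyshev(2)[of "degree f"] degree_ge_2 by (simp add: T_def)
 have mem: "inverse \<kappa> \<in> alg_closure_in F" "- b / \<kappa> \<in> alg_closure_in F"
  using AL.inverse_mem[of \<kappa>] AL.divide_mem[of "- b" \<kappa>] AL.uminus_mem[of b] b by (auto intro!: algebraic_mem_alg_closure_in)
 have f_eq: "f = smult (inverse (inverse \<kappa>)) (pcompose (smult \<epsilon> T) [:- b / \<kappa>, inverse \<kappa>:] - [:- b / \<kappa>:])"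
 proof (intro poly_eq_poly_eq_iff[THEN iffD1] ext)
  fix t
  define s where "s = - b / \<kappa> + t * inverse \<kappa>"
  have t: "t = b + s * \<kappa>" using b(3) by (simp add: s_def field_simps)
  have "poly f t = poly (pcompose f [:b, \<kappa>:]) s" by (simp add: poly_pcompose t)
  also have "... = b + \<epsilon> * \<kappa> * poly T s" by (simp add: eq T_def)
  also have "... = \<kappa> * (\<epsilon> * poly T s - (- b / \<kappa>))" using b(3) by (simp add: field_simps)
  finally show "poly f t = poly (smult (inverse (inverse \<kappa>)) (pcompose (smult \<epsilon> T) [:- b / \<kappa>, inverse \<kappa>:] - [:- b / \<kappa>:])) t"
   by (simp add: poly_pcompose s_def)
 qed
 have "linearly_conjugate (alg_closure_in F) f (smult \<epsilon> T)"
  unfolding linearly_conjugate_def using mem b(3) f_eq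
  by (intro bexI[of _ "inverse \<kappa>"] bexI[of _ "- b / \<kappa>"]) auto
 thus ?thesis using \<epsilon> by (auto simp: T)
qed

end

section \<open>Unramified extensions\<close>

lemma (in closed_subring) polys_iter_poly:
 "f \<in> polys R ==> iter_poly f n \<in> polys R"
 unfolding iter_poly_def
 by (induction n) (auto intro!: polys_pcompose polys_pCons polys_0 zero_mem one_mem)

lemma lead_coeff_diff_left:
 fixes a b :: "'a :: ring_1 poly"
 shows "degree b < degree a ==> lead_coeff (a - b) = lead_coeff a"
 using degree_add_eq_left[of "- b" a] by (simp add: coeff_eq_0)

context alg_prime
begin

lemma poly_diff_vring:
 assumes "h \<in> polys \<O>" "x \<in> \<O>" "y \<in> \<O>"
 shows "\<exists>u\<in>\<O>. poly h x - poly h y = (x - y) * u"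
proof -
 have "poly h x = (x - y) * poly (synthetic_div h y) x + poly h y"
  using arg_cong[OF synthetic_div_correct[of h y], of "\<lambda>h. poly h x"] by (simp add: algebra_simps)
 thus ?thesis using VR.poly_mem[OF VR.polys_synthetic_div[OF assms(1,3)] assms(2)]
  by (intro bexI[of _ "poly (synthetic_div h y) x"]) auto
qed

lemma monic_root_vring:
 assumes h: "h \<in> polys \<O>" "lead_coeff h = 1" "\<And>i. algebraic (coeff h i)" and x: "poly h x = 0"
 shows "x \<in> \<O>"
proof (rule ccontr)
 assume nx: "x \<notin> \<O>"
 hence xnz: "x \<noteq> 0" using VR.zero_mem by auto
 have "h \<noteq> 0" using h(2) by auto
 hence alg: "algebraic x" by (rule algebraic_root_of_algebraic_poly[OF h(3) _ x])
 hence neg: "v x < 0" using vunit_iff(3)[OF alg xnz] nx by simp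
 define n where "n = degree h"
 have "poly h x = x ^ n + (\<Sum>j<n. coeff h j * x ^ j)"
  using h(2) by (simp add: poly_altdef n_def lessThan_Suc_atMost[symmetric] add.commute)
 moreover have "x ^ n + (\<Sum>j<n. coeff h j * x ^ j) \<noteq> 0"
 proof (rule v_add_eq(1))
  have tm: "algebraic (coeff h j * x ^ j)" for j by (intro al h(3) alg)
  show "algebraic (\<Sum>j<n. coeff h j * x ^ j)" by (intro AL.sum_mem[unfolded mem_Collect_eq] tm)
  show "vge ((real n - 1) * v x) (\<Sum>j<n. coeff h j * x ^ j)"
  proof (intro vge_sum conjI tm)
   fix j assume "j \<in> {..<n}"
   hence le: "(real n - 1) * v x \<le> 0 + real j * v x" using neg by (simp add: mult_right_mono_neg)
   have "vge 0 (coeff h j)" using vge_0_iff[OF h(3)] polysD[OF h(1)] by simp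
   moreover have "vge (real j * v x) (x ^ j)" by (rule vge_power[OF alg]) (simp add: vge_def)
   ultimately have "vge (0 + real j * v x) (coeff h j * x ^ j)" by (rule vge_mult[OF h(3) al(7)[OF alg]])
   thus "vge ((real n - 1) * v x) (coeff h j * x ^ j)" using le by (rule vge_mono)
  qed
  show "v (x ^ n) < (real n - 1) * v x" using neg by (simp add: v_power[OF alg xnz])
 qed (use alg xnz al in auto)
 ultimately show False using x by simp
qed

lemma prod_mset_vmax:
 assumes "\<And>c. c \<in># C ==> c \<in> \<O>" "prod_mset C \<in> \<M>"
 shows "\<exists>c. c \<in># C \<and> c \<in> \<M>"
proof (rule ccontr)
 assume no: "\<not> (\<exists>c. c \<in># C \<and> c \<in> \<M>)"
 hence "vunit c" if "c \<in># C" for c using that assms(1) by (auto simp: vunit_def)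
 hence "vunit (prod_mset C)" by (induction C) (auto intro: vunit_1 vunit_mult)
 thus False using assms(2) by (simp add: vunit_def)
qed

end

context pcf_poly_prime
begin

text \<open>On the residue disc of an integral point each step gains at least \<open>c\<close>: the
  top term because its degree is at least 2, the middle terms because their coefficients have
  valuation at least 1.\<close>

lemma contraction:
 assumes \<delta>: "algebraic_int \<delta>" and \<theta>: "algebraic \<theta>" "\<theta> - \<delta> \<in> \<M>"
 shows "\<exists>c>0. \<forall>k. vge (real (Suc k) * c) ((poly f ^^ k) \<theta> - (poly f ^^ k) \<delta>)"
proof -
 have alg: "algebraic ((poly f ^^ k) \<theta>)" for k
  using AL.polys_iter[of f \<theta> k] f_int \<theta>(1) by (auto simp: polys_def)
 have int: "algebraic_int ((poly f ^^ k) \<delta>)" for k by (rule iter_integral[OF \<delta>])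
 have zalg: "algebraic ((poly f ^^ k) \<theta> - (poly f ^^ k) \<delta>)" for k using alg int by (intro al) auto
 obtain t where t: "t > 0" "vge t (\<theta> - \<delta>)"
 proof (cases "\<theta> - \<delta> = 0")
  case True
  thus ?thesis using that[of 1] by simp
 next
  case False
  thus ?thesis using vunit_iff(2)[OF zalg[of 0, simplified] False] \<theta>(2) that[of "v (\<theta> - \<delta>)"] by (simp add: vge_def)
 qed
 define c where "c = min 1 t"
 have c: "c > 0" "c \<le> 1" "c \<le> t" using t by (auto simp: c_def)
 have "vge (real (Suc k) * c) ((poly f ^^ k) \<theta> - (poly f ^^ k) \<delta>)" for k
 proof (induction k)
  case 0
  thus ?case using vge_mono[OF t(2) c(3)] by simp
 next
  case (Suc k)
  define x y where "x = (poly f ^^ k) \<theta>" and "y = (poly f ^^ k) \<delta>"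
  define z where "z = x - y"
  define m where "m = real (Suc k) * c"
  have m: "m \<ge> c" using c(1) by (simp add: m_def)
  have z: "algebraic z" "vge m z" using Suc zalg[of k] by (auto simp: z_def x_def y_def m_def)
  have y: "algebraic_int y" by (simp add: y_def int)
  have balg: "algebraic (coeff (pcompose f [:y, 1:]) j)" for j using shift_coeff_integral[OF y] by auto
  have "vge (m + c) (z ^ degree f)"
  proof (rule vge_mono[OF vge_power[OF z]])
   have "2 * m \<le> real (degree f) * m" using degree_ge_2 m c by (intro mult_right_mono) auto
   thus "m + c \<le> real (degree f) * m" using m by simp
  qed
  moreover have "vge (m + c) (\<Sum>j\<in>{1..<degree f}. coeff (pcompose f [:y, 1:]) j * z ^ j)"
  proof (intro vge_sum conjI al balg z(1))
   fix j assume j: "j \<in> {1..<degree f}"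
   obtain s where s: "s < r" "vge (real (r - s)) (coeff (pcompose f [:y, 1:]) j)" using shift_coeff_vge[OF y j] by blast
   have "vge 1 (coeff (pcompose f [:y, 1:]) j)" by (rule vge_mono[OF s(2)]) (use s(1) in simp)
   hence "vge (1 + real j * m) (coeff (pcompose f [:y, 1:]) j * z ^ j)"
    by (intro vge_mult balg al vge_power z)
   moreover have "1 * m \<le> real j * m" using j m c by (intro mult_right_mono) auto
   hence "m + c \<le> 1 + real j * m" using c by simp
   ultimately show "vge (m + c) (coeff (pcompose f [:y, 1:]) j * z ^ j)" by (rule vge_mono)
  qed
  ultimately have "vge (m + c) (poly f x - poly f y)" unfolding shift_eq z_def[symmetric]
   by (intro vge_add al(7)[OF z(1)] AL.sum_mem[unfolded mem_Collect_eq] al(4)[OF balg al(7)[OF z(1)]])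
  thus ?case by (simp add: x_def y_def m_def algebra_simps)
 qed
 thus ?thesis using c(1) by blast
qed

text \<open>
 If \<open>p\<close> is unramified in \<open>F\<close> at \<open>Q\<close> then it stays so after adjoining a periodic point \<open>\<delta>\<close>: choose
 a monic lift \<open>G\<close> of the minimal polynomial of \<open>\<delta>\<close> modulo \<open>Q\<close> and a root \<open>\<theta>\<close> of \<open>G\<close> near \<open>\<delta>\<close>. The
 extension by \<open>\<theta>\<close> is unramified, and \<open>\<delta>\<close> is the \<open>Q\<close>-adic limit of the iterates of \<open>\<theta>\<close>.
\<close>

lemma unramified_periodic:
 assumes vZ: "\<And>x. x \<in> F ==> x \<noteq> 0 ==> v x \<in> \<int>" and \<delta>: "periodic f \<delta>"
  and y: "y \<in> adjoin F \<delta>" "y \<noteq> 0"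
 shows "v y \<in> \<int>"
proof -
 define R where "R = F \<inter> \<O>"
 interpret R: closed_subring R
  unfolding R_def by unfold_locales (auto intro: mem_intros VR.mem_intros)
 have \<delta>i: "algebraic_int \<delta>" by (rule preperiodic_integral[OF periodic_imp_preperiodic[OF \<delta>]])
 have \<delta>O: "\<delta> \<in> \<O>" by (rule integral_vring[OF \<delta>i])
 have OFR: "{x \<in> F. algebraic_int x} \<subseteq> R" using integral_vring by (auto simp: R_def)
 have RO: "polys R \<subseteq> polys \<O>" by (rule polys_mono) (simp add: R_def)
 have RF: "polys R \<subseteq> polys F" by (rule polys_mono) (simp add: R_def)
 obtain T where T: "T \<ge> 1" "(poly f ^^ T) \<delta> = \<delta>" using \<delta> by (auto simp: periodic_def)
 \<comment> \<open>Polynomials over the local ring of \<open>F\<close> that are nonzero modulo the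
   maximal ideal but vanish there at \<open>\<delta>\<close>. One of least degree lifts the minimal
   polynomial of the residue of \<open>\<delta>\<close>.\<close>
 define P where "P h \<longleftrightarrow> h \<in> polys R \<and> poly h \<delta> \<in> \<M> \<and> (\<exists>i. coeff h i \<notin> \<M>)" for h
 have "P (iter_poly f T - [:0, 1:])"
 proof -
  have "1 < degree f ^ T" using degree_ge_2 T(1) by (intro one_less_power) auto
  hence dg: "degree [:0, 1 :: 'k:] < degree (iter_poly f T)" by (simp add: degree_iter_poly)
  have "coeff (iter_poly f T - [:0, 1:]) (degree (iter_poly f T - [:0, 1:])) \<notin> \<M>" using lead_coeff_iter_poly[OF monic, of T] degree_ge_2 lead_coeff_diff_left[OF dg] one_notin_vmax by simp
  moreover have "iter_poly f T \<in> polys R"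
   using f_int polys_mono[OF OFR] by (intro R.polys_iter_poly) blast
  hence "iter_poly f T - [:0, 1:] \<in> polys R"
   by (intro R.polys_diff R.polys_pCons R.polys_0 R.zero_mem R.one_mem)
  ultimately show ?thesis unfolding P_def using T(2) vmax_0 by (auto simp: poly_iter_poly)
 qed
 define G0 where "G0 = arg_min degree P"
 have PG0: "P G0" "\<And>h. P h ==> degree G0 \<le> degree h"
  unfolding G0_def using arg_min_nat_lemma[of P _ degree] \<open>P (iter_poly f T - [:0, 1:])\<close> by auto
 define l where "l = lead_coeff G0"
 have l: "l \<in> R" using PG0(1) by (auto simp: l_def P_def polys_def)
 \<comment> \<open>Otherwise the top term could be dropped without leaving \<open>P\<close>, against
   minimality of the degree.\<close>
 have "l \<notin> \<M>"
 proof
  assume lM: "l \<in> \<M>"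
  define h where "h = G0 - monom l (degree G0)"
  have "l * \<delta> ^ degree G0 \<in> \<M>" by (intro vmax_mult_right lM VR.power_mem \<delta>O)
  hence "poly h \<delta> \<in> \<M>" using PG0(1) vmax_diff by (simp add: h_def poly_monom P_def)
  moreover obtain i where i: "coeff G0 i \<notin> \<M>" using PG0(1) by (auto simp: P_def)
  hence hi: "coeff h i \<notin> \<M>" using lM by (auto simp: h_def coeff_monom l_def)
  moreover have "h \<in> polys R" unfolding h_def using PG0(1) l by (intro R.polys_diff R.polys_monom) (auto simp: P_def)
  ultimately have "degree G0 \<le> degree h" using PG0(2) by (auto simp: P_def)
  moreover have "degree h \<le> degree G0" unfolding h_def by (intro degree_diff_le degree_monom_le order_refl)
  moreover have "coeff h (degree G0) = 0" by (simp add: h_def l_def)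
  ultimately show False using hi vmax_0 by simp
 qed
 hence inv: "inverse l \<in> R" "l \<noteq> 0" using l inverse_mem_vring inverse_mem vmax_0 by (auto simp: R_def)
 define G where "G = smult (inverse l) G0"
 have GR: "G \<in> polys R" "lead_coeff G = 1" "poly G \<delta> \<in> \<M>"
  using PG0(1) inv R.polys_smult vmax_mult[of "inverse l"] by (auto simp: G_def P_def l_def R_def)
 have G0: "G \<noteq> 0" using GR(2) by auto
 have min: "coeff h i \<in> \<M>" if "h \<in> polys R" "degree h < degree G" "poly h \<delta> \<in> \<M>" for h i
  using PG0(2)[of h] that inv by (auto simp: P_def G_def)
 obtain A where A: "G = (\<Prod>\<theta>\<in>#A. [:-\<theta>, 1:])" using alg_closed_imp_factorization[OF G0] GR(2) by auto
 have Gco: "coeff G i \<in> F" "coeff G i \<in> \<O>" for i using polysD[OF GR(1)] by (auto simp: R_def)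
 have root: "poly G \<theta> = 0" if "\<theta> \<in># A" for \<theta>
  using that by (subst A) (auto simp: poly_prod_mset prod_mset_zero_iff)
 have rootO: "\<theta> \<in> \<O>" "algebraic \<theta>" if "\<theta> \<in># A" for \<theta>
  using monic_root_vring[OF _ GR(2) algebraic_mem[OF Gco(1)] root[OF that]] subsetD[OF RO GR(1)]
   algebraic_root_of_algebraic_poly[OF algebraic_mem[OF Gco(1)] G0 root[OF that]] by auto
 \<comment> \<open>This value lies in the maximal ideal, so some factor does, and the corresponding
   root shares the residue of \<open>\<delta>\<close>.\<close>
 have "poly G \<delta> = prod_mset (image_mset (\<lambda>\<theta>. \<delta> - \<theta>) A)"
  by (subst A) (simp add: poly_prod_mset image_mset.compositionality o_def)
 hence "\<exists>c. c \<in># image_mset (\<lambda>\<theta>. \<delta> - \<theta>) A \<and> c \<in> \<M>"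
  using GR(3) rootO(1) \<delta>O by (intro prod_mset_vmax) (auto intro: VR.diff_mem)
 then obtain \<theta> where \<theta>A: "\<theta> \<in># A" and "\<delta> - \<theta> \<in> \<M>" by auto
 hence \<theta>: "\<theta> - \<delta> \<in> \<M>" using vmax_diff[OF vmax_0, of "\<delta> - \<theta>"] by simp
 have scal: "\<exists>c\<in>F. c \<noteq> 0 \<and> smult c h \<in> polys R \<and> (\<exists>i. coeff (smult c h) i \<notin> \<M>)"
  if h: "h \<in> polys F" "h \<noteq> 0" for h
 proof -
  obtain c i where c: "c \<in> F" "c \<noteq> 0" "smult c h \<in> polys {x \<in> F. algebraic_int x}" "coeff (smult c h) i \<notin> Q"
   using primitive_scaling[OF closed_subfield_axioms algebraic_mem h] by blast
  show ?thesis using vmax_integral_iff[of "coeff (smult c h) i"] polysD[OF c(3), of i] c(4) c polys_mono[OF OFR] by blast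
 qed
 \<comment> \<open>Suitably scaled, a polynomial of degree below that of \<open>G\<close> is a unit
   at \<open>\<delta>\<close>, hence at the congruent \<open>\<theta>\<close>; only the scaling
   factor from \<open>F\<close> contributes to the valuation.\<close>
 have small: "v (poly h \<theta>) \<in> \<int>" if h: "h \<in> polys F" "h \<noteq> 0" "degree h < degree G" for h
 proof -
  obtain c i where c: "c \<in> F" "c \<noteq> 0" "smult c h \<in> polys R" "coeff (smult c h) i \<notin> \<M>"
   using scal[OF h(1,2)] by blast
  define h1 where "h1 = smult c h"
  have h1: "h1 \<in> polys \<O>" using c(3) RO by (auto simp: h1_def)
  have 1: "poly h1 \<delta> \<notin> \<M>" using min[of h1 i] c h(3) by (auto simp: h1_def)
  obtain u where u: "u \<in> \<O>" "poly h1 \<theta> - poly h1 \<delta> = (\<theta> - \<delta>) * u"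
   using poly_diff_vring[OF h1 rootO(1)[OF \<theta>A] \<delta>O] by blast
  have diffM: "poly h1 \<theta> - poly h1 \<delta> \<in> \<M>" unfolding u(2) by (rule vmax_mult_right[OF \<theta> u(1)])
  have "poly h1 \<theta> \<notin> \<M>" using vmax_diff[OF _ diffM, of "poly h1 \<theta>"] 1 by auto
  moreover have "poly h1 \<theta> \<in> \<O>" by (rule VR.poly_mem[OF h1 rootO(1)[OF \<theta>A]])
  ultimately have unit: "vunit (poly h1 \<theta>)" by (simp add: vunit_def)
  have halg: "algebraic (poly h \<theta>)"
   by (rule AL.poly_mem[unfolded mem_Collect_eq]) (use polysD[OF h(1)] algebraic_mem rootO(2)[OF \<theta>A] in \<open>auto simp: polys_def\<close>)
  have hnz: "poly h \<theta> \<noteq> 0" using vunit_nz[OF unit] by (auto simp: h1_def)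
  have "v (poly h \<theta>) = - v c" using v_unit[OF unit] v_mult[OF algebraic_mem[OF c(1)] c(2) halg hnz] by (simp add: h1_def)
  thus ?thesis using vZ[OF c(1,2)] by simp
 qed
 have \<theta>val: "poly h \<theta> = 0 \<or> v (poly h \<theta>) \<in> \<int>" if h: "h \<in> polys F" for h
 proof -
  obtain q s where qs: "q \<in> polys F" "s \<in> polys F" "h = G * q + s" "s = 0 \<or> degree s < degree G"
   using monic_division[OF subsetD[OF RF GR(1)] GR(2) h] by blast
  have "poly h \<theta> = poly s \<theta>" by (simp add: qs(3) root[OF \<theta>A])
  thus ?thesis using small[OF qs(2)] qs(4) by (cases "s = 0") auto
 qed
 obtain c where c: "c > 0" "\<And>k. vge (real (Suc k) * c) ((poly f ^^ k) \<theta> - (poly f ^^ k) \<delta>)"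
  using contraction[OF \<delta>i rootO(2)[OF \<theta>A] \<theta>] by blast
 obtain h where h: "h \<in> polys F" "y = poly h \<delta>" using y(1) by (auto simp: adjoin_def)
 have "h \<noteq> 0" using h(2) y(2) by auto
 then obtain a where a: "a \<in> F" "a \<noteq> 0" "smult a h \<in> polys R" using scal[OF h(1)] by blast
 define h1 where "h1 = smult a h"
 have h1: "h1 \<in> polys \<O>" "h1 \<in> polys F" using a(3) RO RF by (auto simp: h1_def)
 have polyalg: "algebraic (poly g x)" if "g \<in> polys F" "algebraic x" for g x
  by (rule AL.poly_mem[unfolded mem_Collect_eq]) (use polysD[OF that(1)] algebraic_mem that(2) in \<open>auto simp: polys_def\<close>)
 have h1y: "poly h1 \<delta> = a * y" "poly h1 \<delta> \<noteq> 0" "algebraic (poly h1 \<delta>)"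
  using a y(2) h(2) polyalg[OF h1(2), of \<delta>] \<delta>i by (auto simp: h1_def)
 \<comment> \<open>So many iterations, in multiples of the period, bring \<open>\<theta>\<close>
   close enough to \<open>\<delta>\<close> for \<open>h1\<close> to have the same valuation at both
   points.\<close>
 obtain k0 :: nat where k0: "v (poly h1 \<delta>) < real k0 * c" using reals_Archimedean3[OF c(1)] by blast
 define k where "k = k0 * T"
 have fix_pow: "(poly f ^^ (l * T)) \<delta> = \<delta>" for l by (induction l) (use T(2) in \<open>simp_all add: funpow_add\<close>)
 define x where "x = (poly f ^^ k) \<theta>"
 have fF: "f \<in> polys F" using f_int by (auto simp: polys_def)
 have xv: "vge (real (Suc k) * c) (x - \<delta>)" using c(2)[of k] fix_pow[of k0] by (simp add: x_def k_def)
 have xO: "x \<in> \<O>"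
  unfolding x_def using subsetD[OF RO subsetD[OF polys_mono[OF OFR] f_int]] rootO(1)[OF \<theta>A] by (rule VR.polys_iter)
 have xalg: "algebraic x" using polyalg[OF polys_iter_poly[OF fF] rootO(2)[OF \<theta>A], of k] by (simp add: x_def poly_iter_poly)
 obtain u where u: "u \<in> \<O>" "poly h1 x - poly h1 \<delta> = (x - \<delta>) * u" using poly_diff_vring[OF h1(1) xO \<delta>O] by blast
 have \<delta>alg: "algebraic \<delta>" using \<delta>i by auto
 have "vge (real k0 * c) (poly h1 x - poly h1 \<delta>)"
 proof (cases "x - \<delta> = 0")
  case True
  thus ?thesis by (simp add: u(2))
 next
  case False
  have ualg: "algebraic u"
  proof -
   have "u = (poly h1 x - poly h1 \<delta>) / (x - \<delta>)" using u(2) False by simp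
   thus ?thesis by (simp only:) (intro al(3) AL.divide_mem[unfolded mem_Collect_eq] polyalg h1 xalg \<delta>alg)
  qed
  have "vge (real (Suc k) * c + 0) ((x - \<delta>) * u)"
   using u(1) vge_0_iff[OF ualg] by (intro vge_mult xv ualg al(3) xalg \<delta>alg) simp
  moreover have "real k0 * c \<le> real (Suc k) * c + 0"
  proof -
   have "k0 \<le> Suc k" using T(1) by (simp add: k_def Suc_le_eq le_SucI)
   hence "real k0 \<le> real (Suc k)" by (simp only: of_nat_le_iff)
   thus ?thesis using c(1) by (simp add: mult_right_mono)
  qed
  ultimately show ?thesis unfolding u(2) by (rule vge_mono)
 qed
 hence e: "poly h1 \<delta> + (poly h1 x - poly h1 \<delta>) \<noteq> 0" "v (poly h1 \<delta> + (poly h1 x - poly h1 \<delta>)) = v (poly h1 \<delta>)"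
  using v_add_eq[OF h1y(3,2) _ _ k0] al(3)[OF polyalg[OF h1(2) xalg] h1y(3)] by blast+
 have "poly h1 x = poly (pcompose h1 (iter_poly f k)) \<theta>" by (simp add: poly_pcompose poly_iter_poly x_def)
 moreover have "pcompose h1 (iter_poly f k) \<in> polys F" by (intro polys_pcompose h1 polys_iter_poly fF)
 ultimately have "v (poly h1 \<delta>) \<in> \<int>" using \<theta>val e(1) e(2) by fastforce
 moreover have "v (poly h1 \<delta>) = v a + v y"
  unfolding h1y(1) using v_mult[OF algebraic_mem[OF a(1)] a(2) _ y(2)] polyalg[OF h(1) \<delta>alg] h(2) by simp
 ultimately show ?thesis using vZ[OF a(1,2)] Ints_diff[of "v a + v y" "v a"] by simp
qed

end

section \<open>The main theorem\<close>

context pcf_poly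
begin

text \<open>For \<open>p = 2\<close> this excludes 3/2, the only half-integer strictly between 1 and
  the threshold 2: since 3 is odd, the whole power of 2 must divide \<open>i\<close>.\<close>

lemma deg_le_contradiction_two:
 fixes i :: nat and w :: real
 assumes "w \<in> \<int>" "real i * (3 / 2) = real (2 ^ l) * w" "i \<ge> 1"
 shows "i \<ge> 2 ^ Suc l"
proof -
 obtain a where a: "w = real_of_int a" using assms(1) by (auto elim: Ints_cases)
 have "real_of_int (3 * int i) = real_of_int (2 ^ Suc l * a)" using assms(2) a by simp
 hence "3 * int i = 2 ^ Suc l * a" by (simp only: of_int_eq_iff)
 hence "2 ^ Suc l dvd 3 * int i" by simp
 moreover have "coprime (2 ^ Suc l) (3 :: int)" by (simp add: coprime_power_left_iff)
 ultimately have "2 ^ Suc l dvd int i" using coprime_dvd_mult_right_iff by blast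
 hence "2 ^ Suc l \<le> int i" using assms(3) by (intro zdvd_imp_le) auto
 thus ?thesis by (metis of_nat_le_iff of_nat_numeral of_nat_power)
qed

lemma closed_subfield_adjoin_preperiodic:
 assumes "preperiodic f x"
 shows "closed_subfield (adjoin F x)"
proof -
 show ?thesis using preperiodic_integral[OF assms] algebraic_root_over_subring[OF closed_subring_axioms] closed_subfield_adjoin by blast
qed

lemma conjugate_preperiodic:
 assumes K: "closed_subfield K" "F \<subseteq> K" and g: "is_minpoly K x g" "poly g y = 0" and x: "preperiodic f x"
 shows "preperiodic f y"
proof -
 interpret K: closed_subfield K by fact
 obtain i j where ij: "i < j" "(poly f ^^ i) x = (poly f ^^ j) x" using x by (auto simp: preperiodic_iff)
 have "f \<in> polys K" using f_int K(2) by (auto simp: polys_def)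
 hence "iter_poly f i - iter_poly f j \<in> polys K" by (intro K.polys_diff K.polys_iter_poly)
 hence "poly (iter_poly f i - iter_poly f j) y = 0"
  using ij(2) by (intro K.minpoly_conjugate_root[OF g]) (simp_all add: poly_iter_poly)
 thus ?thesis using ij(1) by (auto simp: preperiodic_iff poly_iter_poly)
qed

lemma conjugate_integral:
 fixes K :: "'k set"
 assumes K: "closed_subfield K" and g: "is_minpoly K x g" "poly g y = 0" and H: "H \<in> polys K"
  and int: "algebraic_int (poly H x)"
 shows "algebraic_int (poly H y)"
proof -
 interpret K: closed_subfield K by fact
 obtain c where c: "poly (map_poly of_int c) (poly H x) = 0" "lead_coeff c = 1"
  using int unfolding algebraic_int_altdef_ipoly by blast
 have "map_poly of_int c \<in> polys K" using K.of_int_mem by (simp add: polys_def)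
 hence "pcompose (map_poly of_int c) H \<in> polys K" by (intro K.polys_pcompose H)
 hence "poly (pcompose (map_poly of_int c) H) y = 0"
  using c(1) by (intro K.minpoly_conjugate_root[OF g]) (simp_all add: poly_pcompose)
 hence "poly (map_poly of_int c) (poly H y) = 0" by (simp add: poly_pcompose)
 thus ?thesis using c(2) algebraic_int_altdef_ipoly[of "poly H y"] by blast
qed

text \<open>
 The unramified case. If the degree \<open>n\<close> were too small then \<open>\<gamma> - \<delta>\<close> would be highly divisible
 at every prime above \<open>p\<close>, and so would the differences of the conjugates of \<open>\<gamma>\<close> over \<open>F(\<delta>)\<close>,
 contradicting the archimedean bound on their discriminant.
\<close>

lemma unramified_bound:
 assumes e: "\<And>Q. alg_prime Q p ==> ramification_index F p (Q \<inter> F) \<le> 1"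
  and \<gamma>: "preperiodic f \<gamma>" and \<delta>: "periodic f \<delta>" and ne: "\<gamma> \<noteq> \<delta>"
  and good: "alg_prime Q0 p" "alg_prime.v Q0 p (\<gamma> - \<delta>) < real p / (real p - 1)"
  and bad: "\<And>Q. alg_prime Q p ==> alg_prime.v Q p (\<gamma> - \<delta>) > 1"
  and half: "p = 2 ==> alg_prime.v Q0 p (\<gamma> - \<delta>) \<noteq> 3 / 2"
 shows False
proof -
 let ?v = "\<lambda>Q. alg_prime.v Q p"
 define K where "K = adjoin F \<delta>"
 have \<delta>p: "preperiodic f \<delta>" by (rule periodic_imp_preperiodic[OF \<delta>])
 interpret K: closed_subfield K unfolding K_def by (rule closed_subfield_adjoin_preperiodic[OF \<delta>p])
 have K: "closed_subfield K" by unfold_locales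
 have FK: "F \<subseteq> K" unfolding K_def by (rule subset_adjoin)
 have \<delta>K: "\<delta> \<in> K" unfolding K_def by (rule self_mem_adjoin)
 have int: "algebraic_int \<gamma>" "algebraic_int \<delta>" using preperiodic_integral \<gamma> \<delta>p by auto
 have p2: "p \<ge> 2" by (rule prime_ge_2_nat[OF prime])
 define z where "z = \<gamma> - \<delta>"
 have z: "algebraic_int z" "z \<noteq> 0" using int ne by (auto simp: z_def intro: algebraic_int_diff_mult)
 obtain h where h: "h \<in> polys K" "h \<noteq> 0" "poly h \<gamma> = 0"
  using int algebraic_root_over_subring[OF K.closed_subring_axioms] by blast
 then obtain g where g: "is_minpoly K \<gamma> g" using K.minpoly_exists[OF h] by blast
 have gg: "g \<in> polys K" "poly g \<gamma> = 0" "g \<noteq> 0" using g by (auto simp: is_minpoly_def)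
 define n where "n = degree g"
 have n: "n \<ge> 1" using K.minpoly_degree_pos[OF g] by (simp add: n_def)
 have Kalg: "algebraic a" if "a \<in> K" for a
 proof -
  interpret AL: closed_subfield "{x :: 'k. algebraic x}" by (rule closed_subfield_algebraic)
  have "K \<subseteq> {x. algebraic x}" unfolding K_def
   by (rule adjoin_subset) (use AL.closed_subring_axioms algebraic_mem int in auto)
  thus ?thesis using that by blast
 qed
 have vz: "\<exists>i\<in>{1..n}. real i * ?v Q z \<in> \<int>" if Q: "alg_prime Q p" for Q
 proof -
  interpret q: pcf_poly_prime F Q p r f by (intro pcf_poly_prime.intro pcf_poly_axioms Q)
  obtain e' where e': "e' > 0" "e' \<le> ramification_index F p q.P" "\<And>x. x \<in> F ==> x \<noteq> 0 ==> real e' * q.v x \<in> \<int>"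
   using q.v_ramification by blast
  have "e' = 1" using e'(1,2) e[OF Q] by (simp add: q.P_def)
  hence vZ: "q.v x \<in> \<int>" if "x \<in> F" "x \<noteq> 0" for x using e'(3)[OF that] by simp
  have lin: "[:\<delta>, 1:] \<in> polys K" using \<delta>K by (intro K.polys_pCons K.polys_0 K.one_mem)
  have "\<exists>i\<in>{1..degree (pcompose g [:\<delta>, 1:])}. \<exists>y\<in>K. y \<noteq> 0 \<and> real i * q.v z = q.v y"
   by (rule q.root_imp_v_multiple[OF K Kalg _ z(2) K.polys_pcompose[OF gg(1) lin]])
    (use z gg in \<open>auto simp: pcompose_eq_0_iff poly_pcompose z_def\<close>)
  then obtain i y where i: "i \<in> {1..n}" "y \<in> K" "y \<noteq> 0" "real i * q.v z = q.v y"
   by (auto simp: degree_pcompose n_def)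
  have "q.v y \<in> \<int>" using q.unramified_periodic[OF vZ \<delta>] i(2,3) by (simp add: K_def)
  thus ?thesis using i by (intro bexI[of _ i]) auto
 qed
 \<comment> \<open>A value above 1 with denominator \<open>i \<le> n\<close> exceeds 1 by at least
   \<open>1 / i\<close>.\<close>
 have vge: "?v Q z \<ge> 1 + 1 / real n" if Q: "alg_prime Q p" for Q
 proof -
  obtain i a where i: "i \<in> {1..n}" "real i * ?v Q z = real_of_int a"
   using vz[OF Q] by (auto elim: Ints_cases)
  have "real i * 1 < real_of_int a" using bad[OF Q] i(1) unfolding i(2)[symmetric] by (simp add: z_def)
  hence "real_of_int (int i + 1) \<le> real_of_int a" by (simp only: of_int_le_iff)
  hence "1 + 1 / real i \<le> ?v Q z" using i by (simp add: field_simps)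
  moreover have "1 / real n \<le> 1 / real i" using i(1) by (intro divide_left_mono) auto
  ultimately show ?thesis by linarith
 qed
 have small: "1 + 1 / real n < real p / (real p - 1)"
  using vge[OF good(1)] good(2) by (simp add: z_def)
 have pfrac: "real p / (real p - 1) = 1 + 1 / (real p - 1)" using p2 by (simp add: field_simps)
 hence np: "real p - 1 < real n" using small n p2 by (simp add: field_simps)
 \<comment> \<open>The discriminant bound needs \<open>n + 1 \<ge> 4\<close> points. By
   \<open>p - 1 < n\<close> only \<open>n = 2\<close> with \<open>p = 2\<close> is left over, where
   the valuation could only be 3/2.\<close>
 consider "n = 2" "p = 2" | "n \<ge> 3" using np p2 by linarith
 thus False
 proof cases
  case 1
  obtain i where i: "i \<in> {1..2}" "real i * ?v Q0 z \<in> \<int>" using vz[OF good(1)] 1 by auto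
  define w where "w = ?v Q0 z"
  have w: "1 < w" "w < 2" "w \<noteq> 3 / 2" using bad[OF good(1)] good(2) half[OF 1(2)] 1(2) by (auto simp: w_def z_def)
  obtain a where a: "real i * w = real_of_int a" using i(2) by (auto simp: w_def elim: Ints_cases)
  from i(1) consider "i = 1" | "i = 2" by fastforce
  thus False
  proof cases
   case 1
   hence "1 < a" "a < 2" using w a by simp_all
   thus False by linarith
  next
   case 2
   hence a': "2 * w = real_of_int a" using a by simp
   hence "2 < a" "a < 4" using w by linarith+
   thus False using a' w(3) by simp
  qed
 next
  case 2
  define Z where "Z = {y. poly g y = 0}"
  have cardZ: "card Z = n" unfolding Z_def n_def
   by (rule card_roots_eq_degree[OF gg(3)]) (rule minpoly_simple_root[OF K g])
  have finZ: "finite Z" unfolding Z_def by (rule poly_roots_finite[OF gg(3)])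
  have "\<delta> \<notin> Z"
  proof
   assume "\<delta> \<in> Z"
   hence "is_minpoly K \<delta> g" using K.minpoly_conjugate[OF g] by (simp add: Z_def)
   moreover have "[:- \<delta>, 1:] \<in> polys K" using \<delta>K by (intro K.polys_pCons K.polys_0 K.one_mem K.uminus_mem)
   ultimately have "degree g \<le> degree [:- \<delta>, 1:]" unfolding is_minpoly_def by fastforce
   thus False using 2 by (simp add: n_def)
  qed
  define N where "N = Suc n"
  have "card (insert \<delta> Z) = N" using \<open>\<delta> \<notin> Z\<close> finZ cardZ by (simp add: N_def)
  then obtain x where x: "bij_betw x {..<N} (insert \<delta> Z)"
   using ex_bij_betw_nat_finite[of "insert \<delta> Z"] finZ by (auto simp: atLeast0LessThan)
  have xZ: "x i \<in> insert \<delta> Z" if "i < N" for i using x that by (auto simp: bij_betw_def)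
  have inj: "inj_on x {..<N}" using x by (simp add: bij_betw_def)
  have pre: "preperiodic f (x i)" if "i < N" for i
   using xZ[OF that] conjugate_preperiodic[OF K FK g _ \<gamma>] \<delta>p by (auto simp: Z_def)
  have "N \<ge> 4" using 2 by (simp add: N_def)
  from discriminant_prime[OF this pre inj] obtain Q i j where Q: "alg_prime Q p" "j < i" "i < N"
   "?v Q (x i - x j) < real N / (real N - 1)" by blast
  interpret q: pcf_poly_prime F Q p r f by (intro pcf_poly_prime.intro pcf_poly_axioms Q)
  have pnz: "(of_nat p :: 'k) \<noteq> 0" using p2 by simp
  \<comment> \<open>\<open>H\<close> carries the lower bound over to the conjugates: its value at
    \<open>\<gamma>\<close> is integral by \<open>vge\<close> at all primes, so its values at the
    conjugates are integral too, which means valuation at least \<open>N / n\<close> of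
    \<open>x i - \<delta>\<close>.\<close>
  define H where "H = smult (inverse (of_nat p ^ N)) ([:- \<delta>, 1:] ^ n)"
  have H: "H \<in> polys K" unfolding H_def using \<delta>K
   by (intro K.polys_smult K.inverse_mem K.power_mem K.of_nat_mem K.polys_power K.polys_pCons
     K.polys_0 K.one_mem K.uminus_mem)
  have polyH: "poly H y = (y - \<delta>) ^ n / of_nat p ^ N" for y by (simp add: H_def field_simps)
  have Hint: "algebraic_int (poly H \<gamma>)"
  proof (rule algebraic_int_if_vge_0[OF prime])
   show "algebraic_int (of_nat p ^ N * poly H \<gamma>)" using z(1) pnz AI.power_mem[of z n] by (simp add: polyH z_def)
   fix Q :: "'k set" assume Q: "alg_prime Q p"
   interpret q': alg_prime Q p by (rule Q)
   have "real n * (1 + 1 / real n) \<le> real n * q'.v z" using vge[OF Q] by (intro mult_left_mono) auto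
   hence "real N \<le> real n * q'.v z" using n by (simp add: N_def distrib_left)
   moreover have "q'.v (poly H \<gamma>) = real n * q'.v z - real N"
    unfolding polyH z_def[symmetric] using z pnz
    by (simp add: q'.v_divide q'.v_power q'.v_p q'.al algebraic_int_imp_algebraic)
   ultimately show "q'.vge 0 (poly H \<gamma>)" by (simp add: q'.vge_def)
  qed
  have xv: "q.vge (real N / (real N - 1)) (x i - \<delta>)" if "i < N" for i
  proof (cases "x i = \<delta>")
   case False
   hence root: "poly g (x i) = 0" using xZ[OF that] by (simp add: Z_def)
   have xi: "algebraic (x i - \<delta>)" "x i - \<delta> \<noteq> 0"
    using False preperiodic_integral[OF pre[OF that]] int(2) q.al(3) by auto
   have "algebraic_int (poly H (x i))" by (rule conjugate_integral[OF K g root H Hint])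
   moreover have "poly H (x i) \<noteq> 0" using xi pnz by (simp add: polyH)
   ultimately have "q.v (poly H (x i)) \<ge> 0" using q.vge_integral[of "poly H (x i)"] by (simp add: q.vge_def)
   moreover have "q.v (poly H (x i)) = real n * q.v (x i - \<delta>) - real N"
    unfolding polyH using xi pnz q.v_divide[of "(x i - \<delta>) ^ n" "of_nat p ^ N"]
    by (simp add: q.v_power[OF xi] q.v_power q.v_p q.al)
   ultimately show ?thesis using n by (simp add: q.vge_def N_def field_simps)
  qed simp
  have xalg: "algebraic (x i - \<delta>)" if "i < N" for i
   using preperiodic_integral[OF pre[OF that]] int(2) q.al(3) by auto
  have "q.vge (real N / (real N - 1)) ((x i - \<delta>) - (x j - \<delta>))"
   using Q by (intro q.vge_diff xv xalg) auto
  moreover have "x i \<noteq> x j" using inj_onD[OF inj, of i j] Q by auto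
  ultimately show False using Q(4) by (simp add: q.vge_def)
 qed
qed

text \<open>At a good prime \<open>d^k * v (\<alpha> - \<beta>) = v (\<gamma> - \<delta>)\<close> is
  below \<open>p / (p - 1)\<close>, while \<open>v (\<alpha> - \<beta>)\<close> is at least
  \<open>1 / (e n)\<close>. If \<open>e \<le> 1\<close> and \<open>n < d^k\<close>, the same two
  facts push \<open>v (\<gamma> - \<delta>)\<close> above 1 at every prime, which
  \<open>unramified_bound\<close> refutes.\<close>

lemma preper_power_bound:
 assumes \<alpha>: "\<alpha> \<in> alg_closure_in F" "preperiodic f \<alpha>" and m: "preper f \<alpha> = Suc k"
  and e: "\<And>Q. alg_prime Q p ==> ramification_index F p (Q \<inter> F) \<le> e"
  and cheb: "\<And>b \<kappa> \<epsilon>. algebraic b ==> algebraic \<kappa> ==> \<kappa> \<noteq> 0 ==> \<epsilon> \<in> {1, - 1} ==>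
   pcompose f [:b, \<kappa>:] \<noteq> [:b:] + smult (\<epsilon> * \<kappa>) (map_poly of_int (chebyshev_rec (degree f)))"
 shows "real (degree f ^ k) < 2 * (real e * real (adjoin_degree F \<alpha>))"
  "e \<le> 1 ==> degree f ^ k \<le> adjoin_degree F \<alpha>"
proof -
 let ?v = "\<lambda>Q. alg_prime.v Q p"
 define n where "n = adjoin_degree F \<alpha>"
 obtain j where j: "periodic f ((poly f ^^ j) \<alpha>)" "(poly f ^^ Suc k) ((poly f ^^ j) \<alpha>) = (poly f ^^ Suc k) \<alpha>"
  "(poly f ^^ k) ((poly f ^^ j) \<alpha>) \<noteq> (poly f ^^ k) \<alpha>"
  using periodic_companion[OF \<alpha>(2) m] by blast
 define \<beta> where "\<beta> = (poly f ^^ j) \<alpha>"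
 define \<gamma> where "\<gamma> = (poly f ^^ k) \<alpha>"
 define \<delta> where "\<delta> = (poly f ^^ k) \<beta>"
 have int: "algebraic_int \<alpha>" "algebraic_int \<beta>"
  using preperiodic_integral \<alpha>(2) preperiodic_iter[OF \<alpha>(2)] by (auto simp: \<beta>_def)
 have \<gamma>: "preperiodic f \<gamma>" unfolding \<gamma>_def by (rule preperiodic_iter[OF \<alpha>(2)])
 have ne: "\<gamma> \<noteq> \<delta>" using j(3) by (simp add: \<gamma>_def \<delta>_def \<beta>_def)
 have \<delta>: "periodic f \<delta>"
 proof -
  obtain l where l: "l \<ge> 1" "(poly f ^^ l) \<beta> = \<beta>" using j(1) by (auto simp: periodic_def \<beta>_def)
  have "(poly f ^^ l) ((poly f ^^ k) \<beta>) = (poly f ^^ k) ((poly f ^^ l) \<beta>)"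
   by (metis add.commute comp_apply funpow_add)
  thus ?thesis using l by (auto simp: periodic_def \<delta>_def)
 qed
 have \<delta>p: "preperiodic f \<delta>" by (rule periodic_imp_preperiodic[OF \<delta>])
 have "\<exists>Q. alg_prime Q p \<and> ?v Q (\<gamma> - \<delta>) < real p / (real p - 1)"
 proof -
  interpret AL: closed_subfield "{x :: 'k. algebraic x}" by (rule closed_subfield_algebraic)
  have a: "algebraic \<gamma>" "algebraic \<delta>" using preperiodic_integral[OF \<gamma>] preperiodic_integral[OF \<delta>p] by auto
  have "algebraic ((\<gamma> + \<delta>) / 2)" "algebraic ((\<delta> - \<gamma>) / 4)"
   using AL.divide_mem[of "\<gamma> + \<delta>" 2] AL.divide_mem[of "\<delta> - \<gamma>" 4] AL.add_mem[of \<gamma> \<delta>] AL.diff_mem[of \<delta> \<gamma>] a by auto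
  moreover have "(\<delta> - \<gamma>) / 4 \<noteq> 0" using ne by simp
  ultimately show ?thesis using good_prime_or_chebyshev[OF \<gamma> \<delta>p ne] cheb by blast
 qed
 then obtain Q0 where Q0: "alg_prime Q0 p" "?v Q0 (\<gamma> - \<delta>) < real p / (real p - 1)" by blast
 have ab: "\<alpha> \<noteq> \<beta>" using ne by (auto simp: \<gamma>_def \<delta>_def)
 have adj: "\<alpha> - \<beta> \<in> adjoin F \<alpha>"
 proof -
  interpret S: closed_subring "adjoin F \<alpha>" by (rule closed_subring_adjoin)
  have "f \<in> polys (adjoin F \<alpha>)" using f_int subset_adjoin[of \<alpha>] by (auto simp: polys_def)
  thus ?thesis unfolding \<beta>_def by (intro S.diff_mem S.polys_iter self_mem_adjoin)
 qed
 obtain h where h: "h \<in> polys F" "h \<noteq> 0" "degree h \<le> n" "poly h (\<alpha> - \<beta>) = 0"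
  using adjoin_degree_root(2)[OF \<alpha>(1) adj] unfolding n_def by blast
 have small: "?v Q (\<gamma> - \<delta>) = real (degree f ^ k) * ?v Q (\<alpha> - \<beta>)"
   "1 \<le> real (ramification_index F p (Q \<inter> F)) * real n * ?v Q (\<alpha> - \<beta>)"
  if Q: "alg_prime Q p" "?v Q (\<gamma> - \<delta>) < real p / (real p - 1)" for Q
 proof -
  interpret q: pcf_poly_prime F Q p r f by (intro pcf_poly_prime.intro pcf_poly_axioms Q)
  show "q.v (\<gamma> - \<delta>) = real (degree f ^ k) * q.v (\<alpha> - \<beta>)"
   unfolding \<gamma>_def \<delta>_def using ne Q(2) by (intro q.v_iter int) (auto simp: \<gamma>_def \<delta>_def)
  \<comment> \<open>Positivity of the valuation comes for free: the \<open>Suc k\<close>-th iterates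
    coincide and \<open>f\<close> is injective modulo \<open>Q\<close>.\<close>
  have "\<alpha> - \<beta> \<in> Q" using j(2) by (intro q.diff_mem_of_iter_eq[OF int, of "Suc k"]) (simp add: \<beta>_def)
  hence "q.v (\<alpha> - \<beta>) > 0"
   using q.vunit_iff(2)[of "\<alpha> - \<beta>"] q.vmax_integral_iff[of "\<alpha> - \<beta>"] q.integral[of "\<alpha> - \<beta>"] ab by auto
  thus "1 \<le> real (ramification_index F p (Q \<inter> F)) * real n * q.v (\<alpha> - \<beta>)"
   using q.v_lower_bound[OF _ _ h] ab by (simp add: q.P_def)
 qed
 have p2: "p \<ge> 2" by (rule prime_ge_2_nat[OF prime])
 have pfrac: "real p / (real p - 1) \<le> 2" using p2 by (simp add: field_simps)
 define w where "w = ?v Q0 (\<alpha> - \<beta>)"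
 have lower: "1 \<le> real e * real n * w"
 proof -
  have 1: "1 \<le> real (ramification_index F p (Q0 \<inter> F)) * real n * w" using small(2)[OF Q0] by (simp add: w_def)
  hence "w > 0" by (smt (verit) mult_nonneg_nonneg mult_nonneg_nonpos of_nat_0_le_iff)
  hence "real (ramification_index F p (Q0 \<inter> F)) * (real n * w) \<le> real e * (real n * w)"
   using e[OF Q0(1)] by (intro mult_right_mono) auto
  thus ?thesis using 1 by (simp add: mult.assoc)
 qed
 have lt2: "real (degree f ^ k) * w < 2" using small(1)[OF Q0] Q0(2) pfrac by (simp add: w_def)
 have "real (degree f ^ k) * 1 \<le> real (degree f ^ k) * (real e * real n * w)"
  using lower by (intro mult_left_mono) auto
 also have "... = (real e * real n) * (real (degree f ^ k) * w)" by (simp add: mult_ac)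
 also have "... < (real e * real n) * 2"
  using lower by (intro mult_strict_left_mono[OF lt2]) (auto simp: zero_less_mult_iff intro!: gr0I)
 finally show "real (degree f ^ k) < 2 * (real e * real (adjoin_degree F \<alpha>))" by (simp add: n_def mult_ac)
 assume e1: "e \<le> 1"
 show "degree f ^ k \<le> adjoin_degree F \<alpha>"
 proof (rule ccontr)
  assume "\<not> degree f ^ k \<le> adjoin_degree F \<alpha>"
  hence nd: "n < degree f ^ k" by (simp add: n_def)
  have ram: "ramification_index F p (Q \<inter> F) \<le> 1" if "alg_prime Q p" for Q using e[OF that] e1 by simp
  show False
  proof (rule unramified_bound[OF ram \<gamma> \<delta> ne Q0])
   fix Q :: "'k set" assume Q: "alg_prime Q p"
   show "?v Q (\<gamma> - \<delta>) > 1"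
   proof (cases "?v Q (\<gamma> - \<delta>) < real p / (real p - 1)")
    case True
    define w where "w = ?v Q (\<alpha> - \<beta>)"
    have 1: "1 \<le> real (ramification_index F p (Q \<inter> F)) * (real n * w)"
     using small(2)[OF Q True] by (simp add: w_def)
    hence w0: "w > 0" by (smt (verit) mult_nonneg_nonneg mult_nonneg_nonpos of_nat_0_le_iff)
    hence "real (ramification_index F p (Q \<inter> F)) * (real n * w) \<le> 1 * (real n * w)"
     using ram[OF Q] by (intro mult_right_mono) auto
    hence "1 \<le> real n * w" using 1 by simp
    also have "... < real (degree f ^ k) * w" using nd w0 by (intro mult_strict_right_mono) (simp_all only: of_nat_less_iff)
    also have "... = ?v Q (\<gamma> - \<delta>)" using small(1)[OF Q True] by (simp add: w_def)
    finally show ?thesis .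
   next
    case False
    moreover have "real p / (real p - 1) > 1" using p2 by (simp add: field_simps)
    ultimately show ?thesis by linarith
   qed
  next
   assume p: "p = 2"
   show "?v Q0 (\<gamma> - \<delta>) \<noteq> 3 / 2"
   proof
    assume eq: "?v Q0 (\<gamma> - \<delta>) = 3 / 2"
    interpret q: pcf_poly_prime F Q0 p r f by (intro pcf_poly_prime.intro pcf_poly_axioms Q0)
    obtain i y where i: "i \<in> {1..n}" "y \<in> F" "y \<noteq> 0" "real i * q.v (\<alpha> - \<beta>) = q.v y"
     using q.v_multiple_of_degree[OF _ h] ab by auto
    obtain e' where e': "e' > 0" "e' \<le> ramification_index F p q.P" "\<And>x. x \<in> F ==> x \<noteq> 0 ==> real e' * q.v x \<in> \<int>"
     using q.v_ramification by blast
    have "e' = 1" using e'(1,2) ram[OF Q0(1)] by (simp add: q.P_def)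
    hence vy: "q.v y \<in> \<int>" using e'(3)[OF i(2,3)] by simp
    \<comment> \<open>The value 3/2 would force \<open>i\<close> to be at least twice this power of
      2, although \<open>i \<le> n\<close> and \<open>n\<close> is smaller than the power
      itself.\<close>
    have deg: "degree f ^ k = 2 ^ (r * k)" by (simp add: degree p power_mult)
    have "real i * (3 / 2) = real (2 ^ (r * k)) * q.v y"
    proof -
     have "3 / 2 = real (2 ^ (r * k)) * q.v (\<alpha> - \<beta>)" using small(1)[OF Q0] unfolding deg eq .
     thus ?thesis unfolding i(4)[symmetric] by (simp only: mult.left_commute)
    qed
    hence "2 ^ Suc (r * k) \<le> i" using deg_le_contradiction_two[OF vy] i(1) by simp
    thus False using i(1) nd by (simp add: deg)
   qed
  qed
 qed
qed

end

text \<open>Logarithms to the base \<open>d\<close> give \<open>k < log 2 + E + L\<close> with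
  \<open>log 2 \<le> 1\<close>. For \<open>e \<ge> 2\<close> the ceiling \<open>s\<close> is at
  least 1. If also \<open>n \<ge> 2\<close>, then \<open>log 2 \<le> L\<close> and the product on
  the right supplies \<open>2 * L\<close>; if \<open>n = 1\<close>, the strict inequality
  \<open>k < 1 + s\<close> between integers yields the missing unit. For \<open>e = 1\<close> the
  hypothesis \<open>le\<close> replaces \<open>lt\<close>.\<close>

lemma preper_numeric:
 fixes d e n k :: nat
 assumes d: "d \<ge> 2" and e: "e \<ge> 1" and n: "n \<ge> 1"
  and lt: "real (d ^ k) < 2 * (real e * real n)" and le: "e \<le> 1 ==> d ^ k \<le> n"
 shows "real (Suc k) \<le> (1 + real_of_int \<lceil>ln (real e) / ln (real d)\<rceil>) * (1 + ln (real n) / ln (real d))"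
proof -
 define s where "s = real_of_int \<lceil>ln (real e) / ln (real d)\<rceil>"
 define L where "L = ln (real n) / ln (real d)"
 define E where "E = ln (real e) / ln (real d)"
 have ld: "ln (real d) > 0" using d by simp
 have L0: "L \<ge> 0" using n ld by (simp add: L_def)
 have E0: "E \<ge> 0" using e ld by (simp add: E_def)
 have Es: "E \<le> s" by (simp add: s_def E_def)
 have s0: "s \<ge> 0" using E0 Es by linarith
 have main: "real k < ln 2 / ln (real d) + E + L"
 proof -
  have "ln (real (d ^ k)) < ln (2 * (real e * real n))" using lt d e n by (subst ln_less_cancel_iff) auto
  hence "real k * ln (real d) < ln 2 + ln (real e) + ln (real n)"
   using d e n by (simp add: ln_realpow ln_mult)
  hence "real k < (ln 2 + ln (real e) + ln (real n)) / ln (real d)" using ld by (simp add: less_divide_eq)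
  thus ?thesis by (simp add: E_def L_def add_divide_distrib)
 qed
 have ln2: "ln 2 / ln (real d) \<le> 1" using d by (simp add: divide_le_eq)
 show ?thesis
 proof (cases "e = 1")
  case True
  hence "ln (real (d ^ k)) \<le> ln (real n)" using le d n by (subst ln_le_cancel_iff) (auto simp: of_nat_le_iff simp del: of_nat_power)
  hence "real k \<le> L" using ld d by (simp add: L_def ln_realpow le_divide_eq)
  moreover have "s = 0" using True by (simp add: s_def)
  ultimately have "real (Suc k) \<le> (1 + s) * (1 + L)" by simp
  thus ?thesis by (simp only: s_def L_def)
 next
  case False
  hence s1: "s \<ge> 1" using e ld by (simp add: s_def)
  show ?thesis
  proof (cases "n = 1")
   case True
   hence "L = 0" by (simp add: L_def)
   hence "real k < 1 + s" using main ln2 Es by linarith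
   moreover have "1 + s = real_of_int (1 + \<lceil>E\<rceil>)" by (simp add: s_def E_def)
   ultimately have "int k < 1 + \<lceil>E\<rceil>" by linarith
   hence "real (Suc k) \<le> 1 + s" unfolding s_def E_def[symmetric] by linarith
   hence "real (Suc k) \<le> (1 + s) * (1 + L)" using \<open>L = 0\<close> by simp
   thus ?thesis by (simp only: s_def L_def)
  next
   case False
   hence "ln 2 / ln (real d) \<le> L" using n ld unfolding L_def by (intro divide_right_mono) auto
   hence "real k < s + 2 * L" using main Es by linarith
   moreover have "2 * L \<le> (1 + s) * L" using s1 L0 by (intro mult_right_mono) auto
   ultimately have "real (Suc k) \<le> (1 + s) * (1 + L)" by (simp add: algebra_simps)
   thus ?thesis by (simp only: s_def L_def)
  qed
 qed
qed

theorem theorem1p4: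
  fixes F :: "'k :: {field_char_0, alg_closed_field} set"
    and p d :: nat and f :: "'k poly" and \<alpha> :: 'k
  defines "Fbar \<equiv> alg_closure_in F"
    and "\<ee> \<equiv> Max {ramification_index F p P | P. P \<in> places_above F p}"
    and "\<ff> \<equiv> Lcm {residue_degree F P | P. P \<in> places_above F p}"
  assumes "number_field F"
    and "Factorial_Ring.prime p"
    and "\<forall>i. coeff f i \<in> carrier (ring_of_integers F)"
    and "lead_coeff f = 1"
    and "degree f = d"
    and "d \<ge> 2"
    and "\<exists>r. d = p ^ r"
    and "postcritically_finite Fbar f"
    and "algebraic_int (barycenter f)"
    and "\<forall>n\<ge>1. \<not> linearly_conjugate Fbar f (map_poly of_int (chebyshev n)) \<and>
               \<not> linearly_conjugate Fbar f (- map_poly of_int (chebyshev n))"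
    and "\<alpha> \<in> Fbar"
    and "preperiodic f \<alpha>"
  shows "real (preper f \<alpha>) \<le>
           (1 + real_of_int \<lceil>ln (real \<ee>) / ln (real d)\<rceil>) *
           (1 + ln (real (adjoin_degree F \<alpha>)) / ln (real d))
         \<and> per f \<alpha> \<le> p * \<ff> * adjoin_degree F \<alpha>"
proof -
 note alg = \<open>\<alpha> \<in> Fbar\<close>[unfolded Fbar_def] and pre = \<open>preperiodic f \<alpha>\<close>
 obtain r where r: "d = p ^ r" using \<open>\<exists>r. d = p ^ r\<close> by blast
 interpret num_field F by unfold_locales fact
 have fF: "f \<in> polys {x \<in> F. algebraic_int x}"
  using \<open>\<forall>i. coeff f i \<in> carrier (ring_of_integers F)\<close> by (simp add: polys_def OF_simps)
 interpret pcf_poly F p r f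
 proof
  show "Factorial_Ring.prime p" "lead_coeff f = 1" "f \<in> polys {x \<in> F. algebraic_int x}" by fact+
  show "degree f = p ^ r" using r \<open>degree f = d\<close> by simp
  show "r \<ge> 1" using r \<open>d \<ge> 2\<close> by (cases r) auto
  fix c assume c: "poly (pderiv f) c = 0"
  \<comment> \<open>The hypothesis speaks of critical points in \<open>Fbar\<close>; as roots of a
    nonzero polynomial over \<open>F\<close>, all critical points in \<open>'k\<close> are of this
    kind.\<close>
  have "pderiv f \<noteq> 0" using \<open>degree f = d\<close> \<open>d \<ge> 2\<close> by (simp add: pderiv_eq_0_iff)
  moreover have "f \<in> polys F" using fF by (auto simp: polys_def)
  hence "pderiv f \<in> polys F" by (rule polys_pderiv[OF closed_subring_axioms])
  ultimately have "c \<in> Fbar" unfolding Fbar_def using c by (intro mem_alg_closure_inI[of "pderiv f"])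
  thus "preperiodic f c" using \<open>postcritically_finite Fbar f\<close> c by (simp add: postcritically_finite_def)
 qed
 define n where "n = adjoin_degree F \<alpha>"
 have n: "n \<ge> 1" using adjoin_degree_root(1)[OF alg] by (simp add: n_def)
 \<comment> \<open>Finiteness gives the \<open>Max\<close> its meaning and keeps the
   \<open>Lcm\<close> from being 0.\<close>
 have fin: "finite (places_above F p)" by (rule finite_places_above[OF prime])
 have place: "Q \<inter> F \<in> places_above F p" if Q: "alg_prime Q p" for Q
 proof -
  interpret q: pcf_poly_prime F Q p r f by (intro pcf_poly_prime.intro pcf_poly_axioms Q)
  show ?thesis using q.P_place by (simp add: q.P_def)
 qed
 obtain Q0 :: "'k set" where Q0: "alg_prime Q0 p" using alg_prime_above_exists[OF prime] by blast
 interpret q: pcf_poly_prime F Q0 p r f by (intro pcf_poly_prime.intro pcf_poly_axioms Q0)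
 have e_ge: "ramification_index F p (Q \<inter> F) \<le> \<ee>" if "alg_prime Q p" for Q
  unfolding \<ee>_def using fin place[OF that] by (intro Max_ge) auto
 have e1: "\<ee> \<ge> 1" using q.v_ramification e_ge[OF Q0] by (auto simp: q.P_def)
 have cheb: "pcompose f [:b, \<kappa>:] \<noteq> [:b:] + smult (\<epsilon> * \<kappa>) (map_poly of_int (chebyshev_rec (degree f)))"
  if "algebraic b" "algebraic \<kappa>" "\<kappa> \<noteq> 0" "\<epsilon> \<in> {1, - 1}" for b \<kappa> \<epsilon>
  using chebyshev_imp_linearly_conjugate[OF that] degree_ge_2
   \<open>\<forall>n\<ge>1. \<not> linearly_conjugate Fbar f (map_poly of_int (chebyshev n)) \<and>
        \<not> linearly_conjugate Fbar f (- map_poly of_int (chebyshev n))\<close>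
  unfolding Fbar_def by (metis One_nat_def Suc_leD numeral_2_eq_2)
 have "real (preper f \<alpha>) \<le> (1 + real_of_int \<lceil>ln (real \<ee>) / ln (real d)\<rceil>) * (1 + ln (real n) / ln (real d))"
 proof (cases "preper f \<alpha>")
  case 0
  have "ln (real \<ee>) / ln (real d) \<ge> 0" "ln (real n) / ln (real d) \<ge> 0" using e1 n \<open>d \<ge> 2\<close> by auto
  thus ?thesis using 0 by simp
 next
  case (Suc k)
  have "real (d ^ k) < 2 * (real \<ee> * real n)" "\<ee> \<le> 1 ==> d ^ k \<le> n"
   using preper_power_bound[OF alg pre Suc e_ge cheb] \<open>degree f = d\<close> by (simp_all add: n_def)
  thus ?thesis unfolding Suc by (intro preper_numeric \<open>d \<ge> 2\<close> e1 n)
 qed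
 moreover have "per f \<alpha> \<le> p * \<ff> * n"
 proof -
  define \<gamma> where "\<gamma> = (poly f ^^ preper f \<alpha>) \<alpha>"
  obtain i j where ij: "i < j" "(poly f ^^ i) \<alpha> = (poly f ^^ j) \<alpha>" using pre by (auto simp: preperiodic_iff)
  have "periodic f ((poly f ^^ i) \<alpha>)" using ij funpow_add[of "j - i" i "poly f"] ij(1) by (auto simp: periodic_def intro!: exI[of _ "j - i"])
  hence \<gamma>: "periodic f \<gamma>" unfolding \<gamma>_def preper_def by (rule LeastI)
  have "\<gamma> \<in> adjoin F \<alpha>"
  proof -
   interpret S: closed_subring "adjoin F \<alpha>" by (rule closed_subring_adjoin)
   have "f \<in> polys (adjoin F \<alpha>)" using fF subset_adjoin[of \<alpha>] by (auto simp: polys_def)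
   thus ?thesis unfolding \<gamma>_def by (intro S.polys_iter self_mem_adjoin)
  qed
  then obtain h where h: "h \<in> polys F" "h \<noteq> 0" "degree h \<le> n" "poly h \<gamma> = 0"
   using adjoin_degree_root(2)[OF alg] unfolding n_def by blast
  obtain M where M: "M \<ge> 1" "M \<le> p * residue_degree F q.P * n" "(poly f ^^ M) \<gamma> = \<gamma>"
   using q.period_bound[OF \<gamma> h] by blast
  have "per f \<alpha> \<le> M" unfolding per_def \<gamma>_def[symmetric] using M by (intro Least_le) simp
  also have "residue_degree F q.P dvd \<ff>" unfolding \<ff>_def using q.P_place by (intro dvd_Lcm) auto
  moreover have "\<ff> > 0"
  proof -
   have "finite {residue_degree F P | P. P \<in> places_above F p}" using fin by simp
   moreover have "0 \<notin> {residue_degree F P | P. P \<in> places_above F p}"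
    using residue_degree_pos[OF prime] by force
   ultimately have "\<ff> \<noteq> 0" unfolding \<ff>_def by (simp only: Lcm_0_iff not_False_eq_True)
   thus ?thesis by simp
  qed
  ultimately have "residue_degree F q.P \<le> \<ff>" by (intro dvd_imp_le)
  hence "p * residue_degree F q.P * n \<le> p * \<ff> * n" by simp
  thus ?thesis using \<open>per f \<alpha> \<le> M\<close> M(2) by linarith
 qed
 ultimately show ?thesis by (simp add: n_def)
qed

end
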